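(* Let $d\ge 1$, $p\ge 1$ be integers and $0<\alpha\le 2$ with $d<\alpha p$. Let $X_1(t),\dots,X_p(t)$ be independent, identically distributed $d$-dimensional symmetric $\alpha$-stable processes started at $0$, with $\mathbb{E}e^{i\lambda\cdot X_j(t)}=e^{-t\psi(\lambda)}$, where $\psi\ge 0$ is continuous on $\mathbb{R}^d$, $\psi(r\lambda)=r^\alpha\psi(\lambda)$, $\psi(-\lambda)=\psi(\lambda)$ for $r>0$, $\lambda\in\mathbb{R}^d$, and $C^{-1}|\lambda|^\alpha\le\psi(\lambda)\le C|\lambda|^\alpha$ for some constant $C>0$. Let $\tau_1,\dots,\tau_p$ be independent exponential random variables with parameter $1$, independent of $X_1,\dots,X_p$. Let $\eta^x(I)$ be the local time of $\overline{X}(t_1,\dots,t_p)=X_1(t_1)+\cdots+X_p(t_p)$. Then $$\lim_{n\to\infty}\frac1n\log\frac{1}{(n!)^p}\mathbb{E}\big[\eta^0([0,\tau_1]\times\cdots\times[0,\tau_p])^n\big]=\log\frac{\rho}{(2\pi)^d},$$ where $$\rho=\sup_{\|f\|_2=1}\int_{\mathbb{R}^d}\Big[\int_{\mathbb{R}^d}\frac{f(\lambda+\gamma)f(\gamma)}{\sqrt{1+\psi(\lambda+\gamma)}\sqrt{1+\psi(\gamma)}}\,d\gamma\Big]^p d\lambda,$$ the supremum over real-valued $f\in L^2(\mathbb{R}^d)$ with $\|f\|_2=1$.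
   Context: For a box $I\subset(\mathbb{R}^+)^p$, the occupation measure is $\mu_I(A)=\int_I \mathbb{1}_A(X_1(s_1)+\cdots+X_p(s_p))\,ds_1\cdots ds_p$. When $d<\alpha p$, $\mu_I$ is a.s. absolutely continuous with respect to Lebesgue measure for every box $I$, and the local time $\eta^x(I)$ is its density at $x$ (a version jointly continuous in $x$ and the box endpoints is used). *)

theory Defs
  imports "HOL-Probability.Probability"
begin

definition stable_symbol :: "real \<Rightarrow> ('a::euclidean_space \<Rightarrow> real) \<Rightarrow> bool" where
  "stable_symbol \<alpha> \<psi> \<longleftrightarrow>
     continuous_on UNIV \<psi> \<and> (\<forall>l. 0 \<le> \<psi> l) \<and>
     (\<forall>r l. r > 0 \<longrightarrow> \<psi> (r *\<^sub>R l) = r powr \<alpha> * \<psi> l) \<and>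
     (\<forall>l. \<psi> (- l) = \<psi> l) \<and>
     (\<exists>C>0. \<forall>l. norm l powr \<alpha> / C \<le> \<psi> l \<and> \<psi> l \<le> C * norm l powr \<alpha>)"

text \<open>A Levy process started at 0 with cadlag paths, independent increments and
  E exp(i l.(X t - X s)) = exp(-(t-s) psi l) for 0 <= s <= t
  (so the increments are stationary; the law is that of the symmetric stable process).\<close>
definition levy_process_with_symbol ::
    "'w measure \<Rightarrow> (real \<Rightarrow> 'w \<Rightarrow> 'a::euclidean_space) \<Rightarrow> ('a \<Rightarrow> real) \<Rightarrow> bool" where
  "levy_process_with_symbol M X \<psi> \<longleftrightarrow>
     (\<forall>t. X t \<in> borel_measurable M) \<and>
     (\<forall>\<omega>\<in>space M. X 0 \<omega> = 0) \<and>
     (\<forall>\<omega>\<in>space M. \<forall>t\<ge>0. continuous (at_right t) (\<lambda>s. X s \<omega>)) \<and>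
     (\<forall>\<omega>\<in>space M. \<forall>t>0. \<exists>L. ((\<lambda>s. X s \<omega>) \<longlongrightarrow> L) (at_left t)) \<and>
     (\<forall>(n::nat) (t::nat \<Rightarrow> real). 0 \<le> t 0 \<and> (\<forall>i<n. t i \<le> t (Suc i)) \<longrightarrow>
        prob_space.indep_vars M (\<lambda>_. borel) (\<lambda>i \<omega>. X (t (Suc i)) \<omega> - X (t i) \<omega>) {..<n}) \<and>
     (\<forall>s t l. 0 \<le> s \<and> s \<le> t \<longrightarrow>
        (\<integral>\<omega>. cis (l \<bullet> (X t \<omega> - X s \<omega>)) \<partial>M) = complex_of_real (exp (- (t - s) * \<psi> l)))"

definition occupation ::
    "('p::finite \<Rightarrow> real \<Rightarrow> 'w \<Rightarrow> 'a::euclidean_space) \<Rightarrow> ('p \<Rightarrow> real) \<Rightarrow> 'a set \<Rightarrow> 'w \<Rightarrow> ennreal" where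
  "occupation X t A \<omega> =
     emeasure (PiM UNIV (\<lambda>_::'p. lborel))
       {s \<in> PiE UNIV (\<lambda>j. {0..t j}). (\<Sum>j\<in>UNIV. X j (s j) \<omega>) \<in> A}"

definition is_local_time ::
    "'w measure \<Rightarrow> ('p::finite \<Rightarrow> real \<Rightarrow> 'w \<Rightarrow> 'a::euclidean_space) \<Rightarrow>
     ('a \<Rightarrow> ('p \<Rightarrow> real) \<Rightarrow> 'w \<Rightarrow> real) \<Rightarrow> bool" where
  "is_local_time M X \<eta> \<longleftrightarrow>
     (AE \<omega> in M.
        continuous_on (UNIV \<times> {t. \<forall>j. 0 \<le> t j}) (\<lambda>(x, t). \<eta> x t \<omega>) \<and>
        (\<forall>t. (\<forall>j. 0 \<le> t j) \<longrightarrow> (\<forall>A\<in>sets borel.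
           occupation X t A \<omega> = (\<integral>\<^sup>+ x. ennreal (\<eta> x t \<omega>) * indicator A x \<partial>lborel))))"

definition rho_values :: "('a::euclidean_space \<Rightarrow> real) \<Rightarrow> nat \<Rightarrow> real set" where
  "rho_values \<psi> p =
     {(\<integral>l. (\<integral>g. f (l + g) * f g / (sqrt (1 + \<psi> (l + g)) * sqrt (1 + \<psi> g)) \<partial>lborel) ^ p \<partial>lborel)
      | f. f \<in> borel_measurable lborel \<and> integrable lborel (\<lambda>x. (f x)\<^sup>2) \<and>
           (\<integral>x. (f x)\<^sup>2 \<partial>lborel) = 1}"

definition rho :: "('a::euclidean_space \<Rightarrow> real) \<Rightarrow> nat \<Rightarrow> real" where
  "rho \<psi> p = Sup (rho_values \<psi> p)"

text \<open>Mutual independence of the p sample paths (restricted to t >= 0) and the p times tau_j,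
  written out as the library's indep_vars unfolds (indexed by 'p + 'p).\<close>
definition indep_paths_and_times ::
    "'w measure \<Rightarrow> ('p \<Rightarrow> real \<Rightarrow> 'w \<Rightarrow> 'a::euclidean_space) \<Rightarrow> ('p \<Rightarrow> 'w \<Rightarrow> real) \<Rightarrow> bool" where
  "indep_paths_and_times M X \<tau> \<longleftrightarrow>
     (\<forall>j. (\<lambda>\<omega>. restrict (\<lambda>t. X j t \<omega>) {0..}) \<in> measurable M (PiM {0..} (\<lambda>_. borel))) \<and>
     (\<forall>j. \<tau> j \<in> borel_measurable M) \<and>
     prob_space.indep_sets M
       (\<lambda>k. case k of
          Inl j \<Rightarrow> {(\<lambda>\<omega>. restrict (\<lambda>t. X j t \<omega>) {0..}) -` S \<inter> space M | S. S \<in> sets (PiM {0..} (\<lambda>_. borel))}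
        | Inr j \<Rightarrow> {\<tau> j -` S \<inter> space M | S. S \<in> sets borel})
       (UNIV :: ('p + 'p) set)"

end

theory Submission imports Defs
begin

text \<open>
  Write \<open>N(l)\<close> for the Fourier transform at \<open>l\<close> of the occupation measure of the random box.
  Independence of the increments and the exponential times give
  \<open>E (N(l\<^sub>1) \<dots> N(l\<^sub>n)) = \<Phi>(l\<^sub>1, \<dots>, l\<^sub>n)\<^sup>p\<close>, where \<open>\<Phi>\<close> is a sum over the orderings of the
  frequencies of products of \<open>Q = 1 / (1 + \<psi>)\<close> at their partial sums.
  Integrating the kernel \<open>(const * cos\<^sup>2 (ep y / 2))\<^sup>m\<close> against the occupation measure gives a finite
  combination of the \<open>N(l)\<close> with \<open>l\<close> in the lattice of mesh \<open>ep\<close>; it approximates the local time at \<open>0\<close>.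

  Upper bound, for even \<open>n\<close>: by Fatou's lemma it suffices to bound the moments of these combinations
  for fixed \<open>ep\<close>. Frequencies outside a finite set \<open>A\<close> contribute little. On \<open>A\<close> the method of types
  loses only a polynomial factor and linearises the \<open>p\<close>-th power \<open>\<Phi>\<^sup>p\<close>; the linearised sum is an iterated
  operator whose norm is at most the lattice analogue of \<open>rho\<close> to the power \<open>1 / p\<close>.
  Lower bound, for odd \<open>n\<close>: Hoelder's inequality linearises \<open>\<Phi>\<^sup>p\<close> along a near maximiser
  of \<open>rho\<close>; moments of a self-adjoint operator bound an even number of its iterations from below, and
  the limit of vanishing mesh is taken inside the expectation by a bound on the next moment.
  Log-convexity of the moments supplies the missing parities.
\<close>

section \<open>Recursion for the moments of one process\<close>

text \<open>For one process the sum over orderings becomes an iterated operator as soon as the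
  frequencies are weighted independently; for the p-th power of that sum this fails, which is the
  obstacle. Linearising with weights c^(p-1), where the sum of c^p is 1, leads to the kernel sqrt(Q
  x) c(y - x)^(p-1) sqrt(Q y). Its quadratic form pairs c^(p-1) with a correlation of f / sqrt(1 +
  \<psi>), so the best weights give the p-norm of that correlation: this is why \<open>rho\<close>
  has its form and why its p-th root appears. The method of types applies because \<open>Phi\<close>
  depends on the frequencies only through their multiplicities. The condition d < \<alpha> p enters
  as integrability of Q^p, which makes \<open>rho\<close> finite and controls the frequencies
  outside a finite set. The kernel is nonnegative, so it averages the local time, and its Fourier
  weights lie in [0, 1], so upper bounds may drop them. It is also periodic: at fixed mesh it adds
  the density at distant points, which does no harm to an upper bound but forces vanishing mesh in
  the lower one.\<close>

function Phi :: "('a::ab_group_add \<Rightarrow> real) \<Rightarrow> ('i \<Rightarrow> 'a) \<Rightarrow> 'i set \<Rightarrow> 'a \<Rightarrow> real" where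
  "Phi Q l S \<gamma> =
    (if finite S \<and> S \<noteq> {} then Q \<gamma> * (\<Sum>k\<in>S. Phi Q l (S - {k}) (\<gamma> + l k)) else Q \<gamma>)"
  by auto
termination
  by (relation "Wellfounded.measure (\<lambda>(Q, l, S, \<gamma>). card S)") (auto intro: psubset_card_mono simp: card_gt_0_iff)

declare Phi.simps [simp del]

lemma Phi_empty [simp]: "Phi Q l {} \<gamma> = Q \<gamma>"
  by (simp add: Phi.simps)

text \<open>Unfolded completely, this gives one product of \<open>card S + 1\<close> values of
  \<open>Q\<close> for each ordering of \<open>S\<close>. The index split off first is the one with
  the largest time, because \<open>prod_Int0\<close> splits a product of time integrals in this way;
  \<gamma> is the frequency carried by the later increments.\<close>

lemma Phi_nonempty:
  "finite S \<Longrightarrow> S \<noteq> {} \<Longrightarrow> Phi Q l S \<gamma> = Q \<gamma> * (\<Sum>k\<in>S. Phi Q l (S - {k}) (\<gamma> + l k))"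
  by (simp add: Phi.simps)

lemma Phi_nonneg:
  assumes "finite S" "\<And>x. 0 \<le> Q x"
  shows "0 \<le> Phi Q l S \<gamma>"
  using assms(1)
proof (induction S arbitrary: \<gamma> rule: finite_psubset_induct)
  case (psubset S)
  show ?case
  proof (cases "S = {}")
    case False
    have "0 \<le> Phi Q l (S - {k}) (\<gamma> + l k)" if "k \<in> S" for k
      using psubset.IH[of "S - {k}"] that by blast
    then show ?thesis
      using psubset.hyps False by (simp add: Phi_nonempty assms sum_nonneg)
  qed (simp add: assms)
qed

lemma Phi_cong:
  assumes "finite S" "\<And>k. k \<in> S \<Longrightarrow> l k = l' k"
  shows "Phi Q l S \<gamma> = Phi Q l' S \<gamma>"
  using assms
proof (induction S arbitrary: \<gamma> rule: finite_psubset_induct)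
  case (psubset S)
  show ?case
  proof (cases "S = {}")
    case False
    have "Phi Q l (S - {k}) (\<gamma> + l k) = Phi Q l' (S - {k}) (\<gamma> + l' k)" if "k \<in> S" for k
      using psubset.IH[of "S - {k}"] psubset.prems that by auto
    then show ?thesis
      using psubset.hyps False by (simp add: Phi_nonempty cong: sum.cong)
  qed simp
qed

text \<open>The iterated operator that arises from \<open>Phi\<close> when every frequency ranges
  independently over \<open>A\<close> with weight \<open>h\<close>.\<close>

primrec J :: "('a::ab_group_add \<Rightarrow> real) \<Rightarrow> ('a \<Rightarrow> real) \<Rightarrow> 'a set \<Rightarrow> nat \<Rightarrow> 'a \<Rightarrow> real" where
  "J Q h A 0 \<gamma> = Q \<gamma>"
| "J Q h A (Suc n) \<gamma> = Q \<gamma> * (\<Sum>a\<in>A. h a * J Q h A n (\<gamma> + a))"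

lemma J_nonneg:
  assumes "\<And>x. 0 \<le> Q x" "\<And>a. a \<in> A \<Longrightarrow> 0 \<le> h a"
  shows "0 \<le> J Q h A n \<gamma>"
  by (induction n arbitrary: \<gamma>) (auto simp: assms intro!: mult_nonneg_nonneg sum_nonneg)

lemma sum_PiE_remove:
  fixes g :: "('i \<Rightarrow> 'a) \<Rightarrow> 'b::comm_monoid_add"
  assumes "finite S" "k \<in> S" "finite A"
  shows "(\<Sum>x\<in>PiE S (\<lambda>_. A). g x) = (\<Sum>a\<in>A. \<Sum>y\<in>PiE (S - {k}) (\<lambda>_. A). g (y(k := a)))"
proof -
  have S: "S = insert k (S - {k})" using assms by auto
  have "(\<Sum>x\<in>PiE S (\<lambda>_. A). g x) = (\<Sum>x\<in>(\<lambda>(y, f). f(k := y)) ` (A \<times> PiE (S - {k}) (\<lambda>_. A)). g x)"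
    by (subst S, subst PiE_insert_eq) simp
  also have "\<dots> = (\<Sum>(a, y)\<in>A \<times> PiE (S - {k}) (\<lambda>_. A). g (y(k := a)))"
    by (subst sum.reindex) (use inj_combinator[of k "S - {k}" "\<lambda>_. A"] in \<open>auto simp: case_prod_unfold\<close>)
  also have "\<dots> = (\<Sum>a\<in>A. \<Sum>y\<in>PiE (S - {k}) (\<lambda>_. A). g (y(k := a)))"
    by (simp add: sum.cartesian_product)
  finally show ?thesis .
qed

text \<open>After summation over the frequencies all choices of the index split off contribute
  equally, so each level of \<open>Phi\<close> yields a factor \<open>card S\<close> and one
  application of the operator behind \<open>J\<close>.\<close>

lemma sum_PiE_Phi:
  assumes "finite S" "finite A"
  shows "(\<Sum>x\<in>PiE S (\<lambda>_. A). (\<Prod>k\<in>S. h (x k)) * Phi Q x S \<gamma>) = fact (card S) * J Q h A (card S) \<gamma>"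
  using assms(1)
proof (induction "card S" arbitrary: S \<gamma>)
  case 0
  then show ?case by simp
next
  case (Suc n)
  have S: "finite S" "S \<noteq> {}" using Suc.hyps(2) Suc.prems by auto
  have cS: "card (S - {k}) = n" if "k \<in> S" for k using Suc.hyps(2) that S by simp
  have *: "(\<Sum>x\<in>PiE S (\<lambda>_. A). (\<Prod>k\<in>S. h (x k)) * Phi Q x (S - {k}) (\<gamma> + x k))
        = fact n * (\<Sum>a\<in>A. h a * J Q h A n (\<gamma> + a))" if k: "k \<in> S" for k
  proof -
    have pr: "(\<Prod>j\<in>S. h ((y(k := a)) j)) = h a * (\<Prod>j\<in>S - {k}. h (y j))" for y a
      using S k by (subst prod.remove[of _ k]) (auto intro!: prod.cong)
    have ph: "Phi Q (y(k := a)) (S - {k}) x = Phi Q y (S - {k}) x" for y a x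
      using S by (intro Phi_cong) auto
    have "(\<Sum>x\<in>PiE S (\<lambda>_. A). (\<Prod>k\<in>S. h (x k)) * Phi Q x (S - {k}) (\<gamma> + x k))
      = (\<Sum>a\<in>A. \<Sum>y\<in>PiE (S - {k}) (\<lambda>_. A). h a * ((\<Prod>j\<in>S - {k}. h (y j)) * Phi Q y (S - {k}) (\<gamma> + a)))"
      by (subst sum_PiE_remove[OF S(1) k assms(2)]) (simp only: pr ph fun_upd_same mult.assoc)
    also have "\<dots> = (\<Sum>a\<in>A. h a * (fact n * J Q h A n (\<gamma> + a)))"
      using Suc.hyps(1)[of "S - {k}"] cS[OF k] S
      by (simp add: sum_distrib_left[symmetric])
    also have "\<dots> = fact n * (\<Sum>a\<in>A. h a * J Q h A n (\<gamma> + a))"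
      by (simp add: sum_distrib_left mult_ac)
    finally show ?thesis .
  qed
  have "(\<Sum>x\<in>PiE S (\<lambda>_. A). (\<Prod>k\<in>S. h (x k)) * Phi Q x S \<gamma>)
     = (\<Sum>x\<in>PiE S (\<lambda>_. A). \<Sum>k\<in>S. Q \<gamma> * ((\<Prod>k\<in>S. h (x k)) * Phi Q x (S - {k}) (\<gamma> + x k)))"
    using S by (simp add: Phi_nonempty sum_distrib_left mult_ac)
  also have "\<dots> = (\<Sum>k\<in>S. Q \<gamma> * (\<Sum>x\<in>PiE S (\<lambda>_. A). (\<Prod>k\<in>S. h (x k)) * Phi Q x (S - {k}) (\<gamma> + x k)))"
    by (subst sum.swap) (simp add: sum_distrib_left)
  also have "\<dots> = (\<Sum>k\<in>S. Q \<gamma> * (fact n * (\<Sum>a\<in>A. h a * J Q h A n (\<gamma> + a))))"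
    using * by simp
  also have "\<dots> = fact (card S) * J Q h A (card S) \<gamma>"
    unfolding Suc.hyps(2)[symmetric] by (simp add: Suc.hyps(2)[symmetric] algebra_simps)
  finally show ?case .
qed

text \<open>The tangent at \<open>a\<close> to the convex function x^(q+1), multiplied out. It is
  the convexity input both of the power mean inequality and of
  \<open>sum_Holder_power\<close>.\<close>

lemma power_tangent_le:
  fixes a b :: real
  assumes "0 \<le> a" "0 \<le> b"
  shows "real (Suc q) * a ^ q * b \<le> real q * a ^ Suc q + b ^ Suc q"
proof (induction q)
  case (Suc q)
  have "real (Suc (Suc q)) * a ^ Suc q * b = a * (real (Suc q) * a ^ q * b) + a ^ Suc q * b"
    by (simp add: algebra_simps)
  also have "\<dots> \<le> a * (real q * a ^ Suc q + b ^ Suc q) + a ^ Suc q * b"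
    using Suc assms by (intro add_right_mono mult_left_mono) auto
  also have "\<dots> \<le> real (Suc q) * a ^ Suc (Suc q) + b ^ Suc (Suc q)"
  proof -
    have "0 \<le> (a ^ Suc q - b ^ Suc q) * (a - b)"
      using assms power_mono[of a b "Suc q"] power_mono[of b a "Suc q"]
      by (cases "a \<le> b") (auto intro: mult_nonneg_nonneg mult_nonpos_nonpos)
    then show ?thesis by (simp add: algebra_simps)
  qed
  finally show ?case .
qed simp

lemma sum_power_le_card:
  fixes x :: "'i \<Rightarrow> real"
  assumes "finite S" "\<And>i. i \<in> S \<Longrightarrow> 0 \<le> x i"
  shows "(\<Sum>i\<in>S. x i) ^ Suc q \<le> real (card S) ^ q * (\<Sum>i\<in>S. x i ^ Suc q)"
proof (cases "S = {}")
  case False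
  define c where "c = real (card S)"
  define A where "A = (\<Sum>i\<in>S. x i) / c"
  have c: "c > 0" using False assms by (simp add: card_gt_0_iff c_def)
  have A: "0 \<le> A" "(\<Sum>i\<in>S. x i) = c * A"
    using c assms by (auto simp: A_def sum_nonneg)
  have "(\<Sum>i\<in>S. real (Suc q) * A ^ q * x i) \<le> (\<Sum>i\<in>S. real q * A ^ Suc q + x i ^ Suc q)"
    using A assms by (intro sum_mono power_tangent_le) auto
  then have "real (Suc q) * A ^ q * (c * A) \<le> c * (real q * A ^ Suc q) + (\<Sum>i\<in>S. x i ^ Suc q)"
    unfolding A(2)[symmetric] by (simp add: sum_distrib_left[symmetric] sum.distrib c_def)
  then have "c * A ^ Suc q \<le> (\<Sum>i\<in>S. x i ^ Suc q)"
    by (simp add: algebra_simps)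
  then have "c ^ q * (c * A ^ Suc q) \<le> c ^ q * (\<Sum>i\<in>S. x i ^ Suc q)"
    using c by (intro mult_left_mono) auto
  then show ?thesis
    unfolding A(2) by (simp add: c_def[symmetric] power_mult_distrib mult_ac)
qed simp

text \<open>A crude linearisation: the power mean inequality at each level of the recursion costs
  \<open>card S ^ q\<close>, hence \<open>fact (card S) ^ q\<close> altogether. It suffices for far
  frequencies, where lattice sums of Q^p are small.\<close>

lemma Phi_power_le:
  assumes "finite S" "\<And>x. 0 \<le> Q x"
  shows "(Phi Q l S \<gamma>) ^ Suc q \<le> fact (card S) ^ q * Phi (\<lambda>x. Q x ^ Suc q) l S \<gamma>"
  using assms(1)
proof (induction "card S" arbitrary: S \<gamma>)
  case 0
  then show ?case by simp
next
  case (Suc n)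
  have S: "finite S" "S \<noteq> {}" using Suc.hyps(2) Suc.prems by auto
  have cS: "card (S - {k}) = n" if "k \<in> S" for k using Suc.hyps(2) that S by simp
  let ?P = "Phi (\<lambda>x. Q x ^ Suc q) l"
  have "(Phi Q l S \<gamma>) ^ Suc q = Q \<gamma> ^ Suc q * (\<Sum>k\<in>S. Phi Q l (S - {k}) (\<gamma> + l k)) ^ Suc q"
    using S by (simp add: Phi_nonempty power_mult_distrib)
  also have "\<dots> \<le> Q \<gamma> ^ Suc q * (real (card S) ^ q * (\<Sum>k\<in>S. Phi Q l (S - {k}) (\<gamma> + l k) ^ Suc q))"
    using S assms by (intro mult_left_mono sum_power_le_card Phi_nonneg) auto
  also have "\<dots> \<le> Q \<gamma> ^ Suc q * (real (card S) ^ q * (\<Sum>k\<in>S. fact n ^ q * ?P (S - {k}) (\<gamma> + l k)))"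
  proof (intro mult_left_mono sum_mono)
    fix k assume "k \<in> S"
    then show "Phi Q l (S - {k}) (\<gamma> + l k) ^ Suc q \<le> fact n ^ q * ?P (S - {k}) (\<gamma> + l k)"
      using Suc.hyps(1)[of "S - {k}"] cS S by auto
  qed (use assms in auto)
  also have "\<dots> = fact (card S) ^ q * ?P S \<gamma>"
    using S unfolding Suc.hyps(2)[symmetric]
    by (simp add: Phi_nonempty sum_distrib_left power_mult_distrib mult_ac)
  finally show ?case .
qed

text \<open>If no element of \<open>B\<close> is a difference of elements of \<open>A0\<close>, then of two consecutive
  partial sums at least one lies outside \<open>A0\<close>; hence one small factor for every two steps.\<close>

lemma J_far_le:
  fixes R :: "'a::ab_group_add \<Rightarrow> real"
  assumes R: "\<And>x. 0 \<le> R x" and B: "finite B" "B \<subseteq> L" and L: "\<And>x y. x \<in> L \<Longrightarrow> y \<in> L \<Longrightarrow> x + y \<in> L"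
    and far: "\<And>a b. a \<in> A0 \<Longrightarrow> b \<in> A0 \<Longrightarrow> b - a \<notin> B"
    and S: "\<And>U. finite U \<Longrightarrow> U \<subseteq> L \<Longrightarrow> sum R U \<le> s"
    and T: "\<And>U. finite U \<Longrightarrow> U \<subseteq> L - A0 \<Longrightarrow> sum R U \<le> t"
    and \<gamma>: "\<gamma> \<in> L"
  shows "J R (\<lambda>_. 1) B (2 * k) \<gamma> \<le> (2 * s * t) ^ k * R \<gamma>"
  using \<gamma>
proof (induction k arbitrary: \<gamma>)
  case (Suc k)
  have s0: "0 \<le> s" "0 \<le> t" using S[of "{}"] T[of "{}"] by auto
  let ?c = "(2 * s * t) ^ k"
  have c0: "0 \<le> ?c" using s0 by simp
  \<comment> \<open>The pairs formed by the next two partial sums. The map from (x, y) to such a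
    pair is injective, so the double sum is a sum over \<open>P\<close> and may be enlarged to two
    product sets, each with one coordinate outside \<open>A0\<close>; this is the origin of the
    factor 2.\<close>
  define P where "P = (\<lambda>(x, y). (\<gamma> + x, \<gamma> + x + y)) ` (B \<times> B)"
  define U where "U = fst ` P \<union> snd ` P"
  have finU: "finite U" "U \<subseteq> L"
    unfolding U_def P_def using B Suc.prems L by (auto intro!: L)
  have inj: "inj_on (\<lambda>(x, y). (\<gamma> + x, \<gamma> + x + y)) (B \<times> B)"
    by (auto simp: inj_on_def)
  have Psub: "P \<subseteq> (U - A0) \<times> U \<union> U \<times> (U - A0)"
  proof
    fix z assume z: "z \<in> P"
    then obtain x y where xy: "z = (\<gamma> + x, \<gamma> + x + y)" "x \<in> B" "y \<in> B" unfolding P_def by auto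
    have "fst z \<in> U" "snd z \<in> U" using z unfolding U_def by auto
    moreover have "fst z \<notin> A0 \<or> snd z \<notin> A0"
      using far[of "fst z" "snd z"] xy by auto
    ultimately show "z \<in> (U - A0) \<times> U \<union> U \<times> (U - A0)" by (cases z) auto
  qed
  have "J R (\<lambda>_. 1) B (2 * Suc k) \<gamma> = R \<gamma> * (\<Sum>x\<in>B. R (\<gamma> + x) * (\<Sum>y\<in>B. J R (\<lambda>_. 1) B (2 * k) (\<gamma> + x + y)))"
    by simp
  also have "\<dots> \<le> R \<gamma> * (\<Sum>x\<in>B. R (\<gamma> + x) * (\<Sum>y\<in>B. ?c * R (\<gamma> + x + y)))"
    using B Suc.prems by (intro mult_left_mono sum_mono Suc.IH L R) auto
  also have "\<dots> = R \<gamma> * ?c * (\<Sum>(x, y)\<in>B \<times> B. R (\<gamma> + x) * R (\<gamma> + x + y))"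
    by (simp add: sum_distrib_left sum.cartesian_product[symmetric] mult_ac)
  also have "(\<Sum>(x, y)\<in>B \<times> B. R (\<gamma> + x) * R (\<gamma> + x + y)) = (\<Sum>(x, y)\<in>P. R x * R y)"
    unfolding P_def by (subst sum.reindex[OF inj]) (simp add: case_prod_unfold)
  also have "\<dots> \<le> (\<Sum>(x, y)\<in>(U - A0) \<times> U \<union> U \<times> (U - A0). R x * R y)"
    using Psub finU R by (intro sum_mono2) auto
  also have "\<dots> \<le> (\<Sum>(x, y)\<in>(U - A0) \<times> U. R x * R y) + (\<Sum>(x, y)\<in>U \<times> (U - A0). R x * R y)"
    using finU R by (subst sum.union_inter[symmetric]) (auto intro!: sum_nonneg simp del: Times_Un_distrib1)
  also have "\<dots> = 2 * (sum R U * sum R (U - A0))"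
    by (simp add: sum_product sum.cartesian_product[symmetric] sum.swap[of _ U "U - A0"] mult_ac)
  also have "\<dots> \<le> 2 * (s * t)"
    using finU s0 by (intro mult_left_mono mult_mono S T) (auto intro!: sum_nonneg R)
  finally have "J R (\<lambda>_. 1) B (2 * Suc k) \<gamma> \<le> R \<gamma> * ?c * (2 * (s * t))"
    using R c0 by (simp add: mult_left_mono)
  then show ?case by (simp add: mult_ac)
qed simp

text \<open>Hoelder's inequality with exponents q + 1 and (q + 1)/q, cleared of roots. The tangent
  inequality is used at \<open>t * b x\<close>, the extremal shape of \<open>F\<close>, and t = X /
  Y is the value that optimises the resulting bound.\<close>

lemma sum_Holder_power:
  fixes F b :: "'i \<Rightarrow> real"
  assumes "finite \<Omega>" "\<And>x. x \<in> \<Omega> \<Longrightarrow> 0 \<le> F x" "\<And>x. x \<in> \<Omega> \<Longrightarrow> 0 \<le> b x"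
  shows "(\<Sum>x\<in>\<Omega>. b x ^ q * F x) ^ Suc q \<le> (\<Sum>x\<in>\<Omega>. F x ^ Suc q) * (\<Sum>x\<in>\<Omega>. b x ^ Suc q) ^ q"
proof -
  define X where "X = (\<Sum>x\<in>\<Omega>. b x ^ q * F x)"
  define Y where "Y = (\<Sum>x\<in>\<Omega>. b x ^ Suc q)"
  have X0: "0 \<le> X" and Y0: "0 \<le> Y" using assms by (auto simp: X_def Y_def intro!: sum_nonneg)
  show ?thesis
  proof (cases "Y = 0")
    case True
    then have b: "b x = 0" if "x \<in> \<Omega>" for x
      using assms that by (auto simp: Y_def sum_nonneg_eq_0_iff)
    show ?thesis
    \<comment> \<open>For q = 0 the factor \<open>b x ^ q\<close> is 1 even where
      \<open>b x = 0\<close>, so the left-hand sum need not vanish; in that case both sides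
      agree.\<close>
    proof (cases "q = 0")
      case False
      then have "(\<Sum>x\<in>\<Omega>. b x ^ q * F x) = 0" using b by (intro sum.neutral) auto
      then show ?thesis using assms by (simp add: sum_nonneg del: power_Suc)
    qed simp
  next
    case False
    then have Y: "Y > 0" using Y0 by simp
    define t where "t = X / Y"
    have t: "0 \<le> t" using X0 Y by (simp add: t_def)
    have "(\<Sum>x\<in>\<Omega>. real (Suc q) * (t * b x) ^ q * F x) \<le> (\<Sum>x\<in>\<Omega>. real q * (t * b x) ^ Suc q + F x ^ Suc q)"
      using t assms by (intro sum_mono power_tangent_le) auto
    also have "(\<Sum>x\<in>\<Omega>. real (Suc q) * (t * b x) ^ q * F x) = real (Suc q) * t ^ q * X"
      by (simp add: X_def sum_distrib_left power_mult_distrib mult_ac)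
    also have "(\<Sum>x\<in>\<Omega>. real q * (t * b x) ^ Suc q + F x ^ Suc q) = real q * t ^ Suc q * Y + (\<Sum>x\<in>\<Omega>. F x ^ Suc q)"
      by (simp add: Y_def sum_distrib_left power_mult_distrib mult_ac sum.distrib)
    finally have "real (Suc q) * t ^ q * X - real q * t ^ Suc q * Y \<le> (\<Sum>x\<in>\<Omega>. F x ^ Suc q)" by simp
    moreover have "real (Suc q) * t ^ q * X - real q * t ^ Suc q * Y = X ^ Suc q / Y ^ q"
    proof -
      have "t * Y = X" using Y by (simp add: t_def)
      then have "t ^ Suc q * Y = t ^ q * X" by (metis mult.assoc power_Suc2)
      then have "real (Suc q) * t ^ q * X - real q * t ^ Suc q * Y = t ^ q * X"
        by (simp only: mult.assoc) (simp add: algebra_simps)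
      then show ?thesis by (simp add: t_def power_divide)
    qed
    ultimately have "X ^ Suc q / Y ^ q \<le> (\<Sum>x\<in>\<Omega>. F x ^ Suc q)" by simp
    then show ?thesis using Y by (simp add: X_def[symmetric] Y_def[symmetric] pos_divide_le_eq del: power_Suc)
  qed
qed

text \<open>Division by sqrt Q turns the recursion into iteration of the kernel sqrt(Q \<gamma>)
  h(a) sqrt(Q(\<gamma> + a)). Testing the bilinear bound with g = T f gives |T f|^2 \<le> \<tau> |f|
  |T f|, so the hypothesis is a norm bound for T. The window \<open>U j\<close> contains the partial
  sums possible after j steps; only the size of the last one enters, through the norm of the initial
  function sqrt Q \<le> 1.\<close>

lemma J_operator_bound:
  fixes Q h :: "'a::ab_group_add \<Rightarrow> real" and U :: "nat \<Rightarrow> 'a set"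
  assumes Q: "\<And>x. 0 < Q x" "\<And>x. Q x \<le> 1" and A: "finite A" "\<And>a. a \<in> A \<Longrightarrow> 0 \<le> h a"
    and U: "\<And>j. finite (U j)" "U 0 = {0}" "\<And>j \<gamma> a. \<gamma> \<in> U j \<Longrightarrow> a \<in> A \<Longrightarrow> \<gamma> + a \<in> U (Suc j)"
    and \<tau>: "0 \<le> \<tau>"
    and bil: "\<And>j f g. (\<And>x. 0 \<le> f x) \<Longrightarrow> (\<And>x. 0 \<le> g x) \<Longrightarrow>
        (\<Sum>a\<in>A. h a * (\<Sum>\<gamma>\<in>U j. g \<gamma> * (sqrt (Q \<gamma>) * sqrt (Q (\<gamma> + a)) * f (\<gamma> + a))))
        \<le> \<tau> * sqrt (\<Sum>\<gamma>\<in>U (Suc j). (f \<gamma>)\<^sup>2) * sqrt (\<Sum>\<gamma>\<in>U j. (g \<gamma>)\<^sup>2)"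
  shows "J Q h A n 0 \<le> \<tau> ^ n * sqrt (card (U n))"
proof -
  define v where "v k \<gamma> = J Q h A k \<gamma> / sqrt (Q \<gamma>)" for k \<gamma>
  have Jv: "J Q h A k \<gamma> = sqrt (Q \<gamma>) * v k \<gamma>" for k \<gamma>
    using Q(1)[of \<gamma>] by (simp add: v_def)
  have v0: "0 \<le> v k \<gamma>" for k \<gamma>
    unfolding v_def using Q A by (intro divide_nonneg_nonneg J_nonneg) (auto intro: less_imp_le)
  have vSuc: "v (Suc k) \<gamma> = sqrt (Q \<gamma>) * (\<Sum>a\<in>A. h a * (sqrt (Q (\<gamma> + a)) * v k (\<gamma> + a)))" for k \<gamma>
    using Q(1)[of \<gamma>] by (simp add: v_def[of "Suc k"] Jv real_div_sqrt less_imp_le flip: times_divide_eq_left)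
  \<comment> \<open>The iterate \<open>v k\<close> is needed where n - k steps have already been
    made, so its norm is taken over \<open>U (n - k)\<close>. For k = n this window is the single
    point 0.\<close>
  define N where "N k = sqrt (\<Sum>\<gamma>\<in>U (n - k). (v k \<gamma>)\<^sup>2)" for k
  have N0: "0 \<le> N k" for k by (simp add: N_def sum_nonneg)
  have step: "N (Suc k) \<le> \<tau> * N k" if k: "k < n" for k
  proof -
    define j where "j = n - Suc k"
    have j: "Suc j = n - k" using k by (simp add: j_def)
    have "(N (Suc k))\<^sup>2 = (\<Sum>\<gamma>\<in>U j. v (Suc k) \<gamma> * v (Suc k) \<gamma>)"
      by (simp add: N_def j_def sum_nonneg power2_eq_square)
    also have "\<dots> = (\<Sum>\<gamma>\<in>U j. \<Sum>a\<in>A. h a * (v (Suc k) \<gamma> * (sqrt (Q \<gamma>) * sqrt (Q (\<gamma> + a)) * v k (\<gamma> + a))))"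
      by (subst (2) vSuc) (simp add: sum_distrib_left mult_ac)
    also have "\<dots> = (\<Sum>a\<in>A. h a * (\<Sum>\<gamma>\<in>U j. v (Suc k) \<gamma> * (sqrt (Q \<gamma>) * sqrt (Q (\<gamma> + a)) * v k (\<gamma> + a))))"
      by (subst sum.swap) (simp add: sum_distrib_left)
    also have "\<dots> \<le> \<tau> * sqrt (\<Sum>\<gamma>\<in>U (Suc j). (v k \<gamma>)\<^sup>2) * sqrt (\<Sum>\<gamma>\<in>U j. (v (Suc k) \<gamma>)\<^sup>2)"
      using v0 by (intro bil)
    also have "\<dots> = \<tau> * N k * N (Suc k)"
      by (simp add: N_def j, simp add: j_def)
    finally have "(N (Suc k))\<^sup>2 \<le> \<tau> * N k * N (Suc k)" .
    then show ?thesis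
      using N0[of "Suc k"] N0[of k] \<tau> by (cases "N (Suc k) = 0") (auto simp: power2_eq_square)
  qed
  have "N k \<le> \<tau> ^ k * N 0" if "k \<le> n" for k
    using that
  proof (induction k)
    case (Suc k)
    then have "N (Suc k) \<le> \<tau> * N k" by (intro step) simp
    also have "\<dots> \<le> \<tau> * (\<tau> ^ k * N 0)" using Suc \<tau> by (intro mult_left_mono) auto
    finally show ?case by simp
  qed simp
  from this[of n] have "N n \<le> \<tau> ^ n * N 0" by simp
  moreover have "N n = v n 0" using v0 by (simp add: N_def U)
  moreover have "J Q h A n 0 \<le> v n 0"
    using Jv[of n 0] Q(2)[of 0] v0[of n 0] Q(1)[of 0] by (simp add: mult_left_le_one_le)
  moreover have "N 0 \<le> sqrt (card (U n))"
  proof -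
    have "(v 0 \<gamma>)\<^sup>2 \<le> 1" for \<gamma>
      using Q(1)[of \<gamma>] Q(2)[of \<gamma>] by (simp add: v_def real_div_sqrt)
    then have "(\<Sum>\<gamma>\<in>U n. (v 0 \<gamma>)\<^sup>2) \<le> (\<Sum>\<gamma>\<in>U n. 1)" by (intro sum_mono)
    then show ?thesis by (simp add: N_def)
  qed
  ultimately show ?thesis
    using \<tau> by (smt (verit) mult_left_mono zero_le_power)
qed

section \<open>The method of types\<close>

definition types :: "'a set \<Rightarrow> nat \<Rightarrow> ('a \<Rightarrow> nat) set" where
  "types A n = {t \<in> PiE A (\<lambda>_. UNIV). sum t A = n}"

lemma types_iff: "t \<in> types A n \<longleftrightarrow> (\<forall>x. x \<notin> A \<longrightarrow> t x = undefined) \<and> sum t A = n"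
  by (auto simp: types_def PiE_iff extensional_def)

lemma types_le:
  assumes "finite A" "t \<in> types A n" "a \<in> A" shows "t a \<le> n"
  using member_le_sum[of a A t] assms by (simp add: types_iff)

lemma types_subset:
  assumes "finite A" shows "types A n \<subseteq> PiE A (\<lambda>_. {..n})"
  using types_le[OF assms] by (auto simp: PiE_iff extensional_def types_iff)

lemma finite_types: "finite A \<Longrightarrow> finite (types A n)"
  by (rule finite_subset[OF types_subset]) (auto intro!: finite_PiE)

lemma card_types_le:
  assumes "finite A" shows "card (types A n) \<le> Suc n ^ card A"
proof -
  have "card (types A n) \<le> card (PiE A (\<lambda>_. {..n}))"
    using assms by (intro card_mono types_subset finite_PiE) auto
  then show ?thesis using assms by (simp add: card_PiE)
qed

text \<open>In this divided form the addition of one element to \<open>A\<close> is exactly the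
  binomial theorem divided by \<open>fact n\<close>: its multiplicity k is split off and a type of
  size n - k remains.\<close>

lemma multinomial:
  fixes z :: "'a \<Rightarrow> 'b::field_char_0"
  assumes "finite A"
  shows "(\<Sum>a\<in>A. z a) ^ n / fact n = (\<Sum>t\<in>types A n. \<Prod>a\<in>A. z a ^ t a / fact (t a))"
  using assms
proof (induction A arbitrary: n rule: finite_induct)
  case empty
  have "types ({} :: 'a set) n = (if n = 0 then {\<lambda>_. undefined} else {})" by (auto simp: types_iff)
  then show ?case by (cases "n = 0") (simp_all add: power_0_left)
next
  case (insert b A)
  let ?w = "\<lambda>t. \<Prod>a\<in>A. z a ^ t a / fact (t a)"
  let ?D = "SIGMA k:{..n}. types A (n - k)"
  have upd: "sum (f(b := k)) A = sum f A" for f and k :: nat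
    using insert by (intro sum.cong) auto
  have und: "f b = undefined" if "f \<in> types A m" for f m
    using that insert by (auto simp: types_iff)
  have bij: "bij_betw (\<lambda>(k, f). f(b := k)) ?D (types (insert b A) n)"
    unfolding bij_betw_def
  proof (intro conjI inj_onI equalityI subsetI)
    fix x y assume xy: "x \<in> ?D" "y \<in> ?D" "(case x of (k, f) \<Rightarrow> f(b := k)) = (case y of (k, f) \<Rightarrow> f(b := k))"
    obtain k f k' f' where eq: "x = (k, f)" "y = (k', f')" by (cases x, cases y)
    have e: "f(b := k) = f'(b := k')" using xy eq by simp
    have "f b = undefined" "f' b = undefined" using xy eq und by auto
    then have "f = f'" using e by (metis fun_upd_triv fun_upd_upd)
    moreover have "k = k'" using fun_cong[OF e, of b] by simp
    ultimately show "x = y" using eq by simp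
  next
    fix t assume "t \<in> (\<lambda>(k, f). f(b := k)) ` ?D"
    then obtain k f where "t = f(b := k)" "k \<le> n" "f \<in> types A (n - k)" by auto
    then show "t \<in> types (insert b A) n"
      using insert upd[of f k] unfolding types_iff by simp
  next
    fix t assume t: "t \<in> types (insert b A) n"
    then have "sum t (insert b A) = n" by (simp add: types_iff)
    then have "t b + sum t A = n" using insert by simp
    moreover have "t(b := undefined) \<in> types A (n - t b)"
      using t insert upd[of t undefined] calculation unfolding types_iff by auto
    ultimately have "(t b, t(b := undefined)) \<in> ?D" by auto
    then show "t \<in> (\<lambda>(k, f). f(b := k)) ` ?D" by (intro image_eqI) auto
  qed
  have w: "(\<Prod>a\<in>insert b A. z a ^ (f(b := k)) a / fact ((f(b := k)) a)) = z b ^ k / fact k * ?w f" for f k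
  proof -
    have "(\<Prod>a\<in>A. z a ^ (f(b := k)) a / fact ((f(b := k)) a)) = ?w f"
      using insert by (intro prod.cong) auto
    then show ?thesis using insert by simp
  qed
  have "(\<Sum>a\<in>insert b A. z a) ^ n / fact n = (\<Sum>k\<le>n. of_nat (n choose k) * z b ^ k * (\<Sum>a\<in>A. z a) ^ (n - k) / fact n)"
    using insert by (simp add: binomial_ring sum_divide_distrib)
  also have "\<dots> = (\<Sum>k\<le>n. z b ^ k / fact k * ((\<Sum>a\<in>A. z a) ^ (n - k) / fact (n - k)))"
    by (intro sum.cong refl) (simp add: binomial_fact field_simps)
  also have "\<dots> = (\<Sum>k\<le>n. \<Sum>f\<in>types A (n - k). z b ^ k / fact k * ?w f)"
    by (simp only: insert.IH sum_distrib_left)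
  also have "\<dots> = (\<Sum>(k, f)\<in>?D. z b ^ k / fact k * ?w f)"
    using insert by (subst sum.Sigma) (auto intro: finite_types)
  also have "\<dots> = (\<Sum>t\<in>types (insert b A) n. \<Prod>a\<in>insert b A. z a ^ t a / fact (t a))"
    by (subst sum.reindex_bij_betw[OF bij, symmetric]) (simp only: case_prod_unfold w)
  finally show ?case .
qed

lemma power_self_le: "real n ^ n \<le> fact n * exp (real n)"
proof (induction n)
  case (Suc n)
  have "real (Suc n) ^ n \<le> exp 1 * real n ^ n"
  proof (cases "n = 0")
    case False
    have "(1 + 1 / real n) ^ n \<le> exp (1 / real n) ^ n"
      by (intro power_mono exp_ge_add_one_self) auto
    also have "\<dots> = exp 1" using False by (simp flip: exp_of_nat_mult)
    finally have "((real n + 1) / real n) ^ n \<le> exp 1" using False by (simp add: field_simps)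
    then show ?thesis using False by (simp add: power_divide field_simps)
  qed simp
  then have "real (Suc n) ^ Suc n \<le> real (Suc n) * (exp 1 * real n ^ n)" by (simp del: of_nat_Suc)
  also have "\<dots> \<le> real (Suc n) * (exp 1 * (fact n * exp (real n)))"
    using Suc by (intro mult_left_mono) auto
  finally show ?case by (simp add: exp_add mult_ac)
qed simp

text \<open>With \<open>power_self_le\<close> this is Stirling's formula up to a polynomial factor.
  The factor n + 1 in place of n keeps it valid for n = 0, where \<open>0 ^ 0 = 1\<close>.\<close>

lemma fact_exp_le: "fact n * exp (real n) \<le> exp 1 * (real n + 1) * real n ^ n"
proof (cases n)
  case (Suc m)
  have "fact n * exp (real n) \<le> exp 1 * real n * real n ^ n" if "n > 0" for n
    using that
  proof (induction n rule: nat_induct_non_zero)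
    case (Suc n)
    have n: "real n > 0" using Suc by simp
    \<comment> \<open>With x = 1/(n + 1), raising 1 - x \<le> exp(-x) to the power n + 1 gives
      exp(1) n^(n+1) \<le> (n + 1)^(n+1), which drives the induction.\<close>
    have "1 - 1 / (real n + 1) \<le> exp (- (1 / (real n + 1)))"
      using exp_ge_add_one_self[of "- (1 / (real n + 1))"] by simp
    then have "(real n / (real n + 1)) ^ Suc n \<le> exp (- (1 / (real n + 1))) ^ Suc n"
      by (intro power_mono) (auto simp: field_simps)
    also have "\<dots> = exp (real (Suc n) * (- (1 / (real n + 1))))" by (subst exp_of_nat_mult) simp
    also have "\<dots> = exp (- 1)" by (simp add: field_simps)
    finally have "(real n / (real n + 1)) ^ Suc n \<le> 1 / exp 1" by (simp add: exp_minus field_simps)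
    then have e: "exp 1 * real n ^ Suc n \<le> (real n + 1) ^ Suc n"
      using n by (simp add: power_divide field_simps del: power_Suc)
    have "fact (Suc n) * exp (real (Suc n)) = (real n + 1) * exp 1 * (fact n * exp (real n))"
      by (simp add: exp_add algebra_simps)
    also have "\<dots> \<le> (real n + 1) * exp 1 * (exp 1 * real n * real n ^ n)"
      using Suc by (intro mult_left_mono) auto
    also have "\<dots> = (real n + 1) * exp 1 * (exp 1 * real n ^ Suc n)" by simp
    also have "\<dots> \<le> (real n + 1) * exp 1 * ((real n + 1) ^ Suc n)"
      using e by (intro mult_left_mono) auto
    finally show ?case by (simp add: algebra_simps)
  qed simp
  from this[of n] have "fact n * exp (real n) \<le> exp 1 * real n * real n ^ n" using Suc by simp
  also have "\<dots> \<le> exp 1 * (real n + 1) * real n ^ n" by (intro mult_right_mono mult_left_mono) auto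
  finally show ?thesis .
qed simp

text \<open>For independent letters with distribution t / n, the sequences of type t have total
  probability at least \<open>1 / (exp 1 * (n + 1)) ^ card A\<close>; the inequality is this
  estimate multiplied out.\<close>

lemma prod_fact_types_le:
  assumes A: "finite A" and t: "t \<in> types A n"
  shows "(\<Prod>a\<in>A. fact (t a)) * real n ^ n \<le> fact n * (exp 1 * (real n + 1)) ^ card A * (\<Prod>a\<in>A. real (t a) ^ t a)"
proof -
  have tn: "t a \<le> n" if "a \<in> A" for a using types_subset[OF A] t that by (auto simp: PiE_iff)
  have st: "sum t A = n" using t by (simp add: types_def)
  have "(\<Prod>a\<in>A. fact (t a) * exp (real (t a))) \<le> (\<Prod>a\<in>A. exp 1 * (real n + 1) * real (t a) ^ t a)"
  proof (intro prod_mono conjI)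
    fix a assume a: "a \<in> A"
    have "fact (t a) * exp (real (t a)) \<le> exp 1 * (real (t a) + 1) * real (t a) ^ t a" by (rule fact_exp_le)
    also have "\<dots> \<le> exp 1 * (real n + 1) * real (t a) ^ t a"
      using tn[OF a] by (intro mult_right_mono mult_left_mono) auto
    finally show "fact (t a) * exp (real (t a)) \<le> exp 1 * (real n + 1) * real (t a) ^ t a" .
  qed auto
  also have "(\<Prod>a\<in>A. fact (t a) * exp (real (t a))) = (\<Prod>a\<in>A. fact (t a)) * exp (real n)"
    using A st by (simp add: prod.distrib flip: exp_sum of_nat_sum)
  finally have le: "(\<Prod>a\<in>A. fact (t a)) * exp (real n) \<le> (exp 1 * (real n + 1)) ^ card A * (\<Prod>a\<in>A. real (t a) ^ t a)"
    by (simp add: prod.distrib)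
  have "(\<Prod>a\<in>A. fact (t a)) * real n ^ n \<le> (\<Prod>a\<in>A. fact (t a)) * (fact n * exp (real n))"
    using power_self_le by (intro mult_left_mono prod_nonneg) auto
  also have "\<dots> = fact n * ((\<Prod>a\<in>A. fact (t a)) * exp (real n))" by simp
  also have "\<dots> \<le> fact n * ((exp 1 * (real n + 1)) ^ card A * (\<Prod>a\<in>A. real (t a) ^ t a))"
    using le by (intro mult_left_mono) auto
  finally show ?thesis by (simp add: mult_ac)
qed

text \<open>The method of types: the weights \<open>c a ^ Suc q = t a / n\<close> make the single term \<open>t\<close> of the
  weighted sum in the hypothesis dominant up to a polynomial factor.\<close>

lemma types_bound:
  fixes D :: "('a \<Rightarrow> nat) \<Rightarrow> real"
  assumes A: "finite A" and n: "n > 0" and V0: "0 \<le> V" and D: "\<And>t. t \<in> types A n \<Longrightarrow> 0 \<le> D t"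
    and V: "\<And>c. (\<And>a. a \<in> A \<Longrightarrow> 0 \<le> c a) \<Longrightarrow> (\<Sum>a\<in>A. c a ^ Suc q) = 1 \<Longrightarrow>
       (\<Sum>t\<in>types A n. (\<Prod>a\<in>A. (c a ^ q) ^ t a / fact (t a)) * D t) \<le> V"
  shows "(\<Sum>t\<in>types A n. D t ^ Suc q / (\<Prod>a\<in>A. fact (t a)))
    \<le> fact n ^ q * V ^ Suc q * (real (Suc n) ^ card A * ((exp 1 * (real n + 1)) ^ card A) ^ q)"
proof -
  let ?E = "(exp 1 * (real n + 1)) ^ card A"
  have each: "D t ^ Suc q / (\<Prod>a\<in>A. fact (t a)) \<le> fact n ^ q * V ^ Suc q * ?E ^ q" if t: "t \<in> types A n" for t
  proof -
    define c where "c a = root (Suc q) (real (t a) / real n)" for a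
    have c0: "0 \<le> c a" for a by (simp add: c_def)
    have cp: "c a ^ Suc q = real (t a) / real n" for a
      unfolding c_def by (subst real_root_pow_pos2) auto
    have "sum t A = n" using t by (simp add: types_def)
    then have c1: "(\<Sum>a\<in>A. c a ^ Suc q) = 1"
      using n by (simp only: cp flip: sum_divide_distrib of_nat_sum) simp
    let ?F = "\<Prod>a\<in>A. fact (t a) :: real"
    let ?W = "\<Prod>a\<in>A. (c a ^ q) ^ t a"
    let ?P = "\<Prod>a\<in>A. real (t a) ^ t a"
    have F: "?F > 0" by (intro prod_pos) auto
    have P: "?P > 0" by (intro prod_pos) auto
    \<comment> \<open>Where \<open>t a = 0\<close> the weight \<open>c a\<close> vanishes too, but
      the factor is then \<open>0 ^ 0 = 1\<close>.\<close>
    have c0': "c a ^ t a > 0" for a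
      using n by (cases "t a = 0") (auto simp: c_def)
    then have W: "?W > 0" by (intro prod_pos) (metis power_mult mult.commute zero_less_power)
    have "(\<Prod>a\<in>A. (c a ^ q) ^ t a / fact (t a)) * D t \<le> V"
    proof (rule order_trans[OF _ V[of c]])
      show "(\<Prod>a\<in>A. (c a ^ q) ^ t a / fact (t a)) * D t \<le> (\<Sum>t\<in>types A n. (\<Prod>a\<in>A. (c a ^ q) ^ t a / fact (t a)) * D t)"
        using t A c0 D
        by (intro member_le_sum[where f = "\<lambda>t. (\<Prod>a\<in>A. (c a ^ q) ^ t a / fact (t a)) * D t"] finite_types)
           (auto intro!: mult_nonneg_nonneg prod_nonneg)
    qed (use c0 c1 in auto)
    then have "?W * D t \<le> V * ?F" using F by (simp add: prod_dividef field_simps)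
    then have "(?W * D t) ^ Suc q \<le> (V * ?F) ^ Suc q"
      using W D[OF t] by (intro power_mono) auto
    moreover have "?W ^ Suc q = (?P / real n ^ n) ^ q"
    proof -
      have "?W ^ Suc q = (\<Prod>a\<in>A. (c a ^ Suc q) ^ t a) ^ q"
        unfolding prod_power_distrib
        by (intro prod.cong refl) (metis power_mult mult.commute)
      also have "(\<Prod>a\<in>A. (c a ^ Suc q) ^ t a) = ?P / (\<Prod>a\<in>A. real n ^ t a)"
        by (simp only: cp power_divide prod_dividef)
      also have "(\<Prod>a\<in>A. real n ^ t a) = real n ^ n"
        using \<open>sum t A = n\<close> by (simp add: power_sum[symmetric])
      finally show ?thesis .
    qed
    ultimately have "(?P / real n ^ n) ^ q * D t ^ Suc q \<le> V ^ Suc q * ?F ^ Suc q"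
      by (simp only: power_mult_distrib)
    then have 1: "?P ^ q * (D t ^ Suc q / ?F) \<le> V ^ Suc q * (?F * real n ^ n) ^ q"
      using F n by (simp add: power_divide field_simps)
    have "V ^ Suc q * (?F * real n ^ n) ^ q \<le> V ^ Suc q * (fact n * ?E * ?P) ^ q"
      using V0 F prod_fact_types_le[OF A t] by (intro mult_left_mono power_mono) auto
    then have "?P ^ q * (D t ^ Suc q / ?F) \<le> ?P ^ q * (fact n ^ q * V ^ Suc q * ?E ^ q)"
      using 1 by (simp add: power_mult_distrib mult_ac)
    then show ?thesis using P by (meson mult_le_cancel_left_pos zero_less_power)
  qed
  have t0: "0 \<le> D t ^ Suc q / (\<Prod>a\<in>A. fact (t a))" if "t \<in> types A n" for t
    using D[OF that] by (auto intro!: divide_nonneg_nonneg prod_nonneg)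
  show ?thesis
  proof (cases "types A n = {}")
    case True
    show ?thesis
    \<comment> \<open>Since n > 0, types are absent only for empty \<open>A\<close>: otherwise the
      whole multiplicity can be put on one element.\<close>
    proof (cases "A = {}")
      case False
      then obtain a where a: "a \<in> A" by auto
      have "(\<lambda>x\<in>A. if x = a then n else 0) \<in> types A n"
        using a A by (auto simp: types_def)
      then show ?thesis using True by simp
    next
      case True
      then show ?thesis using n V0 by (simp add: types_def)
    qed
  next
    case False
    have "(\<Sum>t\<in>types A n. D t ^ Suc q / (\<Prod>a\<in>A. fact (t a))) \<le> real (card (types A n)) * (fact n ^ q * V ^ Suc q * ?E ^ q)"
      using each by (intro sum_bounded_above) auto
    also have "\<dots> \<le> real (Suc n ^ card A) * (fact n ^ q * V ^ Suc q * ?E ^ q)"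
    proof (intro mult_right_mono)
      obtain t where "t \<in> types A n" using False by auto
      then show "0 \<le> fact n ^ q * V ^ Suc q * ?E ^ q" using each t0 by (meson order_trans)
    qed (use card_types_le[OF A] in \<open>simp only: of_nat_le_iff\<close>)
    finally show ?thesis by (simp add: mult_ac)
  qed
qed

section \<open>Even powers of a symmetric kernel, and lower bounds for \<open>J\<close>\<close>

definition kernel_op :: "'a set \<Rightarrow> ('a \<Rightarrow> 'a \<Rightarrow> real) \<Rightarrow> ('a \<Rightarrow> real) \<Rightarrow> 'a \<Rightarrow> real" where
  "kernel_op B K u x = (\<Sum>y\<in>B. K x y * u y)"

lemma kernel_op_symmetric:
  assumes "\<And>x y. x \<in> B \<Longrightarrow> y \<in> B \<Longrightarrow> K x y = K y x"
  shows "(\<Sum>x\<in>B. u x * kernel_op B K v x) = (\<Sum>x\<in>B. kernel_op B K u x * v x)"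
proof -
  have "(\<Sum>x\<in>B. u x * kernel_op B K v x) = (\<Sum>x\<in>B. \<Sum>y\<in>B. K x y * u x * v y)"
    by (simp add: kernel_op_def sum_distrib_left mult_ac)
  also have "\<dots> = (\<Sum>y\<in>B. \<Sum>x\<in>B. K x y * u x * v y)" by (rule sum.swap)
  also have "\<dots> = (\<Sum>y\<in>B. \<Sum>x\<in>B. K y x * u x * v y)"
    by (intro sum.cong refl) (simp add: assms)
  finally show ?thesis by (simp add: kernel_op_def sum_distrib_right)
qed

text \<open>\<open>b / e\<close> is the Rayleigh quotient of \<open>f\<close>. By symmetry
  \<open>s i\<close> = <f, T^(2i) f> = |T^i f|^2, and Cauchy-Schwarz makes this sequence log-convex.
  Its first ratio is already at least \<open>(b / e)\<^sup>2\<close>, hence so are all later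
  ones.\<close>

lemma kernel_op_power_ge:
  assumes B: "finite B" and sym: "\<And>x y. x \<in> B \<Longrightarrow> y \<in> B \<Longrightarrow> K x y = K y x"
    and e: "e = (\<Sum>x\<in>B. f x * f x)" "e > 0" and b: "b = (\<Sum>x\<in>B. f x * kernel_op B K f x)" "b \<ge> 0"
  shows "e * (b / e) ^ (2 * j) \<le> (\<Sum>x\<in>B. f x * (kernel_op B K ^^ (2 * j)) f x)"
proof -
  define T where "T = kernel_op B K"
  define s where "s i = (\<Sum>x\<in>B. ((T ^^ i) f x)\<^sup>2)" for i
  have move: "(\<Sum>x\<in>B. f x * (T ^^ (i + k)) f x) = (\<Sum>x\<in>B. (T ^^ i) f x * (T ^^ k) f x)" for i k
  proof (induction i arbitrary: k)
    case (Suc i)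
    have "(\<Sum>x\<in>B. f x * (T ^^ (Suc i + k)) f x) = (\<Sum>x\<in>B. (T ^^ i) f x * (T ^^ Suc k) f x)"
      using Suc[of "Suc k"] by simp
    also have "\<dots> = (\<Sum>x\<in>B. (T ^^ Suc i) f x * (T ^^ k) f x)"
      using kernel_op_symmetric[of B K "(T ^^ i) f" "(T ^^ k) f", OF sym] by (simp add: T_def)
    finally show ?case .
  qed simp
  have s2: "(\<Sum>x\<in>B. f x * (T ^^ (2 * i)) f x) = s i" for i
    using move[of i i] by (simp add: s_def power2_eq_square mult_2)
  have s0: "s 0 = e" by (simp add: s_def e power2_eq_square)
  have snn: "0 \<le> s i" for i by (simp add: s_def sum_nonneg)
  have cs: "(s (Suc i))\<^sup>2 \<le> s i * s (Suc (Suc i))" for i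
  proof -
    have "s (Suc i) = (\<Sum>x\<in>B. (T ^^ i) f x * (T ^^ Suc (Suc i)) f x)"
      using move[of i "Suc (Suc i)"] s2[of "Suc i"] by (simp add: mult_2)
    then show ?thesis unfolding s_def by (metis Cauchy_Schwarz_ineq_sum)
  qed
  have s1: "b\<^sup>2 \<le> s 0 * s 1"
    unfolding s_def b using Cauchy_Schwarz_ineq_sum[of f "T f" B] by (simp add: T_def)
  have "e * (b / e) ^ (2 * j) \<le> s j"
  proof (cases "b = 0")
    case True then show ?thesis using snn s0 by (cases j) auto
  next
    case False
    then have bp: "b > 0" using b by simp
    define r where "r = (b / e)\<^sup>2"
    have r: "r > 0" using bp e by (simp add: r_def)
    have ind: "s i > 0 \<and> r * s i \<le> s (Suc i)" for i
    proof (induction i)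
      case 0
      then show ?case using s1 s0 e by (simp add: r_def field_simps power2_eq_square)
    next
      case (Suc i)
      then have p: "s (Suc i) > 0" using r by (smt (verit) mult_pos_pos)
      have "s i * (r * s (Suc i)) \<le> s (Suc i) * s (Suc i)"
        using mult_right_mono[of "r * s i" "s (Suc i)" "s (Suc i)"] Suc p by (simp add: mult_ac)
      also have "\<dots> \<le> s i * s (Suc (Suc i))" using cs[of i] by (simp add: power2_eq_square)
      finally have "r * s (Suc i) \<le> s (Suc (Suc i))" using Suc by simp
      then show ?case using p by simp
    qed
    have "e * r ^ i \<le> s i" for i
    proof (induction i)
      case (Suc i)
      have "e * r ^ Suc i \<le> r * s i" using Suc r by (simp add: mult.left_commute)
      also have "\<dots> \<le> s (Suc i)" using ind by simp
      finally show ?case .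
    qed (simp add: s0)
    then show ?thesis by (simp add: r_def power_mult)
  qed
  then show ?thesis using s2[of j] by (simp add: T_def)
qed

text \<open>Only frequency sequences whose nonzero-th and later partial sums stay in
  \<open>B\<close> are kept: a step from x to y uses the frequency y - x, and the first step leads
  from 0 into \<open>B\<close>. The constants \<open>c1\<close> and \<open>c2\<close> replace the
  functions h sqrt Q and sqrt Q at the two ends by multiples of \<open>f\<close>, so that a
  quadratic form of the kernel remains.\<close>

lemma J_ge_kernel_op:
  fixes Q h :: "'a::ab_group_add \<Rightarrow> real"
  assumes A: "finite A" "B \<subseteq> A" "\<And>x y. x \<in> B \<Longrightarrow> y \<in> B \<Longrightarrow> y - x \<in> A"
    and Q: "\<And>x. 0 < Q x" "Q 0 = 1" and h: "\<And>x. 0 \<le> h x" and f: "\<And>x. 0 \<le> f x"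
    and c: "0 \<le> c1" "0 \<le> c2" "\<And>x. x \<in> B \<Longrightarrow> c1 * f x \<le> h x * sqrt (Q x)" "\<And>x. x \<in> B \<Longrightarrow> c2 * f x \<le> sqrt (Q x)"
    and K: "K = (\<lambda>x y. sqrt (Q x) * h (y - x) * sqrt (Q y))"
  shows "c1 * c2 * (\<Sum>x\<in>B. f x * (kernel_op B K ^^ n) f x) \<le> J Q h A (Suc n) 0"
proof -
  have B: "finite B" using A finite_subset by blast
  have K0: "0 \<le> K x y" for x y using Q(1) h by (simp add: K less_imp_le)
  have T0: "0 \<le> (kernel_op B K ^^ n) f x" for n x
  proof (induction n arbitrary: x)
    case (Suc n)
    then show ?case
      unfolding funpow.simps comp_def kernel_op_def[of _ _ "(kernel_op B K ^^ n) f"]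
      using K0 by (intro sum_nonneg mult_nonneg_nonneg)
  qed (simp add: f)
  have Jnn: "0 \<le> J Q h A k x" for k x using Q h by (intro J_nonneg) (auto intro: less_imp_le)
  have lower: "sqrt (Q x) * c2 * (kernel_op B K ^^ n) f x \<le> J Q h A n x" if "x \<in> B" for n x
    using that
  proof (induction n arbitrary: x)
    case 0
    have "sqrt (Q x) * (c2 * f x) \<le> sqrt (Q x) * sqrt (Q x)"
      using 0 c(4) less_imp_le[OF Q(1)] by (intro mult_left_mono) auto
    then show ?case using less_imp_le[OF Q(1)[of x]] by (simp add: mult.assoc)
  next
    case (Suc n)
    have inj: "inj_on (\<lambda>y. y - x) B" by (auto simp: inj_on_def)
    have "sqrt (Q x) * c2 * (kernel_op B K ^^ Suc n) f x
        = Q x * (\<Sum>y\<in>B. h (y - x) * (sqrt (Q y) * c2 * (kernel_op B K ^^ n) f y))"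
    proof -
      have q: "Q x = sqrt (Q x) * sqrt (Q x)" using less_imp_le[OF Q(1)[of x]] by simp
      have TS: "(kernel_op B K ^^ Suc n) f x = (\<Sum>y\<in>B. K x y * (kernel_op B K ^^ n) f y)"
        by (simp add: kernel_op_def[of B K "(kernel_op B K ^^ n) f"])
      have e: "sqrt (Q x) * c2 * (K x y * u) = Q x * (h (y - x) * (sqrt (Q y) * c2 * u))" for y u
        by (subst q) (simp only: K mult_ac)
      show ?thesis unfolding TS sum_distrib_left e ..
    qed
    also have "\<dots> \<le> Q x * (\<Sum>y\<in>B. h (y - x) * J Q h A n y)"
      using Suc.IH h less_imp_le[OF Q(1)] by (intro mult_left_mono sum_mono) auto
    also have "(\<Sum>y\<in>B. h (y - x) * J Q h A n y) = (\<Sum>a\<in>(\<lambda>y. y - x) ` B. h a * J Q h A n (x + a))"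
      by (subst sum.reindex[OF inj]) simp
    also have "\<dots> \<le> (\<Sum>a\<in>A. h a * J Q h A n (x + a))"
      using A Suc.prems h Jnn by (intro sum_mono2) auto
    finally show ?case using less_imp_le[OF Q(1)[of x]] by (simp add: mult_left_mono)
  qed
  have "c1 * c2 * (\<Sum>x\<in>B. f x * (kernel_op B K ^^ n) f x) = (\<Sum>x\<in>B. (c1 * f x) * (c2 * (kernel_op B K ^^ n) f x))"
    by (simp add: sum_distrib_left mult_ac)
  also have "\<dots> \<le> (\<Sum>x\<in>B. (h x * sqrt (Q x)) * (c2 * (kernel_op B K ^^ n) f x))"
    using c T0 by (intro sum_mono mult_right_mono) auto
  also have "\<dots> = (\<Sum>x\<in>B. h x * (sqrt (Q x) * c2 * (kernel_op B K ^^ n) f x))" by (simp add: mult_ac)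
  also have "\<dots> \<le> (\<Sum>x\<in>B. h x * J Q h A n x)" using lower h by (intro sum_mono mult_left_mono) auto
  also have "\<dots> \<le> (\<Sum>x\<in>A. h x * J Q h A n x)" using A h Jnn by (intro sum_mono2) auto
  finally show ?thesis by (simp add: Q)
qed

section \<open>Joint measurability and exponential integrals along a path\<close>

lemma measurable_cis [measurable]: "cis \<in> borel_measurable borel"
  by (intro borel_measurable_continuous_onI continuous_intros)

text \<open>The process is sampled at the first grid point strictly to the right of the time, where
  right continuity applies. Times are cut off at 0 because the paths are controlled only on the half
  line, and \<open>N\<close> is arbitrary because smaller sigma-algebras generated by single
  processes are needed later.\<close>

lemma right_continuous_jointly_measurable:
  fixes X :: "real \<Rightarrow> 'w \<Rightarrow> 'a::euclidean_space"
  assumes X: "\<And>t. 0 \<le> t \<Longrightarrow> X t \<in> borel_measurable N"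
    and rc: "\<And>w t. w \<in> space N \<Longrightarrow> 0 \<le> t \<Longrightarrow> continuous (at_right t) (\<lambda>s. X s w)"
  shows "(\<lambda>(t, w). X (max 0 t) w) \<in> borel_measurable (borel \<Otimes>\<^sub>M N)"
proof (rule borel_measurable_LIMSEQ_metric)
  let ?g = "\<lambda>m (t::real). \<lfloor>real (Suc m) * max 0 t\<rfloor>"
  let ?u = "\<lambda>m t. (real_of_int (?g m t) + 1) / real (Suc m)"
  let ?f = "\<lambda>m (t, w). X (max 0 ((real_of_int (?g m t) + 1) / real (Suc m))) w"
  show "?f m \<in> borel_measurable (borel \<Otimes>\<^sub>M N)" for m
  proof -
    have "(\<lambda>x. (\<lambda>i x. X (max 0 ((real_of_int i + 1) / real (Suc m))) (snd x)) (?g m (fst x)) x)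
        \<in> borel_measurable (borel \<Otimes>\<^sub>M N)"
    proof (rule measurable_compose_countable[where f = "\<lambda>i x. X (max 0 ((real_of_int i + 1) / real (Suc m))) (snd x)"
        and g = "\<lambda>x. ?g m (fst x)"])
      show "(\<lambda>x. X (max 0 ((real_of_int i + 1) / real (Suc m))) (snd x)) \<in> borel_measurable (borel \<Otimes>\<^sub>M N)" for i
        by (rule measurable_compose[OF measurable_snd X]) simp
    qed measurable
    then show ?thesis by (simp add: case_prod_unfold)
  qed
  fix x :: "real \<times> 'w" assume x: "x \<in> space (borel \<Otimes>\<^sub>M N)"
  obtain t :: real and w where [simp]: "x = (t, w)" by (cases x)
  have w: "w \<in> space N" using x by (simp add: space_pair_measure)
  define s where "s = max 0 t"
  have s0: "0 \<le> s" by (simp add: s_def)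
  have gt: "s < ?u m t" for m
    unfolding s_def[symmetric] using floor_correct[of "real (Suc m) * s"]
    by (subst pos_less_divide_eq) (simp_all only: mult.commute[of s] of_nat_0_less_iff zero_less_Suc of_int_add of_int_1)
  have le: "?u m t \<le> s + 1 / real (Suc m)" for m
    unfolding s_def[symmetric] add_divide_distrib using of_int_floor_le[of "real (Suc m) * s"]
    by (intro add_right_mono) (simp add: pos_divide_le_eq mult.commute[of s] del: of_nat_Suc)
  have "(\<lambda>m. s + 1 / real (Suc m)) \<longlonglongrightarrow> s + 0"
    by (rule tendsto_add[OF tendsto_const LIMSEQ_Suc[OF lim_1_over_n]])
  then have "(\<lambda>m. ?u m t) \<longlonglongrightarrow> s"
    using less_imp_le[OF gt] le
    by (intro tendsto_sandwich[of "\<lambda>_. s" "\<lambda>m. ?u m t" sequentially "\<lambda>m. s + 1 / real (Suc m)"] always_eventually allI)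
       (simp_all only: tendsto_const add_0_right)
  then have "filterlim (\<lambda>m. ?u m t) (at_right s) sequentially"
    using gt by (intro tendsto_imp_filterlim_at_right) auto
  moreover have "((\<lambda>u. X u w) \<longlongrightarrow> X s w) (at_right s)"
    using rc[OF w s0] by (simp add: continuous_within)
  ultimately have "(\<lambda>m. X (?u m t) w) \<longlonglongrightarrow> X s w"
    by (rule filterlim_compose[rotated])
  moreover have "max 0 (?u m t) = ?u m t" for m using gt[of m] s0 by simp
  ultimately show "(\<lambda>m. ?f m x) \<longlonglongrightarrow> (case x of (t, w) \<Rightarrow> X (max 0 t) w)"
    by (simp add: s_def del: of_nat_Suc)
qed

section \<open>Indefinite integrals of bounded functions along a path\<close>

definition Int0 :: "(real \<Rightarrow> complex) \<Rightarrow> real \<Rightarrow> complex" where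
  "Int0 a t = (LINT s|lborel. indicator {0..t} s *\<^sub>R a s)"

definition ft :: "(real \<Rightarrow> 'w \<Rightarrow> 'a::euclidean_space) \<Rightarrow> 'a \<Rightarrow> real \<Rightarrow> 'w \<Rightarrow> complex" where
  "ft X l t w = Int0 (\<lambda>s. cis (l \<bullet> X s w)) t"

lemma Int0_max: "Int0 (\<lambda>s. a (max 0 s)) t = Int0 a t"
  unfolding Int0_def by (intro Bochner_Integration.integral_cong) (auto simp: indicator_def)

lemma integrable_Icc_bounded:
  fixes a :: "real \<Rightarrow> complex"
  assumes "a \<in> borel_measurable borel" "\<And>s. 0 \<le> s \<Longrightarrow> s \<le> t \<Longrightarrow> norm (a s) \<le> C"
  shows "integrable lborel (\<lambda>s. indicator {0..t} s *\<^sub>R a s)"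
proof (rule integrableI_bounded_set_indicator[where B = C])
  show "AE x in lborel. x \<in> {0..t} \<longrightarrow> norm (a x) \<le> C" using assms by auto
  show "emeasure lborel {0..t} < \<infinity>" by (simp add: emeasure_lborel_Icc_eq)
qed (use assms in auto)

lemma norm_Int0_le:
  assumes "a \<in> borel_measurable borel" "\<And>s. 0 \<le> s \<Longrightarrow> s \<le> t \<Longrightarrow> norm (a s) \<le> C" "0 \<le> t"
  shows "norm (Int0 a t) \<le> C * t"
proof -
  have "norm (Int0 a t) \<le> (LINT s|lborel. norm (indicator {0..t} s *\<^sub>R a s))"
    unfolding Int0_def by (rule integral_norm_bound)
  also have "\<dots> \<le> (LINT s|lborel. indicator {0..t} s * C)"
    using assms
    by (intro integral_mono integrable_norm integrable_Icc_bounded integrable_mult_left integrable_real_indicator)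
       (auto simp: indicator_def emeasure_lborel_Icc_eq)
  also have "\<dots> = C * t" using assms by simp
  finally show ?thesis .
qed

lemma Int0_measurable:
  assumes "a \<in> borel_measurable borel"
  shows "Int0 a \<in> borel_measurable borel"
proof -
  have [measurable]: "a \<in> borel_measurable borel" by fact
  have "(\<lambda>t. LINT s|lborel. (if 0 \<le> s \<and> s \<le> t then 1 else 0) *\<^sub>R a s) \<in> borel_measurable borel"
    by measurable
  also have "(\<lambda>t. LINT s|lborel. (if 0 \<le> s \<and> s \<le> t then 1 else 0) *\<^sub>R a s) = Int0 a"
    unfolding Int0_def by (intro ext Bochner_Integration.integral_cong) (auto simp: indicator_def)
  finally show ?thesis .
qed

text \<open>Integration by parts for indefinite integrals, as Fubini on the two halves of a square;
  the integrands are only right continuous, so no derivatives are available.\<close>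

lemma Int0_mult:
  assumes [measurable]: "a \<in> borel_measurable borel" "b \<in> borel_measurable borel"
    and bd: "\<And>s. 0 \<le> s \<Longrightarrow> s \<le> t \<Longrightarrow> norm (a s) \<le> C" "\<And>s. 0 \<le> s \<Longrightarrow> s \<le> t \<Longrightarrow> norm (b s) \<le> D"
  shows "Int0 a t * Int0 b t = Int0 (\<lambda>s. a s * Int0 b s + Int0 a s * b s) t"
proof -
  define g h where "g = (\<lambda>s. indicator {0..t} s *\<^sub>R a s)" and "h = (\<lambda>s. indicator {0..t} s *\<^sub>R b s)"
  have [measurable]: "g \<in> borel_measurable borel" "h \<in> borel_measurable borel" by (simp_all add: g_def h_def)
  have ig: "integrable lborel g" and ih: "integrable lborel h"
    unfolding g_def h_def using bd by (auto intro!: integrable_Icc_bounded)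
  \<comment> \<open>\<open>P\<close> selects one half of the square with side [0, t], either u \<le>
    s or s < u. On each half the inner integral is an indefinite integral up to the larger of the
    two times.\<close>
  let ?k = "\<lambda>P (s::real, u::real). (if P s u then g s * h u else 0)"
  have ik: "integrable (lborel \<Otimes>\<^sub>M lborel) (?k P)" if [measurable]: "Measurable.pred (borel \<Otimes>\<^sub>M borel) (\<lambda>(s, u). P s u)" for P
  proof -
    have P': "Measurable.pred (borel \<Otimes>\<^sub>M borel) (\<lambda>x. P (fst x) (snd x))" using that by (simp add: case_prod_unfold)
    have [measurable]: "?k P \<in> borel_measurable (lborel \<Otimes>\<^sub>M lborel)"
      using P' by (simp add: case_prod_unfold)
    have "integrable (lborel \<Otimes>\<^sub>M lborel) (\<lambda>(s, u). g s * h u)"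
      using ig ih by (intro lborel_pair.Fubini_integrable) (auto simp: norm_mult)
    then show ?thesis by (rule Bochner_Integration.integrable_bound) (auto simp: case_prod_unfold)
  qed
  have ik1: "integrable (lborel \<Otimes>\<^sub>M lborel) (?k (\<lambda>s u. u \<le> s))" by (rule ik) measurable
  have ik2: "integrable (lborel \<Otimes>\<^sub>M lborel) (?k (\<lambda>s u. s < u))" by (rule ik) measurable
  have ik0: "integrable (lborel \<Otimes>\<^sub>M lborel) (\<lambda>(s, u). g s * h u)"
    using ik[of "\<lambda>_ _. True"] by simp
  have "Int0 a t = integral\<^sup>L lborel g" "Int0 b t = integral\<^sup>L lborel h"
    by (simp_all only: Int0_def g_def h_def)
  then have "Int0 a t * Int0 b t = (LINT s|lborel. LINT u|lborel. g s * h u)" by simp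
  also have "\<dots> = integral\<^sup>L (lborel \<Otimes>\<^sub>M lborel) (\<lambda>(s, u). g s * h u)"
    using lborel_pair.integral_fst[OF ik0] by simp
  also have "\<dots> = integral\<^sup>L (lborel \<Otimes>\<^sub>M lborel) (\<lambda>x. ?k (\<lambda>s u. u \<le> s) x + ?k (\<lambda>s u. s < u) x)"
    by (intro Bochner_Integration.integral_cong) (auto simp: case_prod_unfold)
  also have "\<dots> = integral\<^sup>L (lborel \<Otimes>\<^sub>M lborel) (?k (\<lambda>s u. u \<le> s)) + integral\<^sup>L (lborel \<Otimes>\<^sub>M lborel) (?k (\<lambda>s u. s < u))"
    by (rule Bochner_Integration.integral_add[OF ik1 ik2])
  also have "integral\<^sup>L (lborel \<Otimes>\<^sub>M lborel) (?k (\<lambda>s u. u \<le> s)) = (LINT s|lborel. LINT u|lborel. (if u \<le> s then g s * h u else 0))"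
    using lborel_pair.integral_fst[OF ik1] by simp
  also have "\<dots> = Int0 (\<lambda>s. a s * Int0 b s) t"
    unfolding Int0_def[of _ t]
  proof (intro Bochner_Integration.integral_cong refl)
    fix s :: real
    have "(LINT u|lborel. (if u \<le> s then g s * h u else 0)) = (LINT u|lborel. g s * (indicator {0..s} u *\<^sub>R b u))"
      by (intro Bochner_Integration.integral_cong) (auto simp: g_def h_def indicator_def)
    also have "\<dots> = g s * Int0 b s" by (simp only: Int0_def integral_mult_right_zero)
    finally show "(LINT u|lborel. (if u \<le> s then g s * h u else 0)) = indicator {0..t} s *\<^sub>R (a s * Int0 b s)"
      by (simp add: g_def)
  qed
  also have "integral\<^sup>L (lborel \<Otimes>\<^sub>M lborel) (?k (\<lambda>s u. s < u)) = (LINT u|lborel. LINT s|lborel. (if s < u then g s * h u else 0))"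
    using lborel_pair.integral_snd[OF ik2] by simp
  also have "\<dots> = Int0 (\<lambda>s. Int0 a s * b s) t"
    unfolding Int0_def[of _ t]
  proof (intro Bochner_Integration.integral_cong refl)
    fix u :: real
    have "(LINT s|lborel. (if s < u then g s * h u else 0)) = (LINT s|lborel. (indicator {0..u} s *\<^sub>R a s) * h u)"
      using AE_lborel_singleton[of u]
      by (intro integral_cong_AE) (auto simp: g_def h_def indicator_def)
    also have "\<dots> = Int0 a u * h u" by (simp only: Int0_def integral_mult_left_zero)
    finally show "(LINT s|lborel. (if s < u then g s * h u else 0)) = indicator {0..t} u *\<^sub>R (Int0 a u * b u)"
      by (simp add: h_def)
  qed
  also have "Int0 (\<lambda>s. a s * Int0 b s) t + Int0 (\<lambda>s. Int0 a s * b s) t = Int0 (\<lambda>s. a s * Int0 b s + Int0 a s * b s) t"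
    unfolding Int0_def[of _ t] scaleR_add_right
  proof (rule Bochner_Integration.integral_add[symmetric])
    have [measurable]: "Int0 a \<in> borel_measurable borel" "Int0 b \<in> borel_measurable borel"
      by (auto intro: Int0_measurable)
    have C0: "0 \<le> C" "0 \<le> D" if "0 \<le> t" using bd(1)[of 0] bd(2)[of 0] that norm_ge_zero order_trans by blast+
    have n: "norm (Int0 a s) \<le> C * t" "norm (Int0 b s) \<le> D * t" if "0 \<le> s" "s \<le> t" for s
    proof -
      have "norm (Int0 a s) \<le> C * s" "norm (Int0 b s) \<le> D * s"
        using bd that by (auto intro!: norm_Int0_le)
      moreover have "C * s \<le> C * t" "D * s \<le> D * t" using C0 that by (auto intro!: mult_left_mono)
      ultimately show "norm (Int0 a s) \<le> C * t" "norm (Int0 b s) \<le> D * t" by linarith+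
    qed
    show "integrable lborel (\<lambda>x. indicat_real {0..t} x *\<^sub>R (a x * Int0 b x))"
      using n bd by (intro integrable_Icc_bounded[where C = "C * (D * t)"]) (auto simp: norm_mult intro!: mult_mono order_trans[OF norm_ge_zero])
    show "integrable lborel (\<lambda>x. indicat_real {0..t} x *\<^sub>R (Int0 a x * b x))"
      using n bd by (intro integrable_Icc_bounded[where C = "(C * t) * D"]) (auto simp: norm_mult intro!: mult_mono order_trans[OF norm_ge_zero])
  qed
  finally show ?thesis .
qed

text \<open>The product rule in integrated form: points of the cube with side [0, t] are classified
  by the coordinate that is largest.\<close>

lemma prod_Int0:
  assumes "finite S" "S \<noteq> {}" and m: "\<And>k. k \<in> S \<Longrightarrow> a k \<in> borel_measurable borel"
    and bd: "\<And>k s. k \<in> S \<Longrightarrow> norm (a k s) \<le> 1" and "0 \<le> t"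
  shows "(\<Prod>k\<in>S. Int0 (a k) t) = Int0 (\<lambda>s. \<Sum>j\<in>S. a j s * (\<Prod>k\<in>S - {j}. Int0 (a k) s)) t"
  using assms
proof (induction S arbitrary: t rule: finite_ne_induct)
  case (insert x S)
  define b where "b s = (\<Sum>j\<in>S. a j s * (\<Prod>k\<in>S - {j}. Int0 (a k) s))" for s
  have mi: "Int0 (a k) \<in> borel_measurable borel" if "k \<in> S" for k using insert that by (intro Int0_measurable) auto
  have bm: "b \<in> borel_measurable borel"
    unfolding b_def using insert mi by (intro borel_measurable_sum borel_measurable_times borel_measurable_prod) auto
  have IH: "(\<Prod>k\<in>S. Int0 (a k) s) = Int0 b s" if "0 \<le> s" for s
    using insert that unfolding b_def by simp
  have n: "norm (Int0 (a k) s) \<le> t" if "k \<in> S" "0 \<le> s" "s \<le> t" for k s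
    using norm_Int0_le[of "a k" s 1] insert that by force
  have bb: "norm (b s) \<le> (\<Sum>j\<in>S. 1 * (\<Prod>k\<in>S - {j}. t))" if "0 \<le> s" "s \<le> t" for s
    unfolding b_def
  proof (rule sum_norm_le)
    fix j assume j: "j \<in> S"
    have "norm (\<Prod>k\<in>S - {j}. Int0 (a k) s) \<le> (\<Prod>k\<in>S - {j}. t)"
      unfolding prod_norm[symmetric] using n that by (intro prod_mono) auto
    then show "norm (a j s * (\<Prod>k\<in>S - {j}. Int0 (a k) s)) \<le> 1 * (\<Prod>k\<in>S - {j}. t)"
      unfolding norm_mult using insert j by (intro mult_mono) auto
  qed
  have "(\<Prod>k\<in>insert x S. Int0 (a k) t) = Int0 (a x) t * Int0 b t" using insert IH[OF \<open>0 \<le> t\<close>] by simp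
  also have "\<dots> = Int0 (\<lambda>s. a x s * Int0 b s + Int0 (a x) s * b s) t"
    by (rule Int0_mult[where C = 1, OF _ bm _ bb]) (use insert in auto)
  also have "\<dots> = Int0 (\<lambda>s. \<Sum>j\<in>insert x S. a j s * (\<Prod>k\<in>insert x S - {j}. Int0 (a k) s)) t"
    unfolding Int0_def[of _ t]
  proof (intro Bochner_Integration.integral_cong refl)
    fix s :: real
    show "indicat_real {0..t} s *\<^sub>R (a x s * Int0 b s + Int0 (a x) s * b s) =
      indicat_real {0..t} s *\<^sub>R (\<Sum>j\<in>insert x S. a j s * (\<Prod>k\<in>insert x S - {j}. Int0 (a k) s))"
    proof (cases "s \<in> {0..t}")
      case True
      have "(\<Prod>k\<in>insert x S - {j}. Int0 (a k) s) = Int0 (a x) s * (\<Prod>k\<in>S - {j}. Int0 (a k) s)" if "j \<in> S" for j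
      proof -
        have "insert x S - {j} = insert x (S - {j})" using that insert by auto
        then show ?thesis using insert by simp
      qed
      then have "(\<Sum>j\<in>S. a j s * (\<Prod>k\<in>insert x S - {j}. Int0 (a k) s)) = Int0 (a x) s * b s"
        unfolding b_def by (simp add: sum_distrib_left mult_ac)
      moreover have "insert x S - {x} = S" using insert by auto
      ultimately show ?thesis using insert True IH[of s] by simp
    qed simp
  qed
  finally show ?case .
qed (auto simp: Int0_def)

lemma ft_jointly_measurable:
  fixes X :: "real \<Rightarrow> 'w \<Rightarrow> 'a::euclidean_space"
  assumes X: "\<And>t. 0 \<le> t \<Longrightarrow> X t \<in> borel_measurable N"
    and rc: "\<And>w t. w \<in> space N \<Longrightarrow> 0 \<le> t \<Longrightarrow> continuous (at_right t) (\<lambda>s. X s w)"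
  shows "(\<lambda>x. ft X l (fst x) (snd x)) \<in> borel_measurable (borel \<Otimes>\<^sub>M N)"
proof -
  have j: "(\<lambda>x. X (max 0 (fst x)) (snd x)) \<in> borel_measurable (borel \<Otimes>\<^sub>M N)"
    using right_continuous_jointly_measurable[of X N, OF X rc] by (simp add: case_prod_unfold)
  have [measurable]: "(\<lambda>x. X (max 0 (snd x)) (snd (fst x))) \<in> borel_measurable ((borel \<Otimes>\<^sub>M N) \<Otimes>\<^sub>M lborel)"
    by (rule measurable_compose[OF _ j, of "\<lambda>x. (snd x, snd (fst x))", simplified]) measurable
  have "(\<lambda>x. LINT s|lborel. (if 0 \<le> s \<and> s \<le> fst x then 1 else 0) *\<^sub>R cis (l \<bullet> X (max 0 s) (snd x)))
     \<in> borel_measurable (borel \<Otimes>\<^sub>M N)"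
    by (rule lborel.borel_measurable_lebesgue_integral) (simp add: case_prod_unfold)
  also have "(\<lambda>x. LINT s|lborel. (if 0 \<le> s \<and> s \<le> fst x then 1 else 0) *\<^sub>R cis (l \<bullet> X (max 0 s) (snd x)))
     = (\<lambda>x. ft X l (fst x) (snd x))"
    unfolding ft_def Int0_def by (intro ext Bochner_Integration.integral_cong) (auto simp: indicator_def)
  finally show ?thesis .
qed

section \<open>A single Levy process\<close>

locale levy = prob_space M for M :: "'w measure" +
  fixes X :: "real \<Rightarrow> 'w \<Rightarrow> 'a::euclidean_space" and \<psi> :: "'a \<Rightarrow> real"
  assumes levy: "levy_process_with_symbol M X \<psi>" and psi0: "\<And>l. 0 \<le> \<psi> l"
begin

lemma X_measurable [measurable]: "X t \<in> borel_measurable M"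
  using levy by (simp add: levy_process_with_symbol_def)

lemma X_0: "w \<in> space M \<Longrightarrow> X 0 w = 0"
  using levy by (simp add: levy_process_with_symbol_def)

lemma X_right_continuous: "w \<in> space M \<Longrightarrow> 0 \<le> t \<Longrightarrow> continuous (at_right t) (\<lambda>s. X s w)"
  using levy by (simp add: levy_process_with_symbol_def)

lemma X_increment_char: "0 \<le> s \<Longrightarrow> s \<le> t \<Longrightarrow>
    (\<integral>w. cis (l \<bullet> (X t w - X s w)) \<partial>M) = complex_of_real (exp (- (t - s) * \<psi> l))"
  using levy by (simp add: levy_process_with_symbol_def)

lemma X_indep_increments: "0 \<le> t 0 \<Longrightarrow> (\<And>i. i < n \<Longrightarrow> t i \<le> t (Suc i)) \<Longrightarrow>
    indep_vars (\<lambda>_. borel) (\<lambda>i w. X (t (Suc i)) w - X (t i) w) {..<n}"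
  using levy by (simp add: levy_process_with_symbol_def)

lemma X_joint: "(\<lambda>x. X (max 0 (fst x)) (snd x)) \<in> borel_measurable (borel \<Otimes>\<^sub>M M)"
  using right_continuous_jointly_measurable[of X M] X_right_continuous
  by (simp add: case_prod_unfold)

lemma path_measurable:
  assumes "w \<in> space M" shows "(\<lambda>t. X (max 0 t) w) \<in> borel_measurable borel"
  using measurable_compose[OF _ X_joint, of "\<lambda>t. (t, w)" borel] assms by simp

lemma cis_path_measurable:
  assumes "w \<in> space M" shows "(\<lambda>s. cis (l \<bullet> X (max 0 s) w)) \<in> borel_measurable borel"
  using path_measurable[OF assms] by simp

lemma ft_eq: "ft X l t w = Int0 (\<lambda>s. cis (l \<bullet> X (max 0 s) w)) t"
  unfolding ft_def using Int0_max[of "\<lambda>s. cis (l \<bullet> X s w)" t] by simp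

lemma norm_ft_le: "w \<in> space M \<Longrightarrow> 0 \<le> t \<Longrightarrow> norm (ft X l t w) \<le> t"
  unfolding ft_eq using norm_Int0_le[OF cis_path_measurable, of w t l 1] by simp

lemma ft_joint: "(\<lambda>x. ft X l (fst x) (snd x)) \<in> borel_measurable (borel \<Otimes>\<^sub>M M)"
  using X_right_continuous by (intro ft_jointly_measurable) auto

lemma ft_measurable [measurable]: "ft X l t \<in> borel_measurable M"
  using measurable_compose[OF _ ft_joint, of "\<lambda>w. (t, w)" M l] by simp

lemma integrable_bounded:
  fixes f :: "'w \<Rightarrow> complex"
  assumes "f \<in> borel_measurable M" "\<And>w. w \<in> space M \<Longrightarrow> norm (f w) \<le> B"
  shows "integrable M f"
  using assms by (intro integrable_const_bound[where B = B]) auto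

text \<open>It replaces a time integral by finitely many path values, to which independence of
  increments applies. Right endpoints are taken because the paths are right continuous.\<close>

lemma Riemann_sum_ft:
  assumes w: "w \<in> space M" and s: "0 < s"
  shows "(\<lambda>m. \<Sum>i<m. complex_of_real (s / real m) * cis (l \<bullet> X (real (Suc i) * s / real m) w)) \<longlonglongrightarrow> ft X l s w"
proof -
  \<comment> \<open>Left-open intervals: each positive u lies in exactly one of them, the one with
    index \<open>?r m u\<close>, and the sample point attached to u is never to the left of
    u.\<close>
  let ?I = "\<lambda>m i. {real i * s / real m<..real (Suc i) * s / real m}"
  let ?f = "\<lambda>m u. \<Sum>i<m. indicat_real (?I m i) u *\<^sub>R cis (l \<bullet> X (real (Suc i) * s / real m) w)"
  let ?r = "\<lambda>m u. nat \<lceil>u * real m / s\<rceil> - 1"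
  have idx: "u \<in> ?I m i \<longleftrightarrow> i = ?r m u" if "0 < m" "0 < u" for m i u
  proof -
    have "u \<in> ?I m i \<longleftrightarrow> real i < u * real m / s \<and> u * real m / s \<le> real (Suc i)"
      using that s by (auto simp: field_simps)
    also have "\<dots> \<longleftrightarrow> \<lceil>u * real m / s\<rceil> = int (Suc i)"
      by (subst ceiling_eq_iff) auto
    also have "\<dots> \<longleftrightarrow> i = ?r m u"
    proof -
      have "c = int (Suc i) \<longleftrightarrow> i = nat c - 1" if "c > 0" for c :: int using that by auto
      moreover have "\<lceil>u * real m / s\<rceil> > 0" using that s by simp
      ultimately show ?thesis by blast
    qed
    finally show ?thesis .
  qed
  have val: "?f m u = (if u \<le> s then cis (l \<bullet> X (real (Suc (?r m u)) * s / real m) w) else 0)"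
    if m: "0 < m" and u: "0 < u" for m u
  proof -
    have uin: "u \<in> ?I m (?r m u)" using idx[OF m u] by blast
    have lt: "?r m u < m \<longleftrightarrow> u \<le> s"
    proof
      assume "?r m u < m"
      then have "real (Suc (?r m u)) * s \<le> real m * s" using s by (intro mult_right_mono) (auto simp del: of_nat_Suc)
      then have "real (Suc (?r m u)) * s / real m \<le> s" using m by (simp add: divide_le_eq mult.commute del: of_nat_Suc)
      then show "u \<le> s" using uin by auto
    next
      assume us: "u \<le> s"
      have "real (?r m u) * s / real m < s" using uin us by simp
      then show "?r m u < m" using s m by (simp add: field_simps)
    qed
    have "?f m u = (\<Sum>i<m. if i = ?r m u then cis (l \<bullet> X (real (Suc i) * s / real m) w) else 0)"
      using idx[OF m u] by (intro sum.cong refl) (auto simp: indicator_def)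
    also have "\<dots> = (if ?r m u < m then cis (l \<bullet> X (real (Suc (?r m u)) * s / real m) w) else 0)"
      by (simp add: sum.delta)
    finally show ?thesis using lt by simp
  qed
  have f0: "?f m u = 0" if "u \<le> 0" for m u
  proof (intro sum.neutral ballI)
    fix i
    have "0 \<le> real i * s / real m" using s by (intro divide_nonneg_nonneg mult_nonneg_nonneg) auto
    then have "u \<notin> ?I m i" using that by auto
    then show "indicat_real (?I m i) u *\<^sub>R cis (l \<bullet> X (real (Suc i) * s / real m) w) = 0" by simp
  qed
  have "(\<lambda>m. LINT u|lborel. ?f m u) \<longlonglongrightarrow> (LINT u|lborel. indicat_real {0<..s} u *\<^sub>R cis (l \<bullet> X u w))"
  proof (rule integral_dominated_convergence[where w = "indicat_real {0..s}"])
    have "(\<lambda>u. indicat_real {0<..s} u *\<^sub>R cis (l \<bullet> X (max 0 u) w)) \<in> borel_measurable lborel"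
      using cis_path_measurable[OF w] by simp
    also have "(\<lambda>u. indicat_real {0<..s} u *\<^sub>R cis (l \<bullet> X (max 0 u) w)) = (\<lambda>u. indicat_real {0<..s} u *\<^sub>R cis (l \<bullet> X u w))"
      by (auto simp: indicator_def)
    finally show "(\<lambda>u. indicat_real {0<..s} u *\<^sub>R cis (l \<bullet> X u w)) \<in> borel_measurable lborel" .
    show "?f m \<in> borel_measurable lborel" for m by measurable
    show "integrable lborel (indicat_real {0..s})" by (simp add: emeasure_lborel_Icc_eq)
    show "AE u in lborel. (\<lambda>m. ?f m u) \<longlonglongrightarrow> indicat_real {0<..s} u *\<^sub>R cis (l \<bullet> X u w)"
    proof (rule AE_I2)
      fix u :: real
      consider "u \<le> 0" | "u > s" | "0 < u" "u \<le> s" by linarith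
      then show "(\<lambda>m. ?f m u) \<longlonglongrightarrow> indicat_real {0<..s} u *\<^sub>R cis (l \<bullet> X u w)"
      proof cases
        case 1 then show ?thesis using f0[OF 1] by simp
      next
        case 2
        then have "\<forall>\<^sub>F m in sequentially. ?f m u = 0"
          using s val[of _ u] by (intro eventually_sequentiallyI[of 1]) auto
        then show ?thesis using 2 by (simp add: tendsto_eventually)
      next
        case 3
        let ?v = "\<lambda>m. real (Suc (?r m u)) * s / real m"
        have ge: "u \<le> ?v m" "?v m \<le> u + s / real m" if "m \<ge> 1" for m
        proof -
          have uin: "u \<in> ?I m (?r m u)" using idx[of m u "?r m u"] 3 that by auto
          then show "u \<le> ?v m" by simp
          have "?v m = real (?r m u) * s / real m + s / real m"
            by (simp only: of_nat_Suc ring_distribs add_divide_distrib mult_1_left add.commute)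
          then show "?v m \<le> u + s / real m" using uin by simp
        qed
        have "(\<lambda>m. u + s / real m) \<longlonglongrightarrow> u + 0" by (intro tendsto_intros lim_const_over_n)
        then have lim: "?v \<longlonglongrightarrow> u"
          by (intro tendsto_sandwich[of "\<lambda>_. u" ?v sequentially "\<lambda>m. u + s / real m"]
                eventually_sequentiallyI[of 1] ge tendsto_const) simp_all
        \<comment> \<open>The sample point may coincide with u, so the limit is taken within
          \<open>{u..}\<close> and not only from the open right side.\<close>
        have cont: "((\<lambda>v. X v w) \<longlongrightarrow> X u w) (at u within {u..})"
        proof -
          have "((\<lambda>v. X v w) \<longlongrightarrow> X u w) (at_right u)"
            using X_right_continuous[OF w, of u] 3 by (simp add: continuous_within)
          moreover have "at u within {u..} = at_right u"
            by (rule at_within_nhd[of u UNIV]) auto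
          ultimately show ?thesis by simp
        qed
        have "continuous (at u within {u..}) (\<lambda>v. X v w)" using cont by (simp add: continuous_within)
        then have "(\<lambda>m. X (?v m) w) \<longlonglongrightarrow> X u w"
          by (rule continuous_within_tendsto_compose[OF _ eventually_sequentiallyI[of 1] lim]) (use ge(1) in blast)
        then have "(\<lambda>m. cis (l \<bullet> X (?v m) w)) \<longlonglongrightarrow> cis (l \<bullet> X u w)"
          by (intro tendsto_intros)
        moreover have "\<forall>\<^sub>F m in sequentially. cis (l \<bullet> X (?v m) w) = ?f m u"
          using val[of _ u] 3 by (intro eventually_sequentiallyI[of 1]) auto
        ultimately show ?thesis using 3 by (auto intro: Lim_transform_eventually)
      qed
    qed
    show "AE u in lborel. norm (?f m u) \<le> indicat_real {0..s} u" for m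
    proof (rule AE_I2)
      fix u :: real
      show "norm (?f m u) \<le> indicat_real {0..s} u"
      proof (cases "m = 0 \<or> u \<le> 0")
        case True then show ?thesis using f0[of u m] by auto
      next
        case False
        then have "?f m u = (if u \<le> s then cis (l \<bullet> X (real (Suc (?r m u)) * s / real m) w) else 0)"
          by (intro val) auto
        then show ?thesis using False by (auto simp: indicator_def)
      qed
    qed
  qed
  moreover have "(LINT u|lborel. ?f m u) = (\<Sum>i<m. complex_of_real (s / real m) * cis (l \<bullet> X (real (Suc i) * s / real m) w))" for m
  proof -
    have "(LINT u|lborel. ?f m u) = (\<Sum>i<m. LINT u|lborel. indicat_real (?I m i) u *\<^sub>R cis (l \<bullet> X (real (Suc i) * s / real m) w))"
      by (intro Bochner_Integration.integral_sum integrable_scaleR_left integrable_real_indicator)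
         (use s in \<open>auto simp: divide_right_mono mult_right_mono\<close>)
    also have "\<dots> = (\<Sum>i<m. complex_of_real (s / real m) * cis (l \<bullet> X (real (Suc i) * s / real m) w))"
    proof (intro sum.cong refl)
      fix i
      have "(LINT u|lborel. indicat_real (?I m i) u *\<^sub>R cis (l \<bullet> X (real (Suc i) * s / real m) w))
          = measure lborel (?I m i) *\<^sub>R cis (l \<bullet> X (real (Suc i) * s / real m) w)"
        using s by (subst integral_scaleR_left) (auto simp: divide_right_mono mult_right_mono)
      also have "measure lborel (?I m i) = s / real m"
        using s by (subst measure_lborel_Ioc) (auto simp: ring_distribs add_divide_distrib)
      finally show "(LINT u|lborel. indicat_real (?I m i) u *\<^sub>R cis (l \<bullet> X (real (Suc i) * s / real m) w))
        = complex_of_real (s / real m) * cis (l \<bullet> X (real (Suc i) * s / real m) w)"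
        by (simp add: scaleR_conv_of_real)
    qed
    finally show ?thesis .
  qed
  moreover have "(LINT u|lborel. indicat_real {0<..s} u *\<^sub>R cis (l \<bullet> X u w)) = ft X l s w"
    unfolding ft_eq Int0_def
  proof (rule integral_cong_AE)
    show "AE x in lborel. indicat_real {0<..s} x *\<^sub>R cis (l \<bullet> X x w) = indicat_real {0..s} x *\<^sub>R cis (l \<bullet> X (max 0 x) w)"
      using AE_lborel_singleton[of "0::real"] by eventually_elim (auto simp: indicator_def)
    have "(\<lambda>u. indicat_real {0<..s} u *\<^sub>R cis (l \<bullet> X (max 0 u) w)) \<in> borel_measurable lborel"
      using cis_path_measurable[OF w] by simp
    also have "(\<lambda>u. indicat_real {0<..s} u *\<^sub>R cis (l \<bullet> X (max 0 u) w)) = (\<lambda>u. indicat_real {0<..s} u *\<^sub>R cis (l \<bullet> X u w))"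
      by (auto simp: indicator_def)
    finally show "(\<lambda>u. indicat_real {0<..s} u *\<^sub>R cis (l \<bullet> X u w)) \<in> borel_measurable lborel" .
    show "(\<lambda>x. indicat_real {0..s} x *\<^sub>R cis (l \<bullet> X (max 0 x) w)) \<in> borel_measurable lborel"
      using cis_path_measurable[OF w] by simp
  qed
  ultimately show ?thesis by simp
qed

end

section \<open>Moments at an exponential time\<close>

context levy begin

text \<open>Through Riemann sums the past becomes a function of finitely many increments up to time
  s. Independence holds for each such sum, and the limit passes under the integral with the bound
  \<open>s ^ card S\<close>.\<close>

lemma indep_past_increment:
  fixes l :: "'i \<Rightarrow> 'a" and \<beta> \<gamma> :: 'a
  assumes s: "0 < s" "s \<le> t" and S: "finite S"
  defines "W \<equiv> \<lambda>w. (\<Prod>k\<in>S. ft X (l k) s w) * cis (\<beta> \<bullet> X s w)"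
  shows "(\<integral>w. W w * cis (\<gamma> \<bullet> (X t w - X s w)) \<partial>M) = (\<integral>w. W w \<partial>M) * complex_of_real (exp (- (t - s) * \<psi> \<gamma>))"
proof -
  define A where "A m k w = (\<Sum>i<m. complex_of_real (s / real m) * cis (l k \<bullet> X (real (Suc i) * s / real m) w))" for m k w
  define V where "V m w = (\<Prod>k\<in>S. A m k w) * cis (\<beta> \<bullet> X s w)" for m w
  define E where "E w = cis (\<gamma> \<bullet> (X t w - X s w))" for w
  have [measurable]: "A m k \<in> borel_measurable M" for m k unfolding A_def by measurable
  have [measurable]: "V m \<in> borel_measurable M" for m unfolding V_def by measurable
  have [measurable]: "E \<in> borel_measurable M" unfolding E_def by measurable
  have [measurable]: "W \<in> borel_measurable M" unfolding W_def by measurable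
  have nA: "norm (A m k w) \<le> s" for m k w
  proof -
    have "norm (A m k w) \<le> (\<Sum>i<m. s / real m)" unfolding A_def
      using s by (intro sum_norm_le) (simp add: norm_mult norm_divide)
    then show ?thesis using s by (cases "m = 0") auto
  qed
  have nV: "norm (V m w) \<le> s ^ card S" for m w
    unfolding V_def norm_mult prod_norm[symmetric] using nA prod_mono[of S "\<lambda>k. norm (A m k w)" "\<lambda>_. s"] by simp
  have lim: "(\<lambda>m. V m w) \<longlonglongrightarrow> W w" if "w \<in> space M" for w
    unfolding V_def W_def A_def using that s by (intro tendsto_intros Riemann_sum_ft)
  have l1: "(\<lambda>m. \<integral>w. V m w * E w \<partial>M) \<longlonglongrightarrow> (\<integral>w. W w * E w \<partial>M)"
    by (rule integral_dominated_convergence[where w = "\<lambda>_. s ^ card S"])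
       (auto simp: norm_mult E_def intro!: AE_I2 tendsto_intros lim nV)
  have l2: "(\<lambda>m. \<integral>w. V m w \<partial>M) \<longlonglongrightarrow> (\<integral>w. W w \<partial>M)"
    by (rule integral_dominated_convergence[where w = "\<lambda>_. s ^ card S"])
       (auto intro!: AE_I2 tendsto_intros lim nV)
  have eq: "(\<integral>w. V m w * E w \<partial>M) = (\<integral>w. V m w \<partial>M) * complex_of_real (exp (- (t - s) * \<psi> \<gamma>))" if m: "m \<ge> 1" for m
  proof -
    \<comment> \<open>The grid 0, s/m, ..., s followed by t: increments with index below m make up
      the past, and the increment with index m is X t - X s.\<close>
    define tt where "tt i = (if i \<le> m then real i * s / real m else t)" for i
    define D where "D i w = X (tt (Suc i)) w - X (tt i) w" for i w
    have tt_le: "tt i \<le> tt (Suc i)" if "i < Suc m" for i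
    proof (cases "i < m")
      case True then show ?thesis using s m by (auto simp: tt_def intro!: divide_right_mono mult_right_mono)
    next
      case False then have "i = m" using that by simp
      then show ?thesis using s m by (simp add: tt_def)
    qed
    have ind: "indep_vars (\<lambda>_. borel) D {..<Suc m}"
      unfolding D_def using s tt_le by (intro X_indep_increments) (auto simp: tt_def)
    define f1 where "f1 x = (\<Prod>k\<in>S. \<Sum>i<m. complex_of_real (s / real m) * cis (l k \<bullet> (\<Sum>j\<le>i. x j))) * cis (\<beta> \<bullet> (\<Sum>j<m. x j))" for x :: "nat \<Rightarrow> 'a"
    define f2 where "f2 x = cis (\<gamma> \<bullet> x m)" for x :: "nat \<Rightarrow> 'a"
    have [measurable]: "(\<lambda>x. x j) \<in> borel_measurable (PiM {..<m} (\<lambda>_. borel :: 'a measure))" if "j < m" for j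
      using that by (intro measurable_component_singleton) auto
    have f1: "f1 \<in> borel_measurable (PiM {..<m} (\<lambda>_. borel))"
      unfolding f1_def
      by (intro borel_measurable_times borel_measurable_prod borel_measurable_sum borel_measurable_const
            measurable_compose[OF _ measurable_cis] borel_measurable_inner measurable_component_singleton) auto
    have f2: "f2 \<in> borel_measurable (PiM {m} (\<lambda>_. borel))"
      unfolding f2_def
      by (intro measurable_compose[OF _ measurable_cis] borel_measurable_inner measurable_component_singleton) auto
    have iv: "indep_var borel (f1 \<circ> (\<lambda>w. restrict (\<lambda>i. D i w) {..<m})) borel (f2 \<circ> (\<lambda>w. restrict (\<lambda>i. D i w) {m}))"
      by (rule indep_var_compose[OF indep_var_restrict[OF ind] f1 f2]) auto
    have XD: "X (tt i) w = (\<Sum>j<i. D j w)" if "w \<in> space M" for i w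
      unfolding D_def using sum_lessThan_telescope[of "\<lambda>i. X (tt i) w" i] X_0[OF that] by (simp add: tt_def)
    have VE: "(f1 \<circ> (\<lambda>w. restrict (\<lambda>i. D i w) {..<m})) w = V m w" if "w \<in> space M" for w
    proof -
      have 1: "(\<Sum>j\<le>i. restrict (\<lambda>i. D i w) {..<m} j) = X (real (Suc i) * s / real m) w" if "i < m" for i
      proof -
        have "(\<Sum>j\<le>i. restrict (\<lambda>i. D i w) {..<m} j) = (\<Sum>j<Suc i. D j w)"
          using that by (intro sum.cong) auto
        also have "\<dots> = X (tt (Suc i)) w" using XD \<open>w \<in> space M\<close> by simp
        also have "tt (Suc i) = real (Suc i) * s / real m" using that by (simp add: tt_def)
        finally show ?thesis .
      qed
      have "(\<Sum>j<m. restrict (\<lambda>i. D i w) {..<m} j) = (\<Sum>j<m. D j w)" by (intro sum.cong) auto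
      also have "\<dots> = X (tt m) w" using XD that by simp
      also have "tt m = s" using m by (simp add: tt_def)
      finally have 2: "(\<Sum>j<m. restrict (\<lambda>i. D i w) {..<m} j) = X s w" .
      show ?thesis unfolding comp_def f1_def V_def A_def 2 using 1 by simp
    qed
    have EE: "(f2 \<circ> (\<lambda>w. restrict (\<lambda>i. D i w) {m})) w = E w" for w
      using m by (simp add: f2_def E_def D_def tt_def)
    have "integrable M (V m)" by (rule integrable_bounded[OF _ nV]) auto
    then have iV: "integrable M (f1 \<circ> (\<lambda>w. restrict (\<lambda>i. D i w) {..<m}))"
      by (rule iffD1[OF Bochner_Integration.integrable_cong, rotated -1]) (auto simp only: VE)
    have "integrable M E" by (rule integrable_bounded[where B = 1]) (auto simp: E_def)
    then have iE: "integrable M (f2 \<circ> (\<lambda>w. restrict (\<lambda>i. D i w) {m}))"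
      by (rule iffD1[OF Bochner_Integration.integrable_cong, rotated -1]) (auto simp only: EE)
    let ?F1 = "f1 \<circ> (\<lambda>w. restrict (\<lambda>i. D i w) {..<m})" and ?F2 = "f2 \<circ> (\<lambda>w. restrict (\<lambda>i. D i w) {m})"
    have "(\<integral>w. V m w * E w \<partial>M) = (\<integral>w. ?F1 w * ?F2 w \<partial>M)"
      by (intro Bochner_Integration.integral_cong refl) (simp only: VE EE)
    also have "\<dots> = (\<integral>w. ?F1 w \<partial>M) * (\<integral>w. ?F2 w \<partial>M)"
      by (rule indep_var_lebesgue_integral[OF iv iV iE])
    also have "(\<integral>w. ?F1 w \<partial>M) = (\<integral>w. V m w \<partial>M)"
      by (intro Bochner_Integration.integral_cong refl) (simp only: VE)
    also have "(\<integral>w. ?F2 w \<partial>M) = (\<integral>w. E w \<partial>M)"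
      by (intro Bochner_Integration.integral_cong refl) (simp only: EE)
    finally have "(\<integral>w. V m w * E w \<partial>M) = (\<integral>w. V m w \<partial>M) * (\<integral>w. E w \<partial>M)" .
    then show ?thesis using s by (simp add: E_def X_increment_char)
  qed
  have "(\<lambda>m. \<integral>w. V m w * E w \<partial>M) \<longlonglongrightarrow> (\<integral>w. W w \<partial>M) * complex_of_real (exp (- (t - s) * \<psi> \<gamma>))"
    by (rule Lim_transform_eventually[OF tendsto_mult_right[OF l2]])
       (use eq in \<open>auto intro!: eventually_sequentiallyI[of 1]\<close>)
  then show ?thesis using LIMSEQ_unique[OF l1] by (simp add: E_def)
qed

text \<open>The extra character with frequency \<gamma> at the end time lets the recursion close;
  the value wanted in the end is \<gamma> = 0.\<close>

definition E :: "('i \<Rightarrow> 'a) \<Rightarrow> 'i set \<Rightarrow> 'a \<Rightarrow> real \<Rightarrow> complex" where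
  "E l S \<gamma> t = (\<integral>w. (\<Prod>k\<in>S. ft X (l k) t w) * cis (\<gamma> \<bullet> X (max 0 t) w) \<partial>M)"

lemma E_measurable [measurable]: "E l S \<gamma> \<in> borel_measurable borel"
proof -
  note X_joint[measurable] ft_joint[measurable]
  have "(\<lambda>t. \<integral>w. (\<Prod>k\<in>S. ft X (l k) (fst (t, w)) (snd (t, w))) * cis (\<gamma> \<bullet> X (max 0 (fst (t, w))) (snd (t, w))) \<partial>M) \<in> borel_measurable borel"
    by (rule borel_measurable_lebesgue_integral) (simp add: case_prod_unfold)
  then show ?thesis unfolding E_def[abs_def] by simp
qed

lemma norm_prod_ft_le: "w \<in> space M \<Longrightarrow> 0 \<le> t \<Longrightarrow> norm (\<Prod>k\<in>S. ft X (l k) t w) \<le> t ^ card S"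
  unfolding prod_norm[symmetric] using norm_ft_le prod_mono[of S "\<lambda>k. norm (ft X (l k) t w)" "\<lambda>_. t"] by simp

lemma norm_E_le: assumes "0 \<le> t" shows "norm (E l S \<gamma> t) \<le> t ^ card S"
proof -
  have "norm (E l S \<gamma> t) \<le> (\<integral>w. norm ((\<Prod>k\<in>S. ft X (l k) t w) * cis (\<gamma> \<bullet> X (max 0 t) w)) \<partial>M)"
    unfolding E_def by (rule integral_norm_bound)
  also have "\<dots> \<le> (\<integral>w. t ^ card S \<partial>M)"
    using norm_prod_ft_le assms
    by (intro integral_mono integrable_norm integrable_bounded[where B = "t ^ card S"]) (auto simp: norm_mult)
  finally show ?thesis by (simp add: prob_space)
qed

lemma E_empty: assumes "0 \<le> t" shows "E l {} \<gamma> t = complex_of_real (exp (- t * \<psi> \<gamma>))"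
proof -
  have "E l {} \<gamma> t = (\<integral>w. cis (\<gamma> \<bullet> (X t w - X 0 w)) \<partial>M)"
    unfolding E_def using assms by (intro Bochner_Integration.integral_cong) (auto simp: X_0)
  then show ?thesis using assms X_increment_char[of 0 t] by simp
qed

text \<open>With s the largest of the times, X t is split at s: the increment after s produces the
  exponential, and X s collects the frequency \<gamma> + l j. The outcome is a convolution in time,
  which an exponential clock turns into a product.\<close>

lemma E_step:
  assumes S: "finite S" "S \<noteq> {}" and t: "0 \<le> t"
  shows "E l S \<gamma> t = Int0 (\<lambda>s. complex_of_real (exp (- (t - s) * \<psi> \<gamma>)) * (\<Sum>j\<in>S. E l (S - {j}) (\<gamma> + l j) s)) t"
proof -
  interpret LM: pair_sigma_finite lborel M ..
  note X_joint[measurable] ft_joint[measurable]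
  define G where "G s w = (\<Sum>j\<in>S. cis (l j \<bullet> X (max 0 s) w) * (\<Prod>k\<in>S - {j}. ft X (l k) s w))" for s w
  define F where "F s w = indicat_real {0..t} s *\<^sub>R (G s w * cis (\<gamma> \<bullet> X t w))" for s w
  have Fm [measurable]: "(\<lambda>x. F (fst x) (snd x)) \<in> borel_measurable (lborel \<Otimes>\<^sub>M M)"
    unfolding F_def G_def by measurable
  have Fm1: "(\<lambda>w. F s w) \<in> borel_measurable M" for s
    using measurable_compose[OF _ Fm, of "\<lambda>w. (s, w)" M] by simp
  define C where "C = (\<Sum>j\<in>S. t ^ card (S - {j}))"
  have nF: "norm (F s w) \<le> indicat_real {0..t} s * C" if "w \<in> space M" for s w
  proof (cases "s \<in> {0..t}")
    case True
    have "norm (G s w) \<le> C" unfolding G_def C_def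
    proof (rule sum_norm_le)
      fix j assume "j \<in> S"
      have "norm (\<Prod>k\<in>S - {j}. ft X (l k) s w) \<le> s ^ card (S - {j})" using norm_prod_ft_le that True by auto
      also have "\<dots> \<le> t ^ card (S - {j})" using True by (intro power_mono) auto
      finally show "norm (cis (l j \<bullet> X (max 0 s) w) * (\<Prod>k\<in>S - {j}. ft X (l k) s w)) \<le> t ^ card (S - {j})"
        by (simp add: norm_mult)
    qed
    then show ?thesis using True by (simp add: F_def norm_mult)
  qed (simp add: F_def)
  have iF: "integrable (lborel \<Otimes>\<^sub>M M) (\<lambda>(s, w). F s w)"
  proof (rule LM.Fubini_integrable)
    show "(\<lambda>(s, w). F s w) \<in> borel_measurable (lborel \<Otimes>\<^sub>M M)" using Fm by (simp add: case_prod_unfold)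
    have m: "(\<lambda>s. \<integral>w. norm (F s w) \<partial>M) \<in> borel_measurable lborel"
      using borel_measurable_lebesgue_integral[of "\<lambda>s w. norm (F s w)" lborel] Fm by (simp add: case_prod_unfold)
    have "integrable lborel (\<lambda>s. indicat_real {0..t} s * C)"
      by (intro integrable_mult_left integrable_real_indicator) (auto simp: emeasure_lborel_Icc_eq)
    then have "integrable lborel (\<lambda>s. \<integral>w. norm (F s w) \<partial>M)"
    proof (rule Bochner_Integration.integrable_bound[OF _ m], intro AE_I2)
      fix s :: real
      have C0: "0 \<le> C" unfolding C_def using t by (intro sum_nonneg) auto
      have "(\<integral>w. norm (F s w) \<partial>M) \<le> (\<integral>w. indicat_real {0..t} s * C \<partial>M)"
        using nF Fm1 by (intro integral_mono integrable_norm integrable_bounded) auto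
      then show "norm (\<integral>w. norm (F s w) \<partial>M) \<le> norm (indicat_real {0..t} s * C)"
        using C0 by (simp add: prob_space integral_nonneg_AE)
    qed
    then show "integrable lborel (\<lambda>s. \<integral>w. norm (case (s, w) of (s, w) \<Rightarrow> F s w) \<partial>M)" by simp
    show "AE s in lborel. integrable M (\<lambda>w. case (s, w) of (s, w) \<Rightarrow> F s w)"
      using nF Fm1 by (intro AE_I2) (auto intro: integrable_bounded)
  qed
  have "E l S \<gamma> t = (\<integral>w. (LINT s|lborel. F s w) \<partial>M)"
    unfolding E_def
  proof (intro Bochner_Integration.integral_cong refl)
    fix w assume w: "w \<in> space M"
    have "(\<Prod>k\<in>S. ft X (l k) t w) = Int0 (\<lambda>s. G s w) t"
      unfolding ft_eq G_def using S t w by (intro prod_Int0 cis_path_measurable) auto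
    then show "(\<Prod>k\<in>S. ft X (l k) t w) * cis (\<gamma> \<bullet> X (max 0 t) w) = (LINT s|lborel. F s w)"
      using t by (simp add: Int0_def F_def flip: scaleR_conv_of_real mult_scaleR_left)
  qed
  also have "\<dots> = (LINT s|lborel. (\<integral>w. F s w \<partial>M))"
    by (rule LM.Fubini_integral[OF iF])
  also have "\<dots> = Int0 (\<lambda>s. complex_of_real (exp (- (t - s) * \<psi> \<gamma>)) * (\<Sum>j\<in>S. E l (S - {j}) (\<gamma> + l j) s)) t"
    unfolding Int0_def
  proof (rule integral_cong_AE)
    show "(\<lambda>s. \<integral>w. F s w \<partial>M) \<in> borel_measurable lborel"
      using borel_measurable_lebesgue_integral[of F lborel] Fm by (simp add: case_prod_unfold)
    show "AE s in lborel. (\<integral>w. F s w \<partial>M) = indicat_real {0..t} s *\<^sub>R (complex_of_real (exp (- (t - s) * \<psi> \<gamma>)) * (\<Sum>j\<in>S. E l (S - {j}) (\<gamma> + l j) s))"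
      using AE_lborel_singleton[of "0::real"]
    proof eventually_elim
      \<comment> \<open>Time 0 is set aside because \<open>indep_past_increment\<close> assumes 0 <
        s.\<close>
      fix s :: real assume s0: "s \<noteq> 0"
      show "(\<integral>w. F s w \<partial>M) = indicat_real {0..t} s *\<^sub>R (complex_of_real (exp (- (t - s) * \<psi> \<gamma>)) * (\<Sum>j\<in>S. E l (S - {j}) (\<gamma> + l j) s))"
      proof (cases "s \<in> {0..t}")
        case True
        then have s: "0 < s" "s \<le> t" using s0 by auto
        let ?W = "\<lambda>j w. (\<Prod>k\<in>S - {j}. ft X (l k) s w) * cis ((\<gamma> + l j) \<bullet> X s w)"
        have "(\<integral>w. F s w \<partial>M) = (\<integral>w. (\<Sum>j\<in>S. ?W j w * cis (\<gamma> \<bullet> (X t w - X s w))) \<partial>M)"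
        proof (intro Bochner_Integration.integral_cong refl)
          fix w
          have "cis (l j \<bullet> X s w) * p * cis (\<gamma> \<bullet> X t w) = p * cis ((\<gamma> + l j) \<bullet> X s w) * cis (\<gamma> \<bullet> (X t w - X s w))" for j p
            by (simp add: cis_mult inner_add_left inner_diff_right algebra_simps mult.left_commute[of "cis _"])
          note e = this
          have i: "indicat_real {0..t} s = 1" "max 0 s = s" using True by auto
          show "F s w = (\<Sum>j\<in>S. ?W j w * cis (\<gamma> \<bullet> (X t w - X s w)))"
            unfolding F_def G_def i scaleR_one sum_distrib_right by (intro sum.cong refl e)
        qed
        also have "\<dots> = (\<Sum>j\<in>S. \<integral>w. ?W j w * cis (\<gamma> \<bullet> (X t w - X s w)) \<partial>M)"
        proof (rule Bochner_Integration.integral_sum)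
          fix j
          show "integrable M (\<lambda>w. ?W j w * cis (\<gamma> \<bullet> (X t w - X s w)))"
            using norm_prod_ft_le[where t = s and S = "S - {j}" and l = l] s
            by (intro integrable_bounded[where B = "s ^ card (S - {j})"]) (auto simp: norm_mult)
        qed
        also have "\<dots> = (\<Sum>j\<in>S. E l (S - {j}) (\<gamma> + l j) s * complex_of_real (exp (- (t - s) * \<psi> \<gamma>)))"
          using S s by (intro sum.cong refl, subst indep_past_increment) (auto simp: E_def)
        finally show ?thesis using True by (simp add: sum_distrib_left mult.commute)
      next
        case False
        then show ?thesis by (simp add: F_def)
      qed
    qed
  qed measurable
  finally show ?thesis .
qed

end

section \<open>Laplace transforms at parameter 1\<close>

lemma integral_exp_Ici:
  assumes "0 < b"
  shows "has_bochner_integral lborel (\<lambda>u. indicat_real {0..} u * exp (- u * b)) (1 / b)"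
proof -
  have m: "(\<lambda>u. exponential_density b u) \<in> borel_measurable lborel" by measurable
  interpret P: prob_space "density lborel (\<lambda>x. ennreal (exponential_density b x))"
    using prob_space_exponential_density[OF assms] .
  have "(\<integral>\<^sup>+u. ennreal (exponential_density b u) \<partial>lborel) = 1"
    using P.emeasure_space_1 m by (simp add: emeasure_density)
  then have "has_bochner_integral lborel (exponential_density b) 1"
    using exponential_density_nonneg[OF assms] by (intro has_bochner_integral_nn_integral) auto
  then have "has_bochner_integral lborel (\<lambda>u. (1 / b) * exponential_density b u) ((1 / b) * 1)"
    by (intro has_bochner_integral_mult_right) auto
  moreover have "(\<lambda>u. (1 / b) * exponential_density b u) = (\<lambda>u. indicat_real {0..} u * exp (- u * b))"
    using assms by (auto simp: exponential_density_def indicator_def)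
  ultimately show ?thesis by simp
qed

text \<open>The factor exp(-t) is divided between t - s and s. For fixed s the integral over t is
  then that of \<open>k\<close>, which is 1 / (1 + c).\<close>

lemma laplace_convolution:
  fixes y :: "real \<Rightarrow> complex"
  assumes c: "0 \<le> c" and Y: "integrable lborel (\<lambda>s. indicat_real {0..} s *\<^sub>R (exp (- s) *\<^sub>R y s))"
    and [measurable]: "y \<in> borel_measurable borel"
  shows "(LINT t|lborel. indicat_real {0..} t *\<^sub>R (exp (- t) *\<^sub>R Int0 (\<lambda>s. complex_of_real (exp (- (t - s) * c)) * y s) t))
    = (1 / (1 + c)) *\<^sub>R (LINT s|lborel. indicat_real {0..} s *\<^sub>R (exp (- s) *\<^sub>R y s))"
proof -
  define Z where "Z s = indicat_real {0..} s *\<^sub>R (exp (- s) *\<^sub>R y s)" for s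
  define k where "k u = indicat_real {0..} u * exp (- u * (1 + c))" for u
  have [measurable]: "Z \<in> borel_measurable borel" "k \<in> borel_measurable borel"
    unfolding Z_def k_def by measurable
  have hk: "has_bochner_integral lborel k (1 / (1 + c))"
    unfolding k_def using c by (intro integral_exp_Ici) auto
  then have hk': "has_bochner_integral lborel (\<lambda>t. k (t - s)) (1 / (1 + c))" for s
    using lborel_has_bochner_integral_real_affine_iff[of 1 k "1 / (1 + c)" "- s"] by (simp add: add.commute)
  have ik: "integrable lborel (\<lambda>t. k (t - s))" "(LINT t|lborel. k (t - s)) = 1 / (1 + c)" for s
    using hk'[of s] by (auto simp: has_bochner_integral_iff)
  have k0: "0 \<le> k u" for u by (simp add: k_def)
  have iZ: "integrable lborel Z" unfolding Z_def by (rule Y)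
  have int: "integrable (lborel \<Otimes>\<^sub>M lborel) (\<lambda>(s, t). k (t - s) *\<^sub>R Z s)"
  proof (rule lborel_pair.Fubini_integrable)
    show "integrable lborel (\<lambda>s. LINT t|lborel. norm (case (s, t) of (s, t) \<Rightarrow> k (t - s) *\<^sub>R Z s))"
      using ik k0 iZ by simp
    show "AE s in lborel. integrable lborel (\<lambda>t. case (s, t) of (s, t) \<Rightarrow> k (t - s) *\<^sub>R Z s)"
      using ik by simp
  qed measurable
  have "(LINT t|lborel. indicat_real {0..} t *\<^sub>R (exp (- t) *\<^sub>R Int0 (\<lambda>s. complex_of_real (exp (- (t - s) * c)) * y s) t))
    = (LINT t|lborel. LINT s|lborel. k (t - s) *\<^sub>R Z s)"
  proof (intro Bochner_Integration.integral_cong refl)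
    fix t :: real
    have "indicat_real {0..} t *\<^sub>R (exp (- t) *\<^sub>R Int0 (\<lambda>s. complex_of_real (exp (- (t - s) * c)) * y s) t)
        = (LINT s|lborel. (indicat_real {0..} t * exp (- t)) *\<^sub>R (indicat_real {0..t} s *\<^sub>R (complex_of_real (exp (- (t - s) * c)) * y s)))"
      unfolding Int0_def by (subst integral_scaleR_right) simp
    also have "\<dots> = (LINT s|lborel. k (t - s) *\<^sub>R Z s)"
    proof (intro Bochner_Integration.integral_cong refl)
      fix s :: real
      have "exp (- t) * exp (- (t - s) * c) = exp (- (t - s) * (1 + c)) * exp (- s)"
        unfolding exp_add[symmetric] by (rule arg_cong[where f = exp]) (simp add: algebra_simps)
      then have "complex_of_real (exp (- t)) * complex_of_real (exp (- (t - s) * c)) = complex_of_real (exp (- (t - s) * (1 + c))) * complex_of_real (exp (- s))"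
        by (metis of_real_mult)
      then have e: "complex_of_real (exp (- t)) * (complex_of_real (exp (- (t - s) * c)) * y s) = complex_of_real (exp (- (t - s) * (1 + c))) * (complex_of_real (exp (- s)) * y s)"
        by (simp only: mult.assoc[symmetric])
      show "(indicat_real {0..} t * exp (- t)) *\<^sub>R (indicat_real {0..t} s *\<^sub>R (complex_of_real (exp (- (t - s) * c)) * y s)) = k (t - s) *\<^sub>R Z s"
        using e unfolding k_def Z_def scaleR_conv_of_real by (auto simp: indicator_def)
    qed
    finally show "indicat_real {0..} t *\<^sub>R (exp (- t) *\<^sub>R Int0 (\<lambda>s. complex_of_real (exp (- (t - s) * c)) * y s) t) = (LINT s|lborel. k (t - s) *\<^sub>R Z s)" .
  qed
  also have "\<dots> = (LINT s|lborel. LINT t|lborel. k (t - s) *\<^sub>R Z s)"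
    by (rule lborel_pair.Fubini_integral[OF int])
  also have "\<dots> = (LINT s|lborel. (1 / (1 + c)) *\<^sub>R Z s)"
    using ik by simp
  also have "\<dots> = (1 / (1 + c)) *\<^sub>R integral\<^sup>L lborel Z" by (intro integral_scaleR_right iZ)
  finally show ?thesis unfolding Z_def .
qed

lemma integrable_exp_polynomial:
  fixes y :: "real \<Rightarrow> complex"
  assumes [measurable]: "y \<in> borel_measurable borel" and "\<And>s. 0 \<le> s \<Longrightarrow> norm (y s) \<le> s ^ k"
  shows "integrable lborel (\<lambda>s. indicat_real {0..} s *\<^sub>R (exp (- s) *\<^sub>R y s))"
proof -
  have "integrable lborel (\<lambda>s. indicat_real {0..} s * (s ^ k * exp (- s)))"
  proof (rule integrableI_nonneg)
    have "(\<integral>\<^sup>+ s. ennreal (indicat_real {0..} s * (s ^ k * exp (- s))) \<partial>lborel)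
        = (\<integral>\<^sup>+ s. ennreal (s ^ k * exp (- s)) * indicator {0..} s \<partial>lborel)"
      by (intro nn_integral_cong) (auto simp: indicator_def)
    then show "(\<integral>\<^sup>+ s. ennreal (indicat_real {0..} s * (s ^ k * exp (- s))) \<partial>lborel) < \<infinity>"
      by (simp add: nn_intergal_power_times_exp_Ici)
  qed (auto simp: indicator_def)
  then show ?thesis
    by (rule Bochner_Integration.integrable_bound) (use assms in \<open>auto simp: indicator_def mult.commute[of "exp _"] intro!: mult_right_mono AE_I2\<close>)
qed

context levy begin

text \<open>Each convolution with the exponential of rate \<psi> \<gamma> becomes multiplication by
  1 / (1 + \<psi> \<gamma>), so that the recursion \<open>E_step\<close> turns into the recursion of
  \<open>Phi\<close>.\<close>

lemma laplace_E:
  fixes l :: "'i \<Rightarrow> 'a"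
  assumes "finite S"
  shows "(LINT t|lborel. indicat_real {0..} t *\<^sub>R (exp (- t) *\<^sub>R E l S \<gamma> t))
    = complex_of_real (Phi (\<lambda>x. 1 / (1 + \<psi> x)) l S \<gamma>)"
  using assms
proof (induction S arbitrary: \<gamma> rule: finite_psubset_induct)
  case (psubset S)
  show ?case
  proof (cases "S = {}")
    case True
    have "(LINT t|lborel. indicat_real {0..} t *\<^sub>R (exp (- t) *\<^sub>R E l S \<gamma> t))
      = (LINT t|lborel. complex_of_real (indicat_real {0..} t * exp (- t * (1 + \<psi> \<gamma>))))"
    proof (intro Bochner_Integration.integral_cong refl)
      fix t :: real
      have "exp (- t) * exp (- t * \<psi> \<gamma>) = exp (- t * (1 + \<psi> \<gamma>))"
        unfolding exp_add[symmetric] by (simp add: algebra_simps)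
      then show "indicat_real {0..} t *\<^sub>R (exp (- t) *\<^sub>R E l S \<gamma> t) = complex_of_real (indicat_real {0..} t * exp (- t * (1 + \<psi> \<gamma>)))"
        using True by (simp add: indicator_def E_empty scaleR_conv_of_real flip: of_real_mult)
    qed
    also have "\<dots> = complex_of_real (1 / (1 + \<psi> \<gamma>))"
      using has_bochner_integral_integral_eq[OF integral_exp_Ici[of "1 + \<psi> \<gamma>"]] psi0[of \<gamma>]
      by (subst integral_complex_of_real) simp
    finally show ?thesis using True by simp
  next
    case False
    define y where "y s = (\<Sum>j\<in>S. E l (S - {j}) (\<gamma> + l j) s)" for s
    have [measurable]: "y \<in> borel_measurable borel" unfolding y_def by measurable
    have iE: "integrable lborel (\<lambda>s. indicat_real {0..} s *\<^sub>R (exp (- s) *\<^sub>R E l S' \<gamma>' s))" for S' \<gamma>'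
      using norm_E_le by (intro integrable_exp_polynomial[where k = "card S'"]) auto
    have ysum: "indicat_real {0..} s *\<^sub>R (exp (- s) *\<^sub>R y s) = (\<Sum>j\<in>S. indicat_real {0..} s *\<^sub>R (exp (- s) *\<^sub>R E l (S - {j}) (\<gamma> + l j) s))" for s
      unfolding y_def by (simp add: scaleR_sum_right)
    have iy: "integrable lborel (\<lambda>s. indicat_real {0..} s *\<^sub>R (exp (- s) *\<^sub>R y s))"
      unfolding ysum using iE by (intro Bochner_Integration.integrable_sum)
    have "(LINT t|lborel. indicat_real {0..} t *\<^sub>R (exp (- t) *\<^sub>R E l S \<gamma> t))
      = (LINT t|lborel. indicat_real {0..} t *\<^sub>R (exp (- t) *\<^sub>R Int0 (\<lambda>s. complex_of_real (exp (- (t - s) * \<psi> \<gamma>)) * y s) t))"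
      unfolding y_def
    proof (intro Bochner_Integration.integral_cong refl)
      fix t :: real
      show "indicat_real {0..} t *\<^sub>R (exp (- t) *\<^sub>R E l S \<gamma> t) = indicat_real {0..} t *\<^sub>R (exp (- t) *\<^sub>R
          Int0 (\<lambda>s. complex_of_real (exp (- (t - s) * \<psi> \<gamma>)) * (\<Sum>j\<in>S. E l (S - {j}) (\<gamma> + l j) s)) t)"
      proof (cases "0 \<le> t")
        case True
        show ?thesis by (subst E_step[OF psubset.hyps False True]) (rule refl)
      qed simp
    qed
    also have "\<dots> = (1 / (1 + \<psi> \<gamma>)) *\<^sub>R (LINT s|lborel. indicat_real {0..} s *\<^sub>R (exp (- s) *\<^sub>R y s))"
      by (rule laplace_convolution[OF psi0 iy]) simp
    also have "(LINT s|lborel. indicat_real {0..} s *\<^sub>R (exp (- s) *\<^sub>R y s))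
       = (\<Sum>j\<in>S. LINT s|lborel. indicat_real {0..} s *\<^sub>R (exp (- s) *\<^sub>R E l (S - {j}) (\<gamma> + l j) s))"
      unfolding ysum using iE by (intro Bochner_Integration.integral_sum)
    also have "\<dots> = (\<Sum>j\<in>S. complex_of_real (Phi (\<lambda>x. 1 / (1 + \<psi> x)) l (S - {j}) (\<gamma> + l j)))"
      by (intro sum.cong refl psubset.IH) auto
    finally show ?thesis using psubset.hyps False
      by (simp add: Phi_nonempty scaleR_conv_of_real)
  qed
qed

text \<open>The clock must be independent of the whole path, not of finitely many values. The joint
  law is therefore formed from the law of \<tau> and the probability space itself restricted to the
  sigma-algebra \<open>G\<close> of the path, along the map from w to (\<tau> w, w).\<close>

lemma expectation_exponential_time:
  fixes l :: "'i \<Rightarrow> 'a"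
  assumes S: "finite S" and G: "subalgebra M G" and XG: "\<And>t. 0 \<le> t \<Longrightarrow> X t \<in> borel_measurable G"
    and \<tau>: "distributed M lborel \<tau> (\<lambda>x. ennreal (exponential_density 1 x))"
    and ind: "\<And>A B. A \<in> sets G \<Longrightarrow> B \<in> sets borel \<Longrightarrow> prob (A \<inter> (\<tau> -` B \<inter> space M)) = prob A * prob (\<tau> -` B \<inter> space M)"
  shows "(\<integral>w. (\<Prod>k\<in>S. ft X (l k) (\<tau> w) w) \<partial>M) = complex_of_real (Phi (\<lambda>x. 1 / (1 + \<psi> x)) l S 0)"
proof -
  define P where "P = restr_to_subalg M G"
  define T where "T = distr M borel \<tau>"
  have [measurable]: "\<tau> \<in> borel_measurable M" using distributed_measurable[OF \<tau>] by simp
  have T_dens: "T = density lborel (\<lambda>x. ennreal (exponential_density 1 x))"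
    using distributed_distr_eq_density[OF \<tau>] unfolding T_def by (metis distr_cong sets_lborel)
  interpret P: prob_space P unfolding P_def by (rule prob_space_restr_to_subalg[OF G prob_space_axioms])
  interpret T: prob_space T unfolding T_def by (rule prob_space_distr) simp
  interpret TP: pair_sigma_finite T P ..
  have GM: "sets G \<subseteq> sets M" "space G = space M" using G by (auto simp: subalgebra_def)
  have sP: "sets P = sets G" "space P = space M" unfolding P_def
    using sets_restr_to_subalg[OF G] by (auto simp: space_restr_to_subalg)
  have emP: "emeasure P A = emeasure M A" if "A \<in> sets G" for A
    unfolding P_def using emeasure_restr_to_subalg[OF G that] .
  have idm: "(\<lambda>w. (\<tau> w, w)) \<in> measurable M (T \<Otimes>\<^sub>M P)"
  proof (rule measurable_Pair)
    show "\<tau> \<in> measurable M T" by (simp add: T_def)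
    show "(\<lambda>w. w) \<in> measurable M P" using GM sP by (intro measurableI) (auto dest: sets.sets_into_space)
  qed
  have joint: "T \<Otimes>\<^sub>M P = distr M (T \<Otimes>\<^sub>M P) (\<lambda>w. (\<tau> w, w))"
  proof (rule pair_measure_eqI)
    fix B A assume B: "B \<in> sets T" and A: "A \<in> sets P"
    then have B': "B \<in> sets borel" by (simp add: T_def)
    have A': "A \<in> sets G" "A \<in> sets M" using A sP GM by auto
    have "(\<lambda>w. (\<tau> w, w)) -` (B \<times> A) \<inter> space M = A \<inter> (\<tau> -` B \<inter> space M)"
      using A' sets.sets_into_space by auto
    then have "emeasure (distr M (T \<Otimes>\<^sub>M P) (\<lambda>w. (\<tau> w, w))) (B \<times> A) = emeasure M (A \<inter> (\<tau> -` B \<inter> space M))"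
      using idm A B by (subst emeasure_distr) auto
    also have "\<dots> = emeasure M A * emeasure M (\<tau> -` B \<inter> space M)"
      using ind[OF A'(1) B'] by (simp add: emeasure_eq_measure ennreal_mult)
    also have "emeasure M (\<tau> -` B \<inter> space M) = emeasure T B"
      unfolding T_def using B' by (subst emeasure_distr) auto
    also have "emeasure M A = emeasure P A" using emP A' by simp
    finally show "emeasure T B * emeasure P A = emeasure (distr M (T \<Otimes>\<^sub>M P) (\<lambda>w. (\<tau> w, w))) (B \<times> A)"
      by (simp add: mult.commute)
  qed (auto intro: T.sigma_finite_measure_axioms P.sigma_finite_measure_axioms)
  define H where "H x = (\<Prod>k\<in>S. ft X (l k) (fst x) (snd x))" for x
  have "sets (T \<Otimes>\<^sub>M P) = sets (borel \<Otimes>\<^sub>M G)" by (intro sets_pair_measure_cong) (auto simp: T_def sP)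
  then have Hm [measurable]: "H \<in> borel_measurable (T \<Otimes>\<^sub>M P)"
    unfolding H_def using ft_jointly_measurable[of X G, OF XG] X_right_continuous GM
    by (intro borel_measurable_prod) (auto cong: measurable_cong_sets)
  have Hm1: "(\<lambda>w. H (t, w)) \<in> borel_measurable P" for t
    using measurable_compose[OF _ Hm, of "\<lambda>w. (t, w)" P] by (simp add: T_def)
  \<comment> \<open>At a negative clock value every integral is 0, and so is the product unless
    \<open>S\<close> is empty; \<open>max 0 t\<close> with the convention \<open>0 ^ 0 = 1\<close>
    covers both cases.\<close>
  have nH: "norm (H (t, w)) \<le> (max 0 t) ^ card S" if "w \<in> space P" for t w
  proof (cases "0 \<le> t")
    case True then show ?thesis using norm_prod_ft_le that sP by (simp add: H_def)
  next
    case False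
    then have "ft X (l k) t w = 0" for k by (simp add: ft_def Int0_def)
    then show ?thesis using S by (cases "S = {}") (simp_all add: H_def card_gt_0_iff power_0_left)
  qed
  have iH: "integrable (T \<Otimes>\<^sub>M P) H"
  proof (rule TP.Fubini_integrable)
    have m: "(\<lambda>t. \<integral>w. norm (H (t, w)) \<partial>P) \<in> borel_measurable T"
      using P.borel_measurable_lebesgue_integral[of "\<lambda>t w. norm (H (t, w))" T] by (simp add: case_prod_unfold)
    have "integrable lborel (\<lambda>s. indicat_real {0..} s *\<^sub>R (exp (- s) *\<^sub>R complex_of_real (s ^ card S)))"
      by (rule integrable_exp_polynomial) (auto simp: norm_power)
    then have "integrable lborel (\<lambda>s. norm (indicat_real {0..} s *\<^sub>R (exp (- s) *\<^sub>R complex_of_real (s ^ card S))))"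
      by (rule integrable_norm)
    also have "(\<lambda>s. norm (indicat_real {0..} s *\<^sub>R (exp (- s) *\<^sub>R complex_of_real (s ^ card S)))) = (\<lambda>s. exponential_density 1 s *\<^sub>R (max 0 s) ^ card S)"
      by (auto simp: indicator_def exponential_density_def norm_mult norm_power)
    finally have "integrable T (\<lambda>s. (max 0 s) ^ card S)"
      unfolding T_dens by (subst integrable_density) (auto simp: exponential_density_nonneg)
    then show "integrable T (\<lambda>t. \<integral>w. norm (H (t, w)) \<partial>P)"
    proof (rule Bochner_Integration.integrable_bound[OF _ m], intro AE_I2)
      fix t
      have "(\<integral>w. norm (H (t, w)) \<partial>P) \<le> (\<integral>w. (max 0 t) ^ card S \<partial>P)"
        using nH Hm1 by (intro integral_mono integrable_norm P.integrable_const_bound[where B = "(max 0 t) ^ card S"]) auto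
      then show "norm (\<integral>w. norm (H (t, w)) \<partial>P) \<le> norm (max 0 t ^ card S)"
        by (simp add: P.prob_space integral_nonneg_AE)
    qed
    show "AE t in T. integrable P (\<lambda>w. H (t, w))"
      using nH Hm1 by (intro AE_I2 P.integrable_const_bound[where B = "(max 0 t) ^ card S" for t]) auto
  qed measurable
  have "(\<integral>w. (\<Prod>k\<in>S. ft X (l k) (\<tau> w) w) \<partial>M) = (\<integral>w. H (\<tau> w, w) \<partial>M)" by (simp add: H_def)
  also have "\<dots> = integral\<^sup>L (distr M (T \<Otimes>\<^sub>M P) (\<lambda>w. (\<tau> w, w))) H"
    by (subst integral_distr[OF idm Hm]) simp
  also have "\<dots> = integral\<^sup>L (T \<Otimes>\<^sub>M P) H" using joint by simp
  also have "\<dots> = (\<integral>t. (\<integral>w. H (t, w) \<partial>P) \<partial>T)" by (rule TP.integral_fst'[OF iH, symmetric])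
  also have "\<dots> = (LINT t|lborel. exponential_density 1 t *\<^sub>R (\<integral>w. H (t, w) \<partial>P))"
  proof -
    have "(\<lambda>t. \<integral>w. H (t, w) \<partial>P) \<in> borel_measurable T"
      using P.borel_measurable_lebesgue_integral[of "\<lambda>t w. H (t, w)" T] by (simp add: case_prod_unfold)
    then show ?thesis unfolding T_dens by (subst integral_density) (auto simp: exponential_density_nonneg)
  qed
  also have "\<dots> = (LINT t|lborel. indicat_real {0..} t *\<^sub>R (exp (- t) *\<^sub>R E l S 0 t))"
  proof (intro Bochner_Integration.integral_cong refl)
    fix t :: real
    have "(\<lambda>w. H (t, w)) \<in> borel_measurable G" using Hm1[of t] measurable_in_subalg'[OF G] by (simp add: P_def)
    then have "(\<integral>w. H (t, w) \<partial>P) = E l S 0 t"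
      unfolding P_def E_def by (subst integral_subalgebra2[OF G]) (auto simp: H_def)
    then show "exponential_density 1 t *\<^sub>R (\<integral>w. H (t, w) \<partial>P) = indicat_real {0..} t *\<^sub>R (exp (- t) *\<^sub>R E l S 0 t)"
      by (simp add: exponential_density_def indicator_def)
  qed
  also have "\<dots> = complex_of_real (Phi (\<lambda>x. 1 / (1 + \<psi> x)) l S 0)" by (rule laplace_E[OF S])
  finally show ?thesis .
qed

end

section \<open>Moments of sums of independent processes\<close>

lemma Int_stable_vimage: "Int_stable {f -` S \<inter> \<Omega> | S. S \<in> sets K}"
proof (rule Int_stableI)
  fix a b assume "a \<in> {f -` S \<inter> \<Omega> | S. S \<in> sets K}" "b \<in> {f -` S \<inter> \<Omega> | S. S \<in> sets K}"
  then obtain S T where "a = f -` S \<inter> \<Omega>" "b = f -` T \<inter> \<Omega>" "S \<in> sets K" "T \<in> sets K" by auto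
  then have "a \<inter> b = f -` (S \<inter> T) \<inter> \<Omega>" "S \<inter> T \<in> sets K" by auto
  then show "a \<inter> b \<in> {f -` S \<inter> \<Omega> | S. S \<in> sets K}" by blast
qed

locale additive_levy = prob_space M for M :: "'w measure" +
  fixes X :: "'p::finite \<Rightarrow> real \<Rightarrow> 'w \<Rightarrow> 'a::euclidean_space"
    and \<tau> :: "'p \<Rightarrow> 'w \<Rightarrow> real" and \<psi> :: "'a \<Rightarrow> real"
  assumes levy_X: "\<And>j. levy_process_with_symbol M (X j) \<psi>" and psi_nonneg: "\<And>l. 0 \<le> \<psi> l"
    and indep_X: "indep_paths_and_times M X \<tau>"
    and distr_tau: "\<And>j. distributed M lborel (\<tau> j) (\<lambda>x. ennreal (exponential_density 1 x))"
begin

definition Q :: "'a \<Rightarrow> real" where "Q x = 1 / (1 + \<psi> x)"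

lemma Q_pos: "0 < Q x" and Q_le_1: "Q x \<le> 1"
  using psi_nonneg[of x] by (auto simp: Q_def)

lemma levy_path: "levy M (X j) \<psi>"
  by (intro levy.intro levy_axioms.intro prob_space_axioms levy_X psi_nonneg)

lemma tau_measurable [measurable]: "\<tau> j \<in> borel_measurable M"
  using distributed_measurable[OF distr_tau[of j]] by simp

definition sample_path :: "'p \<Rightarrow> 'w \<Rightarrow> real \<Rightarrow> 'a" where
  "sample_path j w = restrict (\<lambda>t. X j t w) {0..}"

definition gen :: "'p + 'p \<Rightarrow> 'w set set" where
  "gen k = (case k of Inl j \<Rightarrow> {sample_path j -` S \<inter> space M | S. S \<in> sets (PiM {0..} (\<lambda>_. borel))}
     | Inr j \<Rightarrow> {\<tau> j -` S \<inter> space M | S. S \<in> sets borel})"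

lemma sample_path_measurable [measurable]: "sample_path j \<in> measurable M (PiM {0..} (\<lambda>_. borel))"
  using indep_X unfolding indep_paths_and_times_def sample_path_def[abs_def] by simp

lemma indep_gen: "indep_sets gen UNIV"
  using indep_X unfolding indep_paths_and_times_def gen_def[abs_def] sample_path_def[abs_def] by simp

lemma gen_subset: "gen k \<subseteq> sets M"
  unfolding gen_def by (auto split: sum.splits)

lemma Int_stable_gen: "Int_stable (gen k)"
  unfolding gen_def by (cases k) (simp_all add: Int_stable_vimage)

lemma norm_ft_le_max: "w \<in> space M \<Longrightarrow> norm (ft (X j) l t w) \<le> max 0 t"
  using levy.norm_ft_le[OF levy_path, of w t j l] by (cases "0 \<le> t") (auto simp: ft_def Int0_def)

definition V :: "('i \<Rightarrow> 'a) \<Rightarrow> 'i set \<Rightarrow> 'p \<Rightarrow> 'w \<Rightarrow> complex" where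
  "V l S j w = (\<Prod>k\<in>S. ft (X j) (l k) (\<tau> j w) w)"

text \<open>The joint information of process j and its clock. Grouping the index set
  \<open>'p + 'p\<close> into the blocks {Inl j, Inr j} makes these sigma-algebras independent over
  j.\<close>

definition F :: "'p \<Rightarrow> 'w measure" where
  "F j = sigma (space M) (gen (Inl j) \<union> gen (Inr j))"

lemma space_F [simp]: "space (F j) = space M"
  unfolding F_def using gen_subset[of "Inl j"] gen_subset[of "Inr j"] sets.sets_into_space
  by (intro space_measure_of) blast

lemma sets_F: "sets (F j) = sigma_sets (space M) (gen (Inl j) \<union> gen (Inr j))"
  unfolding F_def using gen_subset[of "Inl j"] gen_subset[of "Inr j"] sets.sets_into_space
  by (intro sets_measure_of) blast

lemma sample_path_measurable_F: "sample_path j \<in> measurable (F j) (PiM {0..} (\<lambda>_. borel))"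
proof (rule measurableI)
  fix A :: "(real \<Rightarrow> 'a) set" assume "A \<in> sets (PiM {0..} (\<lambda>_. borel))"
  then show "sample_path j -` A \<inter> space (F j) \<in> sets (F j)"
    unfolding sets_F by (intro sigma_sets.Basic) (auto simp: gen_def)
qed (auto simp: sample_path_def space_PiM)

lemma X_measurable_F: "0 \<le> t \<Longrightarrow> X j t \<in> borel_measurable (F j)"
  using measurable_compose[OF sample_path_measurable_F measurable_component_singleton[of t "{0..}"]]
  by (simp add: sample_path_def)

lemma tau_measurable_F: "\<tau> j \<in> borel_measurable (F j)"
proof (rule measurableI)
  fix A :: "real set" assume "A \<in> sets borel"
  then show "\<tau> j -` A \<inter> space (F j) \<in> sets (F j)"
    unfolding sets_F by (intro sigma_sets.Basic) (auto simp: gen_def)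
qed auto

lemma ft_tau_measurable_F: "(\<lambda>w. ft (X j) l (\<tau> j w) w) \<in> borel_measurable (F j)"
proof -
  interpret levy M "X j" \<psi> by (rule levy_path)
  have "(\<lambda>x. ft (X j) l (fst x) (snd x)) \<in> borel_measurable (borel \<Otimes>\<^sub>M F j)"
    using X_right_continuous by (intro ft_jointly_measurable X_measurable_F) auto
  from measurable_compose[OF _ this, of "\<lambda>w. (\<tau> j w, w)" "F j"] tau_measurable_F
  show ?thesis by simp
qed

lemma subalgebra_F: "subalgebra M (F j)"
  unfolding subalgebra_def space_F sets_F using gen_subset by (auto intro!: sets.sigma_sets_subset)

lemma ft_tau_measurable [measurable]: "(\<lambda>w. ft (X j) l (\<tau> j w) w) \<in> borel_measurable M"
  by (rule measurable_from_subalg[OF subalgebra_F ft_tau_measurable_F])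

lemma integrable_tau_power: "integrable M (\<lambda>w. (max 0 (\<tau> j w)) ^ n)"
proof -
  have "integrable lborel (\<lambda>s. indicat_real {0..} s *\<^sub>R (exp (- s) *\<^sub>R complex_of_real (s ^ n)))"
    by (rule integrable_exp_polynomial) (auto simp: norm_power)
  then have "integrable lborel (\<lambda>s. norm (indicat_real {0..} s *\<^sub>R (exp (- s) *\<^sub>R complex_of_real (s ^ n))))"
    by (rule integrable_norm)
  also have "(\<lambda>s. norm (indicat_real {0..} s *\<^sub>R (exp (- s) *\<^sub>R complex_of_real (s ^ n)))) = (\<lambda>s. exponential_density 1 s * (max 0 s) ^ n)"
    by (auto simp: indicator_def exponential_density_def norm_mult norm_power)
  finally show ?thesis
    by (subst distributed_integrable[OF distr_tau, symmetric]) (auto simp: exponential_density_nonneg)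
qed

lemma V_integrable: "finite S \<Longrightarrow> integrable M (V l S j)"
proof (rule Bochner_Integration.integrable_bound[OF integrable_tau_power[of j "card S"]])
  show "V l S j \<in> borel_measurable M" unfolding V_def by measurable
  show "AE w in M. norm (V l S j w) \<le> norm (max 0 (\<tau> j w) ^ card S)"
  proof (rule AE_I2)
    fix w assume "w \<in> space M"
    then have "(\<Prod>k\<in>S. norm (ft (X j) (l k) (\<tau> j w) w)) \<le> (\<Prod>k\<in>S. max 0 (\<tau> j w))"
      by (intro prod_mono) (auto intro: norm_ft_le_max)
    then show "norm (V l S j w) \<le> norm (max 0 (\<tau> j w) ^ card S)"
      by (simp add: V_def prod_norm[symmetric])
  qed
qed

lemma expectation_V:
  assumes "finite S" shows "(\<integral>w. V l S j w \<partial>M) = complex_of_real (Phi Q l S 0)"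
proof -
  interpret L: levy M "X j" \<psi> by (rule levy_path)
  let ?P = "PiM {0..} (\<lambda>_. borel) :: (real \<Rightarrow> 'a) measure"
  define G where "G = vimage_algebra (space M) (sample_path j) ?P"
  have sG: "sets G = gen (Inl j)" unfolding G_def
    by (subst sets_vimage_algebra2) (auto simp: gen_def sample_path_def space_PiM)
  have sp: "space G = space M" by (simp add: G_def)
  have sub: "subalgebra M G" using sG gen_subset[of "Inl j"] by (simp add: subalgebra_def sp)
  have pG: "sample_path j \<in> measurable G ?P"
    unfolding G_def by (rule measurable_vimage_algebra1) (auto simp: sample_path_def space_PiM)
  have XG: "X j t \<in> borel_measurable G" if "0 \<le> t" for t
    using measurable_compose[OF pG measurable_component_singleton[of t "{0..}"]] that by (simp add: sample_path_def)
  have ind: "prob (A \<inter> (\<tau> j -` B \<inter> space M)) = prob A * prob (\<tau> j -` B \<inter> space M)"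
    if A: "A \<in> sets G" and B: "B \<in> sets borel" for A B
  proof -
    define D where "D k = (case k of Inl _ \<Rightarrow> A | Inr _ \<Rightarrow> \<tau> j -` B \<inter> space M)" for k :: "'p + 'p"
    have "A \<in> gen (Inl j)" using A sG by simp
    moreover have "\<tau> j -` B \<inter> space M \<in> gen (Inr j)" using B by (auto simp: gen_def)
    ultimately have "prob (\<Inter>k\<in>{Inl j, Inr j}. D k) = (\<Prod>k\<in>{Inl j, Inr j}. prob (D k))"
      by (intro indep_setsD[OF indep_gen]) (simp_all add: D_def)
    then show ?thesis by (simp add: D_def)
  qed
  have "Q = (\<lambda>x. 1 / (1 + \<psi> x))" by (rule ext) (rule Q_def)
  then show ?thesis
    unfolding V_def by (simp only: L.expectation_exponential_time[OF assms sub XG distr_tau ind])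
qed

lemma indep_V: assumes "finite S" shows "indep_vars (\<lambda>_. borel) (V l S) UNIV"
proof -
  have "indep_sets (\<lambda>j. sigma_sets (space M) (\<Union>i\<in>{Inl j, Inr j}. gen i)) UNIV"
  proof (rule indep_sets_collect_sigma)
    show "indep_sets gen (\<Union>j\<in>UNIV. {Inl j, Inr j})"
      by (rule indep_sets_mono_index[OF _ indep_gen]) auto
  qed (auto simp: Int_stable_gen disjoint_family_on_def)
  then have ind: "indep_sets (\<lambda>j. sets (F j)) UNIV" by (simp add: sets_F)
  have m: "V l S j \<in> borel_measurable (F j)" for j
    unfolding V_def using ft_tau_measurable_F by (intro borel_measurable_prod)
  show ?thesis unfolding indep_vars_def2
  proof (intro conjI ballI)
    show "V l S j \<in> borel_measurable M" for j
      by (rule measurable_from_subalg[OF subalgebra_F m])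
    show "indep_sets (\<lambda>j. {V l S j -` A \<inter> space M |A. A \<in> sets borel}) UNIV"
      by (rule indep_sets_mono_sets[OF ind]) (use measurable_sets[OF m] in auto)
  qed
qed

text \<open>The set \<open>I\<close> of processes is a parameter because a one-element set gives
  first powers of \<open>Phi\<close>, as exploited in \<open>sum_types_J\<close>.\<close>

definition N :: "'p set \<Rightarrow> 'a \<Rightarrow> 'w \<Rightarrow> complex" where
  "N I l w = (\<Prod>j\<in>I. ft (X j) l (\<tau> j w) w)"

lemma N_measurable [measurable]: "N I l \<in> borel_measurable M"
  unfolding N_def by measurable

lemma N_minus: "N I (- l) w = cnj (N I l w)"
proof -
  have "ft (X j) (- l) t w = cnj (ft (X j) l t w)" for j t
  proof -
    have "cnj (ft (X j) l t w) = (LINT s|lborel. cnj (indicator {0..t} s *\<^sub>R cis (l \<bullet> X j s w)))"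
      unfolding ft_def Int0_def by (rule Bochner_Integration.integral_cnj[symmetric])
    also have "\<dots> = ft (X j) (- l) t w"
      unfolding ft_def Int0_def by (intro Bochner_Integration.integral_cong refl) (simp add: cis_cnj)
    finally show ?thesis ..
  qed
  then show ?thesis by (simp add: N_def)
qed

lemma prod_N: "(\<Prod>k\<in>S. N I (l k) w) = (\<Prod>j\<in>I. V l S j w)"
  unfolding N_def V_def by (rule prod.swap)

lemma
  assumes "finite S"
  shows expectation_prod_N: "(\<integral>w. (\<Prod>k\<in>S. N I (l k) w) \<partial>M) = complex_of_real (Phi Q l S 0 ^ card I)"
    and integrable_prod_N: "integrable M (\<lambda>w. \<Prod>k\<in>S. N I (l k) w)"
proof -
  have i: "indep_vars (\<lambda>_. borel) (V l S) I" using indep_vars_subset[OF indep_V[OF assms]] by auto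
  show "(\<integral>w. (\<Prod>k\<in>S. N I (l k) w) \<partial>M) = complex_of_real (Phi Q l S 0 ^ card I)"
    unfolding prod_N using i V_integrable[OF assms]
    by (subst indep_vars_lebesgue_integral) (auto simp: expectation_V[OF assms])
  show "integrable M (\<lambda>w. \<Prod>k\<in>S. N I (l k) w)"
    unfolding prod_N using i V_integrable[OF assms] by (intro indep_vars_integrable) auto
qed

definition Sm :: "'p set \<Rightarrow> 'a set \<Rightarrow> ('a \<Rightarrow> real) \<Rightarrow> 'w \<Rightarrow> complex" where
  "Sm I A u w = (\<Sum>x\<in>A. complex_of_real (u x) * N I x w)"

lemma Sm_measurable [measurable]: "Sm I A u \<in> borel_measurable M"
  unfolding Sm_def by measurable

lemma Sm_power:
  assumes "finite A"
  shows "Sm I A u w ^ n = (\<Sum>f\<in>PiE {..<n} (\<lambda>_. A). complex_of_real (\<Prod>k<n. u (f k)) * (\<Prod>k<n. N I (f k) w))"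
proof -
  have "Sm I A u w ^ n = (\<Prod>k<n. \<Sum>x\<in>A. complex_of_real (u x) * N I x w)" by (simp add: Sm_def)
  also have "\<dots> = (\<Sum>f\<in>PiE {..<n} (\<lambda>_. A). \<Prod>k<n. complex_of_real (u (f k)) * N I (f k) w)"
    using assms by (intro prod_sum_PiE) auto
  finally show ?thesis by (simp add: prod.distrib)
qed

lemma
  assumes "finite A"
  shows expectation_Sm_power: "(\<integral>w. Sm I A u w ^ n \<partial>M)
      = complex_of_real (\<Sum>f\<in>PiE {..<n} (\<lambda>_. A). (\<Prod>k<n. u (f k)) * Phi Q f {..<n} 0 ^ card I)"
    and integrable_Sm_power: "integrable M (\<lambda>w. Sm I A u w ^ n)"
proof -
  have i: "integrable M (\<lambda>w. complex_of_real (\<Prod>k<n. u (f k)) * (\<Prod>k<n. N I (f k) w))" for f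
    by (intro integrable_mult_right integrable_prod_N) simp
  show "(\<integral>w. Sm I A u w ^ n \<partial>M)
      = complex_of_real (\<Sum>f\<in>PiE {..<n} (\<lambda>_. A). (\<Prod>k<n. u (f k)) * Phi Q f {..<n} 0 ^ card I)"
    unfolding Sm_power[OF assms] using i by (simp add: expectation_prod_N)
  show "integrable M (\<lambda>w. Sm I A u w ^ n)"
    unfolding Sm_power[OF assms] using i by (intro Bochner_Integration.integrable_sum)
qed

text \<open>The multinomial theorem is applied inside the expectation, which groups sequences by
  multiplicities without counting them. The disjoint union \<open>SIGMA a:A. {..<t a}\<close> with
  the frequency map \<open>fst\<close> lists every \<open>a\<close> exactly \<open>t a\<close>
  times.\<close>

lemma expectation_Sm_types:
  assumes A: "finite A"
  shows "(\<integral>w. Sm I A u w ^ n \<partial>M)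
    = complex_of_real (fact n * (\<Sum>t\<in>types A n. (\<Prod>a\<in>A. u a ^ t a / fact (t a)) * Phi Q fst (SIGMA a:A. {..<t a}) 0 ^ card I))"
proof -
  have p: "(\<Prod>a\<in>A. N I a w ^ t a) = (\<Prod>k\<in>(SIGMA a:A. {..<t a}). N I (fst k) w)" for t w
    using A by (subst prod.Sigma[symmetric, where g = "\<lambda>a _. N I a w", simplified case_prod_unfold]) auto
  have "Sm I A u w ^ n = fact n * (\<Sum>t\<in>types A n. complex_of_real (\<Prod>a\<in>A. u a ^ t a / fact (t a)) * (\<Prod>k\<in>(SIGMA a:A. {..<t a}). N I (fst k) w))" for w
  proof -
    have "Sm I A u w ^ n / fact n = (\<Sum>t\<in>types A n. \<Prod>a\<in>A. (complex_of_real (u a) * N I a w) ^ t a / fact (t a))"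
      unfolding Sm_def by (rule multinomial[OF A])
    also have "\<dots> = (\<Sum>t\<in>types A n. complex_of_real (\<Prod>a\<in>A. u a ^ t a / fact (t a)) * (\<Prod>a\<in>A. N I a w ^ t a))"
      by (intro sum.cong refl) (simp add: power_mult_distrib prod.distrib[symmetric])
    finally show ?thesis unfolding p by (simp add: field_simps)
  qed
  moreover have "integrable M (\<lambda>w. \<Prod>k\<in>(SIGMA a:A. {..<t a}). N I (fst k) w)" for t :: "'a \<Rightarrow> nat"
    using A by (intro integrable_prod_N finite_SigmaI) auto
  moreover have "(\<integral>w. (\<Prod>k\<in>(SIGMA a:A. {..<t a}). N I (fst k) w) \<partial>M) = complex_of_real (Phi Q fst (SIGMA a:A. {..<t a}) 0 ^ card I)" for t :: "'a \<Rightarrow> nat"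
    using A by (intro expectation_prod_N finite_SigmaI) auto
  ultimately show ?thesis by (simp add: Bochner_Integration.integral_sum)
qed

text \<open>A combinatorial identity obtained from probability: the n-th moment of \<open>Sm\<close>
  for one process is expanded once by types and once by sequences. Any process serves, so an
  arbitrary index is taken.\<close>

lemma sum_types_J:
  assumes A: "finite A"
  shows "(\<Sum>t\<in>types A n. (\<Prod>a\<in>A. u a ^ t a / fact (t a)) * Phi Q fst (SIGMA a:A. {..<t a}) 0) = J Q u A n 0"
proof -
  let ?j = "undefined :: 'p"
  have "complex_of_real (fact n * (\<Sum>t\<in>types A n. (\<Prod>a\<in>A. u a ^ t a / fact (t a)) * Phi Q fst (SIGMA a:A. {..<t a}) 0))
      = complex_of_real (\<Sum>f\<in>PiE {..<n} (\<lambda>_. A). (\<Prod>k<n. u (f k)) * Phi Q f {..<n} 0)"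
    using expectation_Sm_types[OF A, of "{?j}" u n] expectation_Sm_power[OF A, of "{?j}" u n] by simp
  also have "(\<Sum>f\<in>PiE {..<n} (\<lambda>_. A). (\<Prod>k<n. u (f k)) * Phi Q f {..<n} 0) = fact n * J Q u A n 0"
    using sum_PiE_Phi[of "{..<n}" A u Q 0] A by simp
  finally have "fact n * (\<Sum>t\<in>types A n. (\<Prod>a\<in>A. u a ^ t a / fact (t a)) * Phi Q fst (SIGMA a:A. {..<t a}) 0) = fact n * J Q u A n 0"
    by (simp only: of_real_eq_iff)
  then show ?thesis by simp
qed

lemma Sm_real:
  assumes "\<And>x. x \<in> A \<Longrightarrow> - x \<in> A" "\<And>x. u (- x) = u x"
  shows "Sm I A u w = complex_of_real (Re (Sm I A u w))"
proof -
  have "cnj (Sm I A u w) = (\<Sum>x\<in>A. complex_of_real (u (- x)) * N I (- x) w)"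
    unfolding Sm_def by (simp add: N_minus assms)
  also have "\<dots> = Sm I A u w"
    unfolding Sm_def using assms(1) by (intro sum.reindex_bij_witness[of _ uminus uminus]) auto
  finally show ?thesis by (metis complex_cnj_cancel_iff complex_is_Real_iff Reals_cnj_iff of_real_Re)
qed

end

section \<open>Bounds for the variational problem\<close>

locale stable_data =
  fixes \<psi> :: "'a::euclidean_space \<Rightarrow> real" and \<alpha> :: real and p :: nat
  assumes alpha_pos: "0 < \<alpha>" and symbol: "stable_symbol \<alpha> \<psi>" and p_pos: "0 < p"
    and dim_less: "real DIM('a) < \<alpha> * real p"
begin

lemma psi_nonneg: "0 \<le> \<psi> l"
  and psi_cont: "continuous_on UNIV \<psi>"
  and psi_scale: "0 < r \<Longrightarrow> \<psi> (r *\<^sub>R l) = r powr \<alpha> * \<psi> l"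
  using symbol unfolding stable_symbol_def by auto

lemma psi_measurable [measurable]: "\<psi> \<in> borel_measurable borel"
  by (rule borel_measurable_continuous_onI[OF psi_cont])

lemma psi_lower: obtains C where "0 < C" "\<And>l. norm l powr \<alpha> \<le> C * \<psi> l"
proof -
  obtain C where C: "C > 0" "\<forall>l. norm l powr \<alpha> / C \<le> \<psi> l"
    using symbol unfolding stable_symbol_def by auto
  then have "norm l powr \<alpha> \<le> C * \<psi> l" for l by (simp add: field_simps)
  then show ?thesis using that C by blast
qed

definition W :: "'a \<Rightarrow> real" where "W x = 1 + \<psi> x"

lemma W_ge_1: "1 \<le> W x" and W_pos: "0 < W x"
  using psi_nonneg[of x] by (auto simp: W_def)

lemma W_measurable [measurable]: "W \<in> borel_measurable borel"
  unfolding W_def[abs_def] by measurable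

text \<open>Multiplicative uniform continuity. For x in the unit ball it is compactness; otherwise
  homogeneity scales x to the unit sphere, and the scaled error is absorbed by \<psi> x through the
  lower bound on the symbol. Passing between a lattice point and its cell therefore costs a factor
  close to 1, uniformly in x.\<close>

lemma W_uniform:
  assumes "0 < \<delta>"
  obtains s where "0 < s" "\<And>x u. norm u \<le> s \<Longrightarrow> W (x + u) \<le> (1 + \<delta>) * W x"
proof -
  obtain C where C: "0 < C" "\<And>l. norm l powr \<alpha> \<le> C * \<psi> l" by (rule psi_lower) (blast intro: that)
  define \<delta>' where "\<delta>' = \<delta> / (1 + C)"
  have \<delta>': "0 < \<delta>'" "\<delta>' \<le> \<delta>" "\<delta>' * C \<le> \<delta>"
    using assms C by (auto simp: \<delta>'_def field_simps)
  have "uniformly_continuous_on (cball 0 2) \<psi>"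
    by (intro compact_uniformly_continuous continuous_on_subset[OF psi_cont]) auto
  then obtain d where d: "0 < d" "\<And>x y. x \<in> cball 0 2 \<Longrightarrow> y \<in> cball 0 2 \<Longrightarrow> dist y x < d \<Longrightarrow> dist (\<psi> y) (\<psi> x) < \<delta>'"
    using \<delta>' unfolding uniformly_continuous_on_def by metis
  have near: "\<psi> (x + u) \<le> \<psi> x + \<delta>'" if "norm x \<le> 1" "norm u \<le> 1" "norm u < d" for x u
  proof -
    have "norm (x + u) \<le> 2" using that norm_triangle_ineq[of x u] by linarith
    then have "dist (\<psi> (x + u)) (\<psi> x) < \<delta>'" using that by (intro d) (auto simp: dist_norm mem_cball_0 simp del: mem_cball)
    then show ?thesis by (simp add: dist_real_def)
  qed
  show ?thesis
  proof (rule that[of "min 1 (d / 2)"])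
    show "0 < min 1 (d / 2)" using d by simp
    fix x u :: 'a assume u: "norm u \<le> min 1 (d / 2)"
    then have u': "norm u \<le> 1" "norm u < d" using d by auto
    have "\<psi> (x + u) \<le> \<psi> x + \<delta> * (1 + \<psi> x)"
    proof (cases "norm x \<le> 1")
      case True
      have "\<delta>' \<le> \<delta> * (1 + \<psi> x)" using \<delta>' psi_nonneg[of x] assms by (smt (verit) mult_le_cancel_left1 mult_left_mono)
      then show ?thesis using near[OF True u'] by linarith
    next
      case False
      define t where "t = norm x"
      have t: "t > 1" using False by (simp add: t_def)
      have nv: "norm (x /\<^sub>R t) \<le> 1" using t by (simp add: t_def divide_simps)
      have nw: "norm (u /\<^sub>R t) \<le> norm u" using t by (simp add: divide_simps mult_left_le) (smt (verit) mult_le_cancel_left1 norm_ge_zero)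
      have "\<psi> (x + u) = \<psi> (t *\<^sub>R (x /\<^sub>R t + u /\<^sub>R t))" using t by (simp add: scaleR_add_right)
      also have "\<dots> = t powr \<alpha> * \<psi> (x /\<^sub>R t + u /\<^sub>R t)" using t by (intro psi_scale) simp
      also have "\<dots> \<le> t powr \<alpha> * (\<psi> (x /\<^sub>R t) + \<delta>')" using nv nw u' by (intro mult_left_mono near) auto
      also have "\<dots> = \<psi> x + \<delta>' * t powr \<alpha>"
        using psi_scale[of t "x /\<^sub>R t"] t by (simp add: algebra_simps)
      also have "\<delta>' * t powr \<alpha> \<le> \<delta>' * (C * \<psi> x)" using C \<delta>' by (intro mult_left_mono) (auto simp: t_def)
      also have "\<dots> = (\<delta>' * C) * \<psi> x" by simp
      also have "\<dots> \<le> \<delta> * \<psi> x" using \<delta>' psi_nonneg by (intro mult_right_mono) auto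
      also have "\<dots> \<le> \<delta> * (1 + \<psi> x)" using assms by (intro mult_left_mono) auto
      finally show ?thesis by simp
    qed
    then show "W (x + u) \<le> (1 + \<delta>) * W x" by (simp add: W_def algebra_simps)
  qed
qed

definition IQ :: ennreal where "IQ = (\<integral>\<^sup>+x. ennreal ((1 / W x) ^ p) \<partial>lborel)"

text \<open>Dyadic shells: on the k-th shell the integrand is of order 2^(-k \<alpha> p) and the
  volume of order 2^(k d), so a geometric series with ratio 2^(d - \<alpha> p) dominates. This is
  where the condition on the dimension enters.\<close>

lemma IQ_finite: "IQ < \<top>"
proof -
  obtain C where C: "0 < C" "\<And>l. norm l powr \<alpha> \<le> C * \<psi> l" by (rule psi_lower) (blast intro: that)
  let ?d = "DIM('a)"
  define V where "V = unit_ball_vol (real ?d)"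
  have V0: "0 \<le> V" by (simp add: V_def)
  define c where "c k = (C / 2 powr (real k * \<alpha>)) ^ p" for k
  have c0: "0 \<le> c k" for k using C by (simp add: c_def)
  have bound: "ennreal ((1 / W x) ^ p) \<le> indicator (cball 0 1) x + (\<Sum>k. ennreal (c k) * indicator (cball 0 (2 ^ Suc k)) x)" for x :: 'a
  proof (cases "norm x \<le> 1")
    case True
    have "(1 / W x) ^ p \<le> 1" using W_ge_1[of x] by (intro power_le_one) auto
    then have "ennreal ((1 / W x) ^ p) \<le> indicator (cball 0 1) x" using True by simp
    then show ?thesis by (meson add_increasing2 zero_le)
  next
    case False
    define k where "k = nat \<lfloor>log 2 (norm x)\<rfloor>"
    have "1 < norm x" using False by simp
    note n1 = this
    then have l0: "0 \<le> log 2 (norm x)" by (subst zero_le_log_cancel_iff) auto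
    have k: "real k \<le> log 2 (norm x)" "log 2 (norm x) < real k + 1"
      using l0 by (auto simp: k_def)
    have "2 powr real k \<le> norm x" using k(1) n1 le_log_iff[of 2 "norm x" "real k"] by (cases "x = 0") auto
    then have ge: "2 powr (real k * \<alpha>) \<le> norm x powr \<alpha>"
      using alpha_pos by (simp add: powr_powr[symmetric] powr_mono2)
    have "norm x < 2 powr (real k + 1)" using k(2) n1 log_less_iff[of 2 "norm x" "real k + 1"] by (cases "x = 0") auto
    then have in_ball: "x \<in> cball 0 (2 ^ Suc k)" by (simp add: powr_add powr_realpow mult.commute)
    have "2 powr (real k * \<alpha>) \<le> C * W x"
      using ge C(2)[of x] C(1) by (smt (verit) W_def mult_left_mono)
    then have "1 / W x \<le> C / 2 powr (real k * \<alpha>)" using W_pos[of x] by (simp add: field_simps)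
    then have "(1 / W x) ^ p \<le> c k" unfolding c_def using W_pos[of x] by (intro power_mono) auto
    then have "ennreal ((1 / W x) ^ p) \<le> ennreal (c k) * indicator (cball 0 (2 ^ Suc k)) x"
      using in_ball by (simp add: ennreal_leI)
    also have "\<dots> \<le> (\<Sum>k. ennreal (c k) * indicator (cball 0 (2 ^ Suc k)) x)"
    proof -
      define g where "g k = ennreal (c k) * indicator (cball 0 (2 ^ Suc k)) x" for k
      have "sum g {k} \<le> suminf g" by (intro sum_le_suminf) auto
      then have "g k \<le> suminf g" by simp
      then show ?thesis unfolding g_def[abs_def] .
    qed
    finally show ?thesis by (simp add: add_increasing)
  qed
  have [measurable]: "(\<lambda>x. indicator (cball (0::'a) r) x :: ennreal) \<in> borel_measurable borel" for r
    by (rule borel_measurable_indicator) simp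
  have "IQ \<le> (\<integral>\<^sup>+x. indicator (cball 0 1) x + (\<Sum>k. ennreal (c k) * indicator (cball 0 (2 ^ Suc k)) x) \<partial>(lborel :: 'a measure))"
    unfolding IQ_def by (intro nn_integral_mono bound)
  also have "\<dots> = emeasure lborel (cball (0::'a) 1) + (\<Sum>k. ennreal (c k) * emeasure lborel (cball (0::'a) (2 ^ Suc k)))"
  proof -
    have "(\<integral>\<^sup>+x. (\<Sum>k. ennreal (c k) * indicator (cball 0 (2 ^ Suc k)) x) \<partial>(lborel :: 'a measure))
        = (\<Sum>k. \<integral>\<^sup>+x. ennreal (c k) * indicator (cball 0 (2 ^ Suc k)) x \<partial>(lborel :: 'a measure))"
      by (rule nn_integral_suminf) measurable
    also have "\<dots> = (\<Sum>k. ennreal (c k) * emeasure lborel (cball (0::'a) (2 ^ Suc k)))"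
      by (intro suminf_cong nn_integral_cmult_indicator) simp
    finally have 1: "(\<integral>\<^sup>+x. (\<Sum>k. ennreal (c k) * indicator (cball 0 (2 ^ Suc k)) x) \<partial>(lborel :: 'a measure))
        = (\<Sum>k. ennreal (c k) * emeasure lborel (cball (0::'a) (2 ^ Suc k)))" .
    have "(\<integral>\<^sup>+x. indicator (cball 0 1) x + (\<Sum>k. ennreal (c k) * indicator (cball 0 (2 ^ Suc k)) x) \<partial>(lborel :: 'a measure))
      = (\<integral>\<^sup>+x. indicator (cball 0 1) x \<partial>(lborel :: 'a measure)) + (\<integral>\<^sup>+x. (\<Sum>k. ennreal (c k) * indicator (cball 0 (2 ^ Suc k)) x) \<partial>(lborel :: 'a measure))"
      by (rule nn_integral_add) measurable
    then show ?thesis unfolding 1 by (simp del: power_Suc)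
  qed
  also have "(\<Sum>k. ennreal (c k) * emeasure lborel (cball (0::'a) (2 ^ Suc k))) = (\<Sum>k. ennreal (c k * (V * (2 ^ Suc k) ^ ?d)))"
  proof (intro suminf_cong)
    fix k
    have "emeasure lborel (cball (0::'a) (2 ^ Suc k)) = ennreal (V * (2 ^ Suc k) ^ ?d)"
      unfolding V_def by (rule emeasure_cball) simp
    then show "ennreal (c k) * emeasure lborel (cball (0::'a) (2 ^ Suc k)) = ennreal (c k * (V * (2 ^ Suc k) ^ ?d))"
      using c0[of k] V0 by (simp only: ennreal_mult mult_nonneg_nonneg zero_le_power zero_le_numeral)
  qed
  also have "(\<lambda>k. c k * (V * (2 ^ Suc k) ^ ?d)) = (\<lambda>k. (C ^ p * V * 2 ^ ?d) * (2 powr (real ?d - \<alpha> * real p)) ^ k)"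
  proof
    fix k
    have "(2 ^ Suc k) ^ ?d = (2::real) ^ ?d * 2 powr (real k * real ?d)"
      by (simp add: power_mult_distrib powr_realpow[symmetric] power_mult[symmetric] powr_powr)
    moreover have "c k = C ^ p * 2 powr (- (real k * \<alpha> * real p))"
      by (simp add: c_def power_divide powr_power powr_minus field_simps)
    moreover have "(2 powr (real ?d - \<alpha> * real p)) ^ k = 2 powr (- (real k * \<alpha> * real p)) * (2::real) powr (real k * real ?d)"
      by (simp add: powr_power powr_add[symmetric] algebra_simps)
    ultimately show "c k * (V * (2 ^ Suc k) ^ ?d) = (C ^ p * V * 2 ^ ?d) * (2 powr (real ?d - \<alpha> * real p)) ^ k"
      by (simp add: mult_ac)
  qed
  also have "emeasure lborel (cball (0::'a) 1) + (\<Sum>k. ennreal ((C ^ p * V * 2 ^ ?d) * (2 powr (real ?d - \<alpha> * real p)) ^ k)) < \<top>"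
  proof -
    have "2 powr (real ?d - \<alpha> * real p) < (2::real) powr 0" using dim_less by (intro powr_less_mono) auto
    then have "summable (\<lambda>k. (C ^ p * V * 2 ^ ?d) * (2 powr (real ?d - \<alpha> * real p)) ^ k)"
      by (intro summable_mult summable_geometric) simp
    then have "(\<Sum>k. ennreal ((C ^ p * V * 2 ^ ?d) * (2 powr (real ?d - \<alpha> * real p)) ^ k)) \<noteq> \<top>"
      using C V0 by (intro ennreal_suminf_neq_top) auto
    moreover have "emeasure lborel (cball (0::'a) 1) < \<top>" by (subst emeasure_cball) simp_all
    ultimately show ?thesis by (simp add: less_top)
  qed
  finally show ?thesis .
qed

end

section \<open>Correlation functionals on Euclidean space\<close>

lemma nn_integral_lborel_shift:
  fixes f :: "'a::euclidean_space \<Rightarrow> ennreal"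
  assumes [measurable]: "f \<in> borel_measurable borel"
  shows "(\<integral>\<^sup>+x. f (c + x) \<partial>lborel) = (\<integral>\<^sup>+x. f x \<partial>lborel)"
proof -
  have "(\<integral>\<^sup>+x. f x \<partial>lborel) = (\<integral>\<^sup>+x. f x \<partial>(distr lborel borel (\<lambda>x. c + x)))"
    by (simp add: lborel_distr_plus)
  also have "\<dots> = (\<integral>\<^sup>+x. f (c + x) \<partial>lborel)" by (subst nn_integral_distr) auto
  finally show ?thesis ..
qed

definition corr :: "('a::euclidean_space \<Rightarrow> ennreal) \<Rightarrow> ('a \<Rightarrow> ennreal) \<Rightarrow> 'a \<Rightarrow> ennreal" where
  "corr F G l = (\<integral>\<^sup>+x. F (l + x) * G x \<partial>lborel)"

definition corr_pow :: "nat \<Rightarrow> ('a::euclidean_space \<Rightarrow> ennreal) \<Rightarrow> ('a \<Rightarrow> ennreal) \<Rightarrow> ennreal" where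
  "corr_pow p F G = (\<integral>\<^sup>+l. corr F G l ^ p \<partial>lborel)"

definition multi_corr :: "nat \<Rightarrow> ('a::euclidean_space \<Rightarrow> ennreal) \<Rightarrow> (nat \<Rightarrow> 'a) \<Rightarrow> ennreal" where
  "multi_corr m F \<delta> = (\<integral>\<^sup>+u. F u * (\<Prod>i<m. F (u + \<delta> i)) \<partial>lborel)"

lemma corr_measurable [measurable]:
  assumes [measurable]: "F \<in> borel_measurable borel" "G \<in> borel_measurable borel"
  shows "corr F G \<in> borel_measurable borel"
  unfolding corr_def[abs_def] by measurable

lemma multi_corr_measurable [measurable]:
  assumes [measurable]: "F \<in> borel_measurable borel"
  shows "multi_corr m F \<in> borel_measurable (PiM {..<m} (\<lambda>_. lborel))"
proof -
  have "(\<lambda>x. F (snd x) * (\<Prod>i<m. F (snd x + fst x i))) \<in> borel_measurable (PiM {..<m} (\<lambda>_. lborel) \<Otimes>\<^sub>M lborel)"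
    by (intro borel_measurable_times_ennreal borel_measurable_prod_ennreal measurable_compose[OF _ assms] borel_measurable_add
        measurable_compose[OF measurable_fst] measurable_component_singleton[of _ _ "\<lambda>_. lborel", simplified]) auto
  then show ?thesis unfolding multi_corr_def[abs_def]
    by (intro lborel.borel_measurable_nn_integral) (simp add: case_prod_unfold)
qed

text \<open>Shifting all \<open>p\<close> integration variables by one of them turns the \<open>p\<close>-th power into an
  inner product; this is where the integrality of \<open>p\<close> enters.\<close>

lemma corr_pow_Suc:
  fixes F G :: "'a::euclidean_space \<Rightarrow> ennreal"
  assumes [measurable]: "F \<in> borel_measurable borel" "G \<in> borel_measurable borel"
  shows "corr_pow (Suc m) F G = (\<integral>\<^sup>+\<delta>. multi_corr m F \<delta> * multi_corr m G \<delta> \<partial>PiM {..<m} (\<lambda>_. lborel))"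
proof -
  interpret P: product_sigma_finite "\<lambda>_::nat. lborel :: 'a measure" ..
  let ?P = "PiM {..<m} (\<lambda>_. lborel :: 'a measure)"
  interpret S: sigma_finite_measure ?P by (rule P.sigma_finite) simp
  interpret LP: pair_sigma_finite "lborel :: 'a measure" ?P ..
  define A where "A F u \<delta> = F u * (\<Prod>i<m. F (u + \<delta> i))" for F :: "'a \<Rightarrow> ennreal" and u and \<delta> :: "nat \<Rightarrow> 'a"
  have comp: "(\<lambda>x. f x i) \<in> borel_measurable N" if "f \<in> measurable N ?P" "i < m" for f i and N :: "'c measure"
    using measurable_compose[OF that(1) measurable_component_singleton[of i "{..<m}" "\<lambda>_. lborel :: 'a measure"]] that(2) by simp
  have Am: "(\<lambda>x. A H (f x) (g x)) \<in> borel_measurable N"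
    if "H \<in> borel_measurable borel" "f \<in> borel_measurable N" "g \<in> measurable N ?P" for H f g and N :: "'c measure"
    unfolding A_def using that comp
    by (intro borel_measurable_times_ennreal borel_measurable_prod_ennreal measurable_compose[OF _ that(1)] borel_measurable_add) auto
  \<comment> \<open>Of the p integration variables one is x; the other m are written as x plus a
    difference.\<close>
  have pow: "corr F G l ^ m = (\<integral>\<^sup>+\<delta>. (\<Prod>i<m. F (l + x + \<delta> i) * G (x + \<delta> i)) \<partial>?P)" for l x
  proof -
    have "corr F G l = (\<integral>\<^sup>+d. F (l + x + d) * G (x + d) \<partial>lborel)"
      unfolding corr_def using nn_integral_lborel_shift[of "\<lambda>d. F (l + d) * G d" x] by (simp add: add.assoc)
    then have "corr F G l ^ m = (\<Prod>i<m. \<integral>\<^sup>+d. F (l + x + d) * G (x + d) \<partial>lborel)" by simp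
    also have "\<dots> = (\<integral>\<^sup>+\<delta>. (\<Prod>i<m. F (l + x + \<delta> i) * G (x + \<delta> i)) \<partial>?P)"
      by (rule P.product_nn_integral_prod[symmetric]) auto
    finally show ?thesis .
  qed
  have "corr F G l ^ Suc m = (\<integral>\<^sup>+x. \<integral>\<^sup>+\<delta>. A F (l + x) \<delta> * A G x \<delta> \<partial>?P \<partial>lborel)" for l
  proof -
    have "corr F G l ^ Suc m = (\<integral>\<^sup>+x. (F (l + x) * G x) * corr F G l ^ m \<partial>lborel)"
      by (subst nn_integral_multc) (auto simp: corr_def)
    also have "\<dots> = (\<integral>\<^sup>+x. \<integral>\<^sup>+\<delta>. A F (l + x) \<delta> * A G x \<delta> \<partial>?P \<partial>lborel)"
    proof (intro nn_integral_cong)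
      fix x
      have m: "(\<lambda>\<delta>. \<Prod>i<m. F (l + x + \<delta> i) * G (x + \<delta> i)) \<in> borel_measurable ?P"
        using comp[of "\<lambda>\<delta>. \<delta>"]
        by (intro borel_measurable_times_ennreal borel_measurable_prod_ennreal measurable_compose[OF _ assms(1)]
            measurable_compose[OF _ assms(2)] borel_measurable_add) auto
      show "F (l + x) * G x * corr F G l ^ m = (\<integral>\<^sup>+\<delta>. A F (l + x) \<delta> * A G x \<delta> \<partial>?P)"
        unfolding pow[of l x] by (subst nn_integral_cmult[symmetric, OF m]) (simp add: A_def prod.distrib mult_ac)
    qed
    finally show ?thesis .
  qed
  then have "corr_pow (Suc m) F G = (\<integral>\<^sup>+l. \<integral>\<^sup>+x. \<integral>\<^sup>+\<delta>. A F (l + x) \<delta> * A G x \<delta> \<partial>?P \<partial>lborel \<partial>lborel)"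
    by (simp add: corr_pow_def)
  also have "\<dots> = (\<integral>\<^sup>+l. \<integral>\<^sup>+\<delta>. \<integral>\<^sup>+x. A F (l + x) \<delta> * A G x \<delta> \<partial>lborel \<partial>?P \<partial>lborel)"
    by (intro nn_integral_cong LP.Fubini'[symmetric])
       (auto simp: case_prod_unfold intro!: borel_measurable_times_ennreal Am)
  also have "\<dots> = (\<integral>\<^sup>+\<delta>. \<integral>\<^sup>+l. \<integral>\<^sup>+x. A F (l + x) \<delta> * A G x \<delta> \<partial>lborel \<partial>lborel \<partial>?P)"
  proof (rule LP.Fubini'[symmetric])
    have "(\<lambda>z. A F (fst (fst z) + snd z) (snd (fst z)) * A G (snd z) (snd (fst z)))
        \<in> borel_measurable ((lborel \<Otimes>\<^sub>M ?P) \<Otimes>\<^sub>M lborel)"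
      by (intro borel_measurable_times_ennreal Am) auto
    then show "(\<lambda>(l, \<delta>). \<integral>\<^sup>+x. A F (l + x) \<delta> * A G x \<delta> \<partial>lborel) \<in> borel_measurable (lborel \<Otimes>\<^sub>M ?P)"
      unfolding case_prod_unfold by (intro lborel.borel_measurable_nn_integral) (simp add: case_prod_unfold)
  qed
  also have "\<dots> = (\<integral>\<^sup>+\<delta>. multi_corr m F \<delta> * multi_corr m G \<delta> \<partial>?P)"
  \<comment> \<open>For fixed differences the integrals over l and x decouple once l + x is taken as
    a new variable, which leaves a product.\<close>
  proof (intro nn_integral_cong)
    fix \<delta> assume d: "\<delta> \<in> space ?P"
    have [measurable]: "(\<lambda>u. A H u \<delta>) \<in> borel_measurable borel" if "H \<in> borel_measurable borel" for H
      using that d by (intro Am) auto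
    have [measurable]: "(\<lambda>u. A F u \<delta>) \<in> borel_measurable borel" "(\<lambda>u. A G u \<delta>) \<in> borel_measurable borel" by simp_all
    have "(\<integral>\<^sup>+l. \<integral>\<^sup>+x. A F (l + x) \<delta> * A G x \<delta> \<partial>lborel \<partial>lborel) = (\<integral>\<^sup>+x. \<integral>\<^sup>+l. A F (x + l) \<delta> * A G x \<delta> \<partial>lborel \<partial>lborel)"
      by (subst lborel_pair.Fubini') (auto simp: add.commute)
    also have "\<dots> = (\<integral>\<^sup>+x. (\<integral>\<^sup>+u. A F u \<delta> \<partial>lborel) * A G x \<delta> \<partial>lborel)"
      by (intro nn_integral_cong, subst nn_integral_multc) (auto simp: nn_integral_lborel_shift[of "\<lambda>u. A F u \<delta>"])
    also have "\<dots> = multi_corr m F \<delta> * multi_corr m G \<delta>"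
      by (subst nn_integral_cmult) (auto simp: multi_corr_def A_def)
    finally show "(\<integral>\<^sup>+l. \<integral>\<^sup>+x. A F (l + x) \<delta> * A G x \<delta> \<partial>lborel \<partial>lborel) = multi_corr m F \<delta> * multi_corr m G \<delta>" .
  qed
  finally show ?thesis .
qed

text \<open>By \<open>corr_pow_Suc\<close> the functional is an inner product of
  \<open>multi_corr\<close> of \<open>F\<close> and of \<open>G\<close>. The mixed case is needed
  because successive iterates of the operator are different functions on different windows, whereas
  \<open>rho\<close> speaks of a single f.\<close>

lemma corr_pow_Cauchy_Schwarz:
  fixes F G :: "'a::euclidean_space \<Rightarrow> ennreal"
  assumes [measurable]: "F \<in> borel_measurable borel" "G \<in> borel_measurable borel" and p: "0 < p"
  shows "(corr_pow p F G)\<^sup>2 \<le> corr_pow p F F * corr_pow p G G"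
proof -
  obtain m where p: "p = Suc m" using p by (cases p) auto
  show ?thesis unfolding p corr_pow_Suc[OF assms(1,2)] corr_pow_Suc[OF assms(1,1)] corr_pow_Suc[OF assms(2,2)]
    using Cauchy_Schwarz_nn_integral[of "multi_corr m F" "PiM {..<m} (\<lambda>_. lborel)" "multi_corr m G"]
    by (simp add: power2_eq_square)
qed

lemma corr_pow_scale: "corr_pow p (\<lambda>x. c * F x) (\<lambda>x. c * F x) = (c\<^sup>2) ^ p * corr_pow p F F"
  if [measurable]: "F \<in> borel_measurable borel"
proof -
  have "corr (\<lambda>x. c * F x) (\<lambda>x. c * F x) l = c\<^sup>2 * corr F F l" for l
    unfolding corr_def by (subst nn_integral_cmult[symmetric]) (auto simp: power2_eq_square mult_ac)
  then show ?thesis unfolding corr_pow_def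
    by (subst nn_integral_cmult[symmetric]) (auto simp: power_mult_distrib)
qed

lemma corr_mono: "(\<And>x. F x \<le> F' x) \<Longrightarrow> (\<And>x. G x \<le> G' x) \<Longrightarrow> corr F G l \<le> corr F' G' l"
  unfolding corr_def by (intro nn_integral_mono mult_mono) auto

text \<open>Every factor is bounded by the largest one. The constant lost against the
  arithmetic-geometric mean inequality appears only as the factor p in
  \<open>corr_pow_bound\<close>.\<close>

lemma prod_le_sum_power:
  fixes x :: "'i \<Rightarrow> ennreal"
  assumes "finite S" "S \<noteq> {}"
  shows "(\<Prod>i\<in>S. x i) \<le> (\<Sum>i\<in>S. x i ^ card S)"
proof -
  have "Max (x ` S) \<in> x ` S" using assms by (intro Max_in) auto
  then obtain j where j: "j \<in> S" "x j = Max (x ` S)" by auto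
  have "(\<Prod>i\<in>S. x i) \<le> (\<Prod>i\<in>S. x j)"
    using assms j by (intro prod_mono_ennreal) auto
  also have "\<dots> = x j ^ card S" by simp
  also have "\<dots> \<le> (\<Sum>i\<in>S. x i ^ card S)" using j assms by (intro member_le_sum) auto
  finally show ?thesis .
qed

section \<open>Finiteness of \<open>rho\<close> and its formulation by energies\<close>

context stable_data begin

text \<open>For fixed differences, Cauchy-Schwarz in the common variable separates \<open>f\<close>
  from the weights. The product of p shifted squared weights is at most the sum of their p-th
  powers, each with integral \<open>IQ\<close>; the part with \<open>f\<close> integrates over the
  differences to the p-th power of the squared norm.\<close>

lemma corr_pow_bound:
  fixes f :: "'a \<Rightarrow> ennreal"
  assumes [measurable]: "f \<in> borel_measurable borel"
  shows "corr_pow p (\<lambda>x. f x * ennreal (1 / sqrt (W x))) (\<lambda>x. f x * ennreal (1 / sqrt (W x)))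
    \<le> of_nat p * IQ * (\<integral>\<^sup>+x. (f x)\<^sup>2 \<partial>lborel) ^ p"
proof -
  obtain m where p: "p = Suc m" using p_pos by (cases p) auto
  interpret P: product_sigma_finite "\<lambda>_::nat. lborel :: 'a measure" ..
  let ?P = "PiM {..<m} (\<lambda>_. lborel :: 'a measure)"
  interpret S: sigma_finite_measure ?P by (rule P.sigma_finite) simp
  interpret LP: pair_sigma_finite "lborel :: 'a measure" ?P ..
  define q where "q x = ennreal (1 / sqrt (W x))" for x
  have [measurable]: "q \<in> borel_measurable borel" unfolding q_def by measurable
  have comp: "(\<lambda>x. f x i) \<in> borel_measurable N" if "f \<in> measurable N ?P" "i < m" for f i and N :: "'c measure"
    using measurable_compose[OF that(1) measurable_component_singleton[of i "{..<m}" "\<lambda>_. lborel :: 'a measure"]] that(2) by simp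
  define A where "A H u \<delta> = H u * (\<Prod>i<m. H (u + \<delta> i))" for H :: "'a \<Rightarrow> ennreal" and u and \<delta> :: "nat \<Rightarrow> 'a"
  have Am: "(\<lambda>x. A H (f x) (g x)) \<in> borel_measurable N"
    if "H \<in> borel_measurable borel" "f \<in> borel_measurable N" "g \<in> measurable N ?P" for H f g and N :: "'c measure"
    unfolding A_def using that comp
    by (intro borel_measurable_times_ennreal borel_measurable_prod_ennreal measurable_compose[OF _ that(1)] borel_measurable_add) auto
  let ?F = "\<lambda>x. f x * q x"
  let ?f2 = "\<lambda>x. (f x)\<^sup>2" and ?q2 = "\<lambda>x. (q x)\<^sup>2"
  have qp: "(q x)\<^sup>2 ^ p = ennreal ((1 / W x) ^ p)" for x
    using W_pos[of x] by (simp add: q_def ennreal_power power_divide less_imp_le)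
  have pt: "(multi_corr m ?F \<delta>)\<^sup>2 \<le> (\<integral>\<^sup>+u. A ?f2 u \<delta> \<partial>lborel) * (of_nat p * IQ)" if d: "\<delta> \<in> space ?P" for \<delta>
  proof -
    have [measurable]: "(\<lambda>u. A H u \<delta>) \<in> borel_measurable borel" if "H \<in> borel_measurable borel" for H
      using that d by (intro Am) auto
    have [measurable]: "(\<lambda>u. A f u \<delta>) \<in> borel_measurable borel" "(\<lambda>u. A q u \<delta>) \<in> borel_measurable borel" by simp_all
    have "multi_corr m ?F \<delta> = (\<integral>\<^sup>+u. A f u \<delta> * A q u \<delta> \<partial>lborel)"
      unfolding multi_corr_def A_def by (intro nn_integral_cong) (simp add: prod.distrib mult_ac)
    then have "(multi_corr m ?F \<delta>)\<^sup>2 \<le> (\<integral>\<^sup>+u. (A f u \<delta>)\<^sup>2 \<partial>lborel) * (\<integral>\<^sup>+u. (A q u \<delta>)\<^sup>2 \<partial>lborel)"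
      using Cauchy_Schwarz_nn_integral[of "\<lambda>u. A f u \<delta>" lborel "\<lambda>u. A q u \<delta>"] by simp
    also have "(\<integral>\<^sup>+u. (A f u \<delta>)\<^sup>2 \<partial>lborel) = (\<integral>\<^sup>+u. A ?f2 u \<delta> \<partial>lborel)"
      by (simp add: A_def power_mult_distrib prod_power_distrib)
    also have "(\<integral>\<^sup>+u. (A q u \<delta>)\<^sup>2 \<partial>lborel) \<le> of_nat p * IQ"
    proof -
      \<comment> \<open>Index m stands for the unshifted factor, so that all p = m + 1 factors have
        the same form.\<close>
      define e where "e i = (if i < m then \<delta> i else 0)" for i
      have "(A q u \<delta>)\<^sup>2 \<le> (\<Sum>i<p. (q (e i + u))\<^sup>2 ^ p)" for u
      proof -
        have "(A q u \<delta>)\<^sup>2 = (\<Prod>i<p. (q (e i + u))\<^sup>2)"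
          unfolding p lessThan_Suc by (simp add: A_def e_def power_mult_distrib prod_power_distrib add.commute)
        also have "\<dots> \<le> (\<Sum>i<p. (q (e i + u))\<^sup>2 ^ p)"
          using prod_le_sum_power[of "{..<p}" "\<lambda>i. (q (e i + u))\<^sup>2"] p_pos by (simp add: lessThan_empty_iff)
        finally show ?thesis .
      qed
      then have "(\<integral>\<^sup>+u. (A q u \<delta>)\<^sup>2 \<partial>lborel) \<le> (\<integral>\<^sup>+u. (\<Sum>i<p. (q (e i + u))\<^sup>2 ^ p) \<partial>lborel)"
        by (intro nn_integral_mono)
      also have "\<dots> = (\<Sum>i<p. \<integral>\<^sup>+u. (q (e i + u))\<^sup>2 ^ p \<partial>lborel)" by (subst nn_integral_sum) auto
      also have "\<dots> = (\<Sum>i<p. IQ)"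
        by (intro sum.cong refl, subst nn_integral_lborel_shift[of "\<lambda>u. (q u)\<^sup>2 ^ p"]) (auto simp: IQ_def qp)
      finally show ?thesis by simp
    qed
    finally show ?thesis by (simp add: mult_left_mono)
  qed
  have "corr_pow p ?F ?F = (\<integral>\<^sup>+\<delta>. (multi_corr m ?F \<delta>)\<^sup>2 \<partial>?P)"
    unfolding p by (subst corr_pow_Suc) (auto simp: power2_eq_square)
  also have "\<dots> \<le> (\<integral>\<^sup>+\<delta>. (\<integral>\<^sup>+u. A ?f2 u \<delta> \<partial>lborel) * (of_nat p * IQ) \<partial>?P)"
    by (intro nn_integral_mono pt)
  also have "\<dots> = (\<integral>\<^sup>+\<delta>. (\<integral>\<^sup>+u. A ?f2 u \<delta> \<partial>lborel) \<partial>?P) * (of_nat p * IQ)"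
    by (intro nn_integral_multc lborel.borel_measurable_nn_integral) (auto simp: case_prod_unfold intro!: Am)
  also have "(\<integral>\<^sup>+\<delta>. (\<integral>\<^sup>+u. A ?f2 u \<delta> \<partial>lborel) \<partial>?P) = (\<integral>\<^sup>+u. (\<integral>\<^sup>+\<delta>. A ?f2 u \<delta> \<partial>?P) \<partial>lborel)"
    by (intro LP.Fubini') (auto simp: case_prod_unfold intro!: Am)
  also have "\<dots> = (\<integral>\<^sup>+u. (f u)\<^sup>2 * (\<integral>\<^sup>+d. (f d)\<^sup>2 \<partial>lborel) ^ m \<partial>lborel)"
  proof (intro nn_integral_cong)
    fix u
    have "(\<integral>\<^sup>+\<delta>. A ?f2 u \<delta> \<partial>?P) = (f u)\<^sup>2 * (\<integral>\<^sup>+\<delta>. (\<Prod>i<m. (f (u + \<delta> i))\<^sup>2) \<partial>?P)"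
      unfolding A_def by (subst nn_integral_cmult) (auto intro!: borel_measurable_prod_ennreal borel_measurable_power_ennreal measurable_compose[OF _ assms] borel_measurable_add comp)
    also have "(\<integral>\<^sup>+\<delta>. (\<Prod>i<m. (f (u + \<delta> i))\<^sup>2) \<partial>?P) = (\<Prod>i<m. \<integral>\<^sup>+d. (f (u + d))\<^sup>2 \<partial>lborel)"
      by (rule P.product_nn_integral_prod[of "{..<m}" "\<lambda>_ d. (f (u + d))\<^sup>2"]) auto
    finally show "(\<integral>\<^sup>+\<delta>. A ?f2 u \<delta> \<partial>?P) = (f u)\<^sup>2 * (\<integral>\<^sup>+d. (f d)\<^sup>2 \<partial>lborel) ^ m"
      by (simp add: nn_integral_lborel_shift[of "\<lambda>d. (f d)\<^sup>2"])
  qed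
  also have "\<dots> = (\<integral>\<^sup>+d. (f d)\<^sup>2 \<partial>lborel) ^ p" by (subst nn_integral_multc) (auto simp: p)
  finally show ?thesis by (simp add: q_def mult_ac)
qed

lemma pIQ_finite: "of_nat p * IQ < \<top>"
  using IQ_finite by (simp add: ennreal_mult_less_top of_nat_less_top)

definition val :: "('a \<Rightarrow> real) \<Rightarrow> real" where
  "val f = (\<integral>l. (\<integral>g. f (l + g) * f g / (sqrt (1 + \<psi> (l + g)) * sqrt (1 + \<psi> g)) \<partial>lborel) ^ p \<partial>lborel)"

lemma rho_values_eq: "rho_values \<psi> p = {val f | f. f \<in> borel_measurable lborel \<and> integrable lborel (\<lambda>x. (f x)\<^sup>2) \<and> (\<integral>x. (f x)\<^sup>2 \<partial>lborel) = 1}"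
  unfolding rho_values_def val_def ..

lemma unit_iff:
  "(f \<in> borel_measurable lborel \<and> integrable lborel (\<lambda>x. (f x)\<^sup>2) \<and> (\<integral>x. (f x)\<^sup>2 \<partial>lborel) = 1)
    \<longleftrightarrow> f \<in> borel_measurable borel \<and> (\<integral>\<^sup>+x. ennreal ((f x)\<^sup>2) \<partial>lborel) = 1" for f :: "'a \<Rightarrow> real"
proof (cases "f \<in> borel_measurable borel")
  case True
  then have [measurable]: "f \<in> borel_measurable borel" .
  have "(\<lambda>x. (f x)\<^sup>2) \<in> borel_measurable lborel" by measurable
  then show ?thesis
    using True nn_integral_eq_integrable[of "\<lambda>x. (f x)\<^sup>2" lborel 1] by auto
qed simp

lemma corr_le_1:
  fixes f :: "'a \<Rightarrow> real"
  assumes [measurable]: "f \<in> borel_measurable borel" and f: "(\<integral>\<^sup>+x. ennreal ((f x)\<^sup>2) \<partial>lborel) = 1"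
  defines "F \<equiv> \<lambda>x. ennreal (\<bar>f x\<bar> / sqrt (W x))"
  shows "corr F F l \<le> 1"
proof -
  have [measurable]: "F \<in> borel_measurable borel" unfolding F_def by measurable
  have "(F x)\<^sup>2 \<le> ennreal ((f x)\<^sup>2)" for x
  proof -
    have "(F x)\<^sup>2 = ennreal ((f x)\<^sup>2 / W x)" using W_pos[of x] by (simp add: F_def ennreal_power power_divide less_imp_le)
    also have "\<dots> \<le> ennreal ((f x)\<^sup>2)"
      using mult_left_mono[OF W_ge_1[of x], of "(f x)\<^sup>2"] W_pos[of x] by (intro ennreal_leI) (simp add: divide_le_eq)
    finally show ?thesis .
  qed
  then have le1: "(\<integral>\<^sup>+x. (F x)\<^sup>2 \<partial>lborel) \<le> 1" using nn_integral_mono[of lborel "\<lambda>x. (F x)\<^sup>2" "\<lambda>x. ennreal ((f x)\<^sup>2)"] f by auto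
  have "(corr F F l)\<^sup>2 \<le> (\<integral>\<^sup>+x. (F (l + x))\<^sup>2 \<partial>lborel) * (\<integral>\<^sup>+x. (F x)\<^sup>2 \<partial>lborel)"
    unfolding corr_def by (intro Cauchy_Schwarz_nn_integral) auto
  moreover have "(\<integral>\<^sup>+x. (F (l + x))\<^sup>2 \<partial>lborel) = (\<integral>\<^sup>+x. (F x)\<^sup>2 \<partial>lborel)"
    by (rule nn_integral_lborel_shift[of "\<lambda>x. (F x)\<^sup>2"]) simp
  ultimately have "(corr F F l)\<^sup>2 \<le> (\<integral>\<^sup>+x. (F x)\<^sup>2 \<partial>lborel) * (\<integral>\<^sup>+x. (F x)\<^sup>2 \<partial>lborel)" by simp
  also have "\<dots> \<le> 1 * 1" by (intro mult_mono le1) auto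
  finally have "(corr F F l)\<^sup>2 \<le> 1 * 1" .
  then have "(corr F F l)\<^sup>2 \<le> 1" by simp
  then show ?thesis using one_less_power[of "corr F F l" 2] by (meson linorder_not_le pos2)
qed

text \<open>The link between the Bochner integrals of \<open>rho_values\<close>, whose integrands
  may change sign, and the extended nonnegative functional. \<open>corr_le_1\<close> makes the inner
  integral finite and \<open>corr_pow_bound\<close> the outer one; for nonnegative f the absolute
  values change nothing.\<close>

lemma val_bounds:
  fixes f :: "'a \<Rightarrow> real"
  assumes [measurable]: "f \<in> borel_measurable borel" and f: "(\<integral>\<^sup>+x. ennreal ((f x)\<^sup>2) \<partial>lborel) = 1"
  defines "F \<equiv> \<lambda>x. ennreal (\<bar>f x\<bar> / sqrt (W x))"
  shows "corr_pow p F F \<le> of_nat p * IQ" "val f \<le> enn2real (corr_pow p F F)"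
    and "(\<And>x. 0 \<le> f x) \<Longrightarrow> val f = enn2real (corr_pow p F F)"
proof -
  have [measurable]: "F \<in> borel_measurable borel" unfolding F_def by measurable
  have "F = (\<lambda>x. ennreal \<bar>f x\<bar> * ennreal (1 / sqrt (W x)))"
    unfolding F_def using W_pos by (intro ext, subst ennreal_mult[symmetric]) (auto simp: less_imp_le)
  then show le: "corr_pow p F F \<le> of_nat p * IQ"
    using corr_pow_bound[of "\<lambda>x. ennreal \<bar>f x\<bar>"] f by (simp add: ennreal_power)
  then have fin: "corr_pow p F F < \<top>" using pIQ_finite by (rule le_less_trans)
  define k where "k l g = f (l + g) * f g / (sqrt (1 + \<psi> (l + g)) * sqrt (1 + \<psi> g))" for l g
  have km [measurable]: "(\<lambda>x. k (fst x) (snd x)) \<in> borel_measurable (borel \<Otimes>\<^sub>M borel)" unfolding k_def by measurable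
  define I where "I l = (\<integral>g. k l g \<partial>lborel)" for l
  have Im [measurable]: "I \<in> borel_measurable borel"
    unfolding I_def by (intro lborel.borel_measurable_lebesgue_integral) (simp add: case_prod_unfold)
  have v: "val f = (\<integral>l. I l ^ p \<partial>lborel)" unfolding val_def I_def k_def ..
  have kF: "ennreal (norm (k l g)) = F (l + g) * F g" for l g
    using psi_nonneg[of g] psi_nonneg[of "l + g"]
    by (simp add: k_def F_def W_def abs_mult ennreal_mult[symmetric])
  have [measurable]: "(\<lambda>g. k l g) \<in> borel_measurable borel" for l
    unfolding k_def by measurable
  have "(\<integral>\<^sup>+g. ennreal (norm (k l g)) \<partial>lborel) = corr F F l" for l
    unfolding kF corr_def ..
  then have ik: "integrable lborel (k l)" for l
    using corr_le_1[OF assms(1) f, of l] unfolding F_def[symmetric]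
    by (intro integrableI_bounded) (auto simp: le_less_trans[OF _ ennreal_one_less_top])
  have In: "ennreal (norm (I l)) \<le> corr F F l" for l
    using integral_norm_bound_ennreal[OF ik[of l]] unfolding kF I_def corr_def .
  have nI: "(\<integral>\<^sup>+l. ennreal (norm (I l ^ p)) \<partial>lborel) \<le> corr_pow p F F"
    unfolding corr_pow_def
  proof (intro nn_integral_mono)
    fix l
    have "ennreal (norm (I l ^ p)) = ennreal (norm (I l)) ^ p" by (simp add: norm_power ennreal_power del: real_norm_def)
    also have "\<dots> \<le> corr F F l ^ p" by (intro power_mono_ennreal In)
    finally show "ennreal (norm (I l ^ p)) \<le> corr F F l ^ p" .
  qed
  then have iI: "integrable lborel (\<lambda>l. I l ^ p)" using fin by (intro integrableI_bounded) auto
  have "ennreal (norm (val f)) \<le> corr_pow p F F"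
    unfolding v using integral_norm_bound_ennreal[OF iI] nI by (rule order_trans)
  then have "norm (val f) \<le> enn2real (corr_pow p F F)"
    using fin by (metis enn2real_ennreal enn2real_mono norm_ge_zero)
  then show "val f \<le> enn2real (corr_pow p F F)" by simp
  assume f0: "\<And>x. 0 \<le> f x"
  have k0: "0 \<le> k l g" for l g using f0 by (simp add: k_def psi_nonneg)
  then have I0: "0 \<le> I l" for l by (simp add: I_def)
  have "ennreal (I l) = corr F F l" for l
    unfolding I_def using nn_integral_eq_integral[OF ik] k0 kF unfolding corr_def by (simp add: abs_of_nonneg)
  then have "corr_pow p F F = (\<integral>\<^sup>+l. ennreal (I l ^ p) \<partial>lborel)"
    unfolding corr_pow_def using I0 by (simp add: ennreal_power[symmetric])
  also have "\<dots> = ennreal (val f)" unfolding v using I0 iI by (intro nn_integral_eq_integral) auto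
  finally show "val f = enn2real (corr_pow p F F)"
    unfolding v using I0 by (simp add: integral_nonneg_AE)
qed

lemma bdd_above_rho_values: "bdd_above (rho_values \<psi> p)"
proof (rule bdd_aboveI)
  fix x assume "x \<in> rho_values \<psi> p"
  then obtain f :: "'a \<Rightarrow> real" where f: "f \<in> borel_measurable borel" "(\<integral>\<^sup>+x. ennreal ((f x)\<^sup>2) \<partial>lborel) = 1" "x = val f"
    unfolding rho_values_eq unit_iff by blast
  show "x \<le> enn2real (of_nat p * IQ)"
    using val_bounds(1,2)[OF f(1,2)] f(3) enn2real_mono[OF _ pIQ_finite] by (meson order_trans)
qed

text \<open>The substitution f = F sqrt W moves the weights from the functional into the constraint:
  \<open>e\<close> is the squared norm of f, and both sides are homogeneous of degree 2p in
  \<open>F\<close>. For e = 0 there is nothing to normalise, and \<open>corr_pow_bound\<close> gives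
  0.\<close>

lemma rho_ge_corr_pow:
  fixes F :: "'a \<Rightarrow> real"
  assumes [measurable]: "F \<in> borel_measurable borel" and F0: "\<And>x. 0 \<le> F x"
    and e: "(\<integral>\<^sup>+x. ennreal ((F x)\<^sup>2 * W x) \<partial>lborel) = ennreal e" "0 \<le> e"
  shows "corr_pow p (\<lambda>x. ennreal (F x)) (\<lambda>x. ennreal (F x)) \<le> ennreal (rho \<psi> p * e ^ p)"
proof -
  have Fe: "ennreal (F x) = ennreal (F x * sqrt (W x)) * ennreal (1 / sqrt (W x))" for x
    using W_pos[of x] F0[of x] by (subst ennreal_mult[symmetric]) auto
  have sq: "(ennreal (F x * sqrt (W x)))\<^sup>2 = ennreal ((F x)\<^sup>2 * W x)" for x
    using W_pos[of x] F0[of x] by (simp add: ennreal_power power_mult_distrib less_imp_le)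
  have le: "corr_pow p (\<lambda>x. ennreal (F x)) (\<lambda>x. ennreal (F x)) \<le> of_nat p * IQ * ennreal e ^ p"
    unfolding Fe using corr_pow_bound[of "\<lambda>x. ennreal (F x * sqrt (W x))"] by (simp add: sq e)
  show ?thesis
  proof (cases "e = 0")
    case True then show ?thesis using le p_pos by (simp add: power_0_left)
  next
    case False
    then have ep: "e > 0" using e by simp
    define f where "f x = F x * sqrt (W x) / sqrt e" for x
    have fm: "f \<in> borel_measurable borel" unfolding f_def by measurable
    have f0: "0 \<le> f x" for x using F0[of x] W_pos[of x] ep by (simp add: f_def)
    have "(\<integral>\<^sup>+x. ennreal ((f x)\<^sup>2) \<partial>lborel) = (\<integral>\<^sup>+x. ennreal (1 / e) * ennreal ((F x)\<^sup>2 * W x) \<partial>lborel)"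
      using ep F0 W_pos by (intro nn_integral_cong) (simp add: f_def ennreal_mult[symmetric] power_divide power_mult_distrib less_imp_le)
    also have "\<dots> = ennreal (1 / e) * ennreal e" by (subst nn_integral_cmult) (auto simp: e)
    also have "\<dots> = 1" using ep by (simp add: ennreal_mult[symmetric])
    finally have f1: "(\<integral>\<^sup>+x. ennreal ((f x)\<^sup>2) \<partial>lborel) = 1" .
    let ?G = "\<lambda>x. ennreal (\<bar>f x\<bar> / sqrt (W x))"
    have G: "ennreal (F x) = ennreal (sqrt e) * ?G x" for x
      using f0[of x] W_pos[of x] ep F0[of x] by (subst ennreal_mult[symmetric]) (auto simp: f_def)
    have vf: "val f \<in> rho_values \<psi> p" unfolding rho_values_eq unit_iff using fm f1 by blast
    have fin: "corr_pow p ?G ?G < \<top>"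
      using val_bounds(1)[OF fm f1] pIQ_finite by (rule le_less_trans)
    have "corr_pow p ?G ?G = ennreal (val f)" using val_bounds(3)[OF fm f1 f0] fin by simp
    also have "\<dots> \<le> ennreal (rho \<psi> p)"
      unfolding rho_def by (intro ennreal_leI cSup_upper vf bdd_above_rho_values)
    finally have cr: "corr_pow p ?G ?G \<le> ennreal (rho \<psi> p)" .
    have [measurable]: "?G \<in> borel_measurable borel" using fm by measurable
    have "corr_pow p (\<lambda>x. ennreal (F x)) (\<lambda>x. ennreal (F x)) = ((ennreal (sqrt e))\<^sup>2) ^ p * corr_pow p ?G ?G"
      unfolding G by (rule corr_pow_scale) simp
    also have "\<dots> \<le> ennreal e ^ p * ennreal (rho \<psi> p)"
      using ep cr by (intro mult_mono power_mono) (auto simp: ennreal_power)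
    also have "\<dots> = ennreal (rho \<psi> p * e ^ p)" using ep by (simp add: ennreal_power ennreal_mult'' mult.commute)
    finally show ?thesis .
  qed
qed

lemma rho_approx:
  assumes "0 \<le> r" "r < rho \<psi> p"
  obtains f :: "'a \<Rightarrow> real" where "f \<in> borel_measurable borel" "\<And>x. 0 \<le> f x" "(\<integral>\<^sup>+x. ennreal ((f x)\<^sup>2) \<partial>lborel) = 1"
    "ennreal r < corr_pow p (\<lambda>x. ennreal (f x / sqrt (W x))) (\<lambda>x. ennreal (f x / sqrt (W x)))"
proof -
  \<comment> \<open>Approximation of a supremum of reals presupposes a nonempty set; a normalised
    indicator of the unit ball is a competitor.\<close>
  have "rho_values \<psi> p \<noteq> {}"
  proof -
    define c where "c = emeasure lborel (cball (0::'a) 1)"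
    have c: "0 < c" "c < \<top>"
      unfolding c_def by (subst emeasure_cball; simp)+
    then have cr: "c = ennreal (enn2real c)" "0 < enn2real c" by (auto simp: enn2real_positive_iff)
    define f where "f x = indicat_real (cball (0::'a) 1) x / sqrt (enn2real c)" for x
    have "(\<integral>\<^sup>+x. ennreal ((f x)\<^sup>2) \<partial>lborel) = (\<integral>\<^sup>+x. ennreal (1 / enn2real c) * indicator (cball (0::'a) 1) x \<partial>lborel)"
      using cr by (intro nn_integral_cong) (auto simp: f_def indicator_def power_divide)
    also have "\<dots> = ennreal (1 / enn2real c) * ennreal (enn2real c)"
      by (subst nn_integral_cmult_indicator) (auto simp: c_def[symmetric] cr(1)[symmetric])
    also have "\<dots> = 1" using cr by (subst ennreal_mult[symmetric]) auto
    finally have "(\<integral>\<^sup>+x. ennreal ((f x)\<^sup>2) \<partial>lborel) = 1" .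
    moreover have "f \<in> borel_measurable borel"
      unfolding f_def[abs_def] by (intro borel_measurable_divide borel_measurable_indicator borel_measurable_const) simp
    ultimately show ?thesis
      unfolding rho_values_eq unit_iff by blast
  qed
  then obtain f :: "'a \<Rightarrow> real" where f: "f \<in> borel_measurable borel" "(\<integral>\<^sup>+x. ennreal ((f x)\<^sup>2) \<partial>lborel) = 1" "r < val f"
    using assms less_cSup_iff[OF _ bdd_above_rho_values, of r]
    unfolding rho_def rho_values_eq unit_iff by blast
  define F where "F x = ennreal (\<bar>f x\<bar> / sqrt (W x))" for x
  have "r < enn2real (corr_pow p F F)" using f(3) val_bounds(2)[OF f(1,2)] unfolding F_def by linarith
  then have "ennreal r < corr_pow p F F"
    using assms(1) val_bounds(1)[OF f(1,2)] pIQ_finite ennreal_lessI[of "enn2real (corr_pow p F F)" r]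
    unfolding F_def[symmetric] by (simp add: le_less_trans)
  then show ?thesis
    using f by (intro that[of "\<lambda>x. \<bar>f x\<bar>"]) (auto simp: F_def[abs_def])
qed

end

section \<open>Comparison of lattice and continuum correlations\<close>

definition lat :: "real \<Rightarrow> 'a::euclidean_space set" where
  "lat ep = {x. \<forall>b\<in>Basis. \<exists>k::int. x \<bullet> b = ep * of_int k}"

definition cell :: "real \<Rightarrow> 'a::euclidean_space set" where
  "cell ep = {x. \<forall>b\<in>Basis. 0 \<le> x \<bullet> b \<and> x \<bullet> b < ep}"

definition latbox :: "real \<Rightarrow> nat \<Rightarrow> 'a::euclidean_space set" where
  "latbox ep m = {x \<in> lat ep. \<forall>b\<in>Basis. \<bar>x \<bullet> b\<bar> \<le> ep * real m}"

lemma lat_0 [simp]: "0 \<in> lat ep"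
  by (auto simp: lat_def intro!: exI[of _ 0])

lemma lat_add: assumes "x \<in> lat ep" "y \<in> lat ep" shows "x + y \<in> lat ep"
  unfolding lat_def
proof (intro CollectI ballI)
  fix b :: 'a assume "b \<in> Basis"
  then obtain k l :: int where "x \<bullet> b = ep * of_int k" "y \<bullet> b = ep * of_int l" using assms by (force simp: lat_def)
  then have "(x + y) \<bullet> b = ep * of_int (k + l)" by (simp add: inner_add_left algebra_simps)
  then show "\<exists>k::int. (x + y) \<bullet> b = ep * of_int k" by blast
qed

lemma lat_minus: assumes "x \<in> lat ep" shows "- x \<in> lat ep"
  unfolding lat_def
proof (intro CollectI ballI)
  fix b :: 'a assume "b \<in> Basis"
  then obtain k :: int where "x \<bullet> b = ep * of_int k" using assms by (force simp: lat_def)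
  then have "(- x) \<bullet> b = ep * of_int (- k)" by simp
  then show "\<exists>k::int. (- x) \<bullet> b = ep * of_int k" by blast
qed

lemma lat_diff: "x \<in> lat ep \<Longrightarrow> y \<in> lat ep \<Longrightarrow> x - y \<in> lat ep"
  using lat_add[OF _ lat_minus, of x ep y] by simp

lemma latbox_subset: "latbox ep m \<subseteq> lat ep"
  by (auto simp: latbox_def)

lemma latbox_eq:
  assumes "0 < ep"
  shows "latbox ep m = (\<lambda>k. \<Sum>b\<in>Basis. (ep * of_int (k b)) *\<^sub>R b) ` (PiE Basis (\<lambda>_. {- int m..int m}))"
    (is "_ = ?f ` ?K")
proof (intro equalityI subsetI)
  fix x :: 'a assume x: "x \<in> latbox ep m"
  then have "\<forall>b\<in>Basis. \<exists>k::int. x \<bullet> b = ep * of_int k" by (simp add: latbox_def lat_def)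
  then obtain k :: "'a \<Rightarrow> int" where k: "\<And>b. b \<in> Basis \<Longrightarrow> x \<bullet> b = ep * of_int (k b)" by metis
  have "k b \<in> {- int m..int m}" if b: "b \<in> Basis" for b
  proof -
    have "\<bar>x \<bullet> b\<bar> \<le> ep * real m" using x b by (simp add: latbox_def)
    then have "ep * \<bar>of_int (k b)\<bar> \<le> ep * real m" using k[OF b] assms by (simp add: abs_mult)
    then have "\<bar>real_of_int (k b)\<bar> \<le> real m" using assms by simp
    then show ?thesis by auto
  qed
  then have "restrict k Basis \<in> ?K" by auto
  moreover have "?f (restrict k Basis) = x"
    using euclidean_representation[of x] k by (simp cong: sum.cong)
  ultimately show "x \<in> ?f ` ?K" by blast
next
  fix x assume "x \<in> ?f ` ?K"
  then obtain k where k: "k \<in> ?K" "x = ?f k" by auto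
  have xb: "x \<bullet> b = ep * of_int (k b)" if "b \<in> Basis" for b
    using that k by (simp add: inner_sum_left inner_Basis if_distrib sum.delta cong: if_cong)
  have "\<bar>x \<bullet> b\<bar> \<le> ep * real m" if b: "b \<in> Basis" for b
  proof -
    have "k b \<in> {- int m..int m}" using k b by auto
    then have "\<bar>real_of_int (k b)\<bar> \<le> real m" by auto
    then show ?thesis using xb[OF b] assms by (simp add: abs_mult)
  qed
  then show "x \<in> latbox ep m" using xb by (auto simp: latbox_def lat_def)
qed

lemma finite_latbox: "0 < ep \<Longrightarrow> finite (latbox ep m)"
  unfolding latbox_eq by (intro finite_imageI finite_PiE) auto

lemma card_latbox_le:
  assumes "0 < ep" shows "card (latbox ep m :: 'a::euclidean_space set) \<le> (2 * m + 1) ^ DIM('a)"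
proof -
  have "card (latbox ep m :: 'a set) \<le> card (PiE (Basis :: 'a set) (\<lambda>_. {- int m..int m}))"
    unfolding latbox_eq[OF assms] by (intro card_image_le finite_PiE) auto
  also have "\<dots> = (2 * m + 1) ^ DIM('a)"
  proof -
    have "nat (int m - - int m + 1) = 2 * m + 1" by linarith
    then show ?thesis by (simp only: card_PiE[OF finite_Basis] card_atLeastAtMost_int prod_constant)
  qed
  finally show ?thesis .
qed

lemma latbox_0: "latbox ep 0 = {0}"
proof -
  have "x = 0" if "x \<in> latbox ep 0" for x :: 'a
    using that by (rule_tac euclidean_eqI) (simp add: latbox_def)
  moreover have "0 \<in> latbox ep 0" by (simp add: latbox_def)
  ultimately show ?thesis by blast
qed

lemma latbox_add: assumes "x \<in> latbox ep m" "y \<in> latbox ep n" shows "x + y \<in> latbox ep (m + n)"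
proof -
  have "\<bar>(x + y) \<bullet> b\<bar> \<le> ep * real (m + n)" if "b \<in> Basis" for b
    using assms that abs_triangle_ineq[of "x \<bullet> b" "y \<bullet> b"] unfolding latbox_def
    by (fastforce simp: inner_add_left algebra_simps)
  then show ?thesis using assms lat_add by (auto simp: latbox_def)
qed

lemma finite_subset_latbox:
  assumes "0 < ep" "finite A" "A \<subseteq> lat ep" obtains m where "A \<subseteq> latbox ep m"
proof -
  obtain r where r: "\<And>x. x \<in> A \<Longrightarrow> norm x \<le> r"
    using bounded_iff finite_imp_bounded[OF assms(2)] by metis
  obtain m where m: "r / ep \<le> real m" using real_arch_simple by blast
  have "\<bar>x \<bullet> b\<bar> \<le> ep * real m" if "x \<in> A" "b \<in> Basis" for x b
    using Basis_le_norm[OF that(2), of x] r[OF that(1)] m assms(1) by (simp add: field_simps)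
  then show ?thesis using assms that[of m] by (auto simp: latbox_def)
qed

lemma cell_measurable [measurable]: "cell ep \<in> sets borel"
proof -
  have "cell ep = (\<Inter>b\<in>Basis. {x. 0 \<le> x \<bullet> b} \<inter> {x. x \<bullet> b < ep})" by (auto simp: cell_def)
  also have "\<dots> \<in> sets borel" by (intro sets.finite_INT) auto
  finally show ?thesis .
qed

lemma emeasure_cell:
  assumes "0 < ep" shows "emeasure lborel (cell ep :: 'a::euclidean_space set) = ennreal (ep ^ DIM('a))"
proof (rule antisym)
  let ?u = "ep *\<^sub>R (\<Sum>Basis) :: 'a"
  have ub: "?u \<bullet> b = ep" if "b \<in> Basis" for b using that by simp
  have "emeasure lborel (cell ep :: 'a set) \<le> emeasure lborel (cbox 0 ?u)"
    using ub by (intro emeasure_mono) (auto simp: cell_def mem_box less_imp_le)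
  also have "\<dots> = ennreal (ep ^ DIM('a))" using assms by (subst emeasure_lborel_cbox) auto
  finally show "emeasure lborel (cell ep :: 'a set) \<le> ennreal (ep ^ DIM('a))" .
  have "ennreal (ep ^ DIM('a)) = emeasure lborel (box 0 ?u)" using assms by (subst emeasure_lborel_box) auto
  also have "\<dots> \<le> emeasure lborel (cell ep :: 'a set)"
    using ub by (intro emeasure_mono) (auto simp: cell_def mem_box less_imp_le)
  finally show "ennreal (ep ^ DIM('a)) \<le> emeasure lborel (cell ep :: 'a set)" .
qed

lemma nn_integral_cell_shift:
  fixes x :: "'a::euclidean_space"
  assumes "0 < ep" shows "(\<integral>\<^sup>+l. indicator (cell ep) (l - x) \<partial>lborel) = ennreal (ep ^ DIM('a))"
  using nn_integral_lborel_shift[of "indicator (cell ep)" "- x"] emeasure_cell[OF assms, where 'a = 'a] by simp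

lemma cell_unique:
  assumes ep: "0 < ep" and "x \<in> lat ep" "y \<in> lat ep" "l - x \<in> cell ep" "l - y \<in> cell ep"
  shows "x = y"
proof (rule euclidean_eqI)
  fix b :: 'a assume b: "b \<in> Basis"
  obtain k m :: int where k: "x \<bullet> b = ep * of_int k" "y \<bullet> b = ep * of_int m"
    using assms b by (force simp: lat_def)
  have "0 \<le> (l - x) \<bullet> b" "(l - x) \<bullet> b < ep" "0 \<le> (l - y) \<bullet> b" "(l - y) \<bullet> b < ep"
    using assms b by (auto simp: cell_def)
  then have "\<bar>ep * of_int k - ep * of_int m\<bar> < ep" using k by (auto simp: inner_diff_left)
  then have "ep * \<bar>of_int (k - m)\<bar> < ep * 1" using ep by (simp add: right_diff_distrib[symmetric] abs_mult)
  then have "\<bar>real_of_int (k - m)\<bar> < 1" using ep by simp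
  then have "k = m" by linarith
  then show "x \<bullet> b = y \<bullet> b" using k by simp
qed

text \<open>Cells attached to distinct lattice points are disjoint, so at each l at most one term of
  the sum is present.\<close>

lemma lattice_sum_le_integral:
  fixes H :: "'a::euclidean_space \<Rightarrow> ennreal"
  assumes ep: "0 < ep" and A: "finite A" "A \<subseteq> lat ep" and [measurable]: "H \<in> borel_measurable borel"
    and le: "\<And>x r. x \<in> A \<Longrightarrow> r \<in> cell ep \<Longrightarrow> c x \<le> H (x + r)"
  shows "ennreal (ep ^ DIM('a)) * (\<Sum>x\<in>A. c x) \<le> (\<integral>\<^sup>+l. H l \<partial>lborel)"
proof -
  have pt: "(\<Sum>x\<in>A. c x * indicator (cell ep) (l - x)) \<le> H l" for l
  proof (cases "\<exists>x\<in>A. l - x \<in> cell ep")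
    case True
    then obtain x where x: "x \<in> A" "l - x \<in> cell ep" by auto
    have "(\<Sum>y\<in>A. c y * indicator (cell ep) (l - y)) = (\<Sum>y\<in>A. if y = x then c x else 0)"
      using cell_unique[OF ep, of _ x l] x A by (intro sum.cong refl) (auto simp: indicator_def)
    also have "\<dots> = c x" using x A by simp
    also have "\<dots> \<le> H l" using le[OF x] by simp
    finally show ?thesis .
  next
    case False
    then have "(\<Sum>x\<in>A. c x * indicator (cell ep) (l - x)) = 0" by (intro sum.neutral) (auto simp: indicator_def)
    then show ?thesis by simp
  qed
  have "ennreal (ep ^ DIM('a)) * (\<Sum>x\<in>A. c x) = (\<Sum>x\<in>A. c x * (\<integral>\<^sup>+l. indicator (cell ep) (l - x) \<partial>lborel))"
    by (simp add: nn_integral_cell_shift[OF ep] sum_distrib_right[symmetric] mult.commute)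
  also have "\<dots> = (\<integral>\<^sup>+l. (\<Sum>x\<in>A. c x * indicator (cell ep) (l - x)) \<partial>lborel)"
    by (subst nn_integral_sum) (auto simp: nn_integral_cmult)
  also have "\<dots> \<le> (\<integral>\<^sup>+l. H l \<partial>lborel)" by (intro nn_integral_mono pt)
  finally show ?thesis .
qed

text \<open>Squared amplitudes are spread out and the root is taken afterwards: this preserves the
  total squared mass of \<open>F\<close> on \<open>U\<close> even though the cells overlap when s
  exceeds the mesh.\<close>

definition spread :: "real \<Rightarrow> 'a::euclidean_space set \<Rightarrow> ('a \<Rightarrow> real) \<Rightarrow> 'a \<Rightarrow> real" where
  "spread s U F l = sqrt (\<Sum>x\<in>U. (F x)\<^sup>2 * (indicator (cell s) (l - x) / s ^ DIM('a)))"

lemma spread_measurable [measurable]: "spread s U F \<in> borel_measurable borel"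
  unfolding spread_def[abs_def] by measurable

text \<open>Spreading a lattice function over cells of side \<open>s\<close> much larger than the mesh, with squared
  amplitudes, does not decrease correlations, by the Cauchy--Schwarz inequality at each point.\<close>

lemma corr_spread_ge:
  fixes F G :: "'a::euclidean_space \<Rightarrow> real"
  assumes s: "0 < ep" "ep < s" and U: "finite U" "finite U'" "\<And>x. x \<in> U \<Longrightarrow> x + a \<in> U'"
    and FG: "\<And>x. 0 \<le> F x" "\<And>x. 0 \<le> G x" and r: "r \<in> cell ep"
  shows "ennreal (((s - ep) / s) ^ DIM('a) * (\<Sum>x\<in>U. F (x + a) * G x))
    \<le> corr (\<lambda>l. ennreal (spread s U' F l)) (\<lambda>l. ennreal (spread s U G l)) (a + r)"
proof -
  define k where "k u = indicat_real (cell s) u / s ^ DIM('a)" for u :: 'a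
  have k0: "0 \<le> k u" for u using s by (simp add: k_def)
  \<comment> \<open>If v lies in the cell of side s - ep, then both v and r + v lie in the cell of
    side s. The ratio of the two volumes is the loss factor in the claim.\<close>
  have kk: "indicator (cell (s - ep)) v / s ^ DIM('a) \<le> sqrt (k (r + v)) * sqrt (k v)" for v :: 'a
  proof (cases "v \<in> cell (s - ep)")
    case True
    then have "v \<in> cell s" using s by (force simp: cell_def)
    moreover have "r + v \<in> cell s" unfolding cell_def
    proof (intro CollectI ballI conjI)
      fix b :: 'a assume b: "b \<in> Basis"
      have "0 \<le> r \<bullet> b" "r \<bullet> b < ep" "0 \<le> v \<bullet> b" "v \<bullet> b < s - ep" using True r b by (auto simp: cell_def)
      then show "0 \<le> (r + v) \<bullet> b" "(r + v) \<bullet> b < s" by (auto simp: inner_add_left)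
    qed
    ultimately show ?thesis using True s by (simp add: k_def)
  next
    case False then show ?thesis using k0 by simp
  qed
  have pt: "(\<Sum>x\<in>U. F (x + a) * G x * (indicator (cell (s - ep)) (g - x) / s ^ DIM('a)))
      \<le> spread s U' F (a + r + g) * spread s U G g" for g
  proof -
    have "(\<Sum>x\<in>U. F (x + a) * G x * (indicator (cell (s - ep)) (g - x) / s ^ DIM('a)))
       \<le> (\<Sum>x\<in>U. F (x + a) * G x * (sqrt (k (r + (g - x))) * sqrt (k (g - x))))"
      using FG by (intro sum_mono mult_left_mono kk) auto
    also have "\<dots> = (\<Sum>x\<in>U. (F (x + a) * sqrt (k (r + (g - x)))) * (G x * sqrt (k (g - x))))"
      by (simp add: mult_ac)
    also have "\<dots> \<le> sqrt (\<Sum>x\<in>U. (F (x + a) * sqrt (k (r + (g - x))))\<^sup>2) * sqrt (\<Sum>x\<in>U. (G x * sqrt (k (g - x)))\<^sup>2)"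
      unfolding real_sqrt_mult[symmetric] by (intro real_le_rsqrt Cauchy_Schwarz_ineq_sum)
    also have "(\<Sum>x\<in>U. (G x * sqrt (k (g - x)))\<^sup>2) = (\<Sum>x\<in>U. (G x)\<^sup>2 * k (g - x))"
      using k0 by (simp add: power_mult_distrib)
    also have "(\<Sum>x\<in>U. (F (x + a) * sqrt (k (r + (g - x))))\<^sup>2) = (\<Sum>y\<in>(\<lambda>x. x + a) ` U. (F y)\<^sup>2 * k (a + r + g - y))"
      using k0 by (subst sum.reindex) (auto simp: power_mult_distrib inj_on_def algebra_simps)
    also have "sqrt (\<Sum>y\<in>(\<lambda>x. x + a) ` U. (F y)\<^sup>2 * k (a + r + g - y)) * sqrt (\<Sum>x\<in>U. (G x)\<^sup>2 * k (g - x))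
       \<le> sqrt (\<Sum>y\<in>U'. (F y)\<^sup>2 * k (a + r + g - y)) * sqrt (\<Sum>x\<in>U. (G x)\<^sup>2 * k (g - x))"
      using U k0 by (intro mult_right_mono real_sqrt_le_mono sum_mono2) (auto intro!: sum_nonneg)
    finally show ?thesis by (simp add: spread_def k_def)
  qed
  have sp0: "0 \<le> spread s U'' H l" for U'' and H :: "'a \<Rightarrow> real" and l
    unfolding spread_def using s by (intro real_sqrt_ge_zero sum_nonneg) auto
  have "ennreal (((s - ep) / s) ^ DIM('a) * (\<Sum>x\<in>U. F (x + a) * G x))
     = (\<Sum>x\<in>U. ennreal (F (x + a) * G x / s ^ DIM('a)) * ennreal ((s - ep) ^ DIM('a)))"
  proof -
    have "ennreal (F (x + a) * G x / s ^ DIM('a)) * ennreal ((s - ep) ^ DIM('a)) = ennreal (((s - ep) / s) ^ DIM('a) * (F (x + a) * G x))" for x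
      using s FG by (subst ennreal_mult[symmetric]) (auto simp: power_divide)
    moreover have "(\<Sum>x\<in>U. ennreal (((s - ep) / s) ^ DIM('a) * (F (x + a) * G x))) = ennreal (\<Sum>x\<in>U. ((s - ep) / s) ^ DIM('a) * (F (x + a) * G x))"
      using s FG by (intro sum_ennreal) auto
    ultimately show ?thesis by (simp add: sum_distrib_left)
  qed
  also have "\<dots> = (\<integral>\<^sup>+g. (\<Sum>x\<in>U. ennreal (F (x + a) * G x / s ^ DIM('a)) * indicator (cell (s - ep)) (g - x)) \<partial>lborel)"
    using s by (subst nn_integral_sum) (auto simp: nn_integral_cmult nn_integral_cell_shift)
  also have "\<dots> \<le> (\<integral>\<^sup>+g. ennreal (spread s U' F (a + r + g)) * ennreal (spread s U G g) \<partial>lborel)"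
  proof (intro nn_integral_mono)
    fix g
    have "(\<Sum>x\<in>U. ennreal (F (x + a) * G x / s ^ DIM('a)) * indicator (cell (s - ep)) (g - x))
      = ennreal (\<Sum>x\<in>U. F (x + a) * G x * (indicator (cell (s - ep)) (g - x) / s ^ DIM('a)))"
    proof -
      have "ennreal (F (x + a) * G x / s ^ DIM('a)) * indicator (cell (s - ep)) (g - x)
        = ennreal (F (x + a) * G x * (indicator (cell (s - ep)) (g - x) / s ^ DIM('a)))" for x
        by (simp add: indicator_def)
      moreover have "(\<Sum>x\<in>U. ennreal (F (x + a) * G x * (indicator (cell (s - ep)) (g - x) / s ^ DIM('a))))
        = ennreal (\<Sum>x\<in>U. F (x + a) * G x * (indicator (cell (s - ep)) (g - x) / s ^ DIM('a)))"
        using s FG by (intro sum_ennreal) auto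
      ultimately show ?thesis by simp
    qed
    also have "\<dots> \<le> ennreal (spread s U' F (a + r + g) * spread s U G g)" by (intro ennreal_leI pt)
    finally show "(\<Sum>x\<in>U. ennreal (F (x + a) * G x / s ^ DIM('a)) * indicator (cell (s - ep)) (g - x))
      \<le> ennreal (spread s U' F (a + r + g)) * ennreal (spread s U G g)"
      using sp0 by (simp add: ennreal_mult)
  qed
  finally show ?thesis by (simp add: corr_def)
qed

context stable_data begin

text \<open>Since W is nearly constant on a cell of side s, spreading multiplies the energy by at
  most 1 + \<delta>. The value \<open>e\<close> makes the energy available as a real number, as
  \<open>rho_ge_corr_pow\<close> expects.\<close>

lemma energy_spread:
  assumes s: "0 < s" and U: "finite U" and near: "\<And>x u. u \<in> cell s \<Longrightarrow> W (x + u) \<le> (1 + \<delta>) * W x" and \<delta>: "0 < \<delta>"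
  obtains e where "0 \<le> e" "(\<integral>\<^sup>+l. ennreal ((spread s U F l)\<^sup>2 * W l) \<partial>lborel) = ennreal e"
    "e \<le> (1 + \<delta>) * (\<Sum>x\<in>U. (F x)\<^sup>2 * W x)"
proof -
  let ?I = "\<integral>\<^sup>+l. ennreal ((spread s U F l)\<^sup>2 * W l) \<partial>lborel"
  let ?B = "(1 + \<delta>) * (\<Sum>x\<in>U. (F x)\<^sup>2 * W x)"
  have B0: "0 \<le> ?B" using \<delta> W_pos by (intro mult_nonneg_nonneg sum_nonneg) (auto simp: less_imp_le)
  define A where "A x = (F x)\<^sup>2 * ((1 + \<delta>) * W x) / s ^ DIM('a)" for x
  have A0: "0 \<le> A x" for x using s \<delta> W_pos[of x] by (simp add: A_def)
  have ind: "(\<Sum>x\<in>U. ennreal (A x) * indicator (cell s) (l - x)) = ennreal (\<Sum>x\<in>U. A x * indicat_real (cell s) (l - x))" for l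
  proof -
    have "ennreal (A x) * indicator (cell s) (l - x) = ennreal (A x * indicat_real (cell s) (l - x))" for x
      by (simp add: indicator_def)
    moreover have "(\<Sum>x\<in>U. ennreal (A x * indicat_real (cell s) (l - x))) = ennreal (\<Sum>x\<in>U. A x * indicat_real (cell s) (l - x))"
      using A0 by (intro sum_ennreal) auto
    ultimately show ?thesis by simp
  qed
  have "?I \<le> (\<integral>\<^sup>+l. (\<Sum>x\<in>U. ennreal ((F x)\<^sup>2 * ((1 + \<delta>) * W x) / s ^ DIM('a)) * indicator (cell s) (l - x)) \<partial>lborel)"
  proof (intro nn_integral_mono)
    fix l
    have "(spread s U F l)\<^sup>2 * W l = (\<Sum>x\<in>U. (F x)\<^sup>2 * (indicator (cell s) (l - x) / s ^ DIM('a)) * W l)"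
      unfolding spread_def using s by (subst real_sqrt_pow2) (auto intro!: sum_nonneg simp: sum_distrib_right)
    also have "\<dots> \<le> (\<Sum>x\<in>U. (F x)\<^sup>2 * ((1 + \<delta>) * W x) / s ^ DIM('a) * indicator (cell s) (l - x))"
    proof (intro sum_mono)
      fix x
      show "(F x)\<^sup>2 * (indicat_real (cell s) (l - x) / s ^ DIM('a)) * W l \<le> (F x)\<^sup>2 * ((1 + \<delta>) * W x) / s ^ DIM('a) * indicat_real (cell s) (l - x)"
      proof (cases "l - x \<in> cell s")
        case True
        then have "W l \<le> (1 + \<delta>) * W x" using near[of "l - x" x] by simp
        then have "(F x)\<^sup>2 / s ^ DIM('a) * W l \<le> (F x)\<^sup>2 / s ^ DIM('a) * ((1 + \<delta>) * W x)" using s by (intro mult_left_mono) auto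
        then show ?thesis using True by simp
      qed simp
    qed
    finally show "ennreal ((spread s U F l)\<^sup>2 * W l) \<le> (\<Sum>x\<in>U. ennreal ((F x)\<^sup>2 * ((1 + \<delta>) * W x) / s ^ DIM('a)) * indicator (cell s) (l - x))"
      unfolding A_def[symmetric] by (simp only: ind ennreal_leI)
  qed
  also have "\<dots> = (\<Sum>x\<in>U. ennreal ((F x)\<^sup>2 * ((1 + \<delta>) * W x) / s ^ DIM('a)) * ennreal (s ^ DIM('a)))"
    using s by (subst nn_integral_sum) (auto simp: nn_integral_cmult nn_integral_cell_shift)
  also have "\<dots> = ennreal ?B"
  proof -
    have "(\<Sum>x\<in>U. ennreal (A x) * ennreal (s ^ DIM('a))) = (\<Sum>x\<in>U. ennreal ((1 + \<delta>) * ((F x)\<^sup>2 * W x)))"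
      using s A0 by (intro sum.cong refl) (simp add: ennreal_mult[symmetric], simp add: A_def mult_ac)
    also have "\<dots> = ennreal ?B"
      using \<delta> W_pos by (subst sum_ennreal) (auto simp: sum_distrib_left less_imp_le)
    finally show ?thesis unfolding A_def .
  qed
  finally have le: "?I \<le> ennreal ?B" .
  then have "?I < \<top>" using ennreal_less_top le_less_trans by blast
  then show ?thesis
    using le B0 that[of "enn2real ?I"] by (auto simp: enn2real_leI)
qed

text \<open>For the indicator of the ball of radius 2 the correlation at each l of norm at most 1 is
  at least the volume of the unit ball. Positivity is needed for the logarithm and for the choice of
  intermediate constants.\<close>

lemma rho_pos: "0 < rho \<psi> p"
proof -
  have bd: "bounded (W ` cball 0 2)"
    unfolding W_def[abs_def]
    by (intro compact_imp_bounded compact_continuous_image continuous_intros continuous_on_subset[OF psi_cont]) auto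
  then obtain B where B: "\<And>x. x \<in> cball 0 2 \<Longrightarrow> W x \<le> B"
    unfolding bounded_iff by (force simp: abs_le_iff)
  let ?V = "\<lambda>r. emeasure lborel (cball (0::'a) r)"
  define F where "F x = indicat_real (cball (0::'a) 2) x" for x
  have Fm [measurable]: "F \<in> borel_measurable borel" unfolding F_def[abs_def] by (intro borel_measurable_indicator) simp
  have V: "?V r < \<top>" "0 < r \<Longrightarrow> 0 < ?V r" for r
    using emeasure_lborel_cball_finite[of "0::'a" r] by (auto simp: emeasure_cball)
  have "(\<integral>\<^sup>+x. ennreal ((F x)\<^sup>2 * W x) \<partial>lborel) \<le> (\<integral>\<^sup>+x. ennreal B * indicator (cball 0 2) x \<partial>(lborel :: 'a measure))"
    using B by (intro nn_integral_mono) (auto simp: F_def indicator_def intro!: ennreal_leI)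
  also have "\<dots> = ennreal B * ?V 2" by (rule nn_integral_cmult_indicator) simp
  also have "\<dots> < \<top>" using V(1)[of 2] by (simp add: ennreal_mult_less_top)
  finally obtain e where e: "(\<integral>\<^sup>+x. ennreal ((F x)\<^sup>2 * W x) \<partial>lborel) = ennreal e" "0 \<le> e"
    by (metis enn2real_nonneg ennreal_enn2real)
  have ge: "?V 1 * indicator (cball 0 1) l \<le> corr (\<lambda>x. ennreal (F x)) (\<lambda>x. ennreal (F x)) l" for l :: 'a
  proof (cases "l \<in> cball 0 1")
    case True
    have "?V 1 = (\<integral>\<^sup>+x. indicator (cball (0::'a) 1) x \<partial>lborel)" by simp
    also have "\<dots> \<le> corr (\<lambda>x. ennreal (F x)) (\<lambda>x. ennreal (F x)) l"
      unfolding corr_def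
    proof (intro nn_integral_mono)
      fix x :: 'a
      have "norm (l + x) \<le> 2" if "norm x \<le> 1" using True that norm_triangle_ineq[of l x] by simp
      then show "indicator (cball 0 1) x \<le> ennreal (F (l + x)) * ennreal (F x)"
        by (simp add: F_def indicator_def)
    qed
    finally show ?thesis using True by simp
  qed simp
  obtain v where v: "?V 1 = ennreal v" "0 < v"
    using emeasure_cball[of 1 "0::'a"] unit_ball_vol_pos[of "real DIM('a)"] by auto
  have "0 < (?V 1) ^ p * ?V 1" unfolding v(1) using v(2) by (simp add: ennreal_power ennreal_mult[symmetric])
  also have "\<dots> = (\<integral>\<^sup>+l. (?V 1 ^ p) * indicator (cball (0::'a) 1) l \<partial>lborel)"
    by (rule nn_integral_cmult_indicator[symmetric]) simp
  also have "\<dots> = (\<integral>\<^sup>+l. (?V 1 * indicator (cball (0::'a) 1) l) ^ p \<partial>lborel)"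
    using p_pos by (intro nn_integral_cong) (auto simp: indicator_def power_0_left)
  also have "\<dots> \<le> corr_pow p (\<lambda>x. ennreal (F x)) (\<lambda>x. ennreal (F x))"
    unfolding corr_pow_def by (intro nn_integral_mono power_mono_ennreal ge)
  also have "\<dots> \<le> ennreal (rho \<psi> p * e ^ p)"
    by (rule rho_ge_corr_pow[OF Fm _ e]) (simp add: F_def)
  finally have "0 < rho \<psi> p * e ^ p" by simp
  then show ?thesis using e(2) by (simp add: zero_less_mult_iff)
qed

text \<open>Spreading over cells of fixed side s while the mesh is small leads to the continuum,
  where Cauchy-Schwarz for \<open>corr_pow\<close> and the definition of \<open>rho\<close> apply.
  The squared form avoids the root of a product of two energies. The mesh threshold does not depend
  on the finite sets, as the growing windows require.\<close>

lemma lattice_correlation_bound: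
  assumes "rho \<psi> p < \<rho>'"
  obtains ep0 where "0 < ep0" "\<And>ep A U U' f g. 0 < ep \<Longrightarrow> ep < ep0 \<Longrightarrow> finite A \<Longrightarrow> A \<subseteq> lat ep \<Longrightarrow> finite U \<Longrightarrow> finite U' \<Longrightarrow>
    (\<And>x a. x \<in> U \<Longrightarrow> a \<in> A \<Longrightarrow> x + a \<in> U') \<Longrightarrow> (\<And>x. 0 \<le> f x) \<Longrightarrow> (\<And>x. 0 \<le> g x) \<Longrightarrow>
    (ep ^ DIM('a) * (\<Sum>a\<in>A. (\<Sum>x\<in>U. f (x + a) / sqrt (W (x + a)) * (g x / sqrt (W x))) ^ p))\<^sup>2
      \<le> \<rho>'\<^sup>2 * (\<Sum>x\<in>U'. (f x)\<^sup>2) ^ p * (\<Sum>x\<in>U. (g x)\<^sup>2) ^ p"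
proof -
  \<comment> \<open>One factor 1 + \<delta> pays for the energies of the spread functions, the other
    for the loss \<open>c\<close> of \<open>corr_spread_ge\<close>.\<close>
  have "((\<lambda>\<delta>. rho \<psi> p * ((1 + \<delta>) * (1 + \<delta>)) ^ p) \<longlongrightarrow> rho \<psi> p * ((1 + 0) * (1 + 0)) ^ p) (at_right 0)"
    by (intro tendsto_intros)
  then have "\<forall>\<^sub>F \<delta> in at_right 0. rho \<psi> p * ((1 + \<delta>) * (1 + \<delta>)) ^ p < \<rho>'"
    using assms by (intro order_tendstoD(2)) auto
  then obtain \<delta> where \<delta>: "0 < \<delta>" "rho \<psi> p * ((1 + \<delta>) * (1 + \<delta>)) ^ p < \<rho>'"
    by (metis (mono_tags, lifting) eventually_at_right_field field_lbound_gt_zero gt_ex)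
  obtain s1 where s1: "0 < s1" "\<And>x u. norm u \<le> s1 \<Longrightarrow> W (x + u) \<le> (1 + \<delta>) * W x"
    using W_uniform[OF \<delta>(1)] by blast
  \<comment> \<open>A point of a cell of side s has norm at most d s, being bounded by the sum of
    its coordinates.\<close>
  define s where "s = s1 / DIM('a)"
  have s: "0 < s" using s1 by (simp add: s_def)
  have near: "W (x + u) \<le> (1 + \<delta>) * W x" if "u \<in> cell s" for x u
  proof (rule s1)
    have "norm u \<le> (\<Sum>b\<in>Basis. \<bar>u \<bullet> b\<bar>)" by (rule norm_le_l1)
    also have "\<dots> \<le> (\<Sum>b\<in>(Basis::'a set). s)" using that by (intro sum_mono) (auto simp: cell_def)
    finally show "norm u \<le> s1" by (simp add: s_def)
  qed
  have "((\<lambda>ep. ((s - ep) / s) ^ DIM('a)) \<longlongrightarrow> ((s - 0) / s) ^ DIM('a)) (at_right 0)"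
    using s by (intro tendsto_intros) auto
  then have "\<forall>\<^sub>F ep in at_right 0. 1 / (1 + \<delta>) < ((s - ep) / s) ^ DIM('a)"
    using s \<delta> by (intro order_tendstoD(1)) auto
  then obtain e1 where e1: "0 < e1" "\<And>ep. 0 < ep \<Longrightarrow> ep < e1 \<Longrightarrow> 1 / (1 + \<delta>) < ((s - ep) / s) ^ DIM('a)"
    unfolding eventually_at_right_field by blast
  show ?thesis
  proof (rule that[of "min e1 s"])
    show "0 < min e1 s" using e1 s by simp
    fix ep :: real and A U U' :: "'a set" and f g :: "'a \<Rightarrow> real"
    assume ep: "0 < ep" "ep < min e1 s" and A: "finite A" "A \<subseteq> lat ep" and U: "finite U" "finite U'"
      "\<And>x a. x \<in> U \<Longrightarrow> a \<in> A \<Longrightarrow> x + a \<in> U'" and fg: "\<And>x. 0 \<le> f x" "\<And>x. 0 \<le> g x"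
    define F where "F x = f x / sqrt (W x)" for x
    define G where "G x = g x / sqrt (W x)" for x
    have FG: "\<And>x. 0 \<le> F x" "\<And>x. 0 \<le> G x" using fg W_pos by (auto simp: F_def G_def less_imp_le)
    have FW: "(F x)\<^sup>2 * W x = (f x)\<^sup>2" "(G x)\<^sup>2 * W x = (g x)\<^sup>2" for x
      using W_pos[of x] by (auto simp: F_def G_def power_divide)
    define c where "c = ((s - ep) / s) ^ DIM('a)"
    have c: "1 / (1 + \<delta>) < c" using e1(2)[of ep] ep by (simp add: c_def)
    have c0: "0 < c" using c \<delta>(1) by (smt (verit) divide_pos_pos)
    define C where "C a = (\<Sum>x\<in>U. F (x + a) * G x)" for a
    have C0: "0 \<le> C a" for a unfolding C_def using FG by (intro sum_nonneg) auto
    let ?F = "spread s U' F" and ?G = "spread s U G"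
    let ?eF = "\<lambda>l. ennreal (?F l)" and ?eG = "\<lambda>l. ennreal (?G l)"
    have sp0: "0 \<le> spread s U'' H l" for U'' and H :: "'a \<Rightarrow> real" and l
      unfolding spread_def using s by (intro real_sqrt_ge_zero sum_nonneg) auto
    have "ennreal (ep ^ DIM('a)) * (\<Sum>a\<in>A. ennreal ((c * C a) ^ p)) \<le> corr_pow p ?eF ?eG"
      unfolding corr_pow_def
    proof (rule lattice_sum_le_integral[OF ep(1) A])
      show "(\<lambda>l. corr ?eF ?eG l ^ p) \<in> borel_measurable borel" by measurable
      fix a r :: 'a assume a: "a \<in> A" and r: "r \<in> cell ep"
      have "ennreal ((c * C a) ^ p) = ennreal (c * C a) ^ p"
        using c0 C0[of a] by (simp add: ennreal_power)
      also have "\<dots> \<le> corr ?eF ?eG (a + r) ^ p"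
        unfolding c_def C_def using ep U a FG r by (intro power_mono_ennreal corr_spread_ge) auto
      finally show "ennreal ((c * C a) ^ p) \<le> corr ?eF ?eG (a + r) ^ p" .
    qed
    moreover have "ennreal (ep ^ DIM('a)) * (\<Sum>a\<in>A. ennreal ((c * C a) ^ p)) = ennreal (c ^ p * (ep ^ DIM('a) * (\<Sum>a\<in>A. C a ^ p)))"
      using ep c0 C0 by (subst sum_ennreal) (auto simp: ennreal_mult[symmetric] sum_nonneg power_mult_distrib sum_distrib_left mult_ac)
    ultimately have le1: "ennreal (c ^ p * (ep ^ DIM('a) * (\<Sum>a\<in>A. C a ^ p))) \<le> corr_pow p ?eF ?eG" by simp
    obtain e where e: "0 \<le> e" "(\<integral>\<^sup>+l. ennreal ((?F l)\<^sup>2 * W l) \<partial>lborel) = ennreal e" "e \<le> (1 + \<delta>) * (\<Sum>x\<in>U'. (F x)\<^sup>2 * W x)"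
      using energy_spread[OF s U(2) near \<delta>(1)] by blast
    obtain e' where e': "0 \<le> e'" "(\<integral>\<^sup>+l. ennreal ((?G l)\<^sup>2 * W l) \<partial>lborel) = ennreal e'" "e' \<le> (1 + \<delta>) * (\<Sum>x\<in>U. (G x)\<^sup>2 * W x)"
      using energy_spread[OF s U(1) near \<delta>(1)] by blast
    let ?SF = "\<Sum>x\<in>U'. (f x)\<^sup>2" and ?SG = "\<Sum>x\<in>U. (g x)\<^sup>2"
    have eS: "e \<le> (1 + \<delta>) * ?SF" "e' \<le> (1 + \<delta>) * ?SG" using e(3) e'(3) by (simp_all add: FW)
    have "(corr_pow p ?eF ?eG)\<^sup>2 \<le> corr_pow p ?eF ?eF * corr_pow p ?eG ?eG"
      by (intro corr_pow_Cauchy_Schwarz p_pos) measurable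
    also have "\<dots> \<le> ennreal (rho \<psi> p * e ^ p) * ennreal (rho \<psi> p * e' ^ p)"
      by (intro mult_mono rho_ge_corr_pow e e') (auto simp: sp0)
    also have "\<dots> = ennreal ((rho \<psi> p * e ^ p) * (rho \<psi> p * e' ^ p))"
      using rho_pos e e' by (intro ennreal_mult[symmetric]) auto
    finally have "ennreal (c ^ p * (ep ^ DIM('a) * (\<Sum>a\<in>A. C a ^ p))) ^ 2 \<le> ennreal ((rho \<psi> p * e ^ p) * (rho \<psi> p * e' ^ p))"
      using power_mono_ennreal[OF le1, of 2] by (rule order_trans[rotated])
    then have "(c ^ p * (ep ^ DIM('a) * (\<Sum>a\<in>A. C a ^ p)))\<^sup>2 \<le> (rho \<psi> p * e ^ p) * (rho \<psi> p * e' ^ p)"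
      using rho_pos e e' c0 ep C0 by (subst (asm) ennreal_power) (auto intro!: mult_nonneg_nonneg sum_nonneg simp: ennreal_le_iff2 zero_le_mult_iff)
    also have "\<dots> \<le> (rho \<psi> p * ((1 + \<delta>) * ?SF) ^ p) * (rho \<psi> p * ((1 + \<delta>) * ?SG) ^ p)"
      using rho_pos e e' eS \<delta> by (intro mult_mono mult_left_mono power_mono) (auto intro!: mult_nonneg_nonneg sum_nonneg zero_le_power)
    finally have 1: "(c ^ p * (ep ^ DIM('a) * (\<Sum>a\<in>A. C a ^ p)))\<^sup>2 \<le> (rho \<psi> p * ((1 + \<delta>) * ?SF) ^ p) * (rho \<psi> p * ((1 + \<delta>) * ?SG) ^ p)" .
    have "1 \<le> c * (1 + \<delta>)" using c \<delta> by (simp add: field_simps)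
    then have cp: "1 \<le> (c * (1 + \<delta>)) ^ p" by simp
    let ?T = "ep ^ DIM('a) * (\<Sum>a\<in>A. C a ^ p)"
    have T0: "0 \<le> ?T" using ep C0 by (auto intro!: mult_nonneg_nonneg sum_nonneg)
    have "?T \<le> (c * (1 + \<delta>)) ^ p * ?T" using cp T0 by (simp add: mult_le_cancel_right1)
    then have "?T\<^sup>2 \<le> ((c * (1 + \<delta>)) ^ p * ?T)\<^sup>2" using T0 by (intro power_mono)
    also have "\<dots> = ((1 + \<delta>) ^ p)\<^sup>2 * (c ^ p * ?T)\<^sup>2" by (simp add: power_mult_distrib)
    also have "\<dots> \<le> ((1 + \<delta>) ^ p)\<^sup>2 * ((rho \<psi> p * ((1 + \<delta>) * ?SF) ^ p) * (rho \<psi> p * ((1 + \<delta>) * ?SG) ^ p))"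
      by (intro mult_left_mono 1) simp
    also have "\<dots> = (rho \<psi> p * ((1 + \<delta>) * (1 + \<delta>)) ^ p)\<^sup>2 * (?SF ^ p * ?SG ^ p)"
      by (simp add: power_mult_distrib power2_eq_square mult_ac)
    also have "\<dots> \<le> \<rho>'\<^sup>2 * (?SF ^ p * ?SG ^ p)"
      using \<delta> rho_pos by (intro mult_right_mono power_mono) (auto intro!: mult_nonneg_nonneg zero_le_power[OF sum_nonneg])
    finally show "(ep ^ DIM('a) * (\<Sum>a\<in>A. (\<Sum>x\<in>U. f (x + a) / sqrt (W (x + a)) * (g x / sqrt (W x))) ^ p))\<^sup>2
      \<le> \<rho>'\<^sup>2 * ?SF ^ p * ?SG ^ p"
      by (simp add: C_def F_def G_def mult.assoc)
  qed
qed

end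

section \<open>Lattice approximation of the variational problem\<close>

context stable_data begin

definition Qw :: "'a \<Rightarrow> real" where "Qw x = 1 / W x"

lemma Qw_pos: "0 < Qw x" and Qw_le_1: "Qw x \<le> 1" and Qw_0: "Qw 0 = 1"
proof -
  show "0 < Qw x" "Qw x \<le> 1" using W_ge_1[of x] by (auto simp: Qw_def)
  have "2 powr \<alpha> * \<psi> 0 = \<psi> 0" using psi_scale[of 2 0] by simp
  moreover have "(2::real) powr \<alpha> > 1" using alpha_pos by simp
  ultimately have "\<psi> 0 = 0" using alpha_pos by auto
  then show "Qw 0 = 1" by (simp add: Qw_def W_def)
qed

text \<open>Hoelder's inequality pairs the weights \<open>c a ^ q\<close> with the lattice
  correlations, whose p-norm is controlled by \<open>lattice_correlation_bound\<close>; hence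
  \<tau>^p = \<rho>'/ep^d. The windows are the boxes \<open>latbox ep (j * K)\<close>, whose size is
  polynomial in j.\<close>

lemma J_upper:
  assumes \<rho>': "rho \<psi> p < \<rho>'" and q: "p = Suc q"
  obtains ep0 where "0 < ep0" "\<And>ep K A c n. 0 < ep \<Longrightarrow> ep < ep0 \<Longrightarrow> A \<subseteq> latbox ep K \<Longrightarrow>
    (\<And>a. a \<in> A \<Longrightarrow> 0 \<le> c a) \<Longrightarrow> (\<Sum>a\<in>A. c a ^ p) = 1 \<Longrightarrow>
    J Qw (\<lambda>a. c a ^ q) A n 0 \<le> root p (\<rho>' / ep ^ DIM('a)) ^ n * sqrt ((2 * real (n * K) + 1) ^ DIM('a))"
proof -
  obtain ep0 where ep0: "0 < ep0" and bound: "\<And>ep A U U' f g. 0 < ep \<Longrightarrow> ep < ep0 \<Longrightarrow> finite A \<Longrightarrow> A \<subseteq> lat ep \<Longrightarrow> finite U \<Longrightarrow> finite U' \<Longrightarrow>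
    (\<And>x a. x \<in> U \<Longrightarrow> a \<in> A \<Longrightarrow> x + a \<in> U') \<Longrightarrow> (\<And>x. 0 \<le> f x) \<Longrightarrow> (\<And>x. 0 \<le> g x) \<Longrightarrow>
    (ep ^ DIM('a) * (\<Sum>a\<in>A. (\<Sum>x\<in>U. f (x + a) / sqrt (W (x + a)) * (g x / sqrt (W x))) ^ p))\<^sup>2
      \<le> \<rho>'\<^sup>2 * (\<Sum>x\<in>U'. (f x)\<^sup>2) ^ p * (\<Sum>x\<in>U. (g x)\<^sup>2) ^ p"
    using lattice_correlation_bound[OF \<rho>'] by blast
  show ?thesis
  proof (rule that[OF ep0])
    fix ep :: real and K :: nat and A :: "'a set" and c :: "'a \<Rightarrow> real" and n :: nat
    assume ep: "0 < ep" "ep < ep0" and AK: "A \<subseteq> latbox ep K" and c: "\<And>a. a \<in> A \<Longrightarrow> 0 \<le> c a" "(\<Sum>a\<in>A. c a ^ p) = 1"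
    define D where "D = ep ^ DIM('a)"
    have D: "0 < D" using ep by (simp add: D_def)
    have rp: "0 < \<rho>'" using rho_pos \<rho>' by simp
    define \<tau> where "\<tau> = root p (\<rho>' / D)"
    have \<tau>0: "0 \<le> \<tau>" unfolding \<tau>_def using rp D by (intro real_root_ge_zero) simp
    have \<tau>p: "\<tau> ^ p = \<rho>' / D" using rp D p_pos by (simp add: \<tau>_def)
    have A: "finite A" "A \<subseteq> lat ep"
      using AK latbox_subset finite_latbox[OF ep(1)] finite_subset by blast+
    have "J Qw (\<lambda>a. c a ^ q) A n 0 \<le> \<tau> ^ n * sqrt (card (latbox ep (n * K) :: 'a set))"
    proof (rule J_operator_bound[where U = "\<lambda>j. latbox ep (j * K)"])
      show "\<gamma> + a \<in> latbox ep (Suc j * K)" if "\<gamma> \<in> latbox ep (j * K)" "a \<in> A" for j \<gamma> a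
        using latbox_add[OF that(1), of a K] that(2) AK by (auto simp: add.commute)
      fix j and f g :: "'a \<Rightarrow> real" assume f: "\<And>x. 0 \<le> f x" and g: "\<And>x. 0 \<le> g x"
      let ?U = "latbox ep (j * K) :: 'a set" and ?U' = "latbox ep (Suc j * K) :: 'a set"
      define C where "C a = (\<Sum>\<gamma>\<in>?U. g \<gamma> * (sqrt (Qw \<gamma>) * sqrt (Qw (\<gamma> + a)) * f (\<gamma> + a)))" for a
      have C0: "0 \<le> C a" for a unfolding C_def using f g Qw_pos by (intro sum_nonneg mult_nonneg_nonneg) (auto simp: less_imp_le)
      have Ceq: "C a = (\<Sum>x\<in>?U. f (x + a) / sqrt (W (x + a)) * (g x / sqrt (W x)))" for a
        unfolding C_def Qw_def by (intro sum.cong refl) (simp add: real_sqrt_divide mult_ac)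
      define Nf where "Nf = sqrt (\<Sum>x\<in>?U'. (f x)\<^sup>2)"
      define Ng where "Ng = sqrt (\<Sum>x\<in>?U. (g x)\<^sup>2)"
      have N0: "0 \<le> Nf" "0 \<le> Ng" by (auto simp: Nf_def Ng_def sum_nonneg)
      have N2: "(\<Sum>x\<in>?U'. (f x)\<^sup>2) = Nf\<^sup>2" "(\<Sum>x\<in>?U. (g x)\<^sup>2) = Ng\<^sup>2" by (auto simp: Nf_def Ng_def sum_nonneg)
      have "(D * (\<Sum>a\<in>A. C a ^ p))\<^sup>2 \<le> \<rho>'\<^sup>2 * (Nf\<^sup>2) ^ p * (Ng\<^sup>2) ^ p"
        unfolding Ceq N2[symmetric] D_def
      proof (rule bound[OF ep A])
        show "x + a \<in> ?U'" if "x \<in> ?U" "a \<in> A" for x a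
          using latbox_add[OF that(1), of a K] that(2) AK by (auto simp: add.commute)
      qed (use f g ep in \<open>auto intro: finite_latbox\<close>)
      also have "\<dots> = (\<rho>' * (Nf * Ng) ^ p)\<^sup>2"
        by (simp only: power_mult_distrib power_mult[symmetric] mult.commute[of 2 p] mult.assoc)
      finally have "D * (\<Sum>a\<in>A. C a ^ p) \<le> \<rho>' * (Nf * Ng) ^ p"
        by (rule power2_le_imp_le) (use rp N0 in \<open>simp add: less_imp_le\<close>)
      then have CS: "(\<Sum>a\<in>A. C a ^ p) \<le> (\<tau> * Nf * Ng) ^ p"
        using D by (simp add: power_mult_distrib \<tau>p field_simps)
      have "(\<Sum>a\<in>A. c a ^ q * C a) ^ p \<le> (\<Sum>a\<in>A. C a ^ p) * (\<Sum>a\<in>A. c a ^ p) ^ q"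
        unfolding q using A c C0 by (intro sum_Holder_power) auto
      also have "\<dots> \<le> (\<tau> * Nf * Ng) ^ p" using c CS by simp
      finally have "(\<Sum>a\<in>A. c a ^ q * C a) \<le> \<tau> * Nf * Ng"
        using \<tau>0 N0 p_pos by (rule_tac power_le_imp_le_base[of _ q]) (auto simp: q)
      then show "(\<Sum>a\<in>A. c a ^ q * (\<Sum>\<gamma>\<in>?U. g \<gamma> * (sqrt (Qw \<gamma>) * sqrt (Qw (\<gamma> + a)) * f (\<gamma> + a))))
        \<le> \<tau> * sqrt (\<Sum>\<gamma>\<in>?U'. (f \<gamma>)\<^sup>2) * sqrt (\<Sum>\<gamma>\<in>?U. (g \<gamma>)\<^sup>2)"
        by (simp add: C_def Nf_def Ng_def)
    qed (use A c \<tau>0 ep Qw_pos Qw_le_1 in \<open>auto intro: finite_latbox simp: latbox_0\<close>)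
    also have "\<dots> \<le> \<tau> ^ n * sqrt ((2 * real (n * K) + 1) ^ DIM('a))"
    proof -
      have "real (card (latbox ep (n * K) :: 'a set)) \<le> real ((2 * (n * K) + 1) ^ DIM('a))"
        using card_latbox_le[OF ep(1), of "n * K", where 'a = 'a] by (simp only: of_nat_le_iff)
      then show ?thesis using \<tau>0 by (intro mult_left_mono real_sqrt_le_mono) (auto simp: add.commute)
    qed
    finally show "J Qw (\<lambda>a. c a ^ q) A n 0 \<le> root p (\<rho>' / ep ^ DIM('a)) ^ n * sqrt ((2 * real (n * K) + 1) ^ DIM('a))"
      by (simp add: \<tau>_def D_def)
  qed
qed

definition IQr :: real where "IQr = enn2real IQ"

lemma lattice_sum_Qw:
  obtains s where "0 < s" "\<And>ep U. 0 < ep \<Longrightarrow> ep \<le> s \<Longrightarrow> finite U \<Longrightarrow> U \<subseteq> lat ep \<Longrightarrow> ep ^ DIM('a) * (\<Sum>x\<in>U. Qw x ^ p) \<le> 2 ^ p * IQr"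
proof -
  \<comment> \<open>With \<delta> = 1 the weight changes at most by the factor 2 on a cell, which is
    the origin of \<open>2 ^ p\<close>.\<close>
  obtain s1 where s1: "0 < s1" "\<And>x u. norm u \<le> s1 \<Longrightarrow> W (x + u) \<le> (1 + 1) * W x"
    using W_uniform[of 1] by auto
  show ?thesis
  proof (rule that[of "s1 / DIM('a)"])
    show "0 < s1 / DIM('a)" using s1 by simp
    fix ep and U :: "'a set" assume ep: "0 < ep" "ep \<le> s1 / DIM('a)" and U: "finite U" "U \<subseteq> lat ep"
    have "ennreal (ep ^ DIM('a)) * (\<Sum>x\<in>U. ennreal (Qw x ^ p / 2 ^ p)) \<le> IQ"
      unfolding IQ_def
    proof (rule lattice_sum_le_integral[OF ep(1) U])
      fix x r :: 'a assume r: "r \<in> cell ep"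
      have "norm r \<le> (\<Sum>b\<in>Basis. \<bar>r \<bullet> b\<bar>)" by (rule norm_le_l1)
      also have "\<dots> \<le> (\<Sum>b\<in>(Basis::'a set). s1 / DIM('a))" using r ep by (intro sum_mono) (auto simp: cell_def)
      finally have "W (x + r) \<le> 2 * W x" using s1(2)[of r x] by simp
      then have "Qw x / 2 \<le> 1 / W (x + r)" using W_pos[of x] W_pos[of "x + r"] by (simp add: Qw_def field_simps)
      then have "(Qw x / 2) ^ p \<le> (1 / W (x + r)) ^ p" using Qw_pos[of x] by (intro power_mono) auto
      then show "ennreal (Qw x ^ p / 2 ^ p) \<le> ennreal ((1 / W (x + r)) ^ p)" by (simp add: power_divide ennreal_leI)
    qed measurable
    moreover have "ennreal (ep ^ DIM('a)) * (\<Sum>x\<in>U. ennreal (Qw x ^ p / 2 ^ p)) = ennreal (ep ^ DIM('a) * (\<Sum>x\<in>U. Qw x ^ p / 2 ^ p))"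
      using ep Qw_pos by (subst sum_ennreal) (auto simp: ennreal_mult[symmetric] sum_nonneg less_imp_le)
    ultimately have "ennreal (ep ^ DIM('a) * (\<Sum>x\<in>U. Qw x ^ p / 2 ^ p)) \<le> ennreal IQr"
      using IQ_finite by (simp add: IQr_def)
    then have "ep ^ DIM('a) * (\<Sum>x\<in>U. Qw x ^ p / 2 ^ p) \<le> IQr" by (simp add: IQr_def)
    then show "ep ^ DIM('a) * (\<Sum>x\<in>U. Qw x ^ p) \<le> 2 ^ p * IQr"
      by (simp add: sum_divide_distrib[symmetric] field_simps)
  qed
qed

end

section \<open>Tails of lattice sums and Riemann sums\<close>

lemma SUP_times_incseq:
  fixes f g :: "nat \<Rightarrow> ennreal"
  assumes "incseq f" "incseq g"
  shows "(SUP n. f n * g n) = (SUP n. f n) * (SUP n. g n)"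
proof (rule antisym)
  show "(SUP n. f n * g n) \<le> (SUP n. f n) * (SUP n. g n)"
    by (intro SUP_least mult_mono SUP_upper) auto
  have "f i * g j \<le> (SUP n. f n * g n)" for i j
  proof -
    have "f i * g j \<le> f (max i j) * g (max i j)" using assms by (intro mult_mono) (auto simp: incseq_def)
    then show ?thesis by (meson SUP_upper2 UNIV_I)
  qed
  then show "(SUP n. f n) * (SUP n. g n) \<le> (SUP n. f n * g n)"
    unfolding SUP_mult_left_ennreal SUP_mult_right_ennreal by (intro SUP_least)
qed

lemma nn_integral_lborel_reflect:
  fixes f :: "'a::euclidean_space \<Rightarrow> ennreal"
  assumes [measurable]: "f \<in> borel_measurable borel"
  shows "(\<integral>\<^sup>+x. f (c - x) \<partial>lborel) = (\<integral>\<^sup>+x. f x \<partial>lborel)"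
proof -
  have "(\<integral>\<^sup>+x. f x \<partial>lborel) = (\<integral>\<^sup>+x. f x \<partial>density (distr lborel borel (\<lambda>x. c + (- 1) *\<^sub>R x)) (\<lambda>_. ennreal (\<bar>- 1\<bar> ^ DIM('a))))"
    by (subst lborel_affine[of "- 1" c]) auto
  also have "\<dots> = (\<integral>\<^sup>+x. f (c - x) \<partial>lborel)"
    by (simp add: nn_integral_density nn_integral_distr)
  finally show ?thesis ..
qed

text \<open>\<open>A0\<close> is a finite set whose sum comes within \<open>t\<close> of the
  supremum of all finite sums; a further disjoint set can then add at most \<open>t\<close>.\<close>

lemma small_tail_sums:
  fixes R :: "'b \<Rightarrow> real"
  assumes R: "\<And>x. 0 \<le> R x" and bd: "\<And>U. finite U \<Longrightarrow> U \<subseteq> L \<Longrightarrow> sum R U \<le> s" and t: "0 < t"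
  obtains A0 where "finite A0" "A0 \<subseteq> L" "\<And>U. finite U \<Longrightarrow> U \<subseteq> L - A0 \<Longrightarrow> sum R U \<le> t"
proof -
  define \<S> where "\<S> = sum R ` {U. finite U \<and> U \<subseteq> L}"
  have ne: "\<S> \<noteq> {}" unfolding \<S>_def by auto
  have bdd: "bdd_above \<S>" unfolding \<S>_def using bd by (intro bdd_aboveI[of _ s]) auto
  obtain y where "y \<in> \<S>" "Sup \<S> - t < y" using less_cSupD[OF ne, of "Sup \<S> - t"] t by auto
  then obtain A0 where A0: "finite A0" "A0 \<subseteq> L" "Sup \<S> - t < sum R A0" unfolding \<S>_def by auto
  have "sum R U \<le> t" if U: "finite U" "U \<subseteq> L - A0" for U
  proof -
    have "sum R A0 + sum R U = sum R (A0 \<union> U)" using A0 U by (intro sum.union_disjoint[symmetric]) auto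
    also have "\<dots> \<le> Sup \<S>" using A0 U by (intro cSup_upper bdd) (auto simp: \<S>_def)
    finally show ?thesis using A0 by linarith
  qed
  then show ?thesis using that A0 by blast
qed

text \<open>The sum is the integral of \<open>v\<close> after rounding down to the lattice. Only
  lattice points where \<open>v\<close> is nonzero must belong to \<open>A j\<close>, so index sets
  adapted to the support are allowed.\<close>

lemma Riemann_lattice_sum:
  fixes v :: "'a::euclidean_space \<Rightarrow> real" and ep :: "nat \<Rightarrow> real"
  assumes v: "continuous_on UNIV v" and supp: "\<And>x. norm x > R \<Longrightarrow> v x = 0"
    and ep: "\<And>j. 0 < ep j" "ep \<longlonglongrightarrow> 0"
    and A: "\<And>j. finite (A j)" "\<And>j. A j \<subseteq> lat (ep j)" "\<And>j x. x \<in> lat (ep j) \<Longrightarrow> v x \<noteq> 0 \<Longrightarrow> x \<in> A j"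
  shows "(\<lambda>j. ep j ^ DIM('a) * (\<Sum>x\<in>A j. v x)) \<longlonglongrightarrow> (\<integral>x. v x \<partial>lborel)"
proof -
  have [measurable]: "v \<in> borel_measurable borel" by (rule borel_measurable_continuous_onI[OF v])
  obtain B where B: "\<And>x. \<bar>v x\<bar> \<le> B" "0 \<le> B"
  proof -
    have "bounded (v ` cball 0 R)"
      by (intro compact_imp_bounded compact_continuous_image continuous_on_subset[OF v]) auto
    then obtain b where "\<forall>y\<in>v ` cball 0 R. norm y \<le> b" unfolding bounded_iff by blast
    then have b: "\<bar>v x\<bar> \<le> b" if "x \<in> cball 0 R" for x using that by simp
    have "\<bar>v x\<bar> \<le> max 0 b" for x
      using b[of x] supp[of x] by (cases "norm x \<le> R") auto
    then show ?thesis using that[of "max 0 b"] by simp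
  qed
  let ?d = "real DIM('a)"
  let ?g = "\<lambda>j l. \<Sum>x\<in>A j. v x * indicat_real (cell (ep j)) (l - x)"
  define rd where "rd j l = (\<Sum>b\<in>Basis. (ep j * of_int \<lfloor>(l \<bullet> b) / ep j\<rfloor>) *\<^sub>R b)" for j and l :: 'a
  have rdb: "rd j l \<bullet> b = ep j * of_int \<lfloor>(l \<bullet> b) / ep j\<rfloor>" if "b \<in> Basis" for j l b
    using that by (simp add: rd_def inner_sum_left inner_Basis if_distrib sum.delta cong: if_cong)
  have rd_lat: "rd j l \<in> lat (ep j)" for j l using rdb by (auto simp: lat_def)
  have rd_cell: "l - rd j l \<in> cell (ep j)" for j l
    unfolding cell_def
  proof (intro CollectI ballI conjI)
    fix b :: 'a assume b: "b \<in> Basis"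
    have "of_int \<lfloor>(l \<bullet> b) / ep j\<rfloor> \<le> (l \<bullet> b) / ep j" "(l \<bullet> b) / ep j < of_int \<lfloor>(l \<bullet> b) / ep j\<rfloor> + 1" by linarith+
    then have "of_int \<lfloor>(l \<bullet> b) / ep j\<rfloor> * ep j \<le> l \<bullet> b" "l \<bullet> b < (of_int \<lfloor>(l \<bullet> b) / ep j\<rfloor> + 1) * ep j"
      using ep(1)[of j] by (simp_all only: pos_le_divide_eq pos_divide_less_eq)
    then show "0 \<le> (l - rd j l) \<bullet> b" "(l - rd j l) \<bullet> b < ep j"
      by (simp_all add: inner_diff_left rdb[OF b] algebra_simps)
  qed
  have cell_norm: "norm u \<le> ?d * e" if "u \<in> cell e" for u :: 'a and e
  proof -
    have "norm u \<le> (\<Sum>b\<in>Basis. \<bar>u \<bullet> b\<bar>)" by (rule norm_le_l1)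
    also have "\<dots> \<le> (\<Sum>b\<in>(Basis::'a set). e)" using that by (intro sum_mono) (auto simp: cell_def)
    finally show ?thesis by simp
  qed
  have geq: "?g j l = v (rd j l)" for j l
  proof -
    have "?g j l = (\<Sum>x\<in>A j. if x = rd j l then v (rd j l) else 0)"
      using cell_unique[OF ep(1), of _ j "rd j l" l] A(2) rd_lat rd_cell
      by (intro sum.cong refl) (auto simp: indicator_def)
    then show ?thesis using A(1) A(3)[OF rd_lat[of j l]] by (auto simp: sum.delta)
  qed
  have int: "(\<integral>l. ?g j l \<partial>lborel) = ep j ^ DIM('a) * (\<Sum>x\<in>A j. v x)" for j
  proof -
    have hb: "has_bochner_integral lborel (\<lambda>l. indicat_real (cell (ep j)) (l - x)) (ep j ^ DIM('a))" for x :: 'a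
      using nn_integral_cell_shift[OF ep(1), of j x] ep(1)[of j]
      by (intro has_bochner_integral_nn_integral) (auto simp: ennreal_indicator)
    have "(\<integral>l. ?g j l \<partial>lborel) = (\<Sum>x\<in>A j. v x * ep j ^ DIM('a))"
      using hb by (subst Bochner_Integration.integral_sum) (auto simp: has_bochner_integral_iff)
    then show ?thesis by (simp add: sum_distrib_right[symmetric] mult.commute)
  qed
  \<comment> \<open>Once the mesh is below 1 all step functions vanish outside one ball of radius R
    + d, which makes a single dominating function possible.\<close>
  have b1: "\<forall>\<^sub>F j in sequentially. ep j < 1" using ep(2) by (intro order_tendstoD(2)) auto
  then obtain j0 where j0: "\<And>j. j \<ge> j0 \<Longrightarrow> ep j < 1" by (auto simp: eventually_sequentially)
  have "(\<lambda>j. \<integral>l. ?g (j + j0) l \<partial>lborel) \<longlonglongrightarrow> (\<integral>x. v x \<partial>lborel)"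
  proof (rule integral_dominated_convergence[where w = "\<lambda>l. indicat_real (cball 0 (R + ?d)) l * B"])
    show "integrable lborel (\<lambda>l::'a. indicat_real (cball 0 (R + ?d)) l * B)"
      using emeasure_lborel_cball_finite by (intro integrable_mult_left integrable_real_indicator) auto
    show "AE l in lborel. (\<lambda>j. ?g (j + j0) l) \<longlonglongrightarrow> v l"
    proof (rule AE_I2)
      fix l :: 'a
      have "(\<lambda>j. rd j l - l) \<longlonglongrightarrow> 0"
      proof (rule Lim_null_comparison)
        show "\<forall>\<^sub>F j in sequentially. norm (rd j l - l) \<le> ?d * ep j"
          using cell_norm[OF rd_cell] by (auto simp: norm_minus_commute)
        show "(\<lambda>j. ?d * ep j) \<longlonglongrightarrow> 0" using tendsto_mult_left[OF ep(2), of ?d] by simp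
      qed
      then have "(\<lambda>j. rd j l) \<longlonglongrightarrow> l" by (simp add: LIM_zero_iff)
      then have "(\<lambda>j. v (rd j l)) \<longlonglongrightarrow> v l"
        using v by (intro isCont_tendsto_compose[of l v]) (auto simp: continuous_on_eq_continuous_at)
      then show "(\<lambda>j. ?g (j + j0) l) \<longlonglongrightarrow> v l" unfolding geq by (rule LIMSEQ_ignore_initial_segment)
    qed
    show "AE l in lborel. norm (?g (j + j0) l) \<le> indicat_real (cball 0 (R + ?d)) l * B" for j
    proof (rule AE_I2)
      fix l :: 'a
      show "norm (?g (j + j0) l) \<le> indicat_real (cball 0 (R + ?d)) l * B"
      proof (cases "norm l \<le> R + ?d")
        case True then show ?thesis using B unfolding geq by simp
      next
        case False
        have "norm (l - rd (j + j0) l) \<le> ?d * ep (j + j0)" by (rule cell_norm[OF rd_cell])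
        also have "\<dots> \<le> ?d" using j0[of "j + j0"] by (simp add: mult_left_le)
        finally have "norm (rd (j + j0) l) > R" using False norm_triangle_ineq2[of l "rd (j + j0) l"] by linarith
        then show ?thesis unfolding geq using supp B by simp
      qed
    qed
  qed measurable
  then show ?thesis unfolding int by (rule LIMSEQ_offset)
qed

section \<open>Regular near maximisers\<close>

context stable_data begin

text \<open>Truncation in height and radius approximates f / sqrt W monotonically from below. The
  positive floor on the ball fixes the support as a full ball, so that a mollified version is
  positive on exactly a larger ball.\<close>

lemma truncated_maximizer:
  assumes "0 \<le> r" "r < rho \<psi> p" and \<delta>: "0 < \<delta>"
  obtains F K where "F \<in> borel_measurable borel" "0 < K" "\<And>x. norm x > K \<Longrightarrow> F x = 0" "\<And>x. 0 \<le> F x"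
    "\<And>x. F x \<le> K" "\<exists>\<kappa>>0. \<forall>x. norm x \<le> K \<longrightarrow> \<kappa> \<le> F x"
    "(\<integral>\<^sup>+x. ennreal ((F x)\<^sup>2 * W x) \<partial>lborel) \<le> ennreal (1 + \<delta>)"
    "ennreal r < corr_pow p (\<lambda>x. ennreal (F x)) (\<lambda>x. ennreal (F x))"
proof -
  obtain f where f: "f \<in> borel_measurable borel" "\<And>x. 0 \<le> f x" "(\<integral>\<^sup>+x. ennreal ((f x)\<^sup>2) \<partial>lborel) = 1"
    "ennreal r < corr_pow p (\<lambda>x. ennreal (f x / sqrt (W x))) (\<lambda>x. ennreal (f x / sqrt (W x)))"
    using rho_approx[OF assms(1,2)] by blast
  note f(1)[measurable]
  define G where "G x = f x / sqrt (W x)" for x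
  have G0: "0 \<le> G x" for x using f(2)[of x] W_pos[of x] by (simp add: G_def)
  have GW: "(G x)\<^sup>2 * W x = (f x)\<^sup>2" for x using W_pos[of x] by (simp add: G_def power_divide)
  have [measurable]: "G \<in> borel_measurable borel" unfolding G_def[abs_def] by measurable
  define T where "T k x = ennreal (min (G x) (real k) * indicat_real (cball 0 (real k)) x)" for k x
  have ind [measurable]: "(\<lambda>x. indicat_real (cball (0::'a) r) x) \<in> borel_measurable borel" for r
    by (rule borel_measurable_indicator) simp
  have [measurable]: "(\<lambda>x. indicator (cball (0::'a) r) x :: ennreal) \<in> borel_measurable borel" for r
    by (rule borel_measurable_indicator) simp
  have [measurable]: "T k \<in> borel_measurable borel" for k
    unfolding T_def by measurable
  have Tmono: "T k x \<le> T (Suc k) x" for k x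
    unfolding T_def by (intro ennreal_leI mult_mono) (auto simp: indicator_def G0)
  have TG: "(SUP k. T k x) = ennreal (G x)" for x
  proof (rule antisym)
    show "(SUP k. T k x) \<le> ennreal (G x)"
      unfolding T_def by (intro SUP_least ennreal_leI) (auto simp: indicator_def G0)
    obtain k where "max (G x) (norm x) \<le> real k" using real_arch_simple by blast
    then have "T k x = ennreal (G x)" by (simp add: T_def)
    then show "ennreal (G x) \<le> (SUP k. T k x)" by (metis SUP_upper UNIV_I)
  qed
  have incT: "incseq (\<lambda>k. T k x)" for x by (intro incseq_SucI Tmono)
  have corrT: "(SUP k. corr (T k) (T k) l) = corr (\<lambda>x. ennreal (G x)) (\<lambda>x. ennreal (G x)) l" for l
  proof -
    have "corr (\<lambda>x. ennreal (G x)) (\<lambda>x. ennreal (G x)) l = (\<integral>\<^sup>+x. (SUP k. T k (l + x) * T k x) \<partial>lborel)"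
      unfolding corr_def TG[symmetric] using incT
      by (intro nn_integral_cong SUP_times_incseq[symmetric] incT)
    also have "\<dots> = (SUP k. corr (T k) (T k) l)"
      unfolding corr_def
      by (rule nn_integral_monotone_convergence_SUP) (auto intro!: incseq_SucI le_funI mult_mono Tmono)
    finally show ?thesis ..
  qed
  have "(SUP k. corr_pow p (T k) (T k)) = corr_pow p (\<lambda>x. ennreal (G x)) (\<lambda>x. ennreal (G x))"
  proof -
    have incc: "incseq (\<lambda>k. corr (T k) (T k) l)" for l by (intro incseq_SucI corr_mono Tmono)
    have pw: "(SUP k. corr (T k) (T k) l ^ m) = (SUP k. corr (T k) (T k) l) ^ m" for l m
    proof (induction m)
      case (Suc m)
      have "(SUP k. corr (T k) (T k) l ^ Suc m) = (SUP k. corr (T k) (T k) l) * (SUP k. corr (T k) (T k) l ^ m)"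
        unfolding power_Suc using incc[of l]
        by (intro SUP_times_incseq) (auto simp: incseq_def intro!: power_mono_ennreal)
      then show ?case using Suc by simp
    qed simp
    have "(SUP k. corr_pow p (T k) (T k)) = (\<integral>\<^sup>+l. (SUP k. corr (T k) (T k) l ^ p) \<partial>lborel)"
      unfolding corr_pow_def
      by (rule nn_integral_monotone_convergence_SUP[symmetric])
         (auto intro!: incseq_SucI le_funI power_mono_ennreal corr_mono Tmono)
    then show ?thesis unfolding pw corrT corr_pow_def .
  qed
  then have "ennreal r < (SUP k. corr_pow p (T k) (T k))" using f(4) by (simp add: G_def)
  then obtain k0 where k0: "ennreal r < corr_pow p (T k0) (T k0)" unfolding less_SUP_iff by auto
  \<comment> \<open>The successor makes the radius positive; by monotonicity the functional does not
    decrease.\<close>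
  define k where "k = Suc k0"
  have k: "0 < k" by (simp add: k_def)
  have "corr_pow p (T k0) (T k0) \<le> corr_pow p (T k) (T k)"
    unfolding corr_pow_def k_def by (intro nn_integral_mono power_mono_ennreal corr_mono Tmono)
  with k0 have k_gt: "ennreal r < corr_pow p (T k) (T k)" by (rule less_le_trans)
  have "bounded (W ` cball 0 (real k))"
    unfolding W_def[abs_def]
    by (intro compact_imp_bounded compact_continuous_image continuous_intros continuous_on_subset[OF psi_cont]) auto
  then obtain B where "\<forall>y\<in>W ` cball 0 (real k). norm y \<le> B" unfolding bounded_iff by blast
  then have B: "W x \<le> B" if "norm x \<le> real k" for x using that by force
  have B0: "0 \<le> B" using B[of 0] W_pos[of 0] by simp
  obtain V where V: "emeasure lborel (cball (0::'a) (real k)) = ennreal V" "0 \<le> V"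
    using emeasure_cball[of "real k" "0::'a"] by auto
  \<comment> \<open>The floor adds at most \<kappa>^2 B V to the energy, where B bounds W on the
    ball and V is its volume; this choice keeps the addition below \<delta>.\<close>
  define \<kappa> where "\<kappa> = min 1 (\<delta> / (1 + B * V))"
  have \<kappa>: "0 < \<kappa>" "\<kappa> \<le> 1" "\<kappa>\<^sup>2 * (B * V) \<le> \<delta>"
  proof -
    have BV: "0 \<le> B * V" using B0 V by simp
    then show 1: "0 < \<kappa>" "\<kappa> \<le> 1" using \<delta> by (auto simp: \<kappa>_def)
    have "\<kappa>\<^sup>2 \<le> \<kappa>" using 1 by (simp add: power2_eq_square mult_left_le)
    then have "\<kappa>\<^sup>2 * (B * V) \<le> \<kappa> * (B * V)" using BV by (intro mult_right_mono)
    also have "\<dots> \<le> (\<delta> / (1 + B * V)) * (1 + B * V)" using BV \<delta> by (intro mult_mono) (auto simp: \<kappa>_def)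
    also have "\<dots> = \<delta>" using BV by simp
    finally show "\<kappa>\<^sup>2 * (B * V) \<le> \<delta>" .
  qed
  define F where "F x = max (min (G x) (real k)) \<kappa> * indicat_real (cball 0 (real k)) x" for x
  have Fm: "F \<in> borel_measurable borel" unfolding F_def[abs_def] by measurable
  have en: "(\<integral>\<^sup>+x. ennreal ((F x)\<^sup>2 * W x) \<partial>lborel) \<le> ennreal (1 + \<delta>)"
  proof -
    have "(\<integral>\<^sup>+x. ennreal ((F x)\<^sup>2 * W x) \<partial>lborel)
      \<le> (\<integral>\<^sup>+x. ennreal ((f x)\<^sup>2) + ennreal (\<kappa>\<^sup>2 * B) * indicator (cball 0 (real k)) x \<partial>lborel)"
    proof (intro nn_integral_mono)
      fix x
      show "ennreal ((F x)\<^sup>2 * W x) \<le> ennreal ((f x)\<^sup>2) + ennreal (\<kappa>\<^sup>2 * B) * indicator (cball 0 (real k)) x"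
      proof (cases "norm x \<le> real k")
        case True
        have "(F x)\<^sup>2 \<le> (G x)\<^sup>2 + \<kappa>\<^sup>2"
        proof (cases "min (G x) (real k) \<le> \<kappa>")
          case False
          then have "F x \<le> G x" "0 \<le> F x" using True \<kappa> by (auto simp: F_def)
          then have "(F x)\<^sup>2 \<le> (G x)\<^sup>2" by (rule power_mono)
          then show ?thesis by (smt (verit) zero_le_power2)
        qed (use True in \<open>simp add: F_def max_def\<close>)
        then have "(F x)\<^sup>2 * W x \<le> ((G x)\<^sup>2 + \<kappa>\<^sup>2) * W x" using W_pos[of x] by (intro mult_right_mono) auto
        also have "\<dots> \<le> (f x)\<^sup>2 + \<kappa>\<^sup>2 * B" using B[OF True] by (simp add: distrib_right GW mult_left_mono)
        finally have "ennreal ((F x)\<^sup>2 * W x) \<le> ennreal ((f x)\<^sup>2 + \<kappa>\<^sup>2 * B)" by (rule ennreal_leI)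
        then show ?thesis using True B0 by (simp add: ennreal_plus)
      qed (simp add: F_def)
    qed
    also have "\<dots> = 1 + ennreal (\<kappa>\<^sup>2 * B) * ennreal V"
      by (subst nn_integral_add) (auto simp: f(3) nn_integral_cmult_indicator V)
    also have "\<dots> = ennreal (1 + \<kappa>\<^sup>2 * B * V)" using B0 V by (simp add: ennreal_mult[symmetric] ennreal_plus)
    also have "\<dots> \<le> ennreal (1 + \<delta>)" using \<kappa> by (intro ennreal_leI) (simp add: mult.assoc)
    finally show ?thesis .
  qed
  have "T k x \<le> ennreal (F x)" for x unfolding T_def F_def by (intro ennreal_leI) (auto simp: indicator_def)
  then have "corr_pow p (T k) (T k) \<le> corr_pow p (\<lambda>x. ennreal (F x)) (\<lambda>x. ennreal (F x))"
    unfolding corr_pow_def by (intro nn_integral_mono power_mono_ennreal corr_mono)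
  with k_gt have gt: "ennreal r < corr_pow p (\<lambda>x. ennreal (F x)) (\<lambda>x. ennreal (F x))" by (rule less_le_trans)
  show ?thesis
  proof (rule that[OF Fm _ _ _ _ _ en gt, of "real k"])
    show "F x \<le> real k" for x using \<kappa> k by (auto simp: F_def indicator_def)
    show "\<exists>\<kappa>>0. \<forall>x. norm x \<le> real k \<longrightarrow> \<kappa> \<le> F x" using \<kappa> by (intro exI[of _ \<kappa>]) (auto simp: F_def)
  qed (use k \<kappa> in \<open>auto simp: F_def G0 indicator_def\<close>)
qed

text \<open>The same pointwise Cauchy--Schwarz inequality as for lattice functions makes mollification
  of \<open>F\<^sup>2\<close> harmless.\<close>

lemma continuous_maximizer:
  assumes r: "0 \<le> r" "r < rho \<psi> p" and \<delta>: "0 < \<delta>"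
  obtains u R where "continuous_on UNIV u" "0 < R" "\<And>x. 0 \<le> u x" "\<And>x. 0 < u x \<longleftrightarrow> norm x < R"
    "(\<integral>\<^sup>+x. ennreal ((u x)\<^sup>2 * W x) \<partial>lborel) \<le> ennreal (1 + \<delta>)"
    "ennreal r < corr_pow p (\<lambda>x. ennreal (u x)) (\<lambda>x. ennreal (u x))"
proof -
  \<comment> \<open>Two factors 1 + \<delta>1 have to fit below 1 + \<delta>: one from the
    truncation, one from shifting the argument of W by at most s.\<close>
  define \<delta>1 where "\<delta>1 = min 1 (\<delta> / 3)"
  have \<delta>1: "0 < \<delta>1" "(1 + \<delta>1) * (1 + \<delta>1) \<le> 1 + \<delta>"
  proof -
    show "0 < \<delta>1" using \<delta> by (simp add: \<delta>1_def)
    have "\<delta>1 * \<delta>1 \<le> \<delta>1" using \<delta> by (intro mult_left_le) (auto simp: \<delta>1_def)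
    moreover have "3 * \<delta>1 \<le> \<delta>" by (simp add: \<delta>1_def)
    ultimately show "(1 + \<delta>1) * (1 + \<delta>1) \<le> 1 + \<delta>" by (simp add: algebra_simps)
  qed
  obtain F K where Fm [measurable]: "F \<in> borel_measurable borel" and K: "0 < K" "\<And>x. norm x > K \<Longrightarrow> F x = 0" and F0: "\<And>x. 0 \<le> F x"
    and FK: "\<And>x. F x \<le> K" and low: "\<exists>\<kappa>>0. \<forall>x. norm x \<le> K \<longrightarrow> \<kappa> \<le> F x"
    and en: "(\<integral>\<^sup>+x. ennreal ((F x)\<^sup>2 * W x) \<partial>lborel) \<le> ennreal (1 + \<delta>1)"
    and gt: "ennreal r < corr_pow p (\<lambda>x. ennreal (F x)) (\<lambda>x. ennreal (F x))"
    using truncated_maximizer[OF r \<delta>1(1)] by blast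
  obtain \<kappa> where \<kappa>: "0 < \<kappa>" "\<And>x. norm x \<le> K \<Longrightarrow> \<kappa> \<le> F x" using low by auto
  obtain s where s: "0 < s" "\<And>x v. norm v \<le> s \<Longrightarrow> W (x + v) \<le> (1 + \<delta>1) * W x"
    using W_uniform[OF \<delta>1(1)] by blast
  \<comment> \<open>A tent function, continuous and positive exactly on the open ball of radius s;
    this determines where the mollified function is positive.\<close>
  define k0 where "k0 v = max 0 (s - norm v)" for v :: 'a
  have k0c: "continuous_on UNIV k0" unfolding k0_def by (intro continuous_intros)
  have [measurable]: "k0 \<in> borel_measurable borel" by (rule borel_measurable_continuous_onI[OF k0c])
  have k0b: "k0 v \<le> s * indicator (cball 0 s) v" "0 \<le> k0 v" "k0 v \<le> s" "0 < k0 v \<longleftrightarrow> norm v < s" for v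
    using s by (auto simp: k0_def indicator_def)
  have ik0: "integrable lborel k0"
  proof (rule Bochner_Integration.integrable_bound)
    show "integrable lborel (\<lambda>v::'a. s * indicat_real (cball 0 s) v)"
      using emeasure_lborel_cball_finite by (intro integrable_mult_right integrable_real_indicator) auto
  qed (use k0b s in auto)
  define Z where "Z = (\<integral>v. k0 v \<partial>lborel)"
  have Z: "0 < Z"
  proof -
    have "(\<integral>v. (s / 2) * indicat_real (cball (0::'a) (s / 2)) v \<partial>lborel) \<le> Z"
      unfolding Z_def using s emeasure_lborel_cball_finite ik0
      by (intro integral_mono integrable_mult_right integrable_real_indicator) (auto simp: k0_def indicator_def)
    moreover have "(\<integral>v. (s / 2) * indicat_real (cball (0::'a) (s / 2)) v \<partial>lborel) = (s / 2) * measure lborel (cball (0::'a) (s / 2))"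
      by simp
    moreover have "0 < (s / 2) * measure lborel (cball (0::'a) (s / 2))" using s by (simp add: content_cball_pos)
    ultimately show ?thesis by linarith
  qed
  define k where "k v = k0 v / Z" for v
  have [measurable]: "k \<in> borel_measurable borel" unfolding k_def by measurable
  have kc: "continuous_on UNIV k" unfolding k_def[abs_def] using k0c Z by (intro continuous_intros) auto
  have kb: "0 \<le> k v" "k v \<le> s / Z" "0 < k v \<longleftrightarrow> norm v < s" for v
    using k0b[of v] Z by (auto simp: k_def divide_right_mono zero_less_divide_iff)
  have k1: "(\<integral>\<^sup>+v. ennreal (k v) \<partial>lborel) = 1"
  proof -
    have "(\<integral>\<^sup>+v. ennreal (k v) \<partial>lborel) = ennreal (\<integral>v. k v \<partial>lborel)"
      unfolding k_def using ik0 kb(1) by (intro nn_integral_eq_integral) (auto simp: k_def)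
    then show ?thesis using Z by (simp add: k_def Z_def)
  qed
  have iF: "integrable lborel (\<lambda>y. (F y)\<^sup>2)"
  proof (rule Bochner_Integration.integrable_bound)
    show "integrable lborel (\<lambda>v::'a. K\<^sup>2 * indicat_real (cball 0 K) v)"
      using emeasure_lborel_cball_finite by (intro integrable_mult_right integrable_real_indicator) auto
    show "AE y in lborel. norm ((F y)\<^sup>2) \<le> norm (K\<^sup>2 * indicat_real (cball 0 K) y)"
      using K F0 FK by (intro AE_I2) (auto simp: indicator_def intro!: power_mono)
  qed simp
  define U where "U x = (\<integral>y. (F y)\<^sup>2 * k (x - y) \<partial>lborel)" for x
  have iU: "integrable lborel (\<lambda>y. (F y)\<^sup>2 * k (x - y))" for x
  proof (rule Bochner_Integration.integrable_bound)
    show "integrable lborel (\<lambda>y. (F y)\<^sup>2 * (s / Z))" using iF by (rule integrable_mult_left)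
    show "AE y in lborel. norm ((F y)\<^sup>2 * k (x - y)) \<le> norm ((F y)\<^sup>2 * (s / Z))"
    proof (rule AE_I2)
      fix y
      have "(F y)\<^sup>2 * k (x - y) \<le> (F y)\<^sup>2 * (s / Z)" by (intro mult_left_mono kb) simp
      moreover have "0 \<le> (F y)\<^sup>2 * k (x - y)" using kb(1) by simp
      ultimately show "norm ((F y)\<^sup>2 * k (x - y)) \<le> norm ((F y)\<^sup>2 * (s / Z))"
        unfolding real_norm_def using abs_ge_self[of "(F y)\<^sup>2 * (s / Z)"] by linarith
    qed
  qed measurable
  have U0: "0 \<le> U x" for x unfolding U_def using kb by (intro integral_nonneg_AE AE_I2) auto
  have Uc: "continuous_on UNIV U"
    unfolding continuous_on_eq_continuous_at[OF open_UNIV] continuous_at_sequentially comp_def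
  proof (intro ballI allI impI)
    fix x and xs :: "nat \<Rightarrow> 'a" assume "xs \<longlonglongrightarrow> x"
    show "(\<lambda>n. U (xs n)) \<longlonglongrightarrow> U x"
      unfolding U_def
    proof (rule integral_dominated_convergence[where w = "\<lambda>y. (F y)\<^sup>2 * (s / Z)"])
      show "integrable lborel (\<lambda>y. (F y)\<^sup>2 * (s / Z))" using iF by (rule integrable_mult_left)
      show "AE y in lborel. (\<lambda>n. (F y)\<^sup>2 * k (xs n - y)) \<longlonglongrightarrow> (F y)\<^sup>2 * k (x - y)"
      proof (intro AE_I2 tendsto_mult_left)
        fix y
        have "isCont k (x - y)" using kc by (simp add: continuous_on_eq_continuous_at)
        then show "(\<lambda>n. k (xs n - y)) \<longlonglongrightarrow> k (x - y)"
          using \<open>xs \<longlonglongrightarrow> x\<close> by (intro isCont_tendsto_compose[of _ k] tendsto_diff tendsto_const)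
      qed
      show "AE y in lborel. norm ((F y)\<^sup>2 * k (xs n - y)) \<le> (F y)\<^sup>2 * (s / Z)" for n
      proof (rule AE_I2)
        fix y
        have "(F y)\<^sup>2 * k (xs n - y) \<le> (F y)\<^sup>2 * (s / Z)" by (intro mult_left_mono kb) simp
        moreover have "0 \<le> (F y)\<^sup>2 * k (xs n - y)" using kb(1) by simp
        ultimately show "norm ((F y)\<^sup>2 * k (xs n - y)) \<le> (F y)\<^sup>2 * (s / Z)" by simp
      qed
    qed measurable
  qed
  have eU: "ennreal (U x) = (\<integral>\<^sup>+v. ennreal ((F (x - v))\<^sup>2 * k v) \<partial>lborel)" for x
  proof -
    have "ennreal (U x) = (\<integral>\<^sup>+y. ennreal ((F y)\<^sup>2 * k (x - y)) \<partial>lborel)"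
      unfolding U_def using iU kb by (intro nn_integral_eq_integral[symmetric]) auto
    also have "\<dots> = (\<integral>\<^sup>+v. ennreal ((F (x - v))\<^sup>2 * k (x - (x - v))) \<partial>lborel)"
      by (rule nn_integral_lborel_reflect[symmetric]) simp
    finally show ?thesis by simp
  qed
  \<comment> \<open>It is the square of \<open>F\<close> that is averaged: the energy is linear in
    it, and Cauchy-Schwarz in the averaging variable gives \<open>corr_le\<close>.\<close>
  define u where "u x = sqrt (U x)" for x
  have u0: "0 \<le> u x" for x using U0 by (simp add: u_def)
  have u2: "(u x)\<^sup>2 = U x" for x using U0 by (simp add: u_def)
  have uc: "continuous_on UNIV u" unfolding u_def[abs_def] using Uc by (intro continuous_intros)
  have [measurable]: "u \<in> borel_measurable borel" by (rule borel_measurable_continuous_onI[OF uc])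
  have upos: "0 < u x \<longleftrightarrow> norm x < K + s" for x
  proof
    assume "0 < u x"
    show "norm x < K + s"
    proof (rule ccontr)
      assume nx: "\<not> norm x < K + s"
      have z: "(F y)\<^sup>2 * k (x - y) = 0" for y
      proof (cases "norm y > K")
        case False
        then have "\<not> norm (x - y) < s" using nx norm_triangle_ineq2[of x y] by linarith
        then have "k (x - y) = 0" using kb(3)[of "x - y"] kb(1)[of "x - y"] by simp
        then show ?thesis by simp
      qed (simp add: K)
      have "U x = 0" unfolding U_def z by simp
      then show False using \<open>0 < u x\<close> by (simp add: u_def)
    qed
  next
    assume nx: "norm x < K + s"
    \<comment> \<open>The point c x with c = K/(K + s) divides the segment from 0 to x in the ratio
      K : s. Its norm is below K and its distance from x is below s, and a small ball around it
      keeps both properties.\<close>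
    obtain z t where z: "0 < t" "\<And>y. y \<in> ball z t \<Longrightarrow> norm y \<le> K \<and> norm (x - y) < s"
    proof -
      define c where "c = K / (K + s)"
      have c: "0 < c" "c < 1" using K s by (auto simp: c_def)
      define m where "m = K + s - norm x"
      define t where "t = min (c * m) ((1 - c) * m)"
      have m: "0 < m" using nx by (simp add: m_def)
      have cK: "c * (K + s) = K" using K s by (simp add: c_def)
      have "norm y \<le> K \<and> norm (x - y) < s" if y: "y \<in> ball (c *\<^sub>R x) t" for y
      proof
        have d: "norm (y - c *\<^sub>R x) < t" using y by (simp add: dist_norm norm_minus_commute)
        have "norm y \<le> c * norm x + norm (y - c *\<^sub>R x)" using norm_triangle_ineq2[of y "c *\<^sub>R x"] c by simp
        also have "\<dots> \<le> c * norm x + c * m" using d by (simp add: t_def)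
        also have "\<dots> = K" using cK by (simp add: m_def algebra_simps)
        finally show "norm y \<le> K" .
        have "norm ((1 - c) *\<^sub>R x - (y - c *\<^sub>R x)) \<le> (1 - c) * norm x + norm (y - c *\<^sub>R x)"
          using norm_triangle_ineq4[of "(1 - c) *\<^sub>R x" "y - c *\<^sub>R x"] c by simp
        moreover have "(1 - c) *\<^sub>R x - (y - c *\<^sub>R x) = x - y" by (simp add: algebra_simps)
        ultimately have "norm (x - y) \<le> (1 - c) * norm x + norm (y - c *\<^sub>R x)" by (simp only:)
        also have "\<dots> < (1 - c) * norm x + (1 - c) * m" using d by (simp add: t_def)
        also have "\<dots> = s" using cK by (simp add: m_def algebra_simps)
        finally show "norm (x - y) < s" .
      qed
      moreover have "0 < t" using c m by (simp add: t_def)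
      ultimately show ?thesis using that by blast
    qed
    have "U x \<noteq> 0"
    proof
      assume "U x = 0"
      then have "AE y in lborel. (F y)\<^sup>2 * k (x - y) = 0"
        unfolding U_def using iU kb by (subst (asm) integral_nonneg_eq_0_iff_AE) auto
      then have "AE y in lborel. y \<notin> ball z t"
      proof eventually_elim
        fix y assume y: "(F y)\<^sup>2 * k (x - y) = 0"
        show "y \<notin> ball z t"
        proof
          assume "y \<in> ball z t"
          then have "norm y \<le> K" "norm (x - y) < s" using z by auto
          then have "0 < F y" "0 < k (x - y)" using \<kappa> kb(3) by (force intro: less_le_trans)+
          then show False using y by simp
        qed
      qed
      then have "emeasure lborel (ball z t) = 0" by (subst (asm) AE_iff_measurable[of "ball z t"]) auto
      then show False using z(1) emeasure_ball[of t z] unit_ball_vol_pos[of "real DIM('a)"] by simp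
    qed
    then show "0 < u x" using U0[of x] by (simp add: u_def)
  qed
  have energy: "(\<integral>\<^sup>+x. ennreal ((u x)\<^sup>2 * W x) \<partial>lborel) \<le> ennreal (1 + \<delta>)"
  proof -
    have "(\<integral>\<^sup>+x. ennreal ((u x)\<^sup>2 * W x) \<partial>lborel) = (\<integral>\<^sup>+x. \<integral>\<^sup>+v. ennreal ((F (x - v))\<^sup>2 * W x) * ennreal (k v) \<partial>lborel \<partial>lborel)"
    proof (intro nn_integral_cong)
      fix x
      have "ennreal ((u x)\<^sup>2 * W x) = (\<integral>\<^sup>+v. ennreal ((F (x - v))\<^sup>2 * k v) \<partial>lborel) * ennreal (W x)"
        using U0 W_pos[of x] by (simp add: u2 ennreal_mult eU)
      also have "\<dots> = (\<integral>\<^sup>+v. ennreal ((F (x - v))\<^sup>2 * k v) * ennreal (W x) \<partial>lborel)"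
        by (rule nn_integral_multc[symmetric]) simp
      also have "\<dots> = (\<integral>\<^sup>+v. ennreal ((F (x - v))\<^sup>2 * W x) * ennreal (k v) \<partial>lborel)"
        using kb W_pos[of x] by (intro nn_integral_cong) (simp add: ennreal_mult[symmetric] less_imp_le mult_ac)
      finally show "ennreal ((u x)\<^sup>2 * W x) = (\<integral>\<^sup>+v. ennreal ((F (x - v))\<^sup>2 * W x) * ennreal (k v) \<partial>lborel)" .
    qed
    also have "\<dots> = (\<integral>\<^sup>+v. \<integral>\<^sup>+x. ennreal ((F (x - v))\<^sup>2 * W x) * ennreal (k v) \<partial>lborel \<partial>lborel)"
      by (rule lborel_pair.Fubini') simp
    also have "\<dots> = (\<integral>\<^sup>+v. (\<integral>\<^sup>+x. ennreal ((F x)\<^sup>2 * W (x + v)) \<partial>lborel) * ennreal (k v) \<partial>lborel)"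
    proof (intro nn_integral_cong)
      fix v
      have "(\<integral>\<^sup>+x. ennreal ((F (x - v))\<^sup>2 * W x) * ennreal (k v) \<partial>lborel) = (\<integral>\<^sup>+x. ennreal ((F (x - v))\<^sup>2 * W x) \<partial>lborel) * ennreal (k v)"
        by (rule nn_integral_multc) simp
      also have "(\<integral>\<^sup>+x. ennreal ((F (x - v))\<^sup>2 * W x) \<partial>lborel) = (\<integral>\<^sup>+x. ennreal ((F x)\<^sup>2 * W (x + v)) \<partial>lborel)"
        using nn_integral_lborel_shift[of "\<lambda>x. ennreal ((F (x - v))\<^sup>2 * W x)" v] by (simp add: add.commute)
      finally show "(\<integral>\<^sup>+x. ennreal ((F (x - v))\<^sup>2 * W x) * ennreal (k v) \<partial>lborel) = (\<integral>\<^sup>+x. ennreal ((F x)\<^sup>2 * W (x + v)) \<partial>lborel) * ennreal (k v)" .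
    qed
    also have "\<dots> \<le> (\<integral>\<^sup>+v. ennreal (1 + \<delta>) * ennreal (k v) \<partial>lborel)"
    proof (intro nn_integral_mono)
      fix v
      show "(\<integral>\<^sup>+x. ennreal ((F x)\<^sup>2 * W (x + v)) \<partial>lborel) * ennreal (k v) \<le> ennreal (1 + \<delta>) * ennreal (k v)"
      proof (cases "norm v < s")
        case True
        have "(\<integral>\<^sup>+x. ennreal ((F x)\<^sup>2 * W (x + v)) \<partial>lborel) \<le> (\<integral>\<^sup>+x. ennreal (1 + \<delta>1) * ennreal ((F x)\<^sup>2 * W x) \<partial>lborel)"
        proof (intro nn_integral_mono)
          fix x
          have "(F x)\<^sup>2 * W (x + v) \<le> (F x)\<^sup>2 * ((1 + \<delta>1) * W x)" using s(2)[of v x] True by (intro mult_left_mono) auto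
          then show "ennreal ((F x)\<^sup>2 * W (x + v)) \<le> ennreal (1 + \<delta>1) * ennreal ((F x)\<^sup>2 * W x)"
            using \<delta>1 W_pos[of x] by (subst ennreal_mult[symmetric]) (auto intro!: ennreal_leI simp: mult_ac less_imp_le)
        qed
        also have "\<dots> = ennreal (1 + \<delta>1) * (\<integral>\<^sup>+x. ennreal ((F x)\<^sup>2 * W x) \<partial>lborel)" by (rule nn_integral_cmult) simp
        also have "\<dots> \<le> ennreal (1 + \<delta>1) * ennreal (1 + \<delta>1)" by (intro mult_left_mono en) simp
        also have "\<dots> \<le> ennreal (1 + \<delta>)" using \<delta>1 by (subst ennreal_mult[symmetric]) (auto intro!: ennreal_leI)
        finally show ?thesis by (rule mult_right_mono) simp
      next
        case False
        then have "k v = 0" using kb(3)[of v] kb(1)[of v] by simp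
        then show ?thesis by simp
      qed
    qed
    also have "\<dots> = ennreal (1 + \<delta>)" by (subst nn_integral_cmult) (auto simp: k1)
    finally show ?thesis .
  qed
  have corr_le: "corr (\<lambda>x. ennreal (F x)) (\<lambda>x. ennreal (F x)) l \<le> corr (\<lambda>x. ennreal (u x)) (\<lambda>x. ennreal (u x)) l" for l
  proof -
    let ?c = "corr (\<lambda>x. ennreal (F x)) (\<lambda>x. ennreal (F x)) l"
    have "?c = (\<integral>\<^sup>+v. ?c * ennreal (k v) \<partial>lborel)" by (subst nn_integral_cmult) (auto simp: k1)
    also have "\<dots> = (\<integral>\<^sup>+v. \<integral>\<^sup>+x. (ennreal (F (l + (x - v))) * ennreal (F (x - v))) * ennreal (k v) \<partial>lborel \<partial>lborel)"
    proof (intro nn_integral_cong)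
      fix v
      have "?c = (\<integral>\<^sup>+x. ennreal (F (l + (x - v))) * ennreal (F (x - v)) \<partial>lborel)"
        unfolding corr_def using nn_integral_lborel_shift[of "\<lambda>x. ennreal (F (l + x)) * ennreal (F x)" "- v"] by simp
      then show "?c * ennreal (k v) = (\<integral>\<^sup>+x. (ennreal (F (l + (x - v))) * ennreal (F (x - v))) * ennreal (k v) \<partial>lborel)"
        by (subst nn_integral_multc) auto
    qed
    also have "\<dots> = (\<integral>\<^sup>+x. \<integral>\<^sup>+v. (ennreal (F (l + (x - v))) * ennreal (F (x - v))) * ennreal (k v) \<partial>lborel \<partial>lborel)"
      by (rule lborel_pair.Fubini') simp
    also have "\<dots> \<le> (\<integral>\<^sup>+x. ennreal (u (l + x)) * ennreal (u x) \<partial>lborel)"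
    proof (intro nn_integral_mono)
      fix x
      let ?I = "\<integral>\<^sup>+v. (ennreal (F (l + (x - v))) * ennreal (F (x - v))) * ennreal (k v) \<partial>lborel"
      have "?I = (\<integral>\<^sup>+v. ennreal (F (l + x - v) * sqrt (k v)) * ennreal (F (x - v) * sqrt (k v)) \<partial>lborel)"
        using F0 kb(1) by (intro nn_integral_cong) (simp add: ennreal_mult[symmetric] algebra_simps)
      then have "?I\<^sup>2 \<le> (\<integral>\<^sup>+v. (ennreal (F (l + x - v) * sqrt (k v)))\<^sup>2 \<partial>lborel) * (\<integral>\<^sup>+v. (ennreal (F (x - v) * sqrt (k v)))\<^sup>2 \<partial>lborel)"
        by (simp only:) (intro Cauchy_Schwarz_nn_integral, auto)
      also have "\<dots> = ennreal (U (l + x)) * ennreal (U x)"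
        unfolding eU using F0 kb(1) by (simp add: ennreal_power power_mult_distrib)
      also have "\<dots> = (ennreal (u (l + x)) * ennreal (u x))\<^sup>2"
        using u0 by (simp add: u2[symmetric] ennreal_power power_mult_distrib)
      also have "\<dots> = ennreal ((u (l + x) * u x)\<^sup>2)"
        using u0 by (simp add: ennreal_mult[symmetric] ennreal_power)
      finally have sq: "?I\<^sup>2 \<le> ennreal ((u (l + x) * u x)\<^sup>2)" .
      have "?I \<le> ennreal (u (l + x) * u x)"
      proof (cases ?I)
        case (real r)
        have "ennreal (r\<^sup>2) \<le> ennreal ((u (l + x) * u x)\<^sup>2)"
          using sq real(1) unfolding real(2) by (simp only: ennreal_power)
        then have "r\<^sup>2 \<le> (u (l + x) * u x)\<^sup>2" by (subst (asm) ennreal_le_iff) simp_all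
        then have "r \<le> u (l + x) * u x" by (rule power2_le_imp_le) (simp add: u0)
        then show ?thesis unfolding real(2) by (rule ennreal_leI)
      next
        case top
        have "(\<top> :: ennreal)\<^sup>2 = \<top>" unfolding power2_eq_square by (simp add: ennreal_top_mult)
        then have "\<top> \<le> ennreal ((u (l + x) * u x)\<^sup>2)" using sq unfolding top by (simp only:)
        then show ?thesis by (simp only: top_unique ennreal_neq_top)
      qed
      then show "?I \<le> ennreal (u (l + x)) * ennreal (u x)" using u0 by (simp add: ennreal_mult)
    qed
    finally show ?thesis by (simp add: corr_def)
  qed
  have "corr_pow p (\<lambda>x. ennreal (F x)) (\<lambda>x. ennreal (F x)) \<le> corr_pow p (\<lambda>x. ennreal (u x)) (\<lambda>x. ennreal (u x))"
    unfolding corr_pow_def by (intro nn_integral_mono power_mono_ennreal corr_le)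
  with gt have "ennreal r < corr_pow p (\<lambda>x. ennreal (u x)) (\<lambda>x. ennreal (u x))" by (rule less_le_trans)
  then show ?thesis using uc u0 upos energy K s by (intro that[of u "K + s"]) auto
qed

section \<open>Lower bound for lattice sums of p-th powers of \<open>Phi\<close>\<close>

definition LR :: "real \<Rightarrow> real \<Rightarrow> 'a set" where "LR e R = {x \<in> lat e. norm x \<le> R}"

lemma finite_LR: assumes "0 < e" shows "finite (LR e R)"
proof -
  obtain m where m: "R / e \<le> real m" using real_arch_simple by blast
  have "LR e R \<subseteq> latbox e m"
  proof
    fix x assume x: "x \<in> LR e R"
    have "\<bar>x \<bullet> b\<bar> \<le> e * real m" if "b \<in> Basis" for b
    proof -
      have "\<bar>x \<bullet> b\<bar> \<le> R" using Basis_le_norm[OF that, of x] x by (simp add: LR_def)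
      also have "R \<le> e * real m" using m assms by (simp add: pos_divide_le_eq mult.commute)
      finally show ?thesis .
    qed
    then show "x \<in> latbox e m" using x by (simp add: latbox_def LR_def)
  qed
  then show ?thesis using finite_latbox[OF assms] finite_subset by blast
qed

text \<open>For the positivity claim: the ball of radius R/2 around -l/2 and its translate by l both
  lie where \<open>u\<close> is positive. Powers of C serve as weights later and must not vanish on
  the ball that carries the quadratic form.\<close>

lemma corr_continuous_function:
  assumes u: "continuous_on UNIV u" "\<And>x. 0 \<le> u x" "\<And>x. 0 < u x \<longleftrightarrow> norm x < R" and R: "0 < R"
  defines "C \<equiv> \<lambda>l. \<integral>x. u (l + x) * u x \<partial>(lborel :: 'a measure)"
  shows "continuous_on UNIV C" "\<And>l. 0 \<le> C l" "\<And>l. norm l \<le> R \<Longrightarrow> 0 < C l" "\<And>l. norm l > 2 * R \<Longrightarrow> C l = 0"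
    "\<And>l. C (- l) = C l" "\<And>l. ennreal (C l) = corr (\<lambda>x. ennreal (u x)) (\<lambda>x. ennreal (u x)) l"
proof -
  have [measurable]: "u \<in> borel_measurable borel" by (rule borel_measurable_continuous_onI[OF u(1)])
  have uz: "u x = 0" if "norm x \<ge> R" for x using u(2)[of x] u(3)[of x] that by linarith
  obtain B where B: "\<And>x. u x \<le> B"
  proof -
    have "bounded (u ` cball 0 R)"
      by (intro compact_imp_bounded compact_continuous_image continuous_on_subset[OF u(1)]) auto
    then obtain b where b: "\<forall>y\<in>u ` cball 0 R. norm y \<le> b" unfolding bounded_iff by blast
    have "u x \<le> max 0 b" for x
      using b uz[of x] by (cases "norm x \<le> R") force+
    then show ?thesis using that by blast
  qed
  have B0: "0 \<le> B" using B[of 0] u(2)[of 0] by linarith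
  have iu: "integrable lborel u"
  proof (rule Bochner_Integration.integrable_bound)
    show "integrable lborel (\<lambda>v::'a. B * indicat_real (cball 0 R) v)"
      using emeasure_lborel_cball_finite by (intro integrable_mult_right integrable_real_indicator) auto
    show "AE x in lborel. norm (u x) \<le> norm (B * indicat_real (cball 0 R) x)"
      using B u(2) uz B0 by (intro AE_I2) (auto simp: indicator_def)
  qed simp
  have bd: "norm (u (l + x) * u x) \<le> B * u x" for l x
    using u(2) B by (simp add: abs_mult mult_right_mono)
  have iC: "integrable lborel (\<lambda>x. u (l + x) * u x)" for l
    by (rule Bochner_Integration.integrable_bound[OF integrable_mult_right[OF iu, of B]])
       (use bd u(2) B0 in \<open>auto intro!: AE_I2 mult_right_mono B simp: abs_mult\<close>)
  show "continuous_on UNIV C"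
    unfolding continuous_on_eq_continuous_at[OF open_UNIV] continuous_at_sequentially comp_def
  proof (intro ballI allI impI)
    fix l and ls :: "nat \<Rightarrow> 'a" assume ls: "ls \<longlonglongrightarrow> l"
    show "(\<lambda>n. C (ls n)) \<longlonglongrightarrow> C l"
      unfolding C_def
    proof (rule integral_dominated_convergence[where w = "\<lambda>x. B * u x"])
      show "integrable lborel (\<lambda>x. B * u x)" using iu by (rule integrable_mult_right)
      show "AE x in lborel. (\<lambda>n. u (ls n + x) * u x) \<longlonglongrightarrow> u (l + x) * u x"
      proof (intro AE_I2 tendsto_mult_right)
        fix x
        have "isCont u (l + x)" using u(1) by (simp add: continuous_on_eq_continuous_at)
        then show "(\<lambda>n. u (ls n + x)) \<longlonglongrightarrow> u (l + x)"
          using ls by (intro isCont_tendsto_compose[of _ u] tendsto_add tendsto_const)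
      qed
    qed (use bd in auto)
  qed
  show C0: "0 \<le> C l" for l unfolding C_def using u(2) by (intro integral_nonneg_AE AE_I2) auto
  show "0 < C l" if l: "norm l \<le> R" for l
  proof -
    have "C l \<noteq> 0"
    proof
      assume "C l = 0"
      then have ae: "AE x in lborel. u (l + x) * u x = 0"
        unfolding C_def using iC u(2) by (subst (asm) integral_nonneg_eq_0_iff_AE) auto
      let ?z = "- (l /\<^sub>R 2)"
      have "AE x in lborel. x \<notin> ball ?z (R / 2)"
        using ae
      proof eventually_elim
        fix x assume x: "u (l + x) * u x = 0"
        show "x \<notin> ball ?z (R / 2)"
        proof
          assume "x \<in> ball ?z (R / 2)"
          then have d: "norm (x - ?z) < R / 2" by (simp add: dist_norm norm_minus_commute)
          have half: "norm (l /\<^sub>R 2) \<le> R / 2" using l by simp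
          have "norm x \<le> norm (x - ?z) + norm ?z" by (metis diff_add_cancel norm_triangle_ineq)
          then have 1: "norm x < R" using d half by simp
          have "l + x = (x - ?z) + l /\<^sub>R 2"
            by (simp add: scaleR_2[symmetric] algebra_simps flip: scaleR_add_left) 
          then have "norm (l + x) \<le> norm (x - ?z) + norm (l /\<^sub>R 2)" by (metis norm_triangle_ineq)
          then have 2: "norm (l + x) < R" using d half by linarith
          show False using 1 2 u(3) x by (metis less_irrefl mult_pos_pos)
        qed
      qed
      then have "emeasure lborel (ball ?z (R / 2)) = 0" by (subst (asm) AE_iff_measurable[of "ball ?z (R / 2)"]) auto
      then show False using R emeasure_ball[of "R / 2" ?z] unit_ball_vol_pos[of "real DIM('a)"] by simp
    qed
    then show ?thesis using C0[of l] by simp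
  qed
  show "C l = 0" if l: "norm l > 2 * R" for l
  proof -
    have z: "u (l + x) * u x = 0" for x
    proof (cases "norm x < R")
      case True
      then have "norm (l + x) \<ge> R" using l norm_triangle_ineq4[of "l + x" x] by simp
      then show ?thesis using uz by simp
    qed (simp add: uz)
    show ?thesis unfolding C_def z by simp
  qed
  show eC: "ennreal (C l) = corr (\<lambda>x. ennreal (u x)) (\<lambda>x. ennreal (u x)) l" for l
  proof -
    have "ennreal (C l) = (\<integral>\<^sup>+x. ennreal (u (l + x) * u x) \<partial>lborel)"
      unfolding C_def using iC u(2) by (intro nn_integral_eq_integral[symmetric]) auto
    then show ?thesis using u(2) by (simp add: corr_def ennreal_mult)
  qed
  show "C (- l) = C l" for l
  proof -
    have "ennreal (C (- l)) = ennreal (C l)"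
      unfolding eC corr_def
      using nn_integral_lborel_shift[of "\<lambda>x. ennreal (u (- l + x)) * ennreal (u x)" l] by (simp add: mult.commute)
    then show ?thesis using C0 by simp
  qed
qed

text \<open>The weights are powers of the autocorrelation C of a near maximiser. For h = C^q the
  Rayleigh quotient of f = u sqrt W tends to I / e, where I is the integral of C^p, and the Hoelder
  denominator is also a power of I. The growth left over is (I/e)^(n p) / I^(n q) = (I / e^p)^n, and
  I / e^p is at least r.\<close>

lemma lattice_lower:
  assumes r: "0 < r" "r < rho \<psi> p" and q: "p = Suc q"
  obtains c R where "0 < c" "0 < R" "\<And>n ep. even n \<Longrightarrow> (\<And>j. 0 < ep j) \<Longrightarrow> ep \<longlonglongrightarrow> 0 \<Longrightarrow>
    \<forall>\<^sub>F j in sequentially. c * r ^ n * fact (Suc n) ^ p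
      \<le> (ep j ^ DIM('a)) ^ Suc n * (\<Sum>x\<in>PiE {..<Suc n} (\<lambda>_. LR (ep j) R). Phi Qw x {..<Suc n} 0 ^ p)"
proof -
  obtain r1 where r1: "r < r1" "r1 < rho \<psi> p" using r(2) dense by blast
  have r1p: "0 \<le> r1" using r r1 by simp
  have "((\<lambda>\<delta>. r * (1 + \<delta>) ^ p) \<longlongrightarrow> r * (1 + 0) ^ p) (at_right 0)" by (intro tendsto_intros)
  then have "\<forall>\<^sub>F \<delta> in at_right 0. r * (1 + \<delta>) ^ p < r1" using r1 by (intro order_tendstoD(2)) auto
  then obtain \<delta> where \<delta>: "0 < \<delta>" "r * (1 + \<delta>) ^ p < r1"
    by (metis (mono_tags, lifting) eventually_at_right_field field_lbound_gt_zero gt_ex)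
  obtain u R where u: "continuous_on UNIV u" "0 < R" "\<And>x. 0 \<le> u x" "\<And>x. 0 < u x \<longleftrightarrow> norm x < R"
    "(\<integral>\<^sup>+x. ennreal ((u x)\<^sup>2 * W x) \<partial>lborel) \<le> ennreal (1 + \<delta>)"
    "ennreal r1 < corr_pow p (\<lambda>x. ennreal (u x)) (\<lambda>x. ennreal (u x))"
    using continuous_maximizer[OF r1p r1(2) \<delta>(1)] by blast
  note [measurable] = borel_measurable_continuous_onI[OF u(1)]
  have uz: "u x = 0" if "norm x \<ge> R" for x using u(3)[of x] u(4)[of x] that by linarith
  define C where "C l = (\<integral>x. u (l + x) * u x \<partial>lborel)" for l
  have Cc: "continuous_on UNIV C" and C0: "\<And>l. 0 \<le> C l" and Cpos: "\<And>l. norm l \<le> R \<Longrightarrow> 0 < C l"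
    and Cz: "\<And>l. norm l > 2 * R \<Longrightarrow> C l = 0" and Csym: "\<And>l. C (- l) = C l"
    and eC: "\<And>l. ennreal (C l) = corr (\<lambda>x. ennreal (u x)) (\<lambda>x. ennreal (u x)) l"
    unfolding C_def using corr_continuous_function[OF u(1) u(3) u(4) u(2)] by auto
  note [measurable] = borel_measurable_continuous_onI[OF Cc]
  define h where "h l = C l ^ q" for l
  have hc: "continuous_on UNIV h" unfolding h_def[abs_def] using Cc by (intro continuous_intros)
  have h0: "0 \<le> h l" for l using C0 by (simp add: h_def)
  have Wc: "continuous_on UNIV W" unfolding W_def[abs_def] using psi_cont by (intro continuous_intros)
  define f where "f x = u x * sqrt (W x)" for x
  have fc: "continuous_on UNIV f" unfolding f_def[abs_def] using u(1) Wc by (intro continuous_intros)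
  have f0: "0 \<le> f x" for x using u(3) W_pos[of x] by (simp add: f_def)
  have fu: "sqrt (Qw x) * f x = u x" for x using W_pos[of x] by (simp add: Qw_def f_def real_sqrt_divide)
  have f2: "f x * f x = (u x)\<^sup>2 * W x" for x using W_pos[of x] by (simp add: f_def power2_eq_square)
  have Qc: "continuous_on UNIV (\<lambda>x. sqrt (Qw x))"
    unfolding Qw_def using Wc W_pos by (intro continuous_intros) (auto simp: less_imp_neq[symmetric] dest: less_imp_neq)
  define I where "I = enn2real (corr_pow p (\<lambda>x. ennreal (u x)) (\<lambda>x. ennreal (u x)))"
  define e where "e = enn2real (\<integral>\<^sup>+x. ennreal ((u x)\<^sup>2 * W x) \<partial>lborel)"
  have en: "(\<integral>\<^sup>+x. ennreal ((u x)\<^sup>2 * W x) \<partial>lborel) = ennreal e" "0 \<le> e"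
    using le_less_trans[OF u(5)] unfolding e_def by auto
  have e\<delta>: "e \<le> 1 + \<delta>" using u(5) \<delta> unfolding en by (subst (asm) ennreal_le_iff) auto
  have Ile: "corr_pow p (\<lambda>x. ennreal (u x)) (\<lambda>x. ennreal (u x)) \<le> ennreal (rho \<psi> p * e ^ p)"
    by (intro rho_ge_corr_pow u en) measurable
  then have Ifin: "corr_pow p (\<lambda>x. ennreal (u x)) (\<lambda>x. ennreal (u x)) = ennreal I"
    unfolding I_def using le_less_trans[OF Ile ennreal_less_top] by simp
  have I1: "r1 < I"
    using u(6) r r1 unfolding Ifin by (simp add: ennreal_less_iff)
  have I0: "0 < I" using I1 r r1 by simp
  have e0: "0 < e"
  proof (rule ccontr)
    assume "\<not> 0 < e"
    then have "rho \<psi> p * e ^ p = 0" using en(2) p_pos by simp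
    then show False using Ile I0 unfolding Ifin by (simp only:) simp
  qed
  have IC: "(\<integral>l. C l ^ p \<partial>lborel) = I"
  proof -
    have "(\<integral>\<^sup>+l. ennreal (C l ^ p) \<partial>lborel) = ennreal I"
      unfolding Ifin[symmetric] corr_pow_def eC[symmetric] using C0 by (simp add: ennreal_power)
    then show ?thesis using C0 I0 by (subst integral_eq_nn_integral) auto
  qed
  have ratio: "r \<le> I / e ^ p"
  proof -
    have "e ^ p \<le> (1 + \<delta>) ^ p" using e\<delta> en(2) by (intro power_mono)
    then have "r * e ^ p \<le> r * (1 + \<delta>) ^ p" using r by (intro mult_left_mono) auto
    then have "r * e ^ p \<le> I" using \<delta>(2) I1 by linarith
    then show ?thesis using e0 by (simp add: pos_le_divide_eq)
  qed
  \<comment> \<open>Extrema over the compact ball: h and sqrt Q are bounded away from 0 there and f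
    is bounded above, which is what \<open>J_ge_kernel_op\<close> asks of the two ends.\<close>
  obtain c1 c2 where c12: "0 < c1" "0 < c2" "\<And>x. norm x \<le> R \<Longrightarrow> c1 * f x \<le> h x * sqrt (Qw x)" "\<And>x. norm x \<le> R \<Longrightarrow> c2 * f x \<le> sqrt (Qw x)"
  proof -
    have ne: "cball (0::'a) R \<noteq> {}" using u(2) by simp
    have cpt: "compact (cball (0::'a) R)" by simp
    have cb: "continuous_on (cball 0 R) g" if "continuous_on UNIV g" for g :: "'a \<Rightarrow> real"
      using that by (rule continuous_on_subset) simp
    obtain x1 where x1: "x1 \<in> cball 0 R" "\<And>y. y \<in> cball 0 R \<Longrightarrow> h x1 * sqrt (Qw x1) \<le> h y * sqrt (Qw y)"
      using continuous_attains_inf[OF cpt ne cb[OF continuous_on_mult[OF hc Qc]]] by blast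
    obtain x2 where x2: "x2 \<in> cball 0 R" "\<And>y. y \<in> cball 0 R \<Longrightarrow> sqrt (Qw x2) \<le> sqrt (Qw y)"
      using continuous_attains_inf[OF cpt ne cb[OF Qc]] by blast
    obtain x3 where x3: "x3 \<in> cball 0 R" "\<And>y. y \<in> cball 0 R \<Longrightarrow> f y \<le> f x3"
      using continuous_attains_sup[OF cpt ne cb[OF fc]] by blast
    define M where "M = f x3 + 1"
    have M: "0 < M" "f y \<le> M" if "norm y \<le> R" for y using x3(2)[of y] f0[of x3] that by (auto simp: M_def)
    have Mp: "0 < M" using f0[of x3] by (simp add: M_def)
    have m1: "0 < h x1 * sqrt (Qw x1)" using x1(1) Cpos[of x1] Qw_pos[of x1] by (simp add: h_def)
    have m2: "0 < sqrt (Qw x2)" using Qw_pos by simp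
    show ?thesis
    proof (rule that[of "h x1 * sqrt (Qw x1) / M" "sqrt (Qw x2) / M"])
      fix x :: 'a assume x: "norm x \<le> R"
      have fM: "f x / M \<le> 1" using M(2)[OF x] Mp by simp
      have "h x1 * sqrt (Qw x1) / M * f x = h x1 * sqrt (Qw x1) * (f x / M)" by simp
      also have "\<dots> \<le> h x1 * sqrt (Qw x1) * 1" using fM m1 by (intro mult_left_mono) auto
      also have "\<dots> \<le> h x * sqrt (Qw x)" using x1(2)[of x] x by simp
      finally show "h x1 * sqrt (Qw x1) / M * f x \<le> h x * sqrt (Qw x)" .
      have "sqrt (Qw x2) / M * f x = sqrt (Qw x2) * (f x / M)" by simp
      also have "\<dots> \<le> sqrt (Qw x2) * 1" using fM m2 by (intro mult_left_mono) auto
      also have "\<dots> \<le> sqrt (Qw x)" using x2(2)[of x] x by simp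
      finally show "sqrt (Qw x2) / M * f x \<le> sqrt (Qw x)" .
    qed (use m1 m2 Mp in auto)
  qed
  define K where "K = (\<lambda>x y. sqrt (Qw x) * h (y - x) * sqrt (Qw y))"
  have hsym: "h (y - x) = h (x - y)" for x y using Csym[of "x - y"] by (simp add: h_def)
  \<comment> \<open>Half of the factor of the limit that does not grow with n; the half gives a
    strict inequality, which persists for all large j.\<close>
  define c where "c = (c1 * c2 * e) ^ p / I ^ q / 2"
  show ?thesis
  \<comment> \<open>The radius 2 R covers both the support of C and all differences of points in the
    ball of radius R.\<close>
  proof (rule that[of c "2 * R"])
    show "0 < c" using c12 e0 I0 by (simp add: c_def)
    show "0 < 2 * R" using u(2) by simp
    fix n :: nat and ep :: "nat \<Rightarrow> real"
    assume n: "even n" and ep: "\<And>j. 0 < ep j" "ep \<longlonglongrightarrow> 0"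
    define D where "D j = ep j ^ DIM('a)" for j
    have D0: "0 < D j" for j using ep(1) by (simp add: D_def)
    define A where "A j = LR (ep j) (2 * R)" for j
    define B where "B j = LR (ep j) R" for j
    have fin: "finite (A j)" "finite (B j)" for j unfolding A_def B_def by (intro finite_LR ep)+
    define ej where "ej j = (\<Sum>x\<in>B j. f x * f x)" for j
    define bj where "bj j = (\<Sum>x\<in>B j. f x * kernel_op (B j) K f x)" for j
    define Sj where "Sj j = (\<Sum>x\<in>A j. C x ^ p)" for j
    have le: "(\<lambda>j. D j * ej j) \<longlonglongrightarrow> e"
    proof -
      have "(\<lambda>j. D j * ej j) \<longlonglongrightarrow> (\<integral>x. f x * f x \<partial>lborel)"
        unfolding D_def ej_def
        by (rule Riemann_lattice_sum[where R = R])
           (use fc ep fin uz in \<open>auto simp: B_def LR_def f_def intro!: continuous_intros leI\<close>)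
      moreover have "(\<integral>x. f x * f x \<partial>lborel) = e"
        unfolding f2 using en W_pos by (subst integral_eq_nn_integral) (auto simp: less_imp_le)
      ultimately show ?thesis by simp
    qed
    have lS: "(\<lambda>j. D j * Sj j) \<longlonglongrightarrow> I"
      unfolding D_def Sj_def IC[symmetric]
      by (rule Riemann_lattice_sum[where R = "2 * R"])
         (use Cc ep fin Cz p_pos in \<open>auto simp: A_def LR_def intro!: continuous_intros leI\<close>)
    have lb: "(\<lambda>j. D j ^ 2 * bj j) \<longlonglongrightarrow> I"
    proof -
      \<comment> \<open>The quadratic form is a double sum, hence a Riemann sum over the lattice of
        the product space with volume element D^2.\<close>
      define v where "v z = u (fst z) * h (snd z - fst z) * u (snd z)" for z :: "'a \<times> 'a"
      have vc: "continuous_on UNIV v"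
        unfolding v_def[abs_def]
        by (intro continuous_intros continuous_on_compose2[OF u(1)] continuous_on_compose2[OF hc]) auto
      have vz: "v z = 0" if "norm z > 2 * R" for z
      proof -
        have "norm z \<le> norm (fst z) + norm (snd z)" by (metis norm_Pair_le prod.collapse)
        then have "norm (fst z) \<ge> R \<or> norm (snd z) \<ge> R" using that by linarith
        then show ?thesis by (auto simp: v_def uz)
      qed
      have latP: "(x, y) \<in> lat e' \<longleftrightarrow> x \<in> lat e' \<and> y \<in> lat e'" for x y :: 'a and e'
        by (simp add: lat_def Basis_prod_def ball_Un)
      have "(\<lambda>j. ep j ^ DIM('a \<times> 'a) * (\<Sum>z\<in>B j \<times> B j. v z)) \<longlonglongrightarrow> (\<integral>z. v z \<partial>lborel)"
      proof (rule Riemann_lattice_sum[OF vc vz ep])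
        show "finite (B j \<times> B j)" for j using fin by simp
        show "B j \<times> B j \<subseteq> lat (ep j)" for j by (auto simp: latP B_def LR_def)
        fix j and z :: "'a \<times> 'a" assume z: "z \<in> lat (ep j)" "v z \<noteq> 0"
        then have "u (fst z) \<noteq> 0" "u (snd z) \<noteq> 0" by (auto simp: v_def)
        then have "norm (fst z) < R" "norm (snd z) < R" using uz[of "fst z"] uz[of "snd z"] by (meson linorder_not_le)+
        then show "z \<in> B j \<times> B j" using z(1) by (cases z) (auto simp: latP B_def LR_def)
      qed auto
      moreover have "ep j ^ DIM('a \<times> 'a) * (\<Sum>z\<in>B j \<times> B j. v z) = D j ^ 2 * bj j" for j
      proof -
        have "bj j = (\<Sum>x\<in>B j. \<Sum>y\<in>B j. (sqrt (Qw x) * f x) * h (y - x) * (sqrt (Qw y) * f y))"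
          unfolding bj_def kernel_op_def K_def by (simp add: sum_distrib_left mult_ac)
        also have "\<dots> = (\<Sum>z\<in>B j \<times> B j. v z)" unfolding fu by (simp add: sum.cartesian_product v_def case_prod_unfold)
        finally show ?thesis by (simp add: D_def power_add power2_eq_square)
      qed
      moreover have "(\<integral>z. v z \<partial>lborel) = I"
      proof -
        have [measurable]: "v \<in> borel_measurable borel" by (rule borel_measurable_continuous_onI[OF vc])
        note [measurable] = borel_measurable_continuous_onI[OF hc]
        have "(\<integral>\<^sup>+z. ennreal (v z) \<partial>lborel) = (\<integral>\<^sup>+x. \<integral>\<^sup>+y. ennreal (v (x, y)) \<partial>lborel \<partial>lborel)"
          by (subst lborel_prod[symmetric], subst lborel.nn_integral_fst[symmetric]) (auto simp: lborel_prod)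
        also have "\<dots> = (\<integral>\<^sup>+x. \<integral>\<^sup>+y. ennreal (u x * h y * u (x + y)) \<partial>lborel \<partial>lborel)"
        proof (rule nn_integral_cong)
          fix x
          show "(\<integral>\<^sup>+y. ennreal (v (x, y)) \<partial>lborel) = (\<integral>\<^sup>+y. ennreal (u x * h y * u (x + y)) \<partial>lborel)"
            using nn_integral_lborel_shift[of "\<lambda>y. ennreal (u x * h (y - x) * u y)" x] by (simp add: v_def)
        qed
        also have "\<dots> = (\<integral>\<^sup>+y. \<integral>\<^sup>+x. ennreal (u x * h y * u (x + y)) \<partial>lborel \<partial>lborel)"
          by (rule lborel_pair.Fubini') simp
        also have "\<dots> = (\<integral>\<^sup>+y. ennreal (C y ^ p) \<partial>lborel)"
        proof (intro nn_integral_cong)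
          fix y
          have "(\<integral>\<^sup>+x. ennreal (u x * h y * u (x + y)) \<partial>lborel) = (\<integral>\<^sup>+x. ennreal (h y) * (ennreal (u (y + x)) * ennreal (u x)) \<partial>lborel)"
            using h0 u(3) by (intro nn_integral_cong) (simp add: ennreal_mult[symmetric] mult_ac add.commute)
          also have "\<dots> = ennreal (h y) * ennreal (C y)"
            unfolding eC corr_def by (rule nn_integral_cmult) simp
          also have "\<dots> = ennreal (C y ^ p)" using C0 by (simp add: h_def q ennreal_mult[symmetric] mult.commute)
          finally show "(\<integral>\<^sup>+x. ennreal (u x * h y * u (x + y)) \<partial>lborel) = ennreal (C y ^ p)" .
        qed
        also have "\<dots> = ennreal I"
          unfolding Ifin[symmetric] corr_pow_def eC[symmetric] using C0 by (simp add: ennreal_power)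
        finally show ?thesis using h0 u(3) I0 by (subst integral_eq_nn_integral) (auto simp: v_def)
      qed
      ultimately show ?thesis by simp
    qed
    have ejp: "0 < ej j" for j
    proof -
      have "0 \<in> B j" using u(2) by (simp add: B_def LR_def)
      moreover have "0 < f 0 * f 0" using u(2) u(4)[of 0] W_pos[of 0] by (simp add: f_def)
      ultimately show ?thesis unfolding ej_def using fin f0 by (intro sum_pos2[of _ 0]) auto
    qed
    have bjp: "0 \<le> bj j" for j
      unfolding bj_def kernel_op_def K_def using f0 h0 Qw_pos
      by (intro sum_nonneg mult_nonneg_nonneg) (auto simp: less_imp_le)
    have Jlow: "c1 * c2 * (ej j * (bj j / ej j) ^ n) \<le> J Qw h (A j) (Suc n) 0" for j
    proof -
      obtain k where k: "n = 2 * k" using n by (elim evenE)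
      have "ej j * (bj j / ej j) ^ n \<le> (\<Sum>x\<in>B j. f x * (kernel_op (B j) K ^^ n) f x)"
        unfolding k using fin ejp bjp hsym by (intro kernel_op_power_ge) (auto simp: ej_def bj_def K_def mult_ac)
      then have "c1 * c2 * (ej j * (bj j / ej j) ^ n) \<le> c1 * c2 * (\<Sum>x\<in>B j. f x * (kernel_op (B j) K ^^ n) f x)"
        using c12 by (intro mult_left_mono) auto
      also have "\<dots> \<le> J Qw h (A j) (Suc n) 0"
      proof (rule J_ge_kernel_op[OF fin(1) _ _ Qw_pos Qw_0 h0 f0 _ _ _ _ K_def])
        show "B j \<subseteq> A j" using u(2) by (auto simp: A_def B_def LR_def)
        show "y - x \<in> A j" if "x \<in> B j" "y \<in> B j" for x y
          using that norm_triangle_ineq4[of y x] lat_diff[of y "ep j" x] by (auto simp: A_def B_def LR_def)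
      qed (use c12 in \<open>auto simp: B_def LR_def\<close>)
      finally show ?thesis .
    qed
    define P where "P j = (\<Sum>x\<in>PiE {..<Suc n} (\<lambda>_. A j). Phi Qw x {..<Suc n} 0 ^ p)" for j
    have Sjp: "0 < Sj j" for j
    proof -
      have "0 \<in> A j" using u(2) by (simp add: A_def LR_def)
      moreover have "0 < C 0 ^ p" using Cpos[of 0] u(2) by simp
      ultimately show ?thesis unfolding Sj_def using fin C0 by (intro sum_pos2[of _ 0]) auto
    qed
    have Plow: "fact (Suc n) ^ p * (c1 * c2 * (ej j * (bj j / ej j) ^ n)) ^ p / Sj j ^ (Suc n * q) \<le> P j" for j
    proof -
      let ?\<Omega> = "PiE {..<Suc n} (\<lambda>_. A j)"
      have f\<Omega>: "finite ?\<Omega>" using fin by (intro finite_PiE) auto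
      have ph0: "0 \<le> Phi Qw x {..<Suc n} 0" for x by (intro Phi_nonneg) (auto simp: Qw_pos less_imp_le)
      have "(\<Sum>x\<in>?\<Omega>. (\<Prod>k<Suc n. C (x k)) ^ q * Phi Qw x {..<Suc n} 0) ^ p
          \<le> P j * (\<Sum>x\<in>?\<Omega>. (\<Prod>k<Suc n. C (x k)) ^ p) ^ q"
        unfolding P_def q using f\<Omega> ph0 C0 by (intro sum_Holder_power) (auto simp del: prod.lessThan_Suc intro!: prod_nonneg)
      also have "(\<Sum>x\<in>?\<Omega>. (\<Prod>k<Suc n. C (x k)) ^ q * Phi Qw x {..<Suc n} 0) = fact (Suc n) * J Qw h (A j) (Suc n) 0"
        using sum_PiE_Phi[of "{..<Suc n}" "A j" h Qw 0] fin by (simp add: h_def prod_power_distrib del: prod.lessThan_Suc fact_Suc J.simps)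
      also have "(\<Sum>x\<in>?\<Omega>. (\<Prod>k<Suc n. C (x k)) ^ p) = Sj j ^ Suc n"
        unfolding Sj_def prod_power_distrib using fin prod_sum_PiE[of "{..<Suc n}" "\<lambda>_. A j" "\<lambda>_ x. C x ^ p"]
        by (simp del: prod.lessThan_Suc)
      finally have "(fact (Suc n) * J Qw h (A j) (Suc n) 0) ^ p \<le> P j * Sj j ^ (Suc n * q)" by (simp only: power_mult)
      moreover have "(fact (Suc n) * (c1 * c2 * (ej j * (bj j / ej j) ^ n))) ^ p \<le> (fact (Suc n) * J Qw h (A j) (Suc n) 0) ^ p"
        using Jlow[of j] c12 ejp[of j] bjp[of j] by (intro power_mono mult_left_mono) (auto simp del: fact_Suc)
      ultimately have "fact (Suc n) ^ p * (c1 * c2 * (ej j * (bj j / ej j) ^ n)) ^ p \<le> P j * Sj j ^ (Suc n * q)"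
        unfolding power_mult_distrib[of "fact (Suc n)"] by linarith
      then show ?thesis using Sjp by (simp add: pos_divide_le_eq del: fact_Suc)
    qed
    \<comment> \<open>The powers of D are distributed over \<open>D j * ej j\<close>,
      \<open>D j ^ 2 * bj j\<close> and \<open>D j * Sj j\<close>, the normalised sums that
      converge.\<close>
    have scale: "D j ^ Suc n * (fact (Suc n) ^ p * (c1 * c2 * (ej j * (bj j / ej j) ^ n)) ^ p / Sj j ^ (Suc n * q))
      = fact (Suc n) ^ p * ((c1 * c2 * ((D j * ej j) * ((D j ^ 2 * bj j) / (D j * ej j)) ^ n)) ^ p / (D j * Sj j) ^ (Suc n * q))" for j
    proof -
      have 1: "(D j * ej j) * ((D j ^ 2 * bj j) / (D j * ej j)) ^ n = D j ^ Suc n * (ej j * (bj j / ej j) ^ n)"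
      proof -
        have "(D j ^ 2 * bj j) / (D j * ej j) = D j * (bj j / ej j)" using D0[of j] by (simp add: power2_eq_square)
        then show ?thesis by (simp only: power_mult_distrib power_Suc mult_ac)
      qed
      have 2: "(D j ^ Suc n) ^ p = D j ^ Suc n * D j ^ (Suc n * q)" by (simp only: q power_mult power_Suc)
      have "(c1 * c2 * (D j ^ Suc n * (ej j * (bj j / ej j) ^ n))) ^ p = (D j ^ Suc n) ^ p * (c1 * c2 * (ej j * (bj j / ej j) ^ n)) ^ p"
        by (simp only: power_mult_distrib mult_ac)
      then show ?thesis unfolding 1 2 power_mult_distrib[of "D j" "Sj j"] using D0[of j]
        by (simp del: fact_Suc power_Suc)
    qed
    let ?L = "(c1 * c2 * (e * (I / e) ^ n)) ^ p / I ^ (Suc n * q)"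
    have lim: "(\<lambda>j. (c1 * c2 * ((D j * ej j) * ((D j ^ 2 * bj j) / (D j * ej j)) ^ n)) ^ p / (D j * Sj j) ^ (Suc n * q)) \<longlonglongrightarrow> ?L"
      using e0 I0 by (intro tendsto_intros le lb lS) auto
    have "c * r ^ n < ?L"
    proof -
      have half: "z < y" if "x \<le> y" "0 < x" "z = x / 2" for x y z :: real using that by linarith
      have "?L = (c1 * c2 * e) ^ p / I ^ q * (I / e ^ p) ^ n"
      proof -
        have a: "(c1 * c2 * (e * (I / e) ^ n)) ^ p = (c1 * c2 * e) ^ p * (I ^ (n * p) / (e ^ p) ^ n)"
          by (simp add: power_mult_distrib power_divide power_mult[symmetric] mult.commute)
        have b: "I ^ (n * p) = I ^ n * I ^ (n * q)" by (simp add: q power_add)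
        have c: "I ^ (Suc n * q) = I ^ q * I ^ (n * q)" by (simp add: power_add)
        show ?thesis unfolding a b c using I0 by (simp add: power_divide)
      qed
      moreover have "r ^ n \<le> (I / e ^ p) ^ n" using ratio r by (intro power_mono) auto
      moreover have "0 < (c1 * c2 * e) ^ p / I ^ q" "0 < r ^ n" using c12 e0 I0 r by auto
      ultimately have "(c1 * c2 * e) ^ p / I ^ q * r ^ n \<le> ?L" "0 < (c1 * c2 * e) ^ p / I ^ q * r ^ n"
        by (auto intro!: mult_left_mono simp del: times_divide_eq_left)
      moreover have "c * r ^ n = (c1 * c2 * e) ^ p / I ^ q * r ^ n / 2" by (simp add: c_def)
      ultimately show ?thesis by (rule half)
    qed
    with lim have "\<forall>\<^sub>F j in sequentially. c * r ^ n < (c1 * c2 * ((D j * ej j) * ((D j ^ 2 * bj j) / (D j * ej j)) ^ n)) ^ p / (D j * Sj j) ^ (Suc n * q)"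
      by (rule order_tendstoD(1))
    then show "\<forall>\<^sub>F j in sequentially. c * r ^ n * fact (Suc n) ^ p
      \<le> (ep j ^ DIM('a)) ^ Suc n * (\<Sum>x\<in>PiE {..<Suc n} (\<lambda>_. LR (ep j) (2 * R)). Phi Qw x {..<Suc n} 0 ^ p)"
    proof eventually_elim
      fix j
      assume "c * r ^ n < (c1 * c2 * ((D j * ej j) * ((D j ^ 2 * bj j) / (D j * ej j)) ^ n)) ^ p / (D j * Sj j) ^ (Suc n * q)"
      then have "c * r ^ n * fact (Suc n) ^ p \<le> fact (Suc n) ^ p * ((c1 * c2 * ((D j * ej j) * ((D j ^ 2 * bj j) / (D j * ej j)) ^ n)) ^ p / (D j * Sj j) ^ (Suc n * q))"
        by (subst mult.commute, intro mult_left_mono) (auto simp del: fact_Suc)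
      also have "\<dots> \<le> D j ^ Suc n * P j"
        unfolding scale[symmetric] using D0[of j] by (intro mult_left_mono Plow) (auto simp del: power_Suc)
      finally show "c * r ^ n * fact (Suc n) ^ p
        \<le> (ep j ^ DIM('a)) ^ Suc n * (\<Sum>x\<in>PiE {..<Suc n} (\<lambda>_. LR (ep j) (2 * R)). Phi Qw x {..<Suc n} 0 ^ p)"
        unfolding D_def P_def A_def .
    qed
  qed
qed

end

section \<open>A trigonometric approximate identity\<close>

text \<open>Fourier coefficients of the de la Vallee Poussin kernel \<open>cos_kernel\<close>,
  scaled so that the coefficient at 0 is 1. The kernel is nonnegative and has finitely many nonzero
  coefficients, all in [0, 1].\<close>

definition cos_weight :: "nat \<Rightarrow> nat \<Rightarrow> real" where
  "cos_weight m k = real (2 * m choose (m + k)) / real (2 * m choose m)"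

definition cos_kernel :: "nat \<Rightarrow> real \<Rightarrow> real" where
  "cos_kernel m y = 4 ^ m / real (2 * m choose m) * cos (y / 2) ^ (2 * m)"

lemma cos_weight_nonneg: "0 \<le> cos_weight m k"
  by (simp add: cos_weight_def)

lemma cos_weight_0 [simp]: "cos_weight m 0 = 1"
  by (simp add: cos_weight_def)

lemma cos_weight_le_1: "cos_weight m k \<le> 1"
proof -
  have "0 < 2 * m choose m" by simp
  moreover have "2 * m choose (m + k) \<le> 2 * m choose m" using binomial_maximum[of "2 * m" "m + k"] by simp
  ultimately show ?thesis unfolding cos_weight_def by (simp add: divide_le_eq_1)
qed

lemma cos_weight_Suc:
  assumes "k < m" shows "cos_weight m (Suc k) = cos_weight m k * (real (m - k) / real (m + k + 1))"
proof -
  have e: "Suc ((m + k) + (m - k - 1)) = 2 * m" "Suc (m - k - 1) = m - k" using assms by auto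
  have "Suc (m + k) * (2 * m choose Suc (m + k)) = (m - k) * (2 * m choose (m + k))"
    using Suc_times_binomial_add[of "m + k" "m - k - 1"] unfolding e .
  then have "real (Suc (m + k)) * real (2 * m choose (m + Suc k)) = real (m - k) * real (2 * m choose (m + k))"
    by (simp only: of_nat_mult[symmetric] add_Suc_right)
  then have "real (2 * m choose (m + Suc k)) = real (m - k) * real (2 * m choose (m + k)) / real (m + k + 1)"
    by (simp add: field_simps del: binomial_Suc_Suc)
  then show ?thesis unfolding cos_weight_def by (simp add: mult_ac del: binomial_Suc_Suc)
qed

lemma cos_weight_tendsto: "(\<lambda>m. cos_weight m k) \<longlonglongrightarrow> 1"
proof (induction k)
  case (Suc k)
  have "(\<lambda>m. (real m - real k) / (real m + real k + 1)) \<longlonglongrightarrow> 1" by real_asymp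
  from tendsto_mult[OF Suc this] have "(\<lambda>m. cos_weight m k * ((real m - real k) / (real m + real k + 1))) \<longlonglongrightarrow> 1" by simp
  then show ?case
  proof (rule Lim_transform_eventually)
    show "\<forall>\<^sub>F m in sequentially. cos_weight m k * ((real m - real k) / (real m + real k + 1)) = cos_weight m (Suc k)"
      using eventually_gt_at_top[of k] by eventually_elim (simp add: cos_weight_Suc of_nat_diff)
  qed
qed simp

text \<open>The binomial theorem for (e^(iy/2) + e^(-iy/2))^(2m), recentred at the middle
  index.\<close>

lemma cos_kernel_sum:
  "complex_of_real (cos_kernel m y) = (\<Sum>k\<in>{- int m..int m}. of_real (cos_weight m (nat \<bar>k\<bar>)) * cis (of_int k * y))"
proof -
  have c: "cis (y / 2) + cis (- (y / 2)) = 2 * complex_of_real (cos (y / 2))" by (simp add: complex_eq_iff)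
  have "(2 * complex_of_real (cos (y / 2))) ^ (2 * m)
      = (\<Sum>j\<le>2 * m. of_nat (2 * m choose j) * cis (y / 2) ^ j * cis (- (y / 2)) ^ (2 * m - j))"
    unfolding c[symmetric] by (rule binomial_ring)
  also have "\<dots> = (\<Sum>j\<le>2 * m. of_nat (2 * m choose j) * cis ((real j - real m) * y))"
  proof (intro sum.cong refl)
    fix j assume "j \<in> {..2 * m}"
    then have "real j * (y / 2) + real (2 * m - j) * (- (y / 2)) = (real j - real m) * y"
      by (simp add: of_nat_diff algebra_simps)
    moreover have "cis (y / 2) ^ j * cis (- (y / 2)) ^ (2 * m - j) = cis (real j * (y / 2) + real (2 * m - j) * (- (y / 2)))"
      unfolding Complex.DeMoivre cis_mult ..
    ultimately have "cis (y / 2) ^ j * cis (- (y / 2)) ^ (2 * m - j) = cis ((real j - real m) * y)" by metis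
    then show "of_nat (2 * m choose j) * cis (y / 2) ^ j * cis (- (y / 2)) ^ (2 * m - j) = of_nat (2 * m choose j) * cis ((real j - real m) * y)"
      by (simp only: mult.assoc)
  qed
  also have "\<dots> = (\<Sum>k\<in>{- int m..int m}. of_nat (2 * m choose (m + nat \<bar>k\<bar>)) * cis (of_int k * y))"
  proof (rule sum.reindex_bij_witness[of _ "\<lambda>k. nat (k + int m)" "\<lambda>j. int j - int m"])
    fix j assume j: "j \<in> {..2 * m}"
    have "2 * m choose (m + nat \<bar>int j - int m\<bar>) = 2 * m choose j"
    proof (cases "m \<le> j")
      case True then have "m + nat \<bar>int j - int m\<bar> = j" by simp
      then show ?thesis by (simp only:)
    next
      case False then have "m + nat \<bar>int j - int m\<bar> = 2 * m - j" by simp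
      then show ?thesis using binomial_symmetric[of j "2 * m"] j by (simp only: atMost_iff)
    qed
    then show "of_nat (2 * m choose (m + nat \<bar>int j - int m\<bar>)) * cis (of_int (int j - int m) * y)
      = of_nat (2 * m choose j) * cis ((real j - real m) * y)" by simp
  qed auto
  finally have "4 ^ m * complex_of_real (cos (y / 2)) ^ (2 * m)
      = (\<Sum>k\<in>{- int m..int m}. of_nat (2 * m choose (m + nat \<bar>k\<bar>)) * cis (of_int k * y))"
    by (simp add: power_mult_distrib power_mult)
  moreover have "complex_of_real (cos_kernel m y) = 4 ^ m * complex_of_real (cos (y / 2)) ^ (2 * m) / of_nat (2 * m choose m)"
    by (simp add: cos_kernel_def)
  ultimately show ?thesis by (simp add: cos_weight_def sum_divide_distrib)
qed

lemma cos_kernel_nonneg: "0 \<le> cos_kernel m y"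
  by (simp add: cos_kernel_def power_mult)

text \<open>The central binomial coefficient is the largest of 2m + 1 coefficients with sum 4^m.
  Polynomial growth of the constant is enough, since the tails decay geometrically.\<close>

lemma cos_kernel_const: "4 ^ m / real (2 * m choose m) \<le> real (2 * m + 1)"
proof -
  have "(\<Sum>k\<le>2 * m. 2 * m choose k) \<le> (\<Sum>k\<le>2 * m. 2 * m choose m)"
    using binomial_maximum[of "2 * m"] by (intro sum_mono) simp
  then have "(2::nat) ^ (2 * m) \<le> (2 * m + 1) * (2 * m choose m)" by (simp add: choose_row_sum)
  then have "real (2 ^ (2 * m)) \<le> real ((2 * m + 1) * (2 * m choose m))" by (simp only: of_nat_le_iff)
  moreover have "real (2 ^ (2 * m)) = 4 ^ m" by (simp add: power_mult)
  ultimately have "4 ^ m \<le> real (2 * m + 1) * real (2 * m choose m)" by (simp only: of_nat_mult)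
  moreover have "0 < real (2 * m choose m)" by simp
  ultimately show ?thesis by (simp only: pos_divide_le_eq)
qed

lemma cos_kernel_le: "cos_kernel m y \<le> real (2 * m + 1)"
proof -
  have "cos (y / 2) ^ (2 * m) \<le> 1"
    unfolding power_mult by (rule power_le_one) (auto simp: abs_square_le_1)
  then have "4 ^ m / real (2 * m choose m) * cos (y / 2) ^ (2 * m) \<le> 4 ^ m / real (2 * m choose m) * 1"
    by (intro mult_left_mono) auto
  then show ?thesis using cos_kernel_const[of m] by (simp add: cos_kernel_def)
qed

lemma cos_kernel_tail:
  assumes "0 \<le> r" "r \<le> \<bar>y\<bar>" "\<bar>y\<bar> \<le> pi"
  shows "cos_kernel m y \<le> real (2 * m + 1) * cos (r / 2) ^ (2 * m)"
proof -
  have "cos (y / 2) = cos (\<bar>y\<bar> / 2)" by (cases "0 \<le> y") auto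
  moreover have "cos (\<bar>y\<bar> / 2) \<le> cos (r / 2)" using assms by (intro cos_monotone_0_pi_le) auto
  moreover have "0 \<le> cos (\<bar>y\<bar> / 2)" using assms by (intro cos_ge_zero) auto
  ultimately have "cos (y / 2) ^ (2 * m) \<le> cos (r / 2) ^ (2 * m)" by (intro power_mono) auto
  then show ?thesis unfolding cos_kernel_def using cos_kernel_const[of m]
    by (intro mult_mono) (auto simp: power_mult)
qed

lemma nn_integral_cos_kernel:
  assumes "0 < ep"
  shows "(\<integral>\<^sup>+y. ennreal (cos_kernel m (ep * y)) * indicator {- pi / ep..pi / ep} y \<partial>lborel) = ennreal (2 * pi / ep)"
proof -
  \<comment> \<open>A termwise antiderivative. Over one full period only k = 0 contributes, since
    the sine of an integer multiple of pi vanishes.\<close>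
  define G where "G y = (\<Sum>k\<in>{- int m..int m}. cos_weight m (nat \<bar>k\<bar>) * (if k = 0 then y else sin (of_int k * ep * y) / (of_int k * ep)))" for y
  have k: "cos_kernel m (ep * y) = (\<Sum>k\<in>{- int m..int m}. cos_weight m (nat \<bar>k\<bar>) * cos (of_int k * ep * y))" for y
  proof -
    have "cos_kernel m (ep * y) = Re (complex_of_real (cos_kernel m (ep * y)))" by simp
    also have "\<dots> = (\<Sum>k\<in>{- int m..int m}. cos_weight m (nat \<bar>k\<bar>) * cos (of_int k * ep * y))"
      unfolding cos_kernel_sum by (simp add: mult.assoc)
    finally show ?thesis .
  qed
  have d: "((\<lambda>y. cos_weight m (nat \<bar>k\<bar>) * (if k = 0 then y else sin (of_int k * ep * y) / (of_int k * ep)))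
     has_real_derivative cos_weight m (nat \<bar>k\<bar>) * cos (of_int k * ep * y)) (at y)" for k :: int and y
  proof (cases "k = 0")
    case False
    then show ?thesis using assms by (auto intro!: derivative_eq_intros)
  qed simp
  have "(\<integral>\<^sup>+y. ennreal (cos_kernel m (ep * y)) * indicator {- pi / ep..pi / ep} y \<partial>lborel) = G (pi / ep) - G (- pi / ep)"
  proof (rule nn_integral_FTC_Icc)
    show "(\<lambda>y. cos_kernel m (ep * y)) \<in> borel_measurable borel" unfolding cos_kernel_def by measurable
    show "DERIV G y :> cos_kernel m (ep * y)" for y
      unfolding G_def[abs_def] k by (intro DERIV_sum d)
    show "- pi / ep \<le> pi / ep" using assms by (auto intro!: divide_right_mono)
  qed (simp add: cos_kernel_nonneg)
  also have "G (pi / ep) - G (- pi / ep) = (\<Sum>k\<in>{- int m..int m}. if k = 0 then 2 * pi / ep else 0)"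
    unfolding G_def sum_subtractf[symmetric] using assms
    by (intro sum.cong refl) (auto simp: sin_int_times_real sin_times_pi_eq_0 divide_simps)
  finally show ?thesis by simp
qed

section \<open>The kernel in several dimensions\<close>

definition lat_weight :: "real \<Rightarrow> nat \<Rightarrow> 'a::euclidean_space \<Rightarrow> real" where
  "lat_weight ep m x = (\<Prod>b\<in>Basis. cos_weight m (nat \<lfloor>\<bar>x \<bullet> b\<bar> / ep\<rfloor>))"

definition lat_kernel :: "real \<Rightarrow> nat \<Rightarrow> 'a::euclidean_space \<Rightarrow> real" where
  "lat_kernel ep m y = (\<Prod>b\<in>Basis. cos_kernel m (ep * (y \<bullet> b)))"

text \<open>One period: \<open>lat_kernel\<close> is a sum of characters with frequencies in the
  lattice, so it has period 2 pi / ep in each coordinate.\<close>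

definition pcube :: "real \<Rightarrow> 'a::euclidean_space set" where
  "pcube ep = {y. \<forall>b\<in>Basis. \<bar>y \<bullet> b\<bar> \<le> pi / ep}"

lemma lat_weight_nonneg: "0 \<le> lat_weight ep m x"
  unfolding lat_weight_def by (intro prod_nonneg) (simp add: cos_weight_nonneg)

lemma lat_weight_le_1: "lat_weight ep m x \<le> 1"
  unfolding lat_weight_def by (intro prod_le_1) (simp add: cos_weight_nonneg cos_weight_le_1)

lemma lat_weight_minus: "lat_weight ep m (- x) = lat_weight ep m x"
  unfolding lat_weight_def by simp

lemma lat_weight_tendsto: "(\<lambda>m. lat_weight ep m x) \<longlonglongrightarrow> 1"
proof -
  have "(\<lambda>m. lat_weight ep m x) \<longlonglongrightarrow> (\<Prod>b\<in>(Basis :: 'a set). 1)"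
    unfolding lat_weight_def by (intro tendsto_prod cos_weight_tendsto)
  then show ?thesis by simp
qed

lemma lat_kernel_nonneg: "0 \<le> lat_kernel ep m y"
  unfolding lat_kernel_def by (intro prod_nonneg) (simp add: cos_kernel_nonneg)

lemma lat_kernel_measurable [measurable]: "lat_kernel ep m \<in> borel_measurable borel"
  unfolding lat_kernel_def cos_kernel_def by measurable

lemma pcube_measurable [measurable]: "pcube ep \<in> sets borel"
  unfolding pcube_def by measurable

lemma lat_kernel_sum:
  fixes y :: "'a::euclidean_space"
  assumes "0 < ep"
  shows "complex_of_real (lat_kernel ep m y) = (\<Sum>x\<in>latbox ep m. of_real (lat_weight ep m x) * cis (x \<bullet> y))"
proof -
  let ?f = "\<lambda>k. \<Sum>b\<in>(Basis :: 'a set). (ep * of_int (k b :: int)) *\<^sub>R b"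
  let ?K = "PiE (Basis :: 'a set) (\<lambda>_. {- int m..int m})"
  have fb: "?f k \<bullet> b = ep * of_int (k b)" if "b \<in> Basis" for k b
    using that by (simp add: inner_sum_left inner_Basis if_distrib cong: if_cong)
  have inj: "inj_on ?f ?K"
  proof (rule inj_onI)
    fix k l assume kl: "k \<in> ?K" "l \<in> ?K" "?f k = ?f l"
    show "k = l"
    proof (rule PiE_ext[OF kl(1,2)])
      fix b :: 'a assume b: "b \<in> Basis"
      have "ep * of_int (k b) = ep * of_int (l b)" using arg_cong[OF kl(3), of "\<lambda>x. x \<bullet> b"] unfolding fb[OF b] .
      then show "k b = l b" using assms by simp
    qed
  qed
  have "complex_of_real (lat_kernel ep m y)
    = (\<Prod>b\<in>(Basis :: 'a set). \<Sum>k\<in>{- int m..int m}. of_real (cos_weight m (nat \<bar>k\<bar>)) * cis (of_int k * (ep * (y \<bullet> b))))"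
    unfolding lat_kernel_def of_real_prod cos_kernel_sum ..
  also have "\<dots> = (\<Sum>k\<in>?K. \<Prod>b\<in>Basis. of_real (cos_weight m (nat \<bar>k b\<bar>)) * cis (of_int (k b) * (ep * (y \<bullet> b))))"
    by (intro prod_sum_PiE) auto
  also have "\<dots> = (\<Sum>k\<in>?K. of_real (lat_weight ep m (?f k)) * cis (?f k \<bullet> y))"
  proof (intro sum.cong refl)
    fix k :: "'a \<Rightarrow> int"
    have "lat_weight ep m (?f k) = (\<Prod>b\<in>Basis. cos_weight m (nat \<bar>k b\<bar>))"
      unfolding lat_weight_def
    proof (intro prod.cong refl)
      fix b :: 'a assume b: "b \<in> Basis"
      have "\<bar>?f k \<bullet> b\<bar> / ep = of_int \<bar>k b\<bar>" unfolding fb[OF b] using assms by (simp add: abs_mult)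
      then show "cos_weight m (nat \<lfloor>\<bar>?f k \<bullet> b\<bar> / ep\<rfloor>) = cos_weight m (nat \<bar>k b\<bar>)" by (simp only: floor_of_int)
    qed
    moreover have "cis (?f k \<bullet> y) = (\<Prod>b\<in>Basis. cis (of_int (k b) * (ep * (y \<bullet> b))))"
    proof -
      have "?f k \<bullet> y = (\<Sum>b\<in>Basis. of_int (k b) * (ep * (y \<bullet> b)))"
        unfolding inner_sum_left by (intro sum.cong refl) (simp add: inner_commute)
      then show ?thesis by (simp only: cis_conv_exp of_real_sum sum_distrib_left exp_sum finite_Basis)
    qed
    ultimately show "(\<Prod>b\<in>Basis. of_real (cos_weight m (nat \<bar>k b\<bar>)) * cis (of_int (k b) * (ep * (y \<bullet> b))))
      = of_real (lat_weight ep m (?f k)) * cis (?f k \<bullet> y)"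
      by (simp only: prod.distrib of_real_prod)
  qed
  also have "\<dots> = (\<Sum>x\<in>?f ` ?K. of_real (lat_weight ep m x) * cis (x \<bullet> y))"
    by (simp only: sum.reindex[OF inj] o_def)
  finally show ?thesis unfolding latbox_eq[OF assms] .
qed

lemma nn_integral_lat_kernel:
  assumes "0 < ep"
  shows "(\<integral>\<^sup>+y. ennreal (lat_kernel ep m y) * indicator (pcube ep) y \<partial>(lborel :: 'a::euclidean_space measure)) = ennreal ((2 * pi / ep) ^ DIM('a))"
    (is "integral\<^sup>N lborel ?g = _")
proof -
  let ?h = "\<lambda>t. ennreal (cos_kernel m (ep * t)) * indicator {- pi / ep..pi / ep} t"
  have "?g y = (\<Prod>b\<in>Basis. ?h (y \<bullet> b))" for y :: 'a
  proof (cases "y \<in> pcube ep")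
    case True
    then have "(\<Prod>b\<in>Basis. ?h (y \<bullet> b)) = (\<Prod>b\<in>Basis. ennreal (cos_kernel m (ep * (y \<bullet> b))))"
      by (intro prod.cong refl) (auto simp: pcube_def abs_le_iff indicator_def minus_le_iff)
    then show ?thesis using True by (simp add: lat_kernel_def prod_ennreal cos_kernel_nonneg)
  next
    case False
    then obtain b where b: "b \<in> Basis" "\<not> \<bar>y \<bullet> b\<bar> \<le> pi / ep" by (auto simp: pcube_def)
    then have "?h (y \<bullet> b) = 0" by (auto simp: abs_le_iff indicator_def)
    then have "(\<Prod>b\<in>Basis. ?h (y \<bullet> b)) = 0" using b(1) by (intro prod_zero) auto
    then show ?thesis using False by simp
  qed
  then have "integral\<^sup>N lborel ?g = (\<integral>\<^sup>+y. (\<Prod>b\<in>Basis. ?h (y \<bullet> b)) \<partial>(lborel :: 'a measure))" by (simp only:)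
  also have "\<dots> = (\<Prod>b\<in>(Basis :: 'a set). \<integral>\<^sup>+t. ?h t \<partial>lborel)"
    by (rule nn_integral_lborel_prod) (auto simp: cos_kernel_def)
  also have "\<dots> = (\<Prod>b\<in>(Basis :: 'a set). ennreal (2 * pi / ep))" by (simp only: nn_integral_cos_kernel[OF assms])
  also have "\<dots> = ennreal ((2 * pi / ep) ^ DIM('a))" using assms by (simp add: ennreal_power)
  finally show ?thesis .
qed

lemma emeasure_pcube:
  assumes "0 < ep" shows "emeasure lborel (pcube ep :: 'a::euclidean_space set) = ennreal ((2 * pi / ep) ^ DIM('a))"
proof -
  have "(\<integral>\<^sup>+y. ennreal (lat_kernel ep 0 y) * indicator (pcube ep) y \<partial>(lborel :: 'a measure)) = emeasure lborel (pcube ep :: 'a set)"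
    by (simp add: lat_kernel_def cos_kernel_def)
  then show ?thesis using nn_integral_lat_kernel[OF assms, of 0] by metis
qed

text \<open>A bound for the kernel on the period cube where some coordinate is at least r, with t =
  ep r: that coordinate supplies the decay, and each of the d coordinates a factor 2m + 1.\<close>

definition tail :: "nat \<Rightarrow> real \<Rightarrow> nat \<Rightarrow> real" where
  "tail d t m = real (2 * m + 1) ^ d * cos (t / 2) ^ (2 * m)"

lemma lat_kernel_tail:
  fixes y :: "'a::euclidean_space"
  assumes "0 < ep" "0 \<le> r" "y \<in> pcube ep" "b \<in> Basis" "r \<le> \<bar>y \<bullet> b\<bar>"
  shows "lat_kernel ep m y \<le> tail DIM('a) (ep * r) m"
proof -
  have "\<bar>y \<bullet> b\<bar> \<le> pi / ep" using assms(3,4) by (simp add: pcube_def)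
  then have "ep * \<bar>y \<bullet> b\<bar> \<le> pi" using assms(1) by (simp add: field_simps)
  then have 1: "cos_kernel m (ep * (y \<bullet> b)) \<le> real (2 * m + 1) * cos (ep * r / 2) ^ (2 * m)"
    using assms by (intro cos_kernel_tail) (auto simp: abs_mult)
  have "(\<Prod>c\<in>Basis - {b}. cos_kernel m (ep * (y \<bullet> c))) \<le> (\<Prod>c\<in>(Basis :: 'a set) - {b}. real (2 * m + 1))"
    by (intro prod_mono conjI cos_kernel_nonneg cos_kernel_le)
  then have 2: "(\<Prod>c\<in>Basis - {b}. cos_kernel m (ep * (y \<bullet> c))) \<le> real (2 * m + 1) ^ (DIM('a) - 1)"
    using assms(4) by simp
  have "lat_kernel ep m y = cos_kernel m (ep * (y \<bullet> b)) * (\<Prod>c\<in>Basis - {b}. cos_kernel m (ep * (y \<bullet> c)))"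
    unfolding lat_kernel_def using assms(4) by (subst prod.remove[of _ b]) auto
  also have "\<dots> \<le> (real (2 * m + 1) * cos (ep * r / 2) ^ (2 * m)) * real (2 * m + 1) ^ (DIM('a) - 1)"
    using 1 2 by (intro mult_mono prod_nonneg) (auto simp: cos_kernel_nonneg power_mult)
  also have "\<dots> = real (2 * m + 1) ^ Suc (DIM('a) - 1) * cos (ep * r / 2) ^ (2 * m)" by (simp only: power_Suc mult_ac)
  also have "Suc (DIM('a) - 1) = DIM('a)" by simp
  finally show ?thesis unfolding tail_def .
qed

lemma tail_nonneg: "0 \<le> tail d t m"
  by (simp add: tail_def power_mult)

lemma tail_tendsto:
  assumes "0 < t" "t < pi" shows "(\<lambda>m. tail d t m) \<longlonglongrightarrow> 0"
proof -
  have c: "0 < cos (t / 2)" using assms by (intro cos_gt_zero) auto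
  have c1: "cos (t / 2) < 1" using assms cos_monotone_0_pi[of 0 "t / 2"] by simp
  define x where "x = cos (t / 2) ^ 2"
  have x: "0 < x" "x < 1" using c c1 by (auto simp: x_def power_less_one_iff)
  \<comment> \<open>A root of order d + 1 divides the decay into equal shares: d of them absorb the
    polynomial factors, the last one tends to 0.\<close>
  define y where "y = root (Suc d) x"
  have y: "0 < y" "y < 1" "y ^ Suc d = x" unfolding y_def using x by (simp_all only: real_root_pow_pos zero_less_Suc real_root_gt_0_iff real_root_lt_1_iff)
  have "(\<lambda>m. 2 * (of_nat m * y ^ m) + y ^ m) \<longlonglongrightarrow> 2 * 0 + 0"
    using y by (intro tendsto_intros powser_times_n_limit_0 LIMSEQ_power_zero) auto
  then have 1: "(\<lambda>m. real (2 * m + 1) * y ^ m) \<longlonglongrightarrow> 0" by (simp add: algebra_simps)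
  have "(\<lambda>m. (real (2 * m + 1) * y ^ m) ^ d * y ^ m) \<longlonglongrightarrow> 0 ^ d * 0"
    using y by (intro tendsto_intros 1 LIMSEQ_power_zero) auto
  moreover have "(real (2 * m + 1) * y ^ m) ^ d * y ^ m = tail d t m" for m
  proof -
    have "(y ^ m) ^ d * y ^ m = (y ^ Suc d) ^ m"
      by (simp add: power_mult_distrib power_mult[symmetric] mult.commute)
    also have "\<dots> = cos (t / 2) ^ (2 * m)" by (simp only: y(3) x_def power_mult)
    finally show ?thesis by (simp add: tail_def power_mult_distrib mult.assoc)
  qed
  ultimately show ?thesis by simp
qed

lemma tail_antimono: "0 \<le> s \<Longrightarrow> s \<le> t \<Longrightarrow> t \<le> pi \<Longrightarrow> tail d t m \<le> tail d s m"
  unfolding tail_def by (intro mult_left_mono power_mono cos_monotone_0_pi_le cos_ge_zero) auto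

section \<open>Approximation of the local time\<close>

lemma cube_norm_less:
  fixes y :: "'a::euclidean_space"
  assumes "\<And>b. b \<in> Basis \<Longrightarrow> \<bar>y \<bullet> b\<bar> < s / real DIM('a)"
  shows "norm y < s"
proof -
  have "norm y \<le> (\<Sum>b\<in>Basis. \<bar>y \<bullet> b\<bar>)" by (rule norm_le_l1)
  also have "\<dots> < (\<Sum>b\<in>(Basis :: 'a set). s / real DIM('a))" using assms by (intro sum_strict_mono) auto
  finally show ?thesis by simp
qed

text \<open>The factor normalises the kernel to mass 1 per period, but the integral runs over the
  whole space. Further periods only add mass, so lower bounds hold at every mesh; upper bounds need
  the support of \<open>g\<close> inside one period.\<close>

definition kernel_mean :: "real \<Rightarrow> nat \<Rightarrow> ('a::euclidean_space \<Rightarrow> real) \<Rightarrow> ennreal" where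
  "kernel_mean ep m g = ennreal ((ep / (2 * pi)) ^ DIM('a)) * (\<integral>\<^sup>+y. ennreal (lat_kernel ep m y) * ennreal (g y) \<partial>lborel)"

lemma scale_inverse:
  assumes "0 < ep" shows "ennreal ((ep / (2 * pi)) ^ d) * ennreal ((2 * pi / ep) ^ d) = 1"
proof -
  have "(ep / (2 * pi)) ^ d * (2 * pi / ep) ^ d = (1::real)"
    unfolding power_mult_distrib[symmetric] using assms by simp
  then show ?thesis using assms by (subst ennreal_mult[symmetric]) auto
qed

text \<open>The normalised kernel has mass 1 on the period cube. The part outside the small cube is
  at most the uniform bound \<open>tail\<close>, because the normalised volume of the period cube is
  1 as well.\<close>

lemma kernel_mean_lower:
  fixes g :: "'a::euclidean_space \<Rightarrow> real"
  assumes ep: "0 < ep" and c: "0 \<le> c" and r: "0 \<le> r"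
    and near: "\<And>y. (\<And>b. b \<in> Basis \<Longrightarrow> \<bar>y \<bullet> b\<bar> < r) \<Longrightarrow> c \<le> g y"
  shows "ennreal (c * (1 - tail DIM('a) (ep * r) m)) \<le> kernel_mean ep m g"
proof -
  let ?K = "lat_kernel ep m :: 'a \<Rightarrow> real" and ?T = "tail DIM('a) (ep * r) m"
  let ?B = "pcube ep \<inter> {y. \<forall>b\<in>Basis. \<bar>y \<bullet> b\<bar> < r} :: 'a set" and ?D = "ennreal ((ep / (2 * pi)) ^ DIM('a))"
  define A where "A = (\<integral>\<^sup>+y. ennreal (?K y) * indicator ?B y \<partial>lborel)"
  have [measurable]: "?B \<in> sets borel" by measurable
  have "ennreal (?K y) * indicator (pcube ep) y \<le> ennreal (?K y) * indicator ?B y + ennreal ?T * indicator (pcube ep) y" for y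
  proof (cases "y \<in> pcube ep \<and> y \<notin> ?B")
    case True
    then obtain b where "b \<in> Basis" "r \<le> \<bar>y \<bullet> b\<bar>" by (auto simp: not_less)
    then have "?K y \<le> ?T" using True ep r by (intro lat_kernel_tail) auto
    then show ?thesis using True by (auto intro!: ennreal_leI)
  qed (auto simp: indicator_def)
  then have "(\<integral>\<^sup>+y. ennreal (?K y) * indicator (pcube ep) y \<partial>lborel)
    \<le> (\<integral>\<^sup>+y. ennreal (?K y) * indicator ?B y + ennreal ?T * indicator (pcube ep) y \<partial>lborel)"
    by (intro nn_integral_mono)
  also have "\<dots> = A + ennreal ?T * ennreal ((2 * pi / ep) ^ DIM('a))"
    unfolding A_def by (subst nn_integral_add) (simp_all add: nn_integral_cmult_indicator emeasure_pcube[OF ep])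
  finally have "ennreal ((2 * pi / ep) ^ DIM('a)) \<le> A + ennreal ?T * ennreal ((2 * pi / ep) ^ DIM('a))"
    unfolding nn_integral_lat_kernel[OF ep] .
  from mult_left_mono[OF this, of ?D]
  have "?D * ennreal ((2 * pi / ep) ^ DIM('a)) \<le> ?D * A + ennreal ?T * (?D * ennreal ((2 * pi / ep) ^ DIM('a)))"
    by (simp add: distrib_left mult.left_commute)
  then have one: "1 \<le> ?D * A + ennreal ?T" unfolding scale_inverse[OF ep] by simp
  have "ennreal (1 - ?T) \<le> ?D * A"
  proof (cases "?D * A")
    case (real x)
    then have "ennreal 1 \<le> ennreal (x + ?T)" using one by (simp add: tail_nonneg)
    then have "1 \<le> x + ?T" using real(1) tail_nonneg[of "DIM('a)" "ep * r" m] by (subst (asm) ennreal_le_iff) auto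
    then show ?thesis unfolding real(2) by (intro ennreal_leI) simp
  qed simp
  from mult_left_mono[OF this, of "ennreal c"]
  have "ennreal (c * (1 - ?T)) \<le> ennreal c * (?D * A)" unfolding ennreal_mult'[OF c] by simp
  also have "\<dots> = ?D * (\<integral>\<^sup>+y. ennreal c * (ennreal (?K y) * indicator ?B y) \<partial>lborel)"
    unfolding A_def by (subst nn_integral_cmult) (auto simp: mult.left_commute)
  also have "\<dots> \<le> kernel_mean ep m g"
    unfolding kernel_mean_def
  proof (intro mult_left_mono nn_integral_mono)
    fix y :: 'a
    show "ennreal c * (ennreal (?K y) * indicator ?B y) \<le> ennreal (?K y) * ennreal (g y)"
    proof (cases "y \<in> ?B")
      case True
      then have "ennreal c \<le> ennreal (g y)" by (intro ennreal_leI near) auto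
      then have "ennreal c * ennreal (?K y) \<le> ennreal (g y) * ennreal (?K y)" by (rule mult_right_mono) simp
      then show ?thesis using True by (simp add: mult.commute)
    qed simp
  qed simp
  finally show ?thesis .
qed

text \<open>In the small cube \<open>g\<close> is at most \<open>c\<close>; elsewhere the kernel is
  at most \<open>tail\<close>, which multiplies the whole mass of \<open>g\<close>. That mass is not
  rescaled, and \<open>ep \<le> 1\<close> keeps the normalising factor below 1.\<close>

lemma kernel_mean_upper:
  fixes g :: "'a::euclidean_space \<Rightarrow> real"
  assumes ep: "0 < ep" "ep \<le> 1" and c: "0 \<le> c" and r: "0 \<le> r" and [measurable]: "g \<in> borel_measurable borel"
    and near: "\<And>y. (\<And>b. b \<in> Basis \<Longrightarrow> \<bar>y \<bullet> b\<bar> < r) \<Longrightarrow> g y \<le> c" and g0: "\<And>y. 0 \<le> g y"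
    and supp: "AE y in lborel. y \<notin> pcube ep \<longrightarrow> g y = 0"
    and mass: "(\<integral>\<^sup>+y. ennreal (g y) \<partial>lborel) = ennreal I" "0 \<le> I"
  shows "kernel_mean ep m g \<le> ennreal (c + tail DIM('a) (ep * r) m * I)"
proof -
  let ?K = "lat_kernel ep m :: 'a \<Rightarrow> real" and ?T = "tail DIM('a) (ep * r) m"
  let ?D = "ennreal ((ep / (2 * pi)) ^ DIM('a))"
  have "(ep / (2 * pi)) ^ DIM('a) \<le> 1" using ep pi_gt3 by (intro power_le_one) (auto simp: divide_simps)
  then have D1: "?D \<le> 1" by (simp add: ennreal_le_1)
  have "(\<integral>\<^sup>+y. ennreal (?K y) * ennreal (g y) \<partial>lborel)
    \<le> (\<integral>\<^sup>+y. ennreal c * (ennreal (?K y) * indicator (pcube ep) y) + ennreal ?T * ennreal (g y) \<partial>lborel)"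
  proof (rule nn_integral_mono_AE)
    show "AE y in lborel. ennreal (?K y) * ennreal (g y) \<le> ennreal c * (ennreal (?K y) * indicator (pcube ep) y) + ennreal ?T * ennreal (g y)"
      using supp
    proof eventually_elim
      fix y assume s: "y \<notin> pcube ep \<longrightarrow> g y = 0"
      show "ennreal (?K y) * ennreal (g y) \<le> ennreal c * (ennreal (?K y) * indicator (pcube ep) y) + ennreal ?T * ennreal (g y)"
      proof (cases "y \<in> pcube ep")
        case True
        show ?thesis
        proof (cases "\<forall>b\<in>Basis. \<bar>y \<bullet> b\<bar> < r")
          case b: True
          then have "ennreal (?K y) * ennreal (g y) \<le> ennreal (?K y) * ennreal c"
            by (intro mult_left_mono ennreal_leI near) auto
          also have "\<dots> \<le> ennreal c * (ennreal (?K y) * indicator (pcube ep) y) + ennreal ?T * ennreal (g y)"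
            using True by (simp add: mult.commute)
          finally show ?thesis .
        next
          case False
          then obtain b where "b \<in> Basis" "r \<le> \<bar>y \<bullet> b\<bar>" by (auto simp: not_less)
          then have "?K y \<le> ?T" using True ep r by (intro lat_kernel_tail) auto
          then have "ennreal (?K y) * ennreal (g y) \<le> ennreal ?T * ennreal (g y)"
            by (intro mult_right_mono ennreal_leI) auto
          also have "\<dots> \<le> ennreal c * (ennreal (?K y) * indicator (pcube ep) y) + ennreal ?T * ennreal (g y)" by simp
          finally show ?thesis .
        qed
      next
        case False then show ?thesis using s by simp
      qed
    qed
  qed
  also have "\<dots> = ennreal c * ennreal ((2 * pi / ep) ^ DIM('a)) + ennreal ?T * ennreal I"
    by (subst nn_integral_add) (simp_all add: nn_integral_cmult nn_integral_lat_kernel[OF ep(1)] mass)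
  finally have "kernel_mean ep m g \<le> ?D * (ennreal c * ennreal ((2 * pi / ep) ^ DIM('a)) + ennreal ?T * ennreal I)"
    unfolding kernel_mean_def by (intro mult_left_mono) auto
  also have "\<dots> = ennreal c * (?D * ennreal ((2 * pi / ep) ^ DIM('a))) + ?D * (ennreal ?T * ennreal I)"
    by (simp add: distrib_left mult.left_commute)
  also have "\<dots> \<le> ennreal c + 1 * (ennreal ?T * ennreal I)"
    unfolding scale_inverse[OF ep(1)] using D1 by (intro add_mono mult_right_mono) auto
  also have "\<dots> = ennreal (c + ?T * I)"
    using c mass(2) tail_nonneg[of "DIM('a)" "ep * r" m] by (simp add: ennreal_mult)
  finally show ?thesis .
qed

lemma eventually_kernel_mean_ge:
  fixes g :: "'a::euclidean_space \<Rightarrow> real"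
  assumes cont: "continuous_on UNIV g" and ep: "\<And>j. 0 < ep j" and r1: "0 < r1"
    and tail: "\<And>r. 0 < r \<Longrightarrow> r \<le> r1 \<Longrightarrow> (\<lambda>j. tail DIM('a) (ep j * r) (m j)) \<longlonglongrightarrow> 0" and e: "0 < e"
  shows "\<forall>\<^sub>F j in sequentially. ennreal (g 0 - e) \<le> kernel_mean (ep j) (m j) g"
proof (cases "g 0 \<le> e")
  case True then show ?thesis by (simp add: ennreal_neg)
next
  case False
  define c where "c = g 0 - e / 2"
  have c: "0 < c" using False e by (simp add: c_def)
  obtain s where s: "0 < s" "\<And>y. norm y < s \<Longrightarrow> \<bar>g y - g 0\<bar> < e / 2"
    using cont e unfolding continuous_on_iff dist_norm by (metis UNIV_I diff_zero half_gt_zero real_norm_def)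
  define r where "r = min r1 (s / real DIM('a))"
  have r: "0 < r" "r \<le> r1" using r1 s by (auto simp: r_def)
  have near: "c \<le> g y" if "\<And>b. b \<in> Basis \<Longrightarrow> \<bar>y \<bullet> b\<bar> < r" for y
  proof -
    have "norm y < s" using that by (intro cube_norm_less) (auto simp: r_def)
    from s(2)[OF this] show ?thesis unfolding c_def by linarith
  qed
  have "\<forall>\<^sub>F j in sequentially. tail DIM('a) (ep j * r) (m j) < e / (2 * c)"
    using tail[OF r] e c by (intro order_tendstoD(2)) auto
  then show ?thesis
  proof eventually_elim
    case (elim j)
    have "c * tail DIM('a) (ep j * r) (m j) \<le> e / 2" using elim c by (simp add: field_simps)
    then have "g 0 - e \<le> c * (1 - tail DIM('a) (ep j * r) (m j))" by (simp add: c_def right_diff_distrib)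
    then have "ennreal (g 0 - e) \<le> ennreal (c * (1 - tail DIM('a) (ep j * r) (m j)))" by (rule ennreal_leI)
    also have "\<dots> \<le> kernel_mean (ep j) (m j) g"
      using c r by (intro kernel_mean_lower ep near) auto
    finally show ?case .
  qed
qed

text \<open>The mesh must tend to 0 here, so that eventually one period contains the support of
  \<open>g\<close>; at a fixed mesh the kernel would also see the values of \<open>g\<close> at
  other points of the dual lattice.\<close>

lemma eventually_kernel_mean_le:
  fixes g :: "'a::euclidean_space \<Rightarrow> real"
  assumes cont: "continuous_on UNIV g" and ep: "\<And>j. 0 < ep j" "\<And>j. ep j \<le> 1" "ep \<longlonglongrightarrow> 0"
    and tail: "\<And>r. 0 < r \<Longrightarrow> r \<le> 1 \<Longrightarrow> (\<lambda>j. tail DIM('a) (ep j * r) (m j)) \<longlonglongrightarrow> 0" and e: "0 < e"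
    and g0: "\<And>y. 0 \<le> g y" and supp: "AE y in lborel. R < norm y \<longrightarrow> g y = 0"
    and mass: "(\<integral>\<^sup>+y. ennreal (g y) \<partial>lborel) < \<top>"
  shows "\<forall>\<^sub>F j in sequentially. kernel_mean (ep j) (m j) g \<le> ennreal (g 0 + e)"
proof -
  have gm: "g \<in> borel_measurable borel" using cont by (rule borel_measurable_continuous_onI)
  obtain I where I: "(\<integral>\<^sup>+y. ennreal (g y) \<partial>lborel) = ennreal I" "0 \<le> I"
    using mass by (cases "\<integral>\<^sup>+y. ennreal (g y) \<partial>lborel") auto
  obtain s where s: "0 < s" "\<And>y. norm y < s \<Longrightarrow> \<bar>g y - g 0\<bar> < e / 2"
    using cont e unfolding continuous_on_iff dist_norm by (metis UNIV_I diff_zero half_gt_zero real_norm_def)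
  define r where "r = min 1 (s / real DIM('a))"
  have r: "0 < r" "r \<le> 1" using s by (auto simp: r_def)
  have near: "g y \<le> g 0 + e / 2" if "\<And>b. b \<in> Basis \<Longrightarrow> \<bar>y \<bullet> b\<bar> < r" for y
  proof -
    have "norm y < s" using that by (intro cube_norm_less) (auto simp: r_def)
    from s(2)[OF this] show ?thesis by linarith
  qed
  have "(\<lambda>j. tail DIM('a) (ep j * r) (m j) * I) \<longlonglongrightarrow> 0 * I" by (intro tendsto_intros tail r)
  then have "\<forall>\<^sub>F j in sequentially. tail DIM('a) (ep j * r) (m j) * I < e / 2"
    using e by (intro order_tendstoD(2)) auto
  moreover have lim: "(\<lambda>j. ep j * (\<bar>R\<bar> + 1)) \<longlonglongrightarrow> 0 * (\<bar>R\<bar> + 1)" by (intro tendsto_intros ep)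
  have "\<forall>\<^sub>F j in sequentially. ep j * (\<bar>R\<bar> + 1) < pi" by (rule order_tendstoD(2)[OF lim]) simp
  ultimately show ?thesis
  proof eventually_elim
    case (elim j)
    have "y \<notin> pcube (ep j) \<Longrightarrow> R < norm y" for y :: 'a
    proof -
      assume "y \<notin> pcube (ep j)"
      then obtain b where b: "b \<in> Basis" "pi / ep j < \<bar>y \<bullet> b\<bar>" by (auto simp: pcube_def not_le)
      have "\<bar>R\<bar> + 1 < pi / ep j" using elim(2) ep(1)[of j] by (simp add: field_simps)
      also have "\<dots> < norm y" using b Basis_le_norm[OF b(1), of y] by simp
      finally show ?thesis by simp
    qed
    then have "AE y in lborel. y \<notin> pcube (ep j) \<longrightarrow> g y = 0" using supp by (auto elim: eventually_mono)
    then have "kernel_mean (ep j) (m j) g \<le> ennreal (g 0 + e / 2 + tail DIM('a) (ep j * r) (m j) * I)"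
      using e r g0[of 0] by (intro kernel_mean_upper ep near g0 gm I) auto
    also have "\<dots> \<le> ennreal (g 0 + e)" using elim(1) by (intro ennreal_leI) simp
    finally show ?case .
  qed
qed

text \<open>One-sided limits bound the path near each time, and Bolzano's bisection principle passes
  to a compact interval. This gives the occupation measure bounded support.\<close>

lemma (in levy) bounded_path:
  assumes w: "w \<in> space M" shows "\<exists>B. \<forall>s\<in>{0..t}. norm (X s w) \<le> B"
proof (cases "0 \<le> t")
  case True
  have "\<exists>B. \<forall>s\<in>{0..t}. norm (X (max 0 s) w) \<le> B"
    using True
  proof (induction rule: Bolzano[where P = "\<lambda>a b. \<exists>B. \<forall>s\<in>{a..b}. norm (X (max 0 s) w) \<le> B"])
    case (trans a b c)
    then obtain B C where B: "\<forall>s\<in>{a..b}. norm (X (max 0 s) w) \<le> B" and C: "\<forall>s\<in>{b..c}. norm (X (max 0 s) w) \<le> C" by blast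
    have "norm (X (max 0 s) w) \<le> max B C" if "s \<in> {a..c}" for s
      using that B C by (cases "s \<le> b") (auto simp: le_max_iff_disj)
    then show ?case by blast
  next
    case (local x)
    have "((\<lambda>s. X s w) \<longlongrightarrow> X x w) (at_right x)"
      using X_right_continuous[OF w, of x] local by (simp add: continuous_within)
    then have "\<forall>\<^sub>F s in at_right x. dist (X s w) (X x w) < 1" by (rule tendstoD) simp
    then obtain c where c: "x < c" "\<And>s. x < s \<Longrightarrow> s < c \<Longrightarrow> dist (X s w) (X x w) < 1"
      unfolding eventually_at_right_field by blast
    have "\<exists>b<x. \<exists>B. \<forall>s. b < s \<and> s < x \<longrightarrow> norm (X (max 0 s) w) \<le> B"
    proof (cases "x = 0")
      case True
      have "\<forall>s. - 1 < s \<and> s < x \<longrightarrow> norm (X (max 0 s) w) \<le> norm (X 0 w)" using True by auto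
      then show ?thesis using True by (intro exI[of _ "- 1"]) auto
    next
      case False
      then obtain l where "((\<lambda>s. X s w) \<longlongrightarrow> l) (at_left x)"
        using levy w local unfolding levy_process_with_symbol_def by (metis order_le_less)
      then have "\<forall>\<^sub>F s in at_left x. dist (X s w) l < 1" by (rule tendstoD) simp
      then obtain b where b: "b < x" "\<And>s. b < s \<Longrightarrow> s < x \<Longrightarrow> dist (X s w) l < 1"
        unfolding eventually_at_left_field by blast
      have "norm (X (max 0 s) w) \<le> norm l + 1" if "max 0 b < s" "s < x" for s
        using b(2)[of s] that norm_triangle_sub[of "X s w" l] by (simp add: dist_norm)
      moreover have "max 0 b < x" using b False local by auto
      ultimately show ?thesis by blast
    qed
    then obtain b B where b: "b < x" "\<And>s. b < s \<Longrightarrow> s < x \<Longrightarrow> norm (X (max 0 s) w) \<le> B" by blast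
    define \<delta> where "\<delta> = min (c - x) (x - b)"
    have "norm (X (max 0 s) w) \<le> max B (norm (X x w) + 1)" if "\<bar>s - x\<bar> < \<delta>" for s
    proof -
      consider "s < x" | "s = x" | "x < s" by linarith
      then show ?thesis
      proof cases
        case 1 then show ?thesis using b(2)[of s] that by (simp add: \<delta>_def le_max_iff_disj)
      next
        case 2 then show ?thesis using local by (simp add: le_max_iff_disj)
      next
        case 3 then show ?thesis using c(2)[of s] that local norm_triangle_sub[of "X s w" "X x w"]
          by (simp add: \<delta>_def dist_norm le_max_iff_disj)
      qed
    qed
    moreover have "0 < \<delta>" using b c by (simp add: \<delta>_def)
    ultimately show ?case
      by (intro exI[of _ \<delta>] conjI allI impI exI[of _ "max B (norm (X x w) + 1)"] ballI) auto
  qed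
  then obtain B where "\<forall>s\<in>{0..t}. norm (X (max 0 s) w) \<le> B" by blast
  then show ?thesis by (intro exI[of _ B]) auto
qed simp

section \<open>Trigonometric integrals of the occupation measure\<close>

context additive_levy
begin

definition path_sum :: "'w \<Rightarrow> ('p \<Rightarrow> real) \<Rightarrow> 'a" where
  "path_sum w s = (\<Sum>j\<in>UNIV. X j (max 0 (s j)) w)"

definition box :: "'w \<Rightarrow> ('p \<Rightarrow> real) set" where
  "box w = PiE UNIV (\<lambda>j. {0..\<tau> j w})"

lemma path_measurable: "w \<in> space M \<Longrightarrow> (\<lambda>t. X j (max 0 t) w) \<in> borel_measurable borel"
  by (rule levy.path_measurable[OF levy_path])

lemma path_sum_measurable:
  assumes "w \<in> space M" shows "path_sum w \<in> borel_measurable (PiM UNIV (\<lambda>_. lborel))"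
  unfolding path_sum_def
proof (intro borel_measurable_sum)
  fix j :: 'p
  show "(\<lambda>s. X j (max 0 (s j)) w) \<in> borel_measurable (PiM UNIV (\<lambda>_. lborel))"
    using path_measurable[OF assms] by (rule measurable_compose[rotated]) simp
qed

lemma box_sets: "box w \<in> sets (PiM UNIV (\<lambda>_. lborel))"
  unfolding box_def by (intro sets_PiM_I_finite) auto

lemma emeasure_box: "emeasure (PiM UNIV (\<lambda>_. lborel)) (box w) < \<top>"
proof -
  interpret product_sigma_finite "\<lambda>_::'p. lborel :: real measure" by standard
  show ?thesis unfolding box_def by (subst emeasure_PiM) (auto simp: emeasure_lborel_Icc_eq prod_ennreal)
qed

text \<open>By Fubini the product over the processes of one-dimensional time integrals is a single
  integral over the box, which identifies \<open>N UNIV x\<close> with the Fourier transform of the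
  occupation measure.\<close>

lemma
  assumes w: "w \<in> space M"
  shows N_eq_box_integral: "N UNIV x w = (\<integral>s. indicator (box w) s *\<^sub>R cis (x \<bullet> path_sum w s) \<partial>PiM UNIV (\<lambda>_. lborel))"
    and integrable_box: "integrable (PiM UNIV (\<lambda>_. lborel)) (\<lambda>s. indicator (box w) s *\<^sub>R cis (x \<bullet> path_sum w s))"
proof -
  interpret product_sigma_finite "\<lambda>_::'p. lborel :: real measure" by standard
  let ?f = "\<lambda>j s. indicator {0..\<tau> j w} s *\<^sub>R cis (x \<bullet> X j (max 0 s) w)"
  have i: "integrable lborel (?f j)" for j
    using path_measurable[OF w, of j] by (intro integrable_Icc_bounded[where C = 1]) auto
  have e: "(\<Prod>j\<in>UNIV. ?f j (s j)) = indicator (box w) s *\<^sub>R cis (x \<bullet> path_sum w s)" for s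
  proof (cases "s \<in> box w")
    case True
    then have "(\<Prod>j\<in>UNIV. ?f j (s j)) = (\<Prod>j\<in>UNIV. cis (x \<bullet> X j (max 0 (s j)) w))"
      by (intro prod.cong refl) (auto simp: box_def PiE_iff)
    also have "\<dots> = cis (x \<bullet> path_sum w s)"
      unfolding path_sum_def inner_sum_right cis_conv_exp by (simp add: sum_distrib_left exp_sum)
    finally show ?thesis using True by simp
  next
    case False
    then obtain j where "s j \<notin> {0..\<tau> j w}" by (auto simp: box_def PiE_iff)
    then have "?f j (s j) = 0" by simp
    then have "(\<Prod>j\<in>UNIV. ?f j (s j)) = 0" by (intro prod_zero) auto
    then show ?thesis using False by simp
  qed
  have "N UNIV x w = (\<Prod>j\<in>UNIV. integral\<^sup>L lborel (?f j))"
    unfolding N_def by (intro prod.cong refl) (simp add: levy.ft_eq[OF levy_path] Int0_def)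
  also have "\<dots> = (\<integral>s. (\<Prod>j\<in>UNIV. ?f j (s j)) \<partial>PiM UNIV (\<lambda>_. lborel))"
    by (rule product_integral_prod[symmetric]) (auto intro: i)
  finally show "N UNIV x w = (\<integral>s. indicator (box w) s *\<^sub>R cis (x \<bullet> path_sum w s) \<partial>PiM UNIV (\<lambda>_. lborel))"
    unfolding e .
  show "integrable (PiM UNIV (\<lambda>_. lborel)) (\<lambda>s. indicator (box w) s *\<^sub>R cis (x \<bullet> path_sum w s))"
    using product_integrable_prod[of UNIV ?f] i unfolding e by simp
qed

lemma occupation_density_integral:
  assumes w: "w \<in> space M" and h[measurable]: "h \<in> borel_measurable borel"
    and occ: "\<And>A. A \<in> sets borel \<Longrightarrow> occupation X (\<lambda>j. \<tau> j w) A w = (\<integral>\<^sup>+x. h x * indicator A x \<partial>lborel)"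
    and k[measurable]: "k \<in> borel_measurable borel"
  shows "(\<integral>\<^sup>+s. indicator (box w) s * k (path_sum w s) \<partial>PiM UNIV (\<lambda>_. lborel)) = (\<integral>\<^sup>+y. k y * h y \<partial>lborel)"
proof -
  let ?P = "PiM (UNIV :: 'p set) (\<lambda>_. lborel :: real measure)"
  have [measurable]: "path_sum w \<in> borel_measurable ?P" "box w \<in> sets ?P"
    using path_sum_measurable[OF w] box_sets by auto
  have "distr (density ?P (indicator (box w))) borel (path_sum w) = density lborel h"
  proof (rule measure_eqI)
    fix A assume "A \<in> sets (distr (density ?P (indicator (box w))) borel (path_sum w))"
    then have A[measurable]: "A \<in> sets borel" by simp
    have [measurable]: "path_sum w -` A \<inter> space ?P \<in> sets ?P" by measurable
    have "emeasure (distr (density ?P (indicator (box w))) borel (path_sum w)) A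
      = (\<integral>\<^sup>+s. indicator (box w) s * indicator (path_sum w -` A \<inter> space ?P) s \<partial>?P)"
      by (simp add: emeasure_distr emeasure_density)
    also have "\<dots> = (\<integral>\<^sup>+s. indicator (box w \<inter> (path_sum w -` A \<inter> space ?P)) s \<partial>?P)"
      by (simp add: indicator_inter_arith)
    also have "\<dots> = emeasure ?P (box w \<inter> (path_sum w -` A \<inter> space ?P))" by (intro nn_integral_indicator) measurable
    also have "box w \<inter> (path_sum w -` A \<inter> space ?P) = {s \<in> PiE UNIV (\<lambda>j. {0..\<tau> j w}). (\<Sum>j\<in>UNIV. X j (s j) w) \<in> A}"
    proof -
      have "path_sum w s = (\<Sum>j\<in>UNIV. X j (s j) w)" if "s \<in> box w" for s
        unfolding path_sum_def using that by (intro sum.cong refl) (auto simp: box_def PiE_iff max_def)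
      then show ?thesis by (auto simp: box_def space_PiM)
    qed
    finally show "emeasure (distr (density ?P (indicator (box w))) borel (path_sum w)) A = emeasure (density lborel h) A"
      using occ[OF A] by (simp add: occupation_def emeasure_density)
  qed simp
  then have "(\<integral>\<^sup>+y. k y \<partial>distr (density ?P (indicator (box w))) borel (path_sum w)) = (\<integral>\<^sup>+y. k y \<partial>density lborel h)" by simp
  then show ?thesis by (simp add: nn_integral_distr nn_integral_density mult.commute)
qed

text \<open>The weights \<open>lat_weight\<close> turn the finite combination into the integral of
  the nonnegative \<open>lat_kernel\<close> against the occupation measure, and then against its
  density.\<close>

lemma Sm_kernel:
  assumes w: "w \<in> space M" and h[measurable]: "h \<in> borel_measurable borel"
    and occ: "\<And>A. A \<in> sets borel \<Longrightarrow> occupation X (\<lambda>j. \<tau> j w) A w = (\<integral>\<^sup>+x. h x * indicator A x \<partial>lborel)"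
    and ep: "0 < ep"
  shows "0 \<le> Re (Sm UNIV (latbox ep m) (lat_weight ep m) w)"
    and "ennreal (Re (Sm UNIV (latbox ep m) (lat_weight ep m) w)) = (\<integral>\<^sup>+y. ennreal (lat_kernel ep m y) * h y \<partial>lborel)"
proof -
  let ?P = "PiM (UNIV :: 'p set) (\<lambda>_. lborel :: real measure)"
  let ?k = "\<lambda>s. indicator (box w) s * lat_kernel ep m (path_sum w s)"
  have c: "complex_of_real (?k s) = (\<Sum>x\<in>latbox ep m. of_real (lat_weight ep m x) * (indicator (box w) s *\<^sub>R cis (x \<bullet> path_sum w s)))" for s
    unfolding of_real_mult lat_kernel_sum[OF ep] sum_distrib_left
    by (intro sum.cong refl) (simp add: scaleR_conv_of_real mult_ac)
  have ic: "integrable ?P (\<lambda>s. complex_of_real (?k s))"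
    unfolding c by (intro Bochner_Integration.integrable_sum integrable_mult_right integrable_box[OF w])
  have i: "integrable ?P ?k" using integrable_Re[OF ic] by (simp only: Re_complex_of_real)
  have "Sm UNIV (latbox ep m) (lat_weight ep m) w = (\<integral>s. complex_of_real (?k s) \<partial>?P)"
    unfolding c Sm_def N_eq_box_integral[OF w]
    by (subst Bochner_Integration.integral_sum)
      (rule integrable_mult_right integrable_box[OF w] | simp only: integral_mult_right_zero)+
  also have "\<dots> = complex_of_real (integral\<^sup>L ?P ?k)" by (rule integral_complex_of_real)
  finally have R: "Re (Sm UNIV (latbox ep m) (lat_weight ep m) w) = integral\<^sup>L ?P ?k" by simp
  have k0: "0 \<le> ?k s" for s by (simp add: lat_kernel_nonneg)
  show "0 \<le> Re (Sm UNIV (latbox ep m) (lat_weight ep m) w)" unfolding R using k0 by (intro Bochner_Integration.integral_nonneg) auto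
  have "ennreal (integral\<^sup>L ?P ?k) = (\<integral>\<^sup>+s. ennreal (?k s) \<partial>?P)"
    using i k0 by (intro nn_integral_eq_integral[symmetric]) auto
  also have "\<dots> = (\<integral>\<^sup>+s. indicator (box w) s * ennreal (lat_kernel ep m (path_sum w s)) \<partial>?P)"
    by (intro nn_integral_cong) (simp add: indicator_def)
  also have "\<dots> = (\<integral>\<^sup>+y. ennreal (lat_kernel ep m y) * h y \<partial>lborel)"
    using w h occ by (intro occupation_density_integral) auto
  finally show "ennreal (Re (Sm UNIV (latbox ep m) (lat_weight ep m) w)) = (\<integral>\<^sup>+y. ennreal (lat_kernel ep m y) * h y \<partial>lborel)"
    unfolding R .
qed

lemma AE_tau_nonneg: "AE w in M. \<forall>j. 0 \<le> \<tau> j w"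
proof -
  have "AE w in M. 0 \<le> \<tau> j w" for j
    by (subst distributed_AE2[OF distr_tau[of j]]) (auto simp: exponential_density_def)
  then show ?thesis by (subst AE_all_countable) auto
qed

definition normalized :: "real \<Rightarrow> nat \<Rightarrow> 'w \<Rightarrow> real" where
  "normalized ep m w = (ep / (2 * pi)) ^ DIM('a) * Re (Sm UNIV (latbox ep m) (lat_weight ep m) w)"

lemma normalized_measurable [measurable]: "normalized ep m \<in> borel_measurable M"
  unfolding normalized_def by measurable

text \<open>It collects, for almost every sample point, a deterministic density \<open>g\<close>
  with all properties that the limit arguments use. Cutting the local time off at 0 agrees with the
  \<open>ennreal\<close> in \<open>is_local_time\<close>; the support is bounded because each path
  is bounded up to its clock value.\<close>

lemma local_time_approximation:
  assumes "is_local_time M X \<eta>"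
  shows "AE w in M. \<exists>(g :: 'a \<Rightarrow> real) R. g 0 = max 0 (\<eta> 0 (\<lambda>j. \<tau> j w) w) \<and> continuous_on UNIV g \<and> (\<forall>y. 0 \<le> g y)
    \<and> (\<integral>\<^sup>+y. ennreal (g y) \<partial>lborel) < \<top> \<and> (AE y in lborel. R < norm y \<longrightarrow> g y = 0)
    \<and> (\<forall>ep m. 0 < ep \<longrightarrow> 0 \<le> normalized ep m w \<and> ennreal (normalized ep m w) = kernel_mean ep m g)"
  using assms[unfolded is_local_time_def] AE_tau_nonneg AE_space
proof eventually_elim
  case (elim w)
  then have w: "w \<in> space M" and \<tau>: "\<And>j. 0 \<le> \<tau> j w"
    and cont: "continuous_on (UNIV \<times> {t. \<forall>j. 0 \<le> t j}) (\<lambda>(x, t). \<eta> x t w)" by auto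
  define g where "g y = max 0 (\<eta> y (\<lambda>j. \<tau> j w) w)" for y
  have gh: "ennreal (g y) = ennreal (\<eta> y (\<lambda>j. \<tau> j w) w)" for y by (simp add: g_def max_def ennreal_neg)
  have occ: "occupation X (\<lambda>j. \<tau> j w) A w = (\<integral>\<^sup>+x. ennreal (g x) * indicator A x \<partial>lborel)" if "A \<in> sets borel" for A
    unfolding gh using elim that \<tau> by auto
  have "continuous_on UNIV ((\<lambda>(x, t). \<eta> x t w) \<circ> (\<lambda>y. (y, \<lambda>j. \<tau> j w)))"
    using \<tau> by (intro continuous_on_compose continuous_on_subset[OF cont] continuous_intros) auto
  then have gc: "continuous_on UNIV g" unfolding g_def by (intro continuous_intros) (simp add: o_def)
  then have gm[measurable]: "g \<in> borel_measurable borel" by (rule borel_measurable_continuous_onI)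
  have mass: "(\<integral>\<^sup>+y. ennreal (g y) \<partial>lborel) < \<top>"
  proof -
    have "(\<integral>\<^sup>+y. ennreal (g y) \<partial>lborel) = occupation X (\<lambda>j. \<tau> j w) UNIV w" by (simp add: occ)
    also have "\<dots> < \<top>" using emeasure_box[of w] by (simp add: occupation_def box_def)
    finally show ?thesis .
  qed
  have "\<forall>j. \<exists>B. \<forall>s\<in>{0..\<tau> j w}. norm (X j s w) \<le> B" using levy.bounded_path[OF levy_path w] by blast
  then obtain B where B: "\<And>j s. s \<in> {0..\<tau> j w} \<Longrightarrow> norm (X j s w) \<le> B j" by metis
  define R where "R = (\<Sum>j\<in>UNIV. B j)"
  have "{s \<in> PiE UNIV (\<lambda>j. {0..\<tau> j w}). (\<Sum>j\<in>UNIV. X j (s j) w) \<in> {y. R < norm y}} = {}"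
  proof -
    have "norm (\<Sum>j\<in>UNIV. X j (s j) w) \<le> R" if "s \<in> PiE UNIV (\<lambda>j. {0..\<tau> j w})" for s
      unfolding R_def using that by (intro sum_norm_le B) (auto simp: PiE_iff)
    then show ?thesis by (auto simp: not_less)
  qed
  then have "occupation X (\<lambda>j. \<tau> j w) {y. R < norm y} w = 0" unfolding occupation_def by (simp only: emeasure_empty)
  moreover have "{y::'a. R < norm y} \<in> sets borel" by measurable
  ultimately have "(\<integral>\<^sup>+x. ennreal (g x) * indicator {y. R < norm y} x \<partial>lborel) = 0" using occ by metis
  then have "AE y in lborel. ennreal (g y) * indicator {y. R < norm y} y = 0"
    by (subst (asm) nn_integral_0_iff_AE) auto
  then have supp: "AE y in lborel. R < norm y \<longrightarrow> g y = 0"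
    by eventually_elim (auto simp: indicator_def g_def ennreal_eq_0_iff split: if_splits)
  have "0 \<le> normalized ep m w \<and> ennreal (normalized ep m w) = kernel_mean ep m g" if "0 < ep" for ep m
  proof -
    note S = Sm_kernel[OF w _ occ that, of m]
    have "0 \<le> Re (Sm UNIV (latbox ep m) (lat_weight ep m) w)" by (rule S(1)) auto
    then show ?thesis unfolding normalized_def kernel_mean_def using that
      by (subst S(2)[symmetric]) (auto simp: ennreal_mult)
  qed
  then have "\<forall>ep m. 0 < ep \<longrightarrow> 0 \<le> normalized ep m w \<and> ennreal (normalized ep m w) = kernel_mean ep m g" by blast
  moreover have "g 0 = max 0 (\<eta> 0 (\<lambda>j. \<tau> j w) w)" "\<forall>y. 0 \<le> g y" by (simp_all add: g_def)
  ultimately show ?case using gc mass supp by blast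
qed

end

section \<open>Moment comparison\<close>

text \<open>If c is the larger of the two scaled moduli, then |a + b| \<le> c. The even exponent
  removes the signs: the near and far parts of a combination need not be nonnegative
  separately.\<close>

lemma power_add_le_scaled:
  fixes a b :: real
  assumes "even n" "0 < \<theta>" "\<theta> < 1"
  shows "(a + b) ^ n \<le> (a / (1 - \<theta>)) ^ n + (b / \<theta>) ^ n"
proof -
  define c where "c = max (\<bar>a\<bar> / (1 - \<theta>)) (\<bar>b\<bar> / \<theta>)"
  have "\<bar>a\<bar> / (1 - \<theta>) \<le> c" "\<bar>b\<bar> / \<theta> \<le> c" by (simp_all add: c_def)
  then have "\<bar>a\<bar> \<le> c * (1 - \<theta>)" "\<bar>b\<bar> \<le> c * \<theta>" using assms by (simp_all add: field_simps)
  then have "\<bar>a + b\<bar> \<le> c" by (simp add: right_diff_distrib)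
  then have "\<bar>a + b\<bar> ^ n \<le> c ^ n" by (rule power_mono) simp
  also have "c ^ n \<le> (\<bar>a\<bar> / (1 - \<theta>)) ^ n + (\<bar>b\<bar> / \<theta>) ^ n" using assms by (simp add: c_def max_def)
  also have "\<bar>a + b\<bar> ^ n = (a + b) ^ n" using assms(1) by (simp add: power_even_abs)
  also have "(\<bar>a\<bar> / (1 - \<theta>)) ^ n + (\<bar>b\<bar> / \<theta>) ^ n = (a / (1 - \<theta>)) ^ n + (b / \<theta>) ^ n"
    using assms(1) by (simp add: power_divide power_even_abs)
  finally show ?thesis .
qed

text \<open>Truncation at L: y^n \<le> min(y, L)^n + y^(n+1) / L. Bounded convergence treats the
  first term, the bound on the next moment treats the second, and L tends to infinity at the
  end.\<close>

lemma (in prob_space) moment_liminf_ge: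
  fixes Y :: "nat \<Rightarrow> 'a \<Rightarrow> real"
  assumes i: "\<And>j. integrable M (\<lambda>w. Y j w ^ n)" "\<And>j. integrable M (\<lambda>w. Y j w ^ Suc n)"
    and Y[measurable]: "\<And>j. Y j \<in> borel_measurable M" and H[measurable]: "H \<in> borel_measurable M"
    and Y0: "AE w in M. \<forall>j. 0 \<le> Y j w" and lim: "AE w in M. (\<lambda>j. Y j w) \<longlonglongrightarrow> H w"
    and B: "\<And>j. expectation (\<lambda>w. Y j w ^ Suc n) \<le> B"
    and v: "\<forall>\<^sub>F j in sequentially. v \<le> expectation (\<lambda>w. Y j w ^ n)"
  shows "ennreal v \<le> (\<integral>\<^sup>+w. ennreal (H w ^ n) \<partial>M)"
proof -
  have H0: "AE w in M. 0 \<le> H w"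
    using Y0 lim by eventually_elim (auto intro: LIMSEQ_le_const)
  have le: "ennreal (v - B / L) \<le> (\<integral>\<^sup>+w. ennreal (H w ^ n) \<partial>M)" if L: "0 < L" for L
  proof -
    have it: "integrable M (\<lambda>w. min (Y j w) L ^ n)" for j
    proof (rule integrable_const_bound[where B = "L ^ n"])
      show "AE w in M. norm (min (Y j w) L ^ n) \<le> L ^ n"
        using Y0 by eventually_elim (use L in \<open>auto simp: norm_power intro!: power_mono\<close>)
    qed measurable
    have "expectation (\<lambda>w. Y j w ^ n) \<le> expectation (\<lambda>w. min (Y j w) L ^ n + Y j w ^ Suc n / L)" for j
    proof (rule integral_mono_AE)
      show "AE w in M. Y j w ^ n \<le> min (Y j w) L ^ n + Y j w ^ Suc n / L"
        using Y0
      proof eventually_elim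
        case (elim w)
        then have y: "0 \<le> Y j w" by simp
        show ?case
        proof (cases "Y j w \<le> L")
          case True then show ?thesis using y L by (simp add: min_def)
        next
          case False
          then have "1 * Y j w ^ n \<le> (Y j w / L) * Y j w ^ n" using y L by (intro mult_right_mono) auto
          also have "\<dots> = Y j w ^ Suc n / L" by simp
          also have "\<dots> \<le> min (Y j w) L ^ n + Y j w ^ Suc n / L" using y L by simp
          finally show ?thesis by simp
        qed
      qed
    qed (use i it in auto)
    also have "expectation (\<lambda>w. min (Y j w) L ^ n + Y j w ^ Suc n / L)
      = expectation (\<lambda>w. min (Y j w) L ^ n) + expectation (\<lambda>w. Y j w ^ Suc n) / L" for j
      using it[of j] i(2)[of j] by (simp del: power_Suc)
    finally have le: "expectation (\<lambda>w. Y j w ^ n) \<le> expectation (\<lambda>w. min (Y j w) L ^ n) + expectation (\<lambda>w. Y j w ^ Suc n) / L" for j .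
    have "expectation (\<lambda>w. Y j w ^ n) - B / L \<le> expectation (\<lambda>w. min (Y j w) L ^ n)" for j
      using le[of j] divide_right_mono[OF B[of j], of L] L by linarith
    then have ev: "\<forall>\<^sub>F j in sequentially. v - B / L \<le> expectation (\<lambda>w. min (Y j w) L ^ n)"
      using v by (auto elim!: eventually_mono intro: order_trans[OF diff_right_mono])
    have "(\<lambda>j. expectation (\<lambda>w. min (Y j w) L ^ n)) \<longlonglongrightarrow> expectation (\<lambda>w. min (H w) L ^ n)"
    proof (rule integral_dominated_convergence[where w = "\<lambda>_. L ^ n"])
      show "AE w in M. (\<lambda>j. min (Y j w) L ^ n) \<longlonglongrightarrow> min (H w) L ^ n"
        using lim by eventually_elim (intro tendsto_intros)
      show "AE w in M. norm (min (Y j w) L ^ n) \<le> L ^ n" for j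
        using Y0 by eventually_elim (use L in \<open>auto simp: norm_power intro!: power_mono\<close>)
    qed measurable
    then have "v - B / L \<le> expectation (\<lambda>w. min (H w) L ^ n)" 
      by (rule tendsto_lowerbound[OF _ ev]) simp
    then have "ennreal (v - B / L) \<le> ennreal (expectation (\<lambda>w. min (H w) L ^ n))" by (rule ennreal_leI)
    also have "\<dots> = (\<integral>\<^sup>+w. ennreal (min (H w) L ^ n) \<partial>M)"
    proof (rule nn_integral_eq_integral[symmetric])
      show "integrable M (\<lambda>w. min (H w) L ^ n)"
      proof (rule integrable_const_bound[where B = "L ^ n"])
        show "AE w in M. norm (min (H w) L ^ n) \<le> L ^ n"
          using H0 by eventually_elim (use L in \<open>auto simp: norm_power intro!: power_mono\<close>)
      qed measurable
      show "AE w in M. 0 \<le> min (H w) L ^ n" using H0 by eventually_elim (use L in auto)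
    qed
    also have "\<dots> \<le> (\<integral>\<^sup>+w. ennreal (H w ^ n) \<partial>M)"
    proof (rule nn_integral_mono_AE)
      show "AE w in M. ennreal (min (H w) L ^ n) \<le> ennreal (H w ^ n)"
        using H0 by eventually_elim (use L in \<open>auto intro!: ennreal_leI power_mono\<close>)
    qed
    finally show ?thesis .
  qed
  have "(\<lambda>i. v - B * inverse (real (Suc i))) \<longlonglongrightarrow> v - B * 0" by (intro tendsto_intros LIMSEQ_inverse_real_of_nat)
  then have "(\<lambda>i. ennreal (v - B / real (Suc i))) \<longlonglongrightarrow> ennreal v"
    by (intro tendsto_ennrealI) (simp add: divide_inverse)
  then show ?thesis by (rule LIMSEQ_le_const2) (use le in auto)
qed

lemma ennreal_power_le_liminf:
  assumes x: "0 \<le> x" and y: "\<And>j. 0 \<le> y j" and ev: "\<And>e. 0 < e \<Longrightarrow> \<forall>\<^sub>F j in sequentially. x - e \<le> y j"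
  shows "ennreal (x ^ n) \<le> liminf (\<lambda>j. ennreal (y j ^ n))"
proof -
  have le: "ennreal (max 0 (x - e) ^ n) \<le> liminf (\<lambda>j. ennreal (y j ^ n))" if "0 < e" for e
    using ev[OF that] y by (intro Liminf_bounded) (auto elim!: eventually_mono intro!: ennreal_leI power_mono)
  have "(\<lambda>i. max 0 (x - inverse (real (Suc i))) ^ n) \<longlonglongrightarrow> max 0 (x - 0) ^ n"
    by (intro tendsto_intros LIMSEQ_inverse_real_of_nat)
  then have "(\<lambda>i. ennreal (max 0 (x - inverse (real (Suc i))) ^ n)) \<longlonglongrightarrow> ennreal (x ^ n)"
    using x by (intro tendsto_ennrealI) simp
  then show ?thesis by (rule LIMSEQ_le_const2) (use le in auto)
qed

lemma latbox_minus: "x \<in> latbox ep m \<Longrightarrow> - x \<in> latbox ep m"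
  by (simp add: latbox_def lat_minus)

lemma latbox_mono: "0 \<le> ep \<Longrightarrow> m \<le> n \<Longrightarrow> latbox ep m \<subseteq> latbox ep n"
  unfolding latbox_def using mult_left_mono[of "real m" "real n" ep] by fastforce

section \<open>Moments of the approximations\<close>

locale stable_local_time = additive_levy M X \<tau> \<psi> + sd: stable_data \<psi> \<alpha> "CARD('p)"
  for M :: "'w measure" and X :: "'p::finite \<Rightarrow> real \<Rightarrow> 'w \<Rightarrow> 'a::euclidean_space"
    and \<tau> :: "'p \<Rightarrow> 'w \<Rightarrow> real" and \<psi> :: "'a \<Rightarrow> real" and \<alpha> :: real +
  fixes \<eta> :: "'a \<Rightarrow> ('p \<Rightarrow> real) \<Rightarrow> 'w \<Rightarrow> real"
  assumes local_time: "is_local_time M X \<eta>"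
    and local_time_measurable: "(\<lambda>w. \<eta> 0 (\<lambda>j. \<tau> j w) w) \<in> borel_measurable M"
begin

definition H :: "'w \<Rightarrow> real" where "H w = max 0 (\<eta> 0 (\<lambda>j. \<tau> j w) w)"

lemma H_measurable [measurable]: "H \<in> borel_measurable M"
  unfolding H_def[abs_def] using local_time_measurable by measurable

lemma H_nonneg: "0 \<le> H w" by (simp add: H_def)

lemma Qw_eq: "sd.Qw = Q"
  by (rule ext) (simp add: sd.Qw_def sd.W_def Q_def)

lemma
  assumes "finite A" "\<And>x. x \<in> A \<Longrightarrow> - x \<in> A" "\<And>x. u (- x) = u x"
  shows expectation_Re_Sm: "(\<integral>w. Re (Sm I A u w) ^ n \<partial>M) = (\<Sum>f\<in>PiE {..<n} (\<lambda>_. A). (\<Prod>k<n. u (f k)) * Phi Q f {..<n} 0 ^ card I)"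
    and integrable_Re_Sm: "integrable M (\<lambda>w. Re (Sm I A u w) ^ n)"
proof -
  have S: "Sm I A u w ^ n = complex_of_real (Re (Sm I A u w) ^ n)" for w
    by (subst Sm_real[of A u I w]) (simp_all add: assms)
  show "integrable M (\<lambda>w. Re (Sm I A u w) ^ n)"
    using integrable_Re[OF integrable_Sm_power[OF assms(1), of I u n]] unfolding S Re_complex_of_real .
  have "complex_of_real (\<integral>w. Re (Sm I A u w) ^ n \<partial>M) = (\<integral>w. Sm I A u w ^ n \<partial>M)"
    unfolding S by (rule integral_complex_of_real[symmetric])
  then show "(\<integral>w. Re (Sm I A u w) ^ n \<partial>M) = (\<Sum>f\<in>PiE {..<n} (\<lambda>_. A). (\<Prod>k<n. u (f k)) * Phi Q f {..<n} 0 ^ card I)"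
    unfolding expectation_Sm_power[OF assms(1)] of_real_eq_iff .
qed

text \<open>The weights are at most 1, and \<open>Phi_power_le\<close> exchanges the p-th power of
  \<open>Phi\<close> for \<open>Phi\<close> with Q^p, to which \<open>J_far_le\<close> applies. With
  empty \<open>A0\<close> it bounds sums over arbitrary finite frequency sets, which controls the
  next moment in \<open>moment_lower\<close>.\<close>

lemma far_moment_le:
  assumes B: "finite B" "B \<subseteq> lat ep" and far: "\<And>a b. a \<in> A0 \<Longrightarrow> b \<in> A0 \<Longrightarrow> b - a \<notin> B"
    and S: "\<And>U. finite U \<Longrightarrow> U \<subseteq> lat ep \<Longrightarrow> (\<Sum>x\<in>U. Q x ^ CARD('p)) \<le> s"
    and T: "\<And>U. finite U \<Longrightarrow> U \<subseteq> lat ep - A0 \<Longrightarrow> (\<Sum>x\<in>U. Q x ^ CARD('p)) \<le> t"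
    and u: "\<And>x. 0 \<le> u x" "\<And>x. u x \<le> 1"
  shows "(\<Sum>f\<in>PiE {..<2 * k} (\<lambda>_. B). (\<Prod>i<2 * k. u (f i)) * Phi Q f {..<2 * k} 0 ^ CARD('p)) \<le> fact (2 * k) ^ CARD('p) * (2 * s * t) ^ k"
proof -
  obtain q where q: "CARD('p) = Suc q" using sd.p_pos gr0_conv_Suc by blast
  let ?n = "2 * k" and ?R = "\<lambda>x. Q x ^ Suc q"
  have st: "0 \<le> s" "0 \<le> t" using S[of "{}"] T[of "{}"] by auto
  have Q0: "0 \<le> Q x" for x using Q_pos[of x] by simp
  have ph: "0 \<le> Phi Q f {..<?n} 0" for f by (intro Phi_nonneg Q0) auto
  have "(\<Sum>f\<in>PiE {..<?n} (\<lambda>_. B). (\<Prod>i<?n. u (f i)) * Phi Q f {..<?n} 0 ^ CARD('p))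
    \<le> (\<Sum>f\<in>PiE {..<?n} (\<lambda>_. B). fact ?n ^ q * ((\<Prod>i<?n. 1) * Phi ?R f {..<?n} 0))"
  proof (intro sum_mono)
    fix f :: "nat \<Rightarrow> 'a"
    have "(\<Prod>i<?n. u (f i)) \<le> 1" by (intro prod_le_1) (auto simp: u)
    then have "(\<Prod>i<?n. u (f i)) * Phi Q f {..<?n} 0 ^ CARD('p) \<le> 1 * Phi Q f {..<?n} 0 ^ CARD('p)"
      using ph[of f] by (intro mult_right_mono) auto
    also have "\<dots> \<le> fact ?n ^ q * Phi ?R f {..<?n} 0"
      using Phi_power_le[of "{..<?n}" Q f 0 q] Q0 by (simp add: q del: power_Suc)
    finally show "(\<Prod>i<?n. u (f i)) * Phi Q f {..<?n} 0 ^ CARD('p) \<le> fact ?n ^ q * ((\<Prod>i<?n. 1) * Phi ?R f {..<?n} 0)" by simp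
  qed
  also have "\<dots> = fact ?n ^ q * (\<Sum>f\<in>PiE {..<?n} (\<lambda>_. B). (\<Prod>i<?n. 1) * Phi ?R f {..<?n} 0)"
    by (rule sum_distrib_left[symmetric])
  also have "\<dots> = fact ?n ^ q * (fact ?n * J ?R (\<lambda>_. 1) B ?n 0)"
    using sum_PiE_Phi[of "{..<?n}" B "\<lambda>_. 1" ?R 0] B(1) by (simp only: finite_lessThan card_lessThan)
  also have "\<dots> \<le> fact ?n ^ q * (fact ?n * ((2 * s * t) ^ k * ?R 0))"
  proof (intro mult_left_mono)
    show "J ?R (\<lambda>_. 1) B ?n 0 \<le> (2 * s * t) ^ k * ?R 0"
      using S T Q0 by (intro J_far_le[where L = "lat ep" and ?A0.0 = A0] B far) (auto simp: q lat_add simp del: power_Suc)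
  qed auto
  also have "\<dots> \<le> fact ?n ^ q * (fact ?n * ((2 * s * t) ^ k * 1))"
    using st Q0[of 0] Q_le_1[of 0] by (intro mult_left_mono power_le_one) auto
  also have "\<dots> = fact ?n ^ CARD('p) * (2 * s * t) ^ k" by (simp add: q)
  finally show ?thesis .
qed

text \<open>The sum over sequences is regrouped by types and the weights, being at most 1, are
  dropped. \<open>types_bound\<close> then converts a bound on \<open>J\<close> for all normalised
  weights \<open>c\<close> into one for p-th powers.\<close>

lemma near_moment_le:
  assumes A: "finite A" and n: "0 < n" and q: "CARD('p) = Suc q" and v0: "0 \<le> v"
    and J_le: "\<And>c. (\<And>a. a \<in> A \<Longrightarrow> 0 \<le> c a) \<Longrightarrow> (\<Sum>a\<in>A. c a ^ CARD('p)) = 1 \<Longrightarrow> J Q (\<lambda>a. c a ^ q) A n 0 \<le> v"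
    and u: "\<And>x. 0 \<le> u x" "\<And>x. u x \<le> 1"
  shows "(\<Sum>f\<in>PiE {..<n} (\<lambda>_. A). (\<Prod>i<n. u (f i)) * Phi Q f {..<n} 0 ^ CARD('p))
    \<le> fact n ^ CARD('p) * v ^ CARD('p) * (real (Suc n) ^ card A * ((exp 1 * (real n + 1)) ^ card A) ^ q)"
proof -
  let ?D = "\<lambda>t. Phi Q fst (SIGMA a:A. {..<t a :: nat}) 0"
  have D: "0 \<le> ?D t" for t
    using Q_pos A by (intro Phi_nonneg finite_SigmaI) (auto simp: less_imp_le)
  have "complex_of_real (\<Sum>f\<in>PiE {..<n} (\<lambda>_. A). (\<Prod>i<n. u (f i)) * Phi Q f {..<n} 0 ^ CARD('p))
    = complex_of_real (fact n * (\<Sum>t\<in>types A n. (\<Prod>a\<in>A. u a ^ t a / fact (t a)) * ?D t ^ CARD('p)))"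
    using expectation_Sm_power[OF A, of UNIV u n] expectation_Sm_types[OF A, of UNIV u n] by (simp only:)
  then have "(\<Sum>f\<in>PiE {..<n} (\<lambda>_. A). (\<Prod>i<n. u (f i)) * Phi Q f {..<n} 0 ^ CARD('p))
    = fact n * (\<Sum>t\<in>types A n. (\<Prod>a\<in>A. u a ^ t a / fact (t a)) * ?D t ^ CARD('p))" by (simp only: of_real_eq_iff)
  also have "\<dots> \<le> fact n * (\<Sum>t\<in>types A n. ?D t ^ Suc q / (\<Prod>a\<in>A. fact (t a)))"
  proof (intro mult_left_mono sum_mono)
    fix t :: "'a \<Rightarrow> nat"
    have "(\<Prod>a\<in>A. u a ^ t a / fact (t a)) \<le> (\<Prod>a\<in>A. 1 / fact (t a))"
      by (intro prod_mono conjI divide_right_mono power_le_one divide_nonneg_nonneg zero_le_power u) auto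
    then have "(\<Prod>a\<in>A. u a ^ t a / fact (t a)) * ?D t ^ CARD('p) \<le> (\<Prod>a\<in>A. 1 / fact (t a)) * ?D t ^ CARD('p)"
      using D by (intro mult_right_mono) auto
    then show "(\<Prod>a\<in>A. u a ^ t a / fact (t a)) * ?D t ^ CARD('p) \<le> ?D t ^ Suc q / (\<Prod>a\<in>A. fact (t a))"
      by (simp add: q prod_dividef del: power_Suc)
  qed simp
  also have "\<dots> \<le> fact n * (fact n ^ q * v ^ Suc q * (real (Suc n) ^ card A * ((exp 1 * (real n + 1)) ^ card A) ^ q))"
  proof (intro mult_left_mono types_bound A n v0 D)
    fix c :: "'a \<Rightarrow> real" assume "\<And>a. a \<in> A \<Longrightarrow> 0 \<le> c a" "(\<Sum>a\<in>A. c a ^ Suc q) = 1"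
    then show "(\<Sum>t\<in>types A n. (\<Prod>a\<in>A. (c a ^ q) ^ t a / fact (t a)) * ?D t) \<le> v"
      unfolding sum_types_J[OF A] by (intro J_le) (simp_all only: q)
  qed simp
  also have "\<dots> = fact n ^ CARD('p) * v ^ CARD('p) * (real (Suc n) ^ card A * ((exp 1 * (real n + 1)) ^ card A) ^ q)"
    by (simp only: q power_Suc mult_ac)
  finally show ?thesis .
qed

lemma normalized_power_eq:
  "normalized ep m w ^ n = ((ep / (2 * pi)) ^ DIM('a)) ^ n * Re (Sm UNIV (latbox ep m) (lat_weight ep m) w) ^ n"
  by (simp add: normalized_def power_mult_distrib)

lemma integrable_normalized: "0 < ep \<Longrightarrow> integrable M (\<lambda>w. normalized ep m w ^ n)"
  unfolding normalized_power_eq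
  by (rule integrable_mult_right, rule integrable_Re_Sm) (auto simp: finite_latbox latbox_minus lat_weight_minus)

lemma lattice_sum_Q:
  obtains s S where "0 < s" "0 \<le> S" "\<And>ep U. 0 < ep \<Longrightarrow> ep \<le> s \<Longrightarrow> finite U \<Longrightarrow> U \<subseteq> lat ep \<Longrightarrow> (\<Sum>x\<in>U. Q x ^ CARD('p)) \<le> S / ep ^ DIM('a)"
proof -
  obtain s where s: "0 < s" "\<And>ep U. 0 < ep \<Longrightarrow> ep \<le> s \<Longrightarrow> finite U \<Longrightarrow> U \<subseteq> lat ep \<Longrightarrow> ep ^ DIM('a) * (\<Sum>x\<in>U. sd.Qw x ^ CARD('p)) \<le> 2 ^ CARD('p) * sd.IQr"
    using sd.lattice_sum_Qw by blast
  show ?thesis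
  proof (rule that[of s "2 ^ CARD('p) * sd.IQr"])
    show "0 \<le> 2 ^ CARD('p) * sd.IQr" by (simp add: sd.IQr_def)
    fix ep :: real and U :: "'a set"
    assume h: "0 < ep" "ep \<le> s" "finite U" "U \<subseteq> lat ep"
    have "0 < ep ^ DIM('a)" using h by simp
    then show "(\<Sum>x\<in>U. Q x ^ CARD('p)) \<le> 2 ^ CARD('p) * sd.IQr / ep ^ DIM('a)"
      using s(2)[OF h] unfolding Qw_eq by (simp only: pos_le_divide_eq mult.commute)
  qed (rule s)
qed

text \<open>At fixed mesh the kernels concentrate at 0 and at its translates by multiples of 2 pi /
  ep, so the limit is at least the density at 0. This one-sided statement is what Fatou's lemma
  needs; \<open>K\<close> moves the sequence beyond a given order.\<close>

lemma normalized_lower_limit: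
  assumes ep: "0 < ep"
  shows "AE w in M. ennreal (H w ^ n) \<le> liminf (\<lambda>j. ennreal (normalized ep (j + K) w ^ n))"
  using local_time_approximation[OF local_time]
proof (rule eventually_mono)
  fix w
  assume "\<exists>(g :: 'a \<Rightarrow> real) R. g 0 = max 0 (\<eta> 0 (\<lambda>j. \<tau> j w) w) \<and> continuous_on UNIV g \<and> (\<forall>y. 0 \<le> g y)
    \<and> (\<integral>\<^sup>+y. ennreal (g y) \<partial>lborel) < \<top> \<and> (AE y in lborel. R < norm y \<longrightarrow> g y = 0)
    \<and> (\<forall>ep m. 0 < ep \<longrightarrow> 0 \<le> normalized ep m w \<and> ennreal (normalized ep m w) = kernel_mean ep m g)"
  then obtain g :: "'a \<Rightarrow> real" where g: "g 0 = H w" "continuous_on UNIV g" "\<And>m. 0 \<le> normalized ep m w"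
    "\<And>m. ennreal (normalized ep m w) = kernel_mean ep m g" using ep unfolding H_def by blast
  \<comment> \<open>The radius is limited so that ep r \<le> pi / 2, inside the range required by
    \<open>tail_tendsto\<close>.\<close>
  have tl: "(\<lambda>j. tail DIM('a) (ep * r) (j + K)) \<longlonglongrightarrow> 0" if r: "0 < r" "r \<le> pi / (2 * ep)" for r
  proof -
    have "ep * r \<le> pi / 2" using r ep by (simp add: field_simps)
    then have "ep * r < pi" using pi_gt_zero by linarith
    then show ?thesis using r ep by (intro LIMSEQ_ignore_initial_segment tail_tendsto) auto
  qed
  have "\<forall>\<^sub>F j in sequentially. H w - e \<le> normalized ep (j + K) w" if "0 < e" for e
  proof -
    have "\<forall>\<^sub>F j in sequentially. ennreal (g 0 - e) \<le> kernel_mean ep (j + K) g"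
      using ep that by (intro eventually_kernel_mean_ge[OF g(2), where ep = "\<lambda>_. ep" and ?r1.0 = "pi / (2 * ep)"] tl) auto
    then show ?thesis unfolding g(4)[symmetric] g(1) using g(3) by simp
  qed
  then show "ennreal (H w ^ n) \<le> liminf (\<lambda>j. ennreal (normalized ep (j + K) w ^ n))"
    by (intro ennreal_power_le_liminf H_nonneg g(3))
qed

lemma moment_le_of_normalized:
  assumes ep: "0 < ep" and n: "even n" and b: "\<And>m. K \<le> m \<Longrightarrow> expectation (\<lambda>w. normalized ep m w ^ n) \<le> b"
  shows "(\<integral>\<^sup>+w. ennreal (H w ^ n) \<partial>M) \<le> ennreal b"
proof -
  have "(\<integral>\<^sup>+w. ennreal (H w ^ n) \<partial>M) \<le> (\<integral>\<^sup>+w. liminf (\<lambda>j. ennreal (normalized ep (j + K) w ^ n)) \<partial>M)"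
    by (rule nn_integral_mono_AE[OF normalized_lower_limit[OF ep]])
  also have "\<dots> \<le> liminf (\<lambda>j. \<integral>\<^sup>+w. ennreal (normalized ep (j + K) w ^ n) \<partial>M)"
    by (rule nn_integral_liminf) measurable
  also have "\<dots> \<le> limsup (\<lambda>j. \<integral>\<^sup>+w. ennreal (normalized ep (j + K) w ^ n) \<partial>M)"
    by (rule Liminf_le_Limsup) simp
  also have "\<dots> \<le> ennreal b"
  proof (rule Limsup_bounded, rule always_eventually, rule allI)
    fix j
    have "(\<integral>\<^sup>+w. ennreal (normalized ep (j + K) w ^ n) \<partial>M) = ennreal (expectation (\<lambda>w. normalized ep (j + K) w ^ n))"
      using n by (intro nn_integral_eq_integral integrable_normalized ep) (auto simp: zero_le_even_power)
    also have "\<dots> \<le> ennreal b" by (intro ennreal_leI b) simp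
    finally show "(\<integral>\<^sup>+w. ennreal (normalized ep (j + K) w ^ n) \<partial>M) \<le> ennreal b" .
  qed
  finally show ?thesis .
qed

end

section \<open>Upper and lower bounds for the moments\<close>

context stable_local_time
begin

text \<open>The mesh and the finite frequency set are chosen from r alone, before n and m. Hence
  \<open>N\<close>, \<open>c\<close> and \<open>q\<close> do not depend on n, and the last bracket
  has polynomial growth.\<close>

lemma moment_upper_lattice:
  assumes r: "rho \<psi> CARD('p) < r"
  obtains N c q :: nat where "\<And>n. even n \<Longrightarrow> 0 < n \<Longrightarrow> (\<integral>\<^sup>+w. ennreal (H w ^ n) \<partial>M)
      \<le> ennreal (fact n ^ CARD('p) * (r / (2 * pi) ^ DIM('a)) ^ n
          * (sqrt ((2 * real (n * N) + 1) ^ DIM('a)) ^ CARD('p) * (real (Suc n) ^ c * ((exp 1 * (real n + 1)) ^ c) ^ q) + 1))"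
proof -
  obtain q where q: "CARD('p) = Suc q" using sd.p_pos gr0_conv_Suc by blast
  \<comment> \<open>\<rho>' lies strictly between \<open>rho\<close> and r, and \<theta> satisfies
    \<rho>' / (1 - \<theta>) = r: the rescaling of the near part in
    \<open>power_add_le_scaled\<close> then turns \<rho>' into r.\<close>
  define \<rho>' where "\<rho>' = (rho \<psi> CARD('p) + r) / 2"
  define \<theta> where "\<theta> = 1 - \<rho>' / r"
  have \<rho>': "rho \<psi> CARD('p) < \<rho>'" "\<rho>' < r" "0 < \<rho>'" "0 < r" using r sd.rho_pos by (auto simp: \<rho>'_def)
  have \<theta>: "0 < \<theta>" "\<theta> < 1" "1 - \<theta> = \<rho>' / r" using \<rho>' by (auto simp: \<theta>_def)
  obtain ep0 where ep0: "0 < ep0" and J: "\<And>ep K A c n. 0 < ep \<Longrightarrow> ep < ep0 \<Longrightarrow> A \<subseteq> latbox ep K \<Longrightarrow>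
    (\<And>a. a \<in> A \<Longrightarrow> 0 \<le> c a) \<Longrightarrow> (\<Sum>a\<in>A. c a ^ CARD('p)) = 1 \<Longrightarrow>
    J Q (\<lambda>a. c a ^ q) A n 0 \<le> root CARD('p) (\<rho>' / ep ^ DIM('a)) ^ n * sqrt ((2 * real (n * K) + 1) ^ DIM('a))"
    using sd.J_upper[OF \<rho>'(1) q] unfolding Qw_eq by blast
  obtain s0 S where s0: "0 < s0" "0 \<le> S" and sums: "\<And>ep U. 0 < ep \<Longrightarrow> ep \<le> s0 \<Longrightarrow> finite U \<Longrightarrow> U \<subseteq> lat ep \<Longrightarrow> (\<Sum>x\<in>U. Q x ^ CARD('p)) \<le> S / ep ^ DIM('a)"
    using lattice_sum_Q by blast
  define ep where "ep = min (ep0 / 2) s0"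
  have ep: "0 < ep" "ep < ep0" "ep \<le> s0" using ep0 s0 by (auto simp: ep_def)
  define D where "D = ep ^ DIM('a)"
  have D: "0 < D" using ep by (simp add: D_def)
  define s where "s = S / D"
  \<comment> \<open>Solved from 2 s t \<le> (\<theta> \<rho>' / D)^2, so that the far part has
    growth rate at most \<theta> \<rho>' / D, which remains below r / D after division by \<theta>.
    Using s + 1 avoids a division by 0.\<close>
  define t where "t = (\<theta> * \<rho>' / D)\<^sup>2 / (2 * (s + 1))"
  have s: "0 \<le> s" using s0 D by (simp add: s_def)
  have t: "0 < t" using \<theta> \<rho>' D s by (simp add: t_def)
  have "2 * s * t \<le> (2 * (s + 1)) * t" using t by (intro mult_right_mono) auto
  also have "(2 * (s + 1)) * t = (\<theta> * \<rho>' / D)\<^sup>2" unfolding t_def using s by (intro nonzero_mult_div_cancel_left[THEN trans[OF times_divide_eq_right]]) auto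
  finally have st: "2 * s * t \<le> (\<theta> * \<rho>' / D)\<^sup>2" .
  have Sum: "(\<Sum>x\<in>U. Q x ^ CARD('p)) \<le> s" if "finite U" "U \<subseteq> lat ep" for U
    unfolding s_def D_def using that ep by (intro sums) auto
  obtain A0 where A0: "finite A0" "A0 \<subseteq> lat ep" "\<And>U. finite U \<Longrightarrow> U \<subseteq> lat ep - A0 \<Longrightarrow> (\<Sum>x\<in>U. Q x ^ CARD('p)) \<le> t"
    using small_tail_sums[of "\<lambda>x. Q x ^ CARD('p)" "lat ep" s t] Sum t Q_pos by (metis less_imp_le zero_le_power)
  \<comment> \<open>The set of differences of \<open>A0\<close> is finite and symmetric, and by
    construction no frequency outside it is a difference of points of \<open>A0\<close>, as
    \<open>far_moment_le\<close> requires.\<close>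
  define A where "A = (\<lambda>(a, b). b - a) ` (A0 \<times> A0)"
  have A: "finite A" "A \<subseteq> lat ep" using A0(1,2) by (auto simp: A_def intro!: lat_diff)
  have Am: "- x \<in> A" if "x \<in> A" for x
    using that unfolding A_def by (auto intro!: image_eqI[where x = "(b, a)" for a b])
  have Adiff: "b - a \<in> A" if "a \<in> A0" "b \<in> A0" for a b using that by (auto simp: A_def)
  obtain N where N: "A \<subseteq> latbox ep N" using finite_subset_latbox[OF ep(1) A] by blast
  show ?thesis
  proof (rule that[of N "card A" q])
    fix n :: nat assume n: "even n" "0 < n"
    let ?P = "sqrt ((2 * real (n * N) + 1) ^ DIM('a)) ^ CARD('p) * (real (Suc n) ^ card A * ((exp 1 * (real n + 1)) ^ card A) ^ q)"
    obtain k where k: "n = 2 * k" using n by blast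
    let ?v = "root CARD('p) (\<rho>' / D) ^ n * sqrt ((2 * real (n * N) + 1) ^ DIM('a))"
    have v0: "0 \<le> ?v" using \<rho>' D by simp
    have "(root CARD('p) (\<rho>' / D) ^ n) ^ CARD('p) = (root CARD('p) (\<rho>' / D) ^ CARD('p)) ^ n"
      by (simp only: power_mult[symmetric] mult.commute)
    also have "root CARD('p) (\<rho>' / D) ^ CARD('p) = \<rho>' / D" using \<rho>' D by (intro real_root_pow_pos2) auto
    finally have vp: "?v ^ CARD('p) = (\<rho>' / D) ^ n * sqrt ((2 * real (n * N) + 1) ^ DIM('a)) ^ CARD('p)"
      by (simp only: power_mult_distrib)
    show "(\<integral>\<^sup>+w. ennreal (H w ^ n) \<partial>M) \<le> ennreal (fact n ^ CARD('p) * (r / (2 * pi) ^ DIM('a)) ^ n * (?P + 1))"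
    proof (rule moment_le_of_normalized[OF ep(1) n(1), of N])
      fix m assume m: "N \<le> m"
      let ?E = "latbox ep m :: 'a set" and ?w = "lat_weight ep m"
      define a where "a w = Re (Sm UNIV A ?w w)" for w
      define b where "b w = Re (Sm UNIV (?E - A) ?w w)" for w
      have E: "finite ?E" "A \<subseteq> ?E" using N latbox_mono[of ep N m] m ep by (auto simp: finite_latbox)
      have BE: "finite (?E - A)" "?E - A \<subseteq> lat ep" using E latbox_subset[of ep m] by auto
      have Bm: "- x \<in> ?E - A" if "x \<in> ?E - A" for x
        using that Am[of "- x"] latbox_minus[of x ep m] by auto
      have split: "Re (Sm UNIV ?E ?w w) = a w + b w" for w
        unfolding a_def b_def Sm_def using sum.subset_diff[OF E(2,1)] by (simp add: add.commute)
      have ia: "integrable M (\<lambda>w. a w ^ n)" unfolding a_def by (intro integrable_Re_Sm A Am lat_weight_minus)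
      have ib: "integrable M (\<lambda>w. b w ^ n)" unfolding b_def by (intro integrable_Re_Sm BE Bm lat_weight_minus)
      have eA: "(\<integral>w. Re (Sm UNIV A ?w w) ^ n \<partial>M) = (\<Sum>f\<in>PiE {..<n} (\<lambda>_. A). (\<Prod>i<n. ?w (f i)) * Phi Q f {..<n} 0 ^ CARD('p))"
        by (rule expectation_Re_Sm) (simp_all add: A(1) Am lat_weight_minus)
      have Ea: "expectation (\<lambda>w. a w ^ n) \<le> fact n ^ CARD('p) * ?v ^ CARD('p) * (real (Suc n) ^ card A * ((exp 1 * (real n + 1)) ^ card A) ^ q)"
        unfolding a_def eA
      proof (rule near_moment_le[OF A(1) n(2) q v0])
        fix c :: "'a \<Rightarrow> real" assume "\<And>a. a \<in> A \<Longrightarrow> 0 \<le> c a" "(\<Sum>a\<in>A. c a ^ CARD('p)) = 1"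
        then show "J Q (\<lambda>a. c a ^ q) A n 0 \<le> ?v" unfolding D_def using J[OF ep(1,2) N] by blast
      qed (rule lat_weight_nonneg lat_weight_le_1)+
      have eB: "(\<integral>w. Re (Sm UNIV (?E - A) ?w w) ^ n \<partial>M) = (\<Sum>f\<in>PiE {..<n} (\<lambda>_. (?E - A)). (\<Prod>i<n. ?w (f i)) * Phi Q f {..<n} 0 ^ CARD('p))"
        by (rule expectation_Re_Sm) (simp_all add: BE(1) Bm lat_weight_minus del: Diff_iff)
      have "expectation (\<lambda>w. b w ^ n) \<le> fact n ^ CARD('p) * (2 * s * t) ^ k"
        unfolding b_def eB unfolding k
        using Adiff by (intro far_moment_le[where ?A0.0 = A0 and ep = ep] BE Sum A0 lat_weight_nonneg lat_weight_le_1) auto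
      also have "\<dots> \<le> fact n ^ CARD('p) * ((\<theta> * \<rho>' / D)\<^sup>2) ^ k"
        using st s t by (intro mult_left_mono power_mono) auto
      also have "((\<theta> * \<rho>' / D)\<^sup>2) ^ k = \<theta> ^ n * (\<rho>' / D) ^ n"
        unfolding k power_mult[symmetric] power_mult_distrib[symmetric] by (simp only: times_divide_eq_right)
      finally have Eb: "expectation (\<lambda>w. b w ^ n) \<le> fact n ^ CARD('p) * (\<theta> ^ n * (\<rho>' / D) ^ n)" .
      have "expectation (\<lambda>w. Re (Sm UNIV ?E ?w w) ^ n) \<le> expectation (\<lambda>w. a w ^ n / (1 - \<theta>) ^ n + b w ^ n / \<theta> ^ n)"
      proof (rule integral_mono)
        show "integrable M (\<lambda>w. Re (Sm UNIV ?E ?w w) ^ n)"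
          by (intro integrable_Re_Sm E latbox_minus lat_weight_minus)
        show "integrable M (\<lambda>w. a w ^ n / (1 - \<theta>) ^ n + b w ^ n / \<theta> ^ n)" using ia ib by simp
        show "Re (Sm UNIV ?E ?w w) ^ n \<le> a w ^ n / (1 - \<theta>) ^ n + b w ^ n / \<theta> ^ n" for w
          unfolding split power_divide[symmetric] using n \<theta> by (intro power_add_le_scaled) auto
      qed
      also have "\<dots> = expectation (\<lambda>w. a w ^ n) / (1 - \<theta>) ^ n + expectation (\<lambda>w. b w ^ n) / \<theta> ^ n"
        using ia ib by simp
      also have "\<dots> \<le> (fact n ^ CARD('p) * ?v ^ CARD('p) * (real (Suc n) ^ card A * ((exp 1 * (real n + 1)) ^ card A) ^ q)) / (1 - \<theta>) ^ n
          + (fact n ^ CARD('p) * (\<theta> ^ n * (\<rho>' / D) ^ n)) / \<theta> ^ n"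
        using Ea Eb \<theta>(1,2) by (intro add_mono divide_right_mono) auto
      also have "\<dots> = fact n ^ CARD('p) * ((\<rho>' / D) ^ n / (1 - \<theta>) ^ n) * ?P + fact n ^ CARD('p) * (\<rho>' / D) ^ n"
        unfolding vp using \<theta>(1) by simp
      also have "\<dots> \<le> fact n ^ CARD('p) * (r / D) ^ n * ?P + fact n ^ CARD('p) * (r / D) ^ n"
      proof (intro add_mono mult_left_mono mult_right_mono)
        have "(\<rho>' / D) / (1 - \<theta>) = r / D" unfolding \<theta>(3) using \<rho>' by simp
        then show "(\<rho>' / D) ^ n / (1 - \<theta>) ^ n \<le> (r / D) ^ n" unfolding power_divide[symmetric] by simp
        show "(\<rho>' / D) ^ n \<le> (r / D) ^ n" using \<rho>' D by (intro power_mono divide_right_mono) auto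
      qed auto
      finally have le: "expectation (\<lambda>w. Re (Sm UNIV ?E ?w w) ^ n) \<le> fact n ^ CARD('p) * (r / D) ^ n * (?P + 1)"
        by (simp only: distrib_left mult_1_right)
      have "expectation (\<lambda>w. normalized ep m w ^ n) = ((ep / (2 * pi)) ^ DIM('a)) ^ n * expectation (\<lambda>w. Re (Sm UNIV ?E ?w w) ^ n)"
        unfolding normalized_power_eq by (rule integral_mult_right_zero)
      also have "\<dots> \<le> ((ep / (2 * pi)) ^ DIM('a)) ^ n * (fact n ^ CARD('p) * (r / D) ^ n * (?P + 1))"
        using ep by (intro mult_left_mono le) auto
      also have "\<dots> = fact n ^ CARD('p) * (((ep / (2 * pi)) ^ DIM('a)) ^ n * (r / D) ^ n) * (?P + 1)"
        by (simp only: mult_ac)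
      also have "((ep / (2 * pi)) ^ DIM('a)) ^ n * (r / D) ^ n = (r / (2 * pi) ^ DIM('a)) ^ n"
        unfolding power_mult_distrib[symmetric] using ep by (simp add: D_def power_divide)
      finally show "expectation (\<lambda>w. normalized ep m w ^ n) \<le> fact n ^ CARD('p) * (r / (2 * pi) ^ DIM('a)) ^ n * (?P + 1)" .
    qed
  qed
qed

text \<open>Two limits are tied together: for each mesh the order \<open>m j\<close> is so large
  that the tail at radius 1/(j + 1) is below 1/(j + 1) and the weights on the ball exceed 1 - 1/(j +
  1). A fixed r is eventually larger than 1/(j + 1), so its tail is smaller still.\<close>

lemma lattice_sequence:
  assumes R: "0 < R" and s: "0 < s"
  obtains ep m where "\<And>j. 0 < ep j" "\<And>j. ep j \<le> 1" "\<And>j. ep j \<le> s" "ep \<longlonglongrightarrow> 0"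
    "\<And>r. 0 < r \<Longrightarrow> r \<le> 1 \<Longrightarrow> (\<lambda>j. tail DIM('a) (ep j * r) (m j)) \<longlonglongrightarrow> 0"
    "\<And>j. sd.LR (ep j) R \<subseteq> latbox (ep j) (m j)" "\<And>j x. x \<in> sd.LR (ep j) R \<Longrightarrow> 1 - 1 / real (Suc j) \<le> lat_weight (ep j) (m j) x"
proof -
  define ep where "ep j = min s 1 / real (Suc j)" for j
  have ep: "0 < ep j" "ep j \<le> min s 1" for j
  proof -
    show "0 < ep j" using s by (simp add: ep_def)
    have "min s 1 / real (Suc j) \<le> min s 1 / 1" using s by (intro divide_left_mono) auto
    then show "ep j \<le> min s 1" by (simp add: ep_def)
  qed
  have "(\<lambda>j. min s 1 * inverse (real (Suc j))) \<longlonglongrightarrow> min s 1 * 0" by (intro tendsto_intros LIMSEQ_inverse_real_of_nat)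
  then have lim: "ep \<longlonglongrightarrow> 0" by (simp add: ep_def[abs_def] divide_inverse)
  have "\<exists>m. tail DIM('a) (ep j / real (Suc j)) m < 1 / real (Suc j) \<and> sd.LR (ep j) R \<subseteq> latbox (ep j) m
     \<and> (\<forall>x\<in>sd.LR (ep j) R. 1 - 1 / real (Suc j) < lat_weight (ep j) m x)" for j
  proof -
    have fin: "finite (sd.LR (ep j) R)" by (rule sd.finite_LR[OF ep(1)])
    obtain m0 where m0: "sd.LR (ep j) R \<subseteq> latbox (ep j) m0"
      using finite_subset_latbox[OF ep(1) fin] by (auto simp: sd.LR_def)
    have "ep j / real (Suc j) \<le> ep j" using ep(1)[of j] by (simp add: divide_le_eq mult_le_cancel_left1 del: of_nat_Suc)
    then have e: "0 < ep j / real (Suc j)" "ep j / real (Suc j) < pi" using ep[of j] pi_gt3 by auto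
    have "\<forall>\<^sub>F m in sequentially. tail DIM('a) (ep j / real (Suc j)) m < 1 / real (Suc j)"
      by (rule order_tendstoD(2)[OF tail_tendsto[OF e]]) simp
    moreover have "\<forall>\<^sub>F m in sequentially. \<forall>x\<in>sd.LR (ep j) R. 1 - 1 / real (Suc j) < lat_weight (ep j) m x"
      by (rule eventually_ball_finite[OF fin], rule ballI, rule order_tendstoD(1)[OF lat_weight_tendsto]) simp
    ultimately have "\<forall>\<^sub>F m in sequentially. tail DIM('a) (ep j / real (Suc j)) m < 1 / real (Suc j) \<and> sd.LR (ep j) R \<subseteq> latbox (ep j) m
      \<and> (\<forall>x\<in>sd.LR (ep j) R. 1 - 1 / real (Suc j) < lat_weight (ep j) m x)"
      using eventually_ge_at_top[of m0]
    proof eventually_elim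
      case (elim m)
      then show ?case using m0 latbox_mono[of "ep j" m0 m] ep(1)[of j] by auto
    qed
    then show ?thesis using eventually_happens by fastforce
  qed
  then obtain m where m: "\<And>j. tail DIM('a) (ep j / real (Suc j)) (m j) < 1 / real (Suc j)" "\<And>j. sd.LR (ep j) R \<subseteq> latbox (ep j) (m j)"
    "\<And>j x. x \<in> sd.LR (ep j) R \<Longrightarrow> 1 - 1 / real (Suc j) < lat_weight (ep j) (m j) x" by metis
  show ?thesis
  proof (rule that[of ep m])
    show "(\<lambda>j. tail DIM('a) (ep j * r) (m j)) \<longlonglongrightarrow> 0" if r: "0 < r" "r \<le> 1" for r
    proof (rule tendsto_sandwich[OF _ _ tendsto_const])
      show "\<forall>\<^sub>F j in sequentially. 0 \<le> tail DIM('a) (ep j * r) (m j)" by (simp add: tail_nonneg)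
      have "\<forall>\<^sub>F j in sequentially. inverse (real (Suc j)) < r" by (rule order_tendstoD(2)[OF LIMSEQ_inverse_real_of_nat r(1)])
      then show "\<forall>\<^sub>F j in sequentially. tail DIM('a) (ep j * r) (m j) \<le> inverse (real (Suc j))"
      proof eventually_elim
        case (elim j)
        have "ep j * inverse (real (Suc j)) \<le> ep j * r" using elim ep(1)[of j] by (intro mult_left_mono) auto
        moreover have "ep j * r \<le> 1 * 1" using ep[of j] r by (intro mult_mono) auto
        ultimately have "tail DIM('a) (ep j * r) (m j) \<le> tail DIM('a) (ep j * inverse (real (Suc j))) (m j)"
          using ep(1)[of j] pi_gt3 by (intro tail_antimono) auto
        also have "\<dots> \<le> inverse (real (Suc j))" using m(1)[of j] by (simp add: divide_inverse)
        finally show ?case .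
      qed
    qed (rule LIMSEQ_inverse_real_of_nat)
    show "ep j \<le> 1" "ep j \<le> s" for j using ep(2)[of j] by auto
  qed (use ep lim m in \<open>auto intro: less_imp_le\<close>)
qed

text \<open>Here the approximations must converge, so the mesh tends to 0. All terms of the expanded
  moment are nonnegative; hence the sum may be restricted to frequencies of norm at most R, where
  the weights are close to 1.\<close>

lemma moment_lower:
  assumes r: "0 < r" "r < rho \<psi> CARD('p)"
  obtains c where "0 < c" "\<And>n. even n \<Longrightarrow> ennreal (c * r ^ n * fact (Suc n) ^ CARD('p) / ((2 * pi) ^ DIM('a)) ^ Suc n)
    \<le> (\<integral>\<^sup>+w. ennreal (H w ^ Suc n) \<partial>M)"
proof -
  obtain q where q: "CARD('p) = Suc q" using sd.p_pos gr0_conv_Suc by blast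
  obtain c R where cR: "0 < c" "0 < R" and low: "\<And>n ep. even n \<Longrightarrow> (\<And>j. 0 < ep j) \<Longrightarrow> ep \<longlonglongrightarrow> 0 \<Longrightarrow>
    \<forall>\<^sub>F j in sequentially. c * r ^ n * fact (Suc n) ^ CARD('p)
      \<le> (ep j ^ DIM('a)) ^ Suc n * (\<Sum>x\<in>PiE {..<Suc n} (\<lambda>_. sd.LR (ep j) R). Phi Q x {..<Suc n} 0 ^ CARD('p))"
    using sd.lattice_lower[OF r q] unfolding Qw_eq by blast
  obtain s0 S where s0: "0 < s0" "0 \<le> S" and sums: "\<And>ep U. 0 < ep \<Longrightarrow> ep \<le> s0 \<Longrightarrow> finite U \<Longrightarrow> U \<subseteq> lat ep \<Longrightarrow> (\<Sum>x\<in>U. Q x ^ CARD('p)) \<le> S / ep ^ DIM('a)"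
    using lattice_sum_Q by blast
  obtain ep m where ep: "\<And>j. 0 < ep j" "\<And>j. ep j \<le> 1" "\<And>j. ep j \<le> s0" "ep \<longlonglongrightarrow> 0"
    and tail: "\<And>r. 0 < r \<Longrightarrow> r \<le> 1 \<Longrightarrow> (\<lambda>j. tail DIM('a) (ep j * r) (m j)) \<longlonglongrightarrow> 0"
    and LR: "\<And>j. sd.LR (ep j) R \<subseteq> latbox (ep j) (m j)" "\<And>j x. x \<in> sd.LR (ep j) R \<Longrightarrow> 1 - 1 / real (Suc j) \<le> lat_weight (ep j) (m j) x"
    using lattice_sequence[OF cR(2) s0(1)] by blast
  define Y where "Y j = normalized (ep j) (m j)" for j
  have good: "AE w in M. (\<forall>j. 0 \<le> Y j w) \<and> (\<lambda>j. Y j w) \<longlonglongrightarrow> H w"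
    using local_time_approximation[OF local_time]
  proof (rule eventually_mono)
    fix w
    assume "\<exists>(g :: 'a \<Rightarrow> real) R. g 0 = max 0 (\<eta> 0 (\<lambda>j. \<tau> j w) w) \<and> continuous_on UNIV g \<and> (\<forall>y. 0 \<le> g y)
      \<and> (\<integral>\<^sup>+y. ennreal (g y) \<partial>lborel) < \<top> \<and> (AE y in lborel. R < norm y \<longrightarrow> g y = 0)
      \<and> (\<forall>ep m. 0 < ep \<longrightarrow> 0 \<le> normalized ep m w \<and> ennreal (normalized ep m w) = kernel_mean ep m g)"
    then obtain g :: "'a \<Rightarrow> real" and R where g: "g 0 = H w" "continuous_on UNIV g" "\<And>y. 0 \<le> g y"
      "(\<integral>\<^sup>+y. ennreal (g y) \<partial>lborel) < \<top>" "AE y in lborel. R < norm y \<longrightarrow> g y = 0"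
      and all: "\<And>ep m. 0 < ep \<Longrightarrow> 0 \<le> normalized ep m w \<and> ennreal (normalized ep m w) = kernel_mean ep m g" unfolding H_def by blast
    have Yg: "0 \<le> Y j w" "kernel_mean (ep j) (m j) g = ennreal (Y j w)" for j
      using all[OF ep(1)[of j], of "m j"] unfolding Y_def by simp_all
    have "(\<lambda>j. Y j w) \<longlonglongrightarrow> g 0"
    proof (rule LIMSEQ_I)
      fix e :: real assume e: "0 < e"
      have "\<forall>\<^sub>F j in sequentially. ennreal (g 0 - e / 2) \<le> ennreal (Y j w)"
        unfolding Yg(2)[symmetric] using e by (intro eventually_kernel_mean_ge[OF g(2), where ?r1.0 = 1] ep(1) tail) auto
      moreover have "\<forall>\<^sub>F j in sequentially. ennreal (Y j w) \<le> ennreal (g 0 + e / 2)"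
        unfolding Yg(2)[symmetric] using e by (intro eventually_kernel_mean_le[OF g(2) ep(1,2,4) tail _ g(3,5,4)]) auto
      ultimately have "\<forall>\<^sub>F j in sequentially. norm (Y j w - g 0) < e"
      proof eventually_elim
        case (elim j)
        have "g 0 - e / 2 \<le> Y j w" using elim(1) Yg(1) by simp
        moreover have "Y j w \<le> g 0 + e / 2" using elim(2) e g(3)[of 0] by (subst (asm) ennreal_le_iff) auto
        ultimately show ?case using e by (simp add: abs_less_iff)
      qed
      then show "\<exists>no. \<forall>n\<ge>no. norm (Y n w - g 0) < e" by (simp add: eventually_sequentially)
    qed
    then show "(\<forall>j. 0 \<le> Y j w) \<and> (\<lambda>j. Y j w) \<longlonglongrightarrow> H w" using Yg(1) g(1) by simp
  qed
  have EY: "expectation (\<lambda>w. Y j w ^ n) = ((ep j / (2 * pi)) ^ DIM('a)) ^ n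
    * (\<Sum>f\<in>PiE {..<n} (\<lambda>_. latbox (ep j) (m j)). (\<Prod>k<n. lat_weight (ep j) (m j) (f k)) * Phi Q f {..<n} 0 ^ CARD('p))" for j n
  proof -
    have "expectation (\<lambda>w. Y j w ^ n) = ((ep j / (2 * pi)) ^ DIM('a)) ^ n * expectation (\<lambda>w. Re (Sm UNIV (latbox (ep j) (m j)) (lat_weight (ep j) (m j)) w) ^ n)"
      unfolding Y_def normalized_power_eq by (rule integral_mult_right_zero)
    then show ?thesis
      using expectation_Re_Sm[of "latbox (ep j) (m j)" "lat_weight (ep j) (m j)" UNIV n, OF finite_latbox[OF ep(1)] latbox_minus lat_weight_minus] by (simp only:)
  qed
  show ?thesis
  proof (rule that[of "c / 2"])
    show "0 < c / 2" using cR by simp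
    fix n :: nat assume n: "even n"
    obtain k where k: "Suc (Suc n) = 2 * k" using n by (metis even_Suc_Suc_iff evenE)
    \<comment> \<open>A bound for the next moment that does not depend on j: its order is even,
      \<open>far_moment_le\<close> with empty \<open>A0\<close> applies with lattice sums at most S
      / ep^d, and the normalisation cancels the powers of the mesh.\<close>
    define B where "B = fact (2 * k) ^ CARD('p) * (2 * (S / (2 * pi) ^ DIM('a))\<^sup>2) ^ k"
    show "ennreal (c / 2 * r ^ n * fact (Suc n) ^ CARD('p) / ((2 * pi) ^ DIM('a)) ^ Suc n) \<le> (\<integral>\<^sup>+w. ennreal (H w ^ Suc n) \<partial>M)"
    proof (rule moment_liminf_ge[of Y "Suc n" H B])
      show "integrable M (\<lambda>w. Y j w ^ Suc n)" "integrable M (\<lambda>w. Y j w ^ Suc (Suc n))" for j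
        unfolding Y_def by (rule integrable_normalized[OF ep(1)])+
      show "AE w in M. \<forall>j. 0 \<le> Y j w" "AE w in M. (\<lambda>j. Y j w) \<longlonglongrightarrow> H w" using good by auto
      show "Y j \<in> borel_measurable M" for j by (simp add: Y_def)
      show "expectation (\<lambda>w. Y j w ^ Suc (Suc n)) \<le> B" for j
      proof -
        have D: "0 < ep j ^ DIM('a)" using ep(1) by simp
        have "expectation (\<lambda>w. Y j w ^ (2 * k)) \<le> ((ep j / (2 * pi)) ^ DIM('a)) ^ (2 * k) * (fact (2 * k) ^ CARD('p) * (2 * (S / ep j ^ DIM('a)) * (S / ep j ^ DIM('a))) ^ k)"
          unfolding EY
        proof (intro mult_left_mono)
          show "(\<Sum>f\<in>PiE {..<2 * k} (\<lambda>_. latbox (ep j) (m j)). (\<Prod>k<2 * k. lat_weight (ep j) (m j) (f k)) * Phi Q f {..<2 * k} 0 ^ CARD('p))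
            \<le> fact (2 * k) ^ CARD('p) * (2 * (S / ep j ^ DIM('a)) * (S / ep j ^ DIM('a))) ^ k"
            by (rule far_moment_le[where ?A0.0 = "{}" and ep = "ep j"])
              (auto simp: ep finite_latbox lat_weight_nonneg lat_weight_le_1 intro!: sums dest: subsetD[OF latbox_subset])
        qed (use ep(1)[of j] in auto)
        also have "\<dots> = fact (2 * k) ^ CARD('p) * ((((ep j / (2 * pi)) ^ DIM('a))\<^sup>2) ^ k * (2 * (S / ep j ^ DIM('a)) * (S / ep j ^ DIM('a))) ^ k)"
          by (simp only: power_mult mult.left_commute)
        also have "(((ep j / (2 * pi)) ^ DIM('a))\<^sup>2) ^ k * (2 * (S / ep j ^ DIM('a)) * (S / ep j ^ DIM('a))) ^ k = (2 * (S / (2 * pi) ^ DIM('a))\<^sup>2) ^ k"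
        proof -
          have "((ep j / (2 * pi)) ^ DIM('a))\<^sup>2 * (2 * (S / ep j ^ DIM('a)) * (S / ep j ^ DIM('a))) = 2 * (S / (2 * pi) ^ DIM('a))\<^sup>2"
            unfolding power_divide[of "ep j" "2 * pi" "DIM('a)"] using D ep(1)[of j] by (simp add: power2_eq_square mult_ac)
          from arg_cong[OF this, of "\<lambda>x. x ^ k"] show ?thesis
            unfolding power_mult_distrib[of "((ep j / (2 * pi)) ^ DIM('a))\<^sup>2"] .
        qed
        finally show ?thesis unfolding k B_def .
      qed
      \<comment> \<open>The product of the weights of n + 1 frequencies in the ball eventually
        exceeds 1/2, which is the source of the constant c / 2.\<close>
      have "(\<lambda>j. (1 - inverse (real (Suc j))) ^ Suc n) \<longlonglongrightarrow> (1 - 0) ^ Suc n"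
        by (intro tendsto_intros LIMSEQ_inverse_real_of_nat)
      then have "\<forall>\<^sub>F j in sequentially. 1 / 2 < (1 - inverse (real (Suc j))) ^ Suc n" by (rule order_tendstoD(1)) simp
      then show "\<forall>\<^sub>F j in sequentially. c / 2 * r ^ n * fact (Suc n) ^ CARD('p) / ((2 * pi) ^ DIM('a)) ^ Suc n \<le> expectation (\<lambda>w. Y j w ^ Suc n)"
        using low[OF n ep(1,4)]
      proof eventually_elim
        case (elim j)
        let ?n = "Suc n" and ?\<Omega> = "\<lambda>A. PiE {..<Suc n} (\<lambda>_. A)" and ?D = "(ep j ^ DIM('a)) ^ Suc n"
        let ?\<delta> = "1 - inverse (real (Suc j))" and ?LR = "sd.LR (ep j) R"
        let ?\<Sigma> = "\<Sum>f\<in>?\<Omega> ?LR. Phi Q f {..<?n} 0 ^ CARD('p)"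
        have ph: "0 \<le> Phi Q f {..<?n} 0 ^ CARD('p)" for f
          using Q_pos by (intro zero_le_power Phi_nonneg) (auto simp: less_imp_le)
        have \<delta>0: "0 \<le> ?\<delta>" by (simp add: inverse_le_1_iff)
        have "c * r ^ n * fact ?n ^ CARD('p) * (1 / 2) \<le> (?D * ?\<Sigma>) * ?\<delta> ^ ?n"
        proof (rule mult_mono)
          show "0 \<le> ?D * ?\<Sigma>" using ep(1)[of j] ph by (intro mult_nonneg_nonneg sum_nonneg) auto
        qed (use elim in auto)
        also have "\<dots> = ?D * (\<Sum>f\<in>?\<Omega> ?LR. (\<Prod>k<?n. ?\<delta>) * Phi Q f {..<?n} 0 ^ CARD('p))"
          by (simp only: sum_distrib_left[symmetric] prod_constant card_lessThan mult_ac)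
        also have "\<dots> \<le> ?D * (\<Sum>f\<in>?\<Omega> ?LR. (\<Prod>k<?n. lat_weight (ep j) (m j) (f k)) * Phi Q f {..<?n} 0 ^ CARD('p))"
        proof (intro mult_left_mono sum_mono mult_right_mono ph prod_mono conjI \<delta>0)
          fix f k assume "f \<in> ?\<Omega> ?LR" "k \<in> {..<?n}"
          then have "f k \<in> ?LR" by (rule PiE_mem)
          from LR(2)[OF this] show "?\<delta> \<le> lat_weight (ep j) (m j) (f k)" by (simp only: inverse_eq_divide)
        qed (use ep(1)[of j] in auto)
        also have "\<dots> \<le> ?D * (\<Sum>f\<in>?\<Omega> (latbox (ep j) (m j)). (\<Prod>k<?n. lat_weight (ep j) (m j) (f k)) * Phi Q f {..<?n} 0 ^ CARD('p))"
        proof (intro mult_left_mono sum_mono2 PiE_mono LR(1) mult_nonneg_nonneg ph prod_nonneg ballI lat_weight_nonneg)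
          show "finite (?\<Omega> (latbox (ep j) (m j) :: 'a set))" using ep(1) by (intro finite_PiE finite_latbox) auto
        qed (use ep(1)[of j] in auto)
        finally have "c * r ^ n * fact ?n ^ CARD('p) * (1 / 2) / ((2 * pi) ^ DIM('a)) ^ ?n
          \<le> ?D * (\<Sum>f\<in>?\<Omega> (latbox (ep j) (m j)). (\<Prod>k<?n. lat_weight (ep j) (m j) (f k)) * Phi Q f {..<?n} 0 ^ CARD('p)) / ((2 * pi) ^ DIM('a)) ^ ?n"
          by (rule divide_right_mono) simp
        also have "\<dots> = expectation (\<lambda>w. Y j w ^ ?n)" unfolding EY by (simp only: power_divide times_divide_eq_left)
        also have "c * r ^ n * fact ?n ^ CARD('p) * (1 / 2) / ((2 * pi) ^ DIM('a)) ^ ?n = c / 2 * r ^ n * fact ?n ^ CARD('p) / ((2 * pi) ^ DIM('a)) ^ ?n"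
          by (simp only: times_divide_eq_left times_divide_eq_right mult_1_right)
        finally show ?case .
      qed
    qed measurable
  qed
qed

end

section \<open>Interpolation between even and odd moments\<close>

lemma polynomial_times_geometric_tendsto:
  fixes x :: real
  assumes "0 \<le> x" "x < 1" shows "(\<lambda>n. (real n + 1) ^ k * x ^ n) \<longlonglongrightarrow> 0"
proof -
  define y where "y = root (Suc k) x"
  have y: "0 \<le> y" "y < 1" "y ^ Suc k = x" unfolding y_def using assms by (simp_all only: real_root_pow_pos2 zero_less_Suc real_root_ge_0_iff real_root_lt_1_iff)
  have "(\<lambda>n. of_nat n * y ^ n + y ^ n) \<longlonglongrightarrow> 0 + 0"
    using y by (intro tendsto_add powser_times_n_limit_0 LIMSEQ_power_zero) auto
  then have 1: "(\<lambda>n. (real n + 1) * y ^ n) \<longlonglongrightarrow> 0" by (simp add: algebra_simps)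
  have "(\<lambda>n. ((real n + 1) * y ^ n) ^ k * y ^ n) \<longlonglongrightarrow> 0 ^ k * 0"
    using y by (intro tendsto_intros 1 LIMSEQ_power_zero) auto
  moreover have "((real n + 1) * y ^ n) ^ k * y ^ n = (real n + 1) ^ k * x ^ n" for n
  proof -
    have "(y ^ n) ^ k * y ^ n = (y ^ Suc k) ^ n"
      by (simp add: power_mult_distrib power_mult[symmetric] mult.commute)
    then show ?thesis unfolding y(3) power_mult_distrib mult.assoc by (simp only:)
  qed
  ultimately show ?thesis by simp
qed

lemma ln_growth_rate:
  fixes a :: "nat \<Rightarrow> real"
  assumes L: "0 < L"
    and upper: "\<And>u. L < u \<Longrightarrow> \<exists>C>0. \<forall>\<^sub>F n in sequentially. a n \<le> C * u ^ n"
    and lower: "\<And>v. 0 < v \<Longrightarrow> v < L \<Longrightarrow> \<exists>c>0. \<forall>\<^sub>F n in sequentially. c * v ^ n \<le> a n"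
  shows "(\<lambda>n. ln (a n) / real n) \<longlonglongrightarrow> ln L"
proof -
  have lim: "(\<lambda>n. ln C / real n + z) \<longlonglongrightarrow> 0 + z" for C z :: real
    by (intro tendsto_intros lim_const_over_n)
  have ln_eq: "ln (C * u ^ n) / real n = ln C / real n + ln u" if "0 < C" "0 < u" "0 < n" for C u :: real and n
    using that by (simp add: ln_mult ln_realpow add_divide_distrib)
  have pos: "\<forall>\<^sub>F n in sequentially. 0 < a n"
  proof -
    obtain c where c: "0 < c" "\<forall>\<^sub>F n in sequentially. c * (L / 2) ^ n \<le> a n" using lower[of "L / 2"] L by auto
    have "0 < c * (L / 2) ^ n" for n using c L by simp
    with c(2) show ?thesis by (auto elim!: eventually_mono intro: less_le_trans)
  qed
  show ?thesis
  proof (rule order_tendstoI)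
    fix z assume z: "z < ln L"
    then obtain y where y: "z < y" "y < ln L" using dense by blast
    have "exp y < L" using y L by (metis exp_less_cancel_iff exp_ln)
    then obtain c where c: "0 < c" "\<forall>\<^sub>F n in sequentially. c * exp y ^ n \<le> a n" using lower[of "exp y"] by auto
    have "\<forall>\<^sub>F n in sequentially. z < ln c / real n + y" by (rule order_tendstoD(1)[OF lim]) (use y in simp)
    with c(2) eventually_gt_at_top[of 0] show "\<forall>\<^sub>F n in sequentially. z < ln (a n) / real n"
    proof eventually_elim
      case (elim n)
      have "ln (c * exp y ^ n) \<le> ln (a n)" using elim(1) c(1) by (intro ln_mono) auto
      then have "ln (c * exp y ^ n) / real n \<le> ln (a n) / real n" by (intro divide_right_mono) auto
      then show ?case using elim ln_eq[of c "exp y" n] c(1) by simp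
    qed
  next
    fix z assume z: "ln L < z"
    then obtain y where y: "ln L < y" "y < z" using dense by blast
    have "L < exp y" using y L by (metis exp_less_cancel_iff exp_ln)
    then obtain C where C: "0 < C" "\<forall>\<^sub>F n in sequentially. a n \<le> C * exp y ^ n" using upper[of "exp y"] by auto
    have "\<forall>\<^sub>F n in sequentially. ln C / real n + y < z" by (rule order_tendstoD(2)[OF lim]) (use y in simp)
    with C(2) eventually_gt_at_top[of 0] pos show "\<forall>\<^sub>F n in sequentially. ln (a n) / real n < z"
    proof eventually_elim
      case (elim n)
      have "ln (a n) \<le> ln (C * exp y ^ n)" using elim(1,3) C(1) by (intro ln_mono) auto
      then have "ln (a n) / real n \<le> ln (C * exp y ^ n) / real n" by (intro divide_right_mono) auto
      then show ?case using elim ln_eq[of C "exp y" n] C(1) by simp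
    qed
  qed
qed

text \<open>Odd upper bounds follow from the even neighbours. An even lower bound follows from a(n)
  \<ge> a(n+1)^2 / (K a(n+2)), which combines the lower bound at an odd index with the upper bound
  at an even one. The constant K does not affect the rate.\<close>

lemma log_convex_growth_rate:
  fixes a :: "nat \<Rightarrow> real"
  assumes L: "0 < L" and K: "1 \<le> K" and a0: "\<And>n. 0 \<le> a n"
    and conv: "\<And>n. (a (Suc n))\<^sup>2 \<le> K * (a n * a (Suc (Suc n)))"
    and upper: "\<And>u. L < u \<Longrightarrow> \<forall>\<^sub>F n in sequentially. even n \<longrightarrow> a n \<le> u ^ n"
    and lower: "\<And>v. 0 < v \<Longrightarrow> v < L \<Longrightarrow> \<exists>c>0. \<forall>n. even n \<longrightarrow> c * v ^ n \<le> a (Suc n)"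
  shows "(\<lambda>n. ln (a n) / real n) \<longlonglongrightarrow> ln L"
proof (rule ln_growth_rate[OF L])
  have up: "\<forall>\<^sub>F n in sequentially. a n \<le> K * u ^ n" if u: "L < u" for u
  proof -
    obtain n0 where n0: "\<And>n. n0 \<le> n \<Longrightarrow> even n \<Longrightarrow> a n \<le> u ^ n" using upper[OF u] by (auto simp: eventually_sequentially)
    have u0: "0 < u" using L u by simp
    show ?thesis unfolding eventually_sequentially
    proof (intro exI[of _ "Suc n0"] allI impI)
      fix n assume n: "Suc n0 \<le> n"
      show "a n \<le> K * u ^ n"
      proof (cases "even n")
        case True
        then have "a n \<le> 1 * u ^ n" using n0[of n] n by simp
        also have "\<dots> \<le> K * u ^ n" using K u0 by (intro mult_right_mono) auto
        finally show ?thesis .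
      next
        case False
        obtain m where m: "n = Suc m" using n by (cases n) auto
        have "(a n)\<^sup>2 \<le> K * (a m * a (Suc (Suc m)))" unfolding m by (rule conv)
        also have "\<dots> \<le> K * (u ^ m * u ^ Suc (Suc m))"
          using False n m K u0 a0 by (intro mult_left_mono mult_mono n0) auto
        also have "\<dots> = K * (u ^ n)\<^sup>2" unfolding m by (simp add: power2_eq_square)
        also have "\<dots> \<le> K\<^sup>2 * (u ^ n)\<^sup>2" using K by (intro mult_right_mono) (auto simp: power2_eq_square)
        also have "\<dots> = (K * u ^ n)\<^sup>2" by (simp only: power_mult_distrib)
        finally show ?thesis using K u0 by (intro power2_le_imp_le[of "a n"]) auto
      qed
    qed
  qed
  show "\<exists>C>0. \<forall>\<^sub>F n in sequentially. a n \<le> C * u ^ n" if "L < u" for u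
    using up[OF that] K by (intro exI[of _ K]) auto
  fix v assume v: "0 < v" "v < L"
  \<comment> \<open>r^2 is the midpoint of L v and L^2, so that v < r < L, while u = r^2 / v exceeds
    L. Since u v = r^2, the geometric factors in the even lower bound combine to v^n.\<close>
  define r where "r = sqrt ((L * v + L * L) / 2)"
  have Lv: "L * v < L * L" using v by simp
  have Lv0: "0 < L * v" using v L by simp
  have r2: "r\<^sup>2 = (L * v + L * L) / 2" unfolding r_def using Lv Lv0 by (intro real_sqrt_pow2) simp
  have r0: "0 < r" unfolding r_def using Lv Lv0 by (intro real_sqrt_gt_zero) simp
  have half: "(x + y) / 2 < y" if "x < y" for x y :: real using that by simp
  have "r\<^sup>2 < L\<^sup>2" unfolding r2 power2_eq_square[of L] by (rule half[OF Lv])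
  then have rL: "r < L" by (rule power2_less_imp_less) (use L in simp)
  have vr: "v < r"
  proof -
    have "v * v < L * v" using v by simp
    then show ?thesis using Lv r0 r2 by (intro power2_less_imp_less[of v r]) (auto simp: power2_eq_square)
  qed
  define u where "u = r\<^sup>2 / v"
  have u: "L < u" unfolding u_def r2 using Lv v by (simp add: field_simps)
  have u0: "0 < u" using u L by simp
  obtain c where c: "0 < c" "\<And>n. even n \<Longrightarrow> c * r ^ n \<le> a (Suc n)" using lower[OF r0 rL] by blast
  define c' where "c' = min (c / r) (c\<^sup>2 / (K\<^sup>2 * u\<^sup>2))"
  have "\<forall>\<^sub>F n in sequentially. a (Suc (Suc n)) \<le> K * u ^ Suc (Suc n)"
    using up[OF u] unfolding eventually_sequentially by (meson le_SucI)
  then have "\<forall>\<^sub>F n in sequentially. c' * v ^ n \<le> a n"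
    using eventually_gt_at_top[of 0]
  proof eventually_elim
    case (elim n)
    show ?case
    proof (cases "even n")
      case True
      have "K * (u ^ n * u\<^sup>2) * K > 0" using K u0 by auto
      have "(c * r ^ n)\<^sup>2 \<le> (a (Suc n))\<^sup>2" using c(1) c(2)[OF True] r0 by (intro power_mono) auto
      also have "\<dots> \<le> K * (a n * a (Suc (Suc n)))" by (rule conv)
      also have "\<dots> \<le> K * (a n * (K * u ^ Suc (Suc n)))" using elim(1) K a0 by (intro mult_left_mono) auto
      also have "\<dots> = a n * (K\<^sup>2 * u\<^sup>2 * u ^ n)" by (simp add: power2_eq_square mult_ac)
      finally have le: "(c * r ^ n)\<^sup>2 \<le> a n * (K\<^sup>2 * u\<^sup>2 * u ^ n)" .
      have ru: "(c * r ^ n)\<^sup>2 = c\<^sup>2 * (u ^ n * v ^ n)"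
      proof -
        have "u * v = r\<^sup>2" using v by (simp add: u_def)
        then have "u ^ n * v ^ n = (r ^ n)\<^sup>2" by (simp add: power_mult_distrib[symmetric] power_mult[symmetric] mult.commute)
        then show ?thesis by (simp add: power_mult_distrib)
      qed
      have pos: "0 < K\<^sup>2 * u\<^sup>2 * u ^ n" using K u0 by simp
      have "c' * v ^ n \<le> c\<^sup>2 / (K\<^sup>2 * u\<^sup>2) * v ^ n" unfolding c'_def using v by (intro mult_right_mono) auto
      also have "\<dots> = (c * r ^ n)\<^sup>2 / (K\<^sup>2 * u\<^sup>2 * u ^ n)" unfolding ru using u0 by simp
      also have "\<dots> \<le> a n" using le pos by (simp only: pos_divide_le_eq)
      finally show ?thesis .
    next
      case False
      obtain m where m: "n = Suc m" using elim(2) by (cases n) auto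
      have "c' * v ^ n \<le> c / r * r ^ n" unfolding c'_def using v vr c(1) r0 K u0
        by (intro mult_mono power_mono) (auto intro: less_imp_le)
      also have "\<dots> = c * r ^ m" using r0 by (simp add: m)
      also have "\<dots> \<le> a n" using c(2)[of m] False by (simp add: m)
      finally show ?thesis .
    qed
  qed
  moreover have "0 < c'" using c r0 K u0 by (simp add: c'_def)
  ultimately show "\<exists>c>0. \<forall>\<^sub>F n in sequentially. c * v ^ n \<le> a n" by blast
qed

lemma nn_integral_power_Cauchy_Schwarz:
  fixes H :: "'a \<Rightarrow> real"
  assumes [measurable]: "H \<in> borel_measurable M" and H: "\<And>x. 0 \<le> H x"
  shows "(\<integral>\<^sup>+x. ennreal (H x ^ Suc n) \<partial>M)\<^sup>2 \<le> (\<integral>\<^sup>+x. ennreal (H x ^ n) \<partial>M) * (\<integral>\<^sup>+x. ennreal (H x ^ Suc (Suc n)) \<partial>M)"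
proof -
  have "(\<integral>\<^sup>+x. ennreal (sqrt (H x ^ n)) * ennreal (sqrt (H x ^ Suc (Suc n))) \<partial>M)\<^sup>2
     \<le> (\<integral>\<^sup>+x. (ennreal (sqrt (H x ^ n)))\<^sup>2 \<partial>M) * (\<integral>\<^sup>+x. (ennreal (sqrt (H x ^ Suc (Suc n))))\<^sup>2 \<partial>M)"
    by (rule Cauchy_Schwarz_nn_integral) measurable
  moreover have "ennreal (sqrt (H x ^ n)) * ennreal (sqrt (H x ^ Suc (Suc n))) = ennreal (H x ^ Suc n)" for x
  proof -
    have "sqrt (H x ^ n) * sqrt (H x ^ Suc (Suc n)) = sqrt ((H x ^ Suc n)\<^sup>2)"
      unfolding real_sqrt_mult[symmetric] by (simp add: power2_eq_square mult_ac)
    also have "\<dots> = H x ^ Suc n" using H[of x] by (intro real_sqrt_unique) auto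
    finally show ?thesis using H[of x] by (subst ennreal_mult[symmetric]) auto
  qed
  moreover have "(ennreal (sqrt (H x ^ k)))\<^sup>2 = ennreal (H x ^ k)" for x k
    using H[of x] by (simp add: ennreal_power del: power_Suc)
  ultimately show ?thesis by (simp only:)
qed

section \<open>Growth rate of the moments\<close>

context stable_local_time
begin

definition moment :: "nat \<Rightarrow> ennreal" where "moment n = (\<integral>\<^sup>+w. ennreal (H w ^ n) \<partial>M)"

lemma moment_eq: "(\<integral>\<^sup>+w. ennreal (\<eta> 0 (\<lambda>j. \<tau> j w) w) ^ n \<partial>M) = moment n"
  unfolding moment_def
proof (rule nn_integral_cong)
  fix w
  have "ennreal (\<eta> 0 (\<lambda>j. \<tau> j w) w) = ennreal (H w)" by (simp add: H_def max_def ennreal_neg)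
  then show "ennreal (\<eta> 0 (\<lambda>j. \<tau> j w) w) ^ n = ennreal (H w ^ n)" by (simp add: ennreal_power H_nonneg)
qed

text \<open>A value r strictly between \<open>rho\<close> and u (2 pi)^d leaves a geometric factor
  x^n with x < 1, which beats the polynomial bracket of \<open>moment_upper_lattice\<close>.\<close>

lemma moment_even_bound:
  assumes u: "rho \<psi> CARD('p) / (2 * pi) ^ DIM('a) < u"
  shows "\<forall>\<^sub>F n in sequentially. even n \<longrightarrow> moment n \<le> ennreal (fact n ^ CARD('p) * u ^ n)"
proof -
  define \<kappa> where "\<kappa> = (2 * pi) ^ DIM('a)"
  have \<kappa>: "0 < \<kappa>" by (simp add: \<kappa>_def)
  have "rho \<psi> CARD('p) < u * \<kappa>" using u \<kappa> unfolding \<kappa>_def[symmetric] by (simp add: pos_divide_less_eq)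
  then obtain r where r: "rho \<psi> CARD('p) < r" "r < u * \<kappa>" using dense by blast
  have r0: "0 < r" using r sd.rho_pos by simp
  have u0: "0 < u" using r r0 \<kappa> by (smt (verit) zero_less_mult_pos2)
  obtain N c q :: nat where bd': "\<And>n. even n \<Longrightarrow> 0 < n \<Longrightarrow> (\<integral>\<^sup>+w. ennreal (H w ^ n) \<partial>M)
      \<le> ennreal (fact n ^ CARD('p) * (r / (2 * pi) ^ DIM('a)) ^ n
          * (sqrt ((2 * real (n * N) + 1) ^ DIM('a)) ^ CARD('p) * (real (Suc n) ^ c * ((exp 1 * (real n + 1)) ^ c) ^ q) + 1))"
    by (rule moment_upper_lattice[OF r(1)], rule that) (assumption | blast)
  note bd = bd'[folded moment_def \<kappa>_def]
  define k where "k = DIM('a) * CARD('p) + (c + c * q)"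
  define C where "C = (2 * real N + 1) ^ (DIM('a) * CARD('p)) * (exp 1 ^ (c * q))"
  have poly: "sqrt ((2 * real (n * N) + 1) ^ DIM('a)) ^ CARD('p) * (real (Suc n) ^ c * ((exp 1 * (real n + 1)) ^ c) ^ q) \<le> C * (real n + 1) ^ k" for n
  proof -
    have "sqrt ((2 * real (n * N) + 1) ^ DIM('a)) \<le> (2 * real (n * N) + 1) ^ DIM('a)"
    proof -
      have "1 \<le> (2 * real (n * N) + 1) ^ DIM('a)" by (rule one_le_power) simp
      then have "(2 * real (n * N) + 1) ^ DIM('a) * 1 \<le> (2 * real (n * N) + 1) ^ DIM('a) * (2 * real (n * N) + 1) ^ DIM('a)"
        by (intro mult_left_mono) auto
      then show ?thesis by (intro real_le_lsqrt) (simp_all add: power2_eq_square)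
    qed
    moreover have "(2 * real (n * N) + 1) ^ DIM('a) \<le> ((2 * real N + 1) * (real n + 1)) ^ DIM('a)"
      by (rule power_mono) (simp_all add: algebra_simps)
    ultimately have "sqrt ((2 * real (n * N) + 1) ^ DIM('a)) \<le> ((2 * real N + 1) * (real n + 1)) ^ DIM('a)"
      by (meson order_trans)
    then have "sqrt ((2 * real (n * N) + 1) ^ DIM('a)) ^ CARD('p) \<le> (((2 * real N + 1) * (real n + 1)) ^ DIM('a)) ^ CARD('p)"
      by (intro power_mono) auto
    then have "sqrt ((2 * real (n * N) + 1) ^ DIM('a)) ^ CARD('p) * (real (Suc n) ^ c * ((exp 1 * (real n + 1)) ^ c) ^ q)
      \<le> (((2 * real N + 1) * (real n + 1)) ^ DIM('a)) ^ CARD('p) * (real (Suc n) ^ c * ((exp 1 * (real n + 1)) ^ c) ^ q)"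
      by (intro mult_right_mono) auto
    also have "(((2 * real N + 1) * (real n + 1)) ^ DIM('a)) ^ CARD('p) * (real (Suc n) ^ c * ((exp 1 * (real n + 1)) ^ c) ^ q) = C * (real n + 1) ^ k"
      unfolding C_def k_def of_nat_Suc add.commute[of 1 "real n"] by (simp only: power_mult_distrib power_add power_mult mult_ac)
    finally show ?thesis .
  qed
  define x where "x = r / (u * \<kappa>)"
  have x: "0 \<le> x" "x < 1" using r r0 u0 \<kappa> by (auto simp: x_def divide_less_eq_1)
  have "(\<lambda>n. C * ((real n + 1) ^ k * x ^ n) + x ^ n) \<longlonglongrightarrow> C * 0 + 0"
    using x by (intro tendsto_intros polynomial_times_geometric_tendsto LIMSEQ_power_zero) auto
  then have "\<forall>\<^sub>F n in sequentially. C * ((real n + 1) ^ k * x ^ n) + x ^ n < 1" by (rule order_tendstoD(2)) simp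
  then show ?thesis using eventually_gt_at_top[of 0]
  proof eventually_elim
    case (elim n)
    show ?case
    proof
      assume n: "even n"
      have "r / \<kappa> = u * x" using u0 by (simp add: x_def)
      then have rx: "(r / \<kappa>) ^ n = u ^ n * x ^ n" by (simp only: power_mult_distrib)
      have "moment n \<le> ennreal (fact n ^ CARD('p) * (r / \<kappa>) ^ n
          * (sqrt ((2 * real (n * N) + 1) ^ DIM('a)) ^ CARD('p) * (real (Suc n) ^ c * ((exp 1 * (real n + 1)) ^ c) ^ q) + 1))"
        by (rule bd[OF n elim(2)])
      also have "\<dots> \<le> ennreal (fact n ^ CARD('p) * (r / \<kappa>) ^ n * (C * (real n + 1) ^ k + 1))"
        using r0 \<kappa> by (intro ennreal_leI mult_left_mono add_mono poly) auto
      also have "fact n ^ CARD('p) * (r / \<kappa>) ^ n * (C * (real n + 1) ^ k + 1)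
        = fact n ^ CARD('p) * u ^ n * (C * ((real n + 1) ^ k * x ^ n) + x ^ n)"
        unfolding rx by (simp add: algebra_simps)
      also have "ennreal \<dots> \<le> ennreal (fact n ^ CARD('p) * u ^ n * 1)"
        using elim(1) u0 by (intro ennreal_leI mult_left_mono) auto
      finally show "moment n \<le> ennreal (fact n ^ CARD('p) * u ^ n)" by simp
    qed
  qed
qed

text \<open>Every moment is dominated by 1 plus a later moment of even order, for which a bound is
  at hand.\<close>

lemma moment_finite: "moment n < \<top>"
proof -
  obtain n0 where n0: "\<And>n. n0 \<le> n \<Longrightarrow> even n \<Longrightarrow> moment n
      \<le> ennreal (fact n ^ CARD('p) * (rho \<psi> CARD('p) / (2 * pi) ^ DIM('a) + 1) ^ n)"
    using moment_even_bound[of "rho \<psi> CARD('p) / (2 * pi) ^ DIM('a) + 1"] by (auto simp: eventually_sequentially)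
  let ?m = "2 * (n0 + n)"
  have "moment n \<le> (\<integral>\<^sup>+w. (1 + ennreal (H w ^ ?m)) \<partial>M)"
    unfolding moment_def
  proof (rule nn_integral_mono)
    fix w
    have "H w ^ n \<le> 1 + H w ^ ?m"
    proof (cases "H w \<le> 1")
      case True
      then have "H w ^ n \<le> 1" using H_nonneg by (intro power_le_one)
      then show ?thesis using zero_le_power[OF H_nonneg[of w], of ?m] by linarith
    next
      case False
      then have "H w ^ n \<le> H w ^ ?m" by (intro power_increasing) auto
      then show ?thesis by simp
    qed
    then have "ennreal (H w ^ n) \<le> ennreal (1 + H w ^ ?m)" by (rule ennreal_leI)
    then show "ennreal (H w ^ n) \<le> 1 + ennreal (H w ^ ?m)" by (simp add: H_nonneg)
  qed
  also have "\<dots> = 1 + moment ?m" unfolding moment_def by (subst nn_integral_add) (auto simp: emeasure_space_1)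
  also have "\<dots> < \<top>" using n0[of ?m] by (auto simp: less_top[symmetric] top_unique)
  finally show ?thesis .
qed

text \<open>K = 2^p stems from n! (n+2)! \<le> 2 ((n+1)!)^2: the moments themselves are log-convex
  by Cauchy-Schwarz, and the division by factorials costs this constant.\<close>

lemma moment_asymptotics:
  "(\<lambda>n. ln (enn2real (moment n) / fact n ^ CARD('p)) / real n) \<longlonglongrightarrow> ln (rho \<psi> CARD('p) / (2 * pi) ^ DIM('a))"
proof (rule log_convex_growth_rate[where K = "2 ^ CARD('p)"])
  let ?\<kappa> = "(2 * pi) ^ DIM('a)" and ?p = "CARD('p)"
  have \<kappa>: "0 < ?\<kappa>" by simp
  show L0: "0 < rho \<psi> ?p / ?\<kappa>" using sd.rho_pos by simp
  show "(enn2real (moment (Suc n)) / fact (Suc n) ^ ?p)\<^sup>2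
    \<le> 2 ^ ?p * (enn2real (moment n) / fact n ^ ?p * (enn2real (moment (Suc (Suc n))) / fact (Suc (Suc n)) ^ ?p))" for n
  proof -
    let ?g = "\<lambda>n. enn2real (moment n)"
    have e: "moment n = ennreal (?g n)" for n using moment_finite[of n] by simp
    have "(moment (Suc n))\<^sup>2 \<le> moment n * moment (Suc (Suc n))"
      unfolding moment_def by (intro nn_integral_power_Cauchy_Schwarz H_nonneg) measurable
    then have "ennreal ((?g (Suc n))\<^sup>2) \<le> ennreal (?g n * ?g (Suc (Suc n)))"
      by (subst (asm) (1 2 3) e) (simp add: ennreal_power ennreal_mult)
    then have g: "(?g (Suc n))\<^sup>2 \<le> ?g n * ?g (Suc (Suc n))" by (subst (asm) ennreal_le_iff) auto
    have f: "(fact n * fact (Suc (Suc n)) :: real) \<le> 2 * (fact (Suc n))\<^sup>2"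
    proof -
      have "(fact n * fact (Suc (Suc n)) :: real) = (real n + 2) * (real n + 1) * (fact n)\<^sup>2" by (simp add: power2_eq_square algebra_simps)
      also have "\<dots> \<le> (2 * (real n + 1)) * (real n + 1) * (fact n)\<^sup>2" by (intro mult_right_mono) auto
      also have "\<dots> = 2 * (fact (Suc n))\<^sup>2" by (simp add: power2_eq_square algebra_simps)
      finally show ?thesis .
    qed
    have "(fact n * fact (Suc (Suc n)) :: real) ^ ?p \<le> (2 * (fact (Suc n))\<^sup>2) ^ ?p" by (intro power_mono f) auto
    also have "(2 * (fact (Suc n))\<^sup>2 :: real) ^ ?p = 2 ^ ?p * (fact (Suc n) ^ ?p)\<^sup>2"
      by (simp only: power_mult_distrib power_mult[symmetric] mult.commute)
    finally have F: "(fact n ^ ?p * fact (Suc (Suc n)) ^ ?p :: real) \<le> 2 ^ ?p * (fact (Suc n) ^ ?p)\<^sup>2"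
      by (simp only: power_mult_distrib)
    have pos: "0 < (fact m ^ ?p :: real)" for m by simp
    have "(?g (Suc n) / fact (Suc n) ^ ?p)\<^sup>2 \<le> ?g n * ?g (Suc (Suc n)) / (fact (Suc n) ^ ?p)\<^sup>2"
      unfolding power_divide by (intro divide_right_mono g) auto
    also have "\<dots> \<le> ?g n * ?g (Suc (Suc n)) / ((fact n ^ ?p * fact (Suc (Suc n)) ^ ?p) / 2 ^ ?p)"
      using F pos[of n] pos[of "Suc (Suc n)"] pos[of "Suc n"]
      by (intro divide_left_mono mult_pos_pos divide_pos_pos zero_less_power) (simp_all only: fact_gt_zero pos_divide_le_eq zero_less_numeral zero_less_power mult.commute enn2real_nonneg mult_nonneg_nonneg)
    also have "\<dots> = 2 ^ ?p * (?g n / fact n ^ ?p * (?g (Suc (Suc n)) / fact (Suc (Suc n)) ^ ?p))"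
      by (simp only: divide_divide_eq_right divide_divide_eq_left times_divide_times_eq times_divide_eq_right mult.commute)
    finally show ?thesis .
  qed
  show "\<forall>\<^sub>F n in sequentially. even n \<longrightarrow> enn2real (moment n) / fact n ^ ?p \<le> u ^ n" if u: "rho \<psi> ?p / ?\<kappa> < u" for u
    using moment_even_bound[OF u]
  proof eventually_elim
    case (elim n)
    have u0: "0 < u" using L0 u by simp
    show ?case
    proof
      assume "even n"
      then have "enn2real (moment n) \<le> fact n ^ ?p * u ^ n" using elim u0 by (intro enn2real_leI) auto
      then show "enn2real (moment n) / fact n ^ ?p \<le> u ^ n" by (simp add: divide_le_eq mult.commute)
    qed
  qed
  show "\<exists>c>0. \<forall>n. even n \<longrightarrow> c * v ^ n \<le> enn2real (moment (Suc n)) / fact (Suc n) ^ ?p" if v: "0 < v" "v < rho \<psi> ?p / ?\<kappa>" for v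
  proof -
    have "0 < v * ?\<kappa>" "v * ?\<kappa> < rho \<psi> ?p" using v \<kappa> by (simp_all add: pos_less_divide_eq)
    then obtain c where c: "0 < c" "\<And>n. even n \<Longrightarrow> ennreal (c * (v * ?\<kappa>) ^ n * fact (Suc n) ^ ?p / ?\<kappa> ^ Suc n) \<le> moment (Suc n)"
      using moment_lower unfolding moment_def by blast
    have "c / ?\<kappa> * v ^ n \<le> enn2real (moment (Suc n)) / fact (Suc n) ^ ?p" if n: "even n" for n
    proof -
      have "enn2real (ennreal (c * (v * ?\<kappa>) ^ n * fact (Suc n) ^ ?p / ?\<kappa> ^ Suc n)) \<le> enn2real (moment (Suc n))"
        by (intro enn2real_mono c(2)[OF n] moment_finite)
      then have "c * (v * ?\<kappa>) ^ n * fact (Suc n) ^ ?p / ?\<kappa> ^ Suc n \<le> enn2real (moment (Suc n))"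
        using c(1) v(1) by (subst (asm) enn2real_ennreal) (auto simp del: fact_Suc power_Suc intro!: divide_nonneg_nonneg mult_nonneg_nonneg)
      then have "c * (v * ?\<kappa>) ^ n * fact (Suc n) ^ ?p / ?\<kappa> ^ Suc n / fact (Suc n) ^ ?p \<le> enn2real (moment (Suc n)) / fact (Suc n) ^ ?p"
        by (intro divide_right_mono) auto
      moreover have "c * (v * k) ^ n * F / k ^ Suc n / F = c / k * v ^ n" if "0 < k" "0 < F" for k F :: real
        using that by (simp add: power_mult_distrib)
      from this[OF \<kappa>, of "fact (Suc n) ^ ?p"]
      have "c * (v * ?\<kappa>) ^ n * fact (Suc n) ^ ?p / ?\<kappa> ^ Suc n / fact (Suc n) ^ ?p = c / ?\<kappa> * v ^ n" by (simp only: zero_less_power fact_gt_zero)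
      ultimately show ?thesis by (simp only:)
    qed
    moreover have "0 < c / ?\<kappa>" using c(1) \<kappa> by (intro divide_pos_pos)
    ultimately show ?thesis by blast
  qed
qed auto

end

text \<open>The number p is encoded as the cardinality of the index type. The first two conjuncts
  guard against default values: they make the real supremum \<open>rho\<close> meaningful and
  exclude that \<open>enn2real\<close> sends an infinite moment to 0.\<close>

theorem theorem2p1:
  fixes M :: "'w measure"
    and X :: "'p::finite \<Rightarrow> real \<Rightarrow> 'w \<Rightarrow> 'a::euclidean_space"
    and \<tau> :: "'p \<Rightarrow> 'w \<Rightarrow> real"
    and \<psi> :: "'a \<Rightarrow> real"
    and \<alpha> :: real
    and \<eta> :: "'a \<Rightarrow> ('p \<Rightarrow> real) \<Rightarrow> 'w \<Rightarrow> real"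
  assumes "prob_space M"
    and "0 < \<alpha>" "\<alpha> \<le> 2"
    and "real DIM('a) < \<alpha> * real CARD('p)"
    and "stable_symbol \<alpha> \<psi>"
    and "\<And>j. levy_process_with_symbol M (X j) \<psi>"
    and "indep_paths_and_times M X \<tau>"
    and "\<And>j. distributed M lborel (\<tau> j) (\<lambda>x. ennreal (exponential_density 1 x))"
    and "is_local_time M X \<eta>"
    and "(\<lambda>\<omega>. \<eta> 0 (\<lambda>j. \<tau> j \<omega>) \<omega>) \<in> borel_measurable M"
  shows "bdd_above (rho_values \<psi> CARD('p))
    \<and> (\<forall>n. (\<integral>\<^sup>+ \<omega>. ennreal (\<eta> 0 (\<lambda>j. \<tau> j \<omega>) \<omega>) ^ n \<partial>M) < \<top>)
    \<and> (\<lambda>n. ln (enn2real (\<integral>\<^sup>+ \<omega>. ennreal (\<eta> 0 (\<lambda>j. \<tau> j \<omega>) \<omega>) ^ n \<partial>M)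
                  / fact n ^ CARD('p)) / real n)
      \<longlonglongrightarrow> ln (rho \<psi> CARD('p) / (2 * pi) ^ DIM('a))"
proof -
  interpret sd: stable_data \<psi> \<alpha> "CARD('p)"
    using assms by (intro stable_data.intro) auto
  interpret stable_local_time M X \<tau> \<psi> \<alpha> \<eta>
  proof (intro stable_local_time.intro additive_levy.intro additive_levy_axioms.intro stable_local_time_axioms.intro)
    show "stable_data \<psi> \<alpha> CARD('p)" by (rule sd.stable_data_axioms)
  qed (use assms sd.psi_nonneg in auto)
  show ?thesis
    unfolding moment_eq using sd.bdd_above_rho_values moment_finite moment_asymptotics by blast
qed

end
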